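(* Let $K$ be a $\phi\sigma$-field, $k:=K^\phi$, $A\in\mathrm{GL}_n(K)$, and let $R$ be a $\sigma$-Picard--Vessiot ring for $\phi(y)=Ay$ over $K$ with $R^\phi=k$. Let $H:=(R\otimes_KR)^\phi$ (the $k$-$\sigma$-Hopf algebra representing the $\sigma$-Galois group of $\mathrm{Quot}(R)$ over $K$). Then $$\sigma\text{-}\dim_KR=\sigma\text{-}\dim_kH .$$
   Context: All rings are commutative with $1$. A $\phi\sigma$-ring is a ring with two commuting endomorphisms $\phi,\sigma$; a $\phi\sigma$-field is such a ring that is a field. A nonzero ring with endomorphism $\phi$ is $\phi$-simple if its only ideals stable under $\phi$ are $(0)$ and the whole ring. A $\phi$-pseudo field is a $\phi$-simple Noetherian $\phi$-ring in which every non-zero divisor is invertible. A $\phi$-pseudo $\sigma$-domain is a $\phi\sigma$-ring admitting an injective morphism of $\phi$-rings into some $\phi$-pseudo field. $R^\phi=\{r\mid\phi(r)=r\}$. $K\{S\}_\sigma$ is the $K$-subalgebra generated by all $\sigma^i(s)$, $s\in S$, $i\ge0$. A $K$-$\phi\sigma$-algebra $R$ that is a $\phi$-pseudo $\sigma$-domain is a $\sigma$-Picard--Vessiot ring for $\phi(y)=Ay$ if it is $\phi$-simple and $R=K\{Y,1/\det(Y)\}_\sigma$ for some $Y\in\mathrm{GL}_n(R)$ with $\phi(Y)=AY$. On $R\otimes_KR$, $\phi(a\otimes b)=\phi(a)\otimes\phi(b)$ and likewise for $\sigma$. One has $H=k\{Z,1/\det Z\}_\sigma$ with $Z=(Y\otimes1)^{-1}(1\otimes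 Y)$, so $H$ is finitely $\sigma$-generated over $k$. $\sigma$-dimension: for a $\sigma$-field $E$ and a finitely $\sigma$-generated $E$-$\sigma$-algebra $T=E\{a\}_\sigma$ ($a$ a finite tuple), let $d_i$ be the Krull dimension of $E[a,\sigma(a),\dots,\sigma^i(a)]$; then $\sigma\text{-}\dim_E T:=\big\lfloor\limsup_{i\to\infty}d_i/(i+1)\big\rfloor$, which does not depend on the choice of $a$. *)

theory Defs
  imports "HOL-Algebra.Algebra" "HOL-Combinatorics.Permutations" "HOL-Library.Extended_Real"
begin

section \<open>Rings with endomorphisms\<close>

locale phi_ring = cring R for R (structure) +
  fixes \<phi>
  assumes phi_hom: "\<phi> \<in> ring_hom R R"

locale phi_sigma_ring = phi_ring R \<phi> for R (structure) and \<phi> +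
  fixes \<sigma>
  assumes sigma_hom: "\<sigma> \<in> ring_hom R R"
    and phi_sigma_commute: "x \<in> carrier R \<Longrightarrow> \<phi> (\<sigma> x) = \<sigma> (\<phi> x)"

locale phi_sigma_field = phi_sigma_ring R \<phi> \<sigma> + field R for R (structure) and \<phi> \<sigma>

text \<open>An algebra over \<open>K\<close> is a ring \<open>R\<close> together with its structure morphism \<open>\<iota>\<close> from \<open>K\<close> to \<open>R\<close>.\<close>

locale phi_sigma_algebra =
  base: phi_sigma_ring K \<phi>\<^sub>K \<sigma>\<^sub>K + phi_sigma_ring R \<phi> \<sigma>
  for K (structure) and \<phi>\<^sub>K \<sigma>\<^sub>K and R (structure) and \<phi> \<sigma> +
  fixes \<iota>
  assumes struct_hom: "\<iota> \<in> ring_hom K R"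
    and struct_phi: "c \<in> carrier K \<Longrightarrow> \<phi> (\<iota> c) = \<iota> (\<phi>\<^sub>K c)"
    and struct_sigma: "c \<in> carrier K \<Longrightarrow> \<sigma> (\<iota> c) = \<iota> (\<sigma>\<^sub>K c)"

definition phi_simple :: "('a, 'm) ring_scheme \<Rightarrow> ('a \<Rightarrow> 'a) \<Rightarrow> bool" where
  "phi_simple R \<phi> \<longleftrightarrow> carrier R \<noteq> {\<zero>\<^bsub>R\<^esub>} \<and>
    (\<forall>I. ideal I R \<and> \<phi> ` I \<subseteq> I \<longrightarrow> I = {\<zero>\<^bsub>R\<^esub>} \<or> I = carrier R)"

locale phi_pseudo_field = phi_ring R \<phi> + noetherian_ring R for R (structure) and \<phi> +
  assumes simple: "phi_simple R \<phi>"
    and non_zero_divisor_Units: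
      "\<lbrakk>a \<in> carrier R; \<And>b. \<lbrakk>b \<in> carrier R; a \<otimes> b = \<zero>\<rbrakk> \<Longrightarrow> b = \<zero>\<rbrakk> \<Longrightarrow> a \<in> Units R"

text \<open>The ambient pseudo field ranges over all rings on some type \<open>'l\<close>. A definition cannot quantify
  existentially over types, so \<open>'l\<close> is a parameter; when the predicate is used as a hypothesis with
  \<open>'l\<close> a free type variable, this amounts to the existence of a pseudo field on an arbitrary type.\<close>

definition pseudo_sigma_domain ::
    "'l itself \<Rightarrow> ('a, 'm) ring_scheme \<Rightarrow> ('a \<Rightarrow> 'a) \<Rightarrow> ('a \<Rightarrow> 'a) \<Rightarrow> bool" where
  "pseudo_sigma_domain _ R \<phi> \<sigma> \<longleftrightarrow> phi_sigma_ring R \<phi> \<sigma> \<and>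
    (\<exists>(L :: 'l ring) \<psi> e. phi_pseudo_field L \<psi> \<and> e \<in> ring_hom R L \<and> inj_on e (carrier R) \<and>
      (\<forall>x\<in>carrier R. e (\<phi> x) = \<psi> (e x)))"

definition fixed_ring :: "('a, 'm) ring_scheme \<Rightarrow> ('a \<Rightarrow> 'a) \<Rightarrow> ('a, 'm) ring_scheme" where
  "fixed_ring R \<phi> = R\<lparr>carrier := {r \<in> carrier R. \<phi> r = r}\<rparr>"


section \<open>Matrices and Picard--Vessiot rings\<close>

text \<open>An \<open>n\<close> by \<open>n\<close> matrix is a function of two indices, of which only the values at indices
  below \<open>n\<close> matter.\<close>

definition mat_mult ::
    "('a, 'm) ring_scheme \<Rightarrow> nat \<Rightarrow> (nat \<Rightarrow> nat \<Rightarrow> 'a) \<Rightarrow> (nat \<Rightarrow> nat \<Rightarrow> 'a) \<Rightarrow> nat \<Rightarrow> nat \<Rightarrow> 'a" where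
  "mat_mult R n M N i j = (\<Oplus>\<^bsub>R\<^esub>l\<in>{..<n}. M i l \<otimes>\<^bsub>R\<^esub> N l j)"

definition mat_one :: "('a, 'm) ring_scheme \<Rightarrow> nat \<Rightarrow> nat \<Rightarrow> 'a" where
  "mat_one R i j = (if i = j then \<one>\<^bsub>R\<^esub> else \<zero>\<^bsub>R\<^esub>)"

definition mat_eq :: "nat \<Rightarrow> (nat \<Rightarrow> nat \<Rightarrow> 'a) \<Rightarrow> (nat \<Rightarrow> nat \<Rightarrow> 'a) \<Rightarrow> bool" where
  "mat_eq n M N \<longleftrightarrow> (\<forall>i<n. \<forall>j<n. M i j = N i j)"

definition mat_carrier :: "('a, 'm) ring_scheme \<Rightarrow> nat \<Rightarrow> (nat \<Rightarrow> nat \<Rightarrow> 'a) set" where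
  "mat_carrier R n = {M. \<forall>i<n. \<forall>j<n. M i j \<in> carrier R}"

definition GL :: "nat \<Rightarrow> ('a, 'm) ring_scheme \<Rightarrow> (nat \<Rightarrow> nat \<Rightarrow> 'a) set" where
  "GL n R = {M \<in> mat_carrier R n. \<exists>N\<in>mat_carrier R n.
     mat_eq n (mat_mult R n M N) (mat_one R) \<and> mat_eq n (mat_mult R n N M) (mat_one R)}"

definition mat_det :: "('a, 'm) ring_scheme \<Rightarrow> nat \<Rightarrow> (nat \<Rightarrow> nat \<Rightarrow> 'a) \<Rightarrow> 'a" where
  "mat_det R n M = (\<Oplus>\<^bsub>R\<^esub>p\<in>{p. p permutes {..<n}}.
     if evenperm p then (\<Otimes>\<^bsub>R\<^esub>i\<in>{..<n}. M i (p i)) else \<ominus>\<^bsub>R\<^esub> (\<Otimes>\<^bsub>R\<^esub>i\<in>{..<n}. M i (p i)))"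

definition sigma_generate ::
    "('k, 'x) ring_scheme \<Rightarrow> ('k \<Rightarrow> 'a) \<Rightarrow> ('a, 'm) ring_scheme \<Rightarrow> ('a \<Rightarrow> 'a) \<Rightarrow> 'a set \<Rightarrow> 'a set" where
  "sigma_generate E \<iota> T \<sigma> S = generate_ring T (\<iota> ` carrier E \<union> (\<Union>i. (\<sigma> ^^ i) ` S))"

definition sigma_PV_ring ::
    "'l itself \<Rightarrow> ('k, 'x) ring_scheme \<Rightarrow> ('k \<Rightarrow> 'k) \<Rightarrow> ('k \<Rightarrow> 'k) \<Rightarrow> nat \<Rightarrow> (nat \<Rightarrow> nat \<Rightarrow> 'k) \<Rightarrow>
      ('r, 'y) ring_scheme \<Rightarrow> ('r \<Rightarrow> 'r) \<Rightarrow> ('r \<Rightarrow> 'r) \<Rightarrow> ('k \<Rightarrow> 'r) \<Rightarrow> bool" where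
  "sigma_PV_ring l K \<phi>\<^sub>K \<sigma>\<^sub>K n A R \<phi> \<sigma> \<iota> \<longleftrightarrow>
     phi_sigma_algebra K \<phi>\<^sub>K \<sigma>\<^sub>K R \<phi> \<sigma> \<iota> \<and>
     pseudo_sigma_domain l R \<phi> \<sigma> \<and>
     phi_simple R \<phi> \<and>
     (\<exists>Y\<in>GL n R.
        mat_eq n (\<lambda>i j. \<phi> (Y i j)) (mat_mult R n (\<lambda>i j. \<iota> (A i j)) Y) \<and>
        carrier R = sigma_generate K \<iota> R \<sigma>
          ({Y i j | i j. i < n \<and> j < n} \<union> {inv\<^bsub>R\<^esub> (mat_det R n Y)}))"


section \<open>Tensor products of algebras\<close>

text \<open>The tensor product of two \<open>K\<close>-algebras \<open>R\<close>, \<open>S\<close> is the free abelian group on the pairs \<open>(a, b)\<close>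
  with the multiplication \<open>(a, b) (c, d) = (a c, b d)\<close>, modulo the relations of biadditivity and
  \<open>K\<close>-balancedness. The additive subgroup generated by these relations is already an ideal.\<close>

definition pair_ring ::
    "('r, 'y) ring_scheme \<Rightarrow> ('s, 'z) ring_scheme \<Rightarrow> (('r \<times> 's) \<Rightarrow>\<^sub>0 int) ring" where
  "pair_ring R S =
    \<lparr>carrier = carrier (free_Abelian_group (carrier R \<times> carrier S)),
     monoid.mult = (\<lambda>p q. frag_extend (\<lambda>(a, b).
       frag_extend (\<lambda>(c, d). frag_of (a \<otimes>\<^bsub>R\<^esub> c, b \<otimes>\<^bsub>S\<^esub> d)) q) p),
     one = frag_of (\<one>\<^bsub>R\<^esub>, \<one>\<^bsub>S\<^esub>), ring.zero = 0, ring.add = (+)\<rparr>"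

definition tensor_ideal ::
    "('k, 'x) ring_scheme \<Rightarrow> ('k \<Rightarrow> 'r) \<Rightarrow> ('r, 'y) ring_scheme \<Rightarrow> ('k \<Rightarrow> 's) \<Rightarrow> ('s, 'z) ring_scheme
      \<Rightarrow> (('r \<times> 's) \<Rightarrow>\<^sub>0 int) set" where
  "tensor_ideal K \<iota> R \<kappa> S = Idl\<^bsub>pair_ring R S\<^esub>
    ({frag_of (a \<oplus>\<^bsub>R\<^esub> a', b) - frag_of (a, b) - frag_of (a', b) | a a' b.
        a \<in> carrier R \<and> a' \<in> carrier R \<and> b \<in> carrier S} \<union>
     {frag_of (a, b \<oplus>\<^bsub>S\<^esub> b') - frag_of (a, b) - frag_of (a, b') | a b b'.
        a \<in> carrier R \<and> b \<in> carrier S \<and> b' \<in> carrier S} \<union>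
     {frag_of (\<iota> c \<otimes>\<^bsub>R\<^esub> a, b) - frag_of (a, \<kappa> c \<otimes>\<^bsub>S\<^esub> b) | a b c.
        a \<in> carrier R \<and> b \<in> carrier S \<and> c \<in> carrier K})"

definition tensor_ring ::
    "('k, 'x) ring_scheme \<Rightarrow> ('k \<Rightarrow> 'r) \<Rightarrow> ('r, 'y) ring_scheme \<Rightarrow> ('k \<Rightarrow> 's) \<Rightarrow> ('s, 'z) ring_scheme
      \<Rightarrow> (('r \<times> 's) \<Rightarrow>\<^sub>0 int) set ring" where
  "tensor_ring K \<iota> R \<kappa> S = pair_ring R S Quot tensor_ideal K \<iota> R \<kappa> S"

definition tensor ::
    "('k, 'x) ring_scheme \<Rightarrow> ('k \<Rightarrow> 'r) \<Rightarrow> ('r, 'y) ring_scheme \<Rightarrow> ('k \<Rightarrow> 's) \<Rightarrow> ('s, 'z) ring_scheme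
      \<Rightarrow> 'r \<Rightarrow> 's \<Rightarrow> (('r \<times> 's) \<Rightarrow>\<^sub>0 int) set" where
  "tensor K \<iota> R \<kappa> S a b = tensor_ideal K \<iota> R \<kappa> S +>\<^bsub>pair_ring R S\<^esub> frag_of (a, b)"

text \<open>The additive map with \<open>a \<otimes> b \<mapsto> f a \<otimes> g b\<close>; the image below is a singleton whenever \<open>f\<close> and \<open>g\<close>
  are ring endomorphisms extending the same endomorphism of \<open>K\<close>.\<close>

definition tensor_endo ::
    "('k, 'x) ring_scheme \<Rightarrow> ('k \<Rightarrow> 'r) \<Rightarrow> ('r, 'y) ring_scheme \<Rightarrow> ('k \<Rightarrow> 's) \<Rightarrow> ('s, 'z) ring_scheme
      \<Rightarrow> ('r \<Rightarrow> 'r) \<Rightarrow> ('s \<Rightarrow> 's) \<Rightarrow> (('r \<times> 's) \<Rightarrow>\<^sub>0 int) set \<Rightarrow> (('r \<times> 's) \<Rightarrow>\<^sub>0 int) set" where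
  "tensor_endo K \<iota> R \<kappa> S f g t = the_elem ((\<lambda>p. tensor_ideal K \<iota> R \<kappa> S +>\<^bsub>pair_ring R S\<^esub>
     frag_extend (\<lambda>(a, b). frag_of (f a, g b)) p) ` t)"


section \<open>Krull dimension and \<open>\<sigma>\<close>-dimension\<close>

definition krull_dim :: "('a, 'm) ring_scheme \<Rightarrow> enat" where
  "krull_dim R = (SUP l \<in> {l. \<exists>P :: nat \<Rightarrow> 'a set.
     (\<forall>i\<le>l. primeideal (P i) R) \<and> (\<forall>i<l. P i \<subset> P (Suc i))}. enat l)"

definition sigma_dim_wrt ::
    "('k, 'x) ring_scheme \<Rightarrow> ('k \<Rightarrow> 'a) \<Rightarrow> ('a, 'm) ring_scheme \<Rightarrow> ('a \<Rightarrow> 'a) \<Rightarrow> 'a set \<Rightarrow> int" where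
  "sigma_dim_wrt E \<iota> T \<sigma> S =
    (let d = (\<lambda>i. krull_dim
       (T\<lparr>carrier := generate_ring T (\<iota> ` carrier E \<union> (\<Union>j\<le>i. (\<sigma> ^^ j) ` S))\<rparr>))
     in \<lfloor>real_of_ereal (limsup (\<lambda>i. ereal_of_enat (d i) / ereal (real (i + 1))))\<rfloor>)"

text \<open>Meaningful for finitely \<open>\<sigma>\<close>-generated \<open>T\<close> over a \<open>\<sigma>\<close>-field \<open>E\<close>: the common value of
  \<open>sigma_dim_wrt\<close> for all finite \<open>\<sigma>\<close>-generating sets (only the entries of a generating tuple matter).\<close>

definition sigma_dim ::
    "('k, 'x) ring_scheme \<Rightarrow> ('k \<Rightarrow> 'a) \<Rightarrow> ('a, 'm) ring_scheme \<Rightarrow> ('a \<Rightarrow> 'a) \<Rightarrow> int" where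
  "sigma_dim E \<iota> T \<sigma> = (THE d. \<exists>S. finite S \<and> S \<subseteq> carrier T \<and>
     carrier T = sigma_generate E \<iota> T \<sigma> S \<and> d = sigma_dim_wrt E \<iota> T \<sigma> S)"

end

theory Submission
  imports Defs
begin

text \<open>
  Let \<open>T\<close> be the tensor square of \<open>R\<close> over \<open>K\<close>, let \<open>C\<close> be the subring \<open>R \<otimes> 1\<close> and \<open>N\<close> the
  inverse of \<open>Y\<close>. Two \<open>\<sigma>\<close>-algebras inside \<open>T\<close> are compared. The first is \<open>1 \<otimes> R\<close>, generated over
  \<open>K\<close> by the entries of \<open>1 \<otimes> Y\<close> and \<open>1 \<otimes> N\<close>; the second is \<open>H\<close>, generated over \<open>k\<close> by the entries of
  \<open>Z = (N \<otimes> 1) (1 \<otimes> Y)\<close> and of its inverse. Since \<open>1 \<otimes> Y = (Y \<otimes> 1) Z\<close>, the conjugates of order at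
  most \<open>i\<close> of the two sets of generators generate the same algebra over \<open>C\<close>, for every \<open>i\<close>
  (\<open>same_span\<close>).

  Both algebras are linearly disjoint from \<open>C\<close>. For \<open>1 \<otimes> R\<close> this is linear algebra over the field
  \<open>K\<close> (\<open>rt_lin_indep\<close>). For \<open>H\<close> it is the shortest-relation argument for constants: \<open>R\<close> is
  \<open>\<phi>\<close>-simple and its constants are those of \<open>K\<close> (\<open>constants_lin_indep\<close>). Hence elements that are
  algebraically independent over \<open>K\<close>, respectively over \<open>k\<close>, stay independent over \<open>C\<close>. Linear
  disjointness also shows that \<open>Z\<close> and its inverse do generate \<open>H\<close>: the conjugates of their entries
  generate \<open>T\<close> over \<open>C\<close>, and an element of \<open>H\<close> that is a combination of elements of \<open>H\<close> over \<open>C\<close>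
  is one over \<open>k\<close> (\<open>lspan_descend\<close>).

  It remains to pass from \<open>l\<close> elements of \<open>C[s\<^sub>1, \<dots>, s\<^sub>m]\<close> that are independent over \<open>C\<close> to \<open>l\<close> of the
  generators that are independent over the smaller field \<open>K\<close> or \<open>k\<close>. The ring \<open>C\<close> is a copy of \<open>R\<close>,
  which may have zero divisors, so transcendence degrees over \<open>C\<close> are not at hand; but a
  \<open>\<phi>\<close>-simple ring is reduced, and over a reduced ring counting monomials of bounded degree
  suffices (\<open>alg_indep_many_imp_generators_alg_indep\<close>). Used in both directions, this shows that in
  each order the two filtrations contain algebraically independent families of the same sizes
  (\<open>same_transcendence\<close>).

  For a finitely generated algebra over a field, the largest such size is the Krull dimension
  (\<open>krull_dim_ge_iff_alg_indep_of_size\<close>). So the sequences of Krull dimensions for the chosen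
  generators coincide term by term. The \<open>\<sigma>\<close>-dimension may be computed from these generators,
  because another choice only shifts the orders by a constant (\<open>sigma_dim_eq_wrt\<close>).
\<close>

section \<open>Spans and linear independence over a subring\<close>

text \<open>
  The \<open>C\<close>-submodule generated by \<open>U\<close>. Elements are built up one multiple at a time, which makes
  arguments about spans plain inductions without reference to finite index sets.
\<close>

inductive_set lspan :: "('a, 'm) ring_scheme \<Rightarrow> 'a set \<Rightarrow> 'a set \<Rightarrow> 'a set"
  for T (structure) and C U where
  lspan_zero: "\<zero> \<in> lspan T C U"
| lspan_step: "\<lbrakk>c \<in> C; u \<in> U; v \<in> lspan T C U\<rbrakk> \<Longrightarrow> c \<otimes> u \<oplus> v \<in> lspan T C U"

text \<open>
  Independence is taken modulo \<open>P\<close>, so that the notion covers both families in \<open>T\<close> itself, where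
  \<open>P\<close> is \<open>{\<zero>}\<close>, and families that are independent in a quotient by an ideal \<open>P\<close>.
\<close>

definition lin_indep ::
    "('a, 'm) ring_scheme \<Rightarrow> 'a set \<Rightarrow> 'a set \<Rightarrow> 'i set \<Rightarrow> ('i \<Rightarrow> 'a) \<Rightarrow> bool" where
  "lin_indep T C P I u \<longleftrightarrow> (\<forall>W c. finite W \<and> W \<subseteq> I \<and> c \<in> W \<rightarrow> C \<and>
     (\<Oplus>\<^bsub>T\<^esub>i\<in>W. c i \<otimes>\<^bsub>T\<^esub> u i) \<in> P \<longrightarrow> (\<forall>i\<in>W. c i = \<zero>\<^bsub>T\<^esub>))"

lemma lin_indepD:
  "\<lbrakk>lin_indep T C P I u; finite W; W \<subseteq> I; c \<in> W \<rightarrow> C; (\<Oplus>\<^bsub>T\<^esub>i\<in>W. c i \<otimes>\<^bsub>T\<^esub> u i) \<in> P; i \<in> W\<rbrakk>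
    \<Longrightarrow> c i = \<zero>\<^bsub>T\<^esub>"
  unfolding lin_indep_def by blast

context cring
begin

lemma lspan_carrier:
  assumes "C \<subseteq> carrier R" "U \<subseteq> carrier R"
  shows "lspan R C U \<subseteq> carrier R"
proof
  fix v assume "v \<in> lspan R C U"
  then show "v \<in> carrier R" by induct (use assms in auto)
qed

lemma lspan_empty: "lspan R C {} = {\<zero>}"
proof -
  have "v = \<zero>" if "v \<in> lspan R C {}" for v
    using that by (rule lspan.cases) auto
  then show ?thesis by (auto intro: lspan.lspan_zero)
qed

lemma lspan_closed: "\<lbrakk>v \<in> lspan R C U; C \<subseteq> carrier R; U \<subseteq> carrier R\<rbrakk> \<Longrightarrow> v \<in> carrier R"
  using lspan_carrier by blast

lemma lspan_smult_base:
  assumes "c \<in> C" "u \<in> U" "C \<subseteq> carrier R" "U \<subseteq> carrier R"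
  shows "c \<otimes> u \<in> lspan R C U"
proof -
  have "c \<otimes> u \<oplus> \<zero> \<in> lspan R C U"
    using assms by (intro lspan.intros)
  then show ?thesis using assms by (metis m_closed r_zero subsetD)
qed

lemma lspan_base:
  assumes "subring C R" "u \<in> U" "U \<subseteq> carrier R"
  shows "u \<in> lspan R C U"
  using lspan_smult_base[of \<one> C u U] subringE[OF assms(1)] assms by auto

lemma lspan_add:
  assumes "v \<in> lspan R C U" "w \<in> lspan R C U" "C \<subseteq> carrier R" "U \<subseteq> carrier R"
  shows "v \<oplus> w \<in> lspan R C U"
  using assms(1)
proof induct
  case lspan_zero
  then show ?case using assms lspan_closed by simp
next
  case (lspan_step c u v)
  have "c \<otimes> u \<oplus> v \<oplus> w = c \<otimes> u \<oplus> (v \<oplus> w)"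
    using lspan_step assms lspan_closed[of v C U] lspan_closed[of w C U]
    by (intro a_assoc) auto
  then show ?case using lspan_step by (simp add: lspan.intros)
qed

lemma lspan_smult:
  assumes "v \<in> lspan R C U" "a \<in> C" "subring C R" "U \<subseteq> carrier R"
  shows "a \<otimes> v \<in> lspan R C U"
  using assms(1)
proof induct
  case lspan_zero
  have "a \<otimes> \<zero> = \<zero>" using assms subringE(1)[OF assms(3)] by auto
  then show ?case by (simp add: lspan.lspan_zero)
next
  case (lspan_step c u v)
  note C = subringE[OF assms(3)]
  have "a \<otimes> (c \<otimes> u \<oplus> v) = (a \<otimes> c) \<otimes> u \<oplus> a \<otimes> v"
    using lspan_step assms lspan_closed[of v C U] C(1) by (simp add: r_distr m_assoc subsetD)
  then show ?case using lspan_step assms C by (simp add: lspan.intros)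
qed

lemma lspan_uminus:
  assumes "v \<in> lspan R C U" "subring C R" "U \<subseteq> carrier R"
  shows "\<ominus> v \<in> lspan R C U"
proof -
  note C = subringE[OF assms(2)]
  have "(\<ominus> \<one>) \<otimes> v \<in> lspan R C U"
    using assms C by (intro lspan_smult) auto
  then show ?thesis using lspan_closed[OF assms(1) C(1) assms(3)] by (simp add: l_minus)
qed

lemma lspan_finsum:
  assumes "\<And>i. i \<in> I \<Longrightarrow> f i \<in> lspan R C U" "C \<subseteq> carrier R" "U \<subseteq> carrier R"
  shows "finsum R f I \<in> lspan R C U"
proof (cases "finite I")
  case True
  then show ?thesis using assms(1)
  proof (induct I)
    case empty
    then show ?case by (simp add: lspan.intros)
  next
    case (insert x F)
    have "f \<in> insert x F \<rightarrow> carrier R" using insert(4) lspan_closed assms by blast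
    then have "finsum R f (insert x F) = f x \<oplus> finsum R f F"
      using insert by (intro finsum_insert) auto
    then show ?case using insert assms lspan_add by auto
  qed
next
  case False
  then show ?thesis by (simp add: lspan.intros finsum_infinite)
qed

lemma lspan_mono:
  assumes "C \<subseteq> C'" "U \<subseteq> U'"
  shows "lspan R C U \<subseteq> lspan R C' U'"
proof
  fix v assume "v \<in> lspan R C U"
  then show "v \<in> lspan R C' U'" by induct (use assms in \<open>auto intro: lspan.intros\<close>)
qed

lemma lspan_least:
  assumes "U \<subseteq> lspan R C V" "subring C R" "V \<subseteq> carrier R"
  shows "lspan R C U \<subseteq> lspan R C V"
proof
  note C = subringE[OF assms(2)]
  fix v assume "v \<in> lspan R C U"
  then show "v \<in> lspan R C V"
    by induct (use assms C in \<open>auto intro: lspan.intros intro!: lspan_add lspan_smult\<close>)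
qed

lemma lspan_mult:
  assumes "u \<in> lspan R C U" "v \<in> lspan R C V" "subring C R" "U \<subseteq> carrier R" "V \<subseteq> carrier R"
    "\<And>a b. \<lbrakk>a \<in> U; b \<in> V\<rbrakk> \<Longrightarrow> a \<otimes> b \<in> W" "W \<subseteq> carrier R"
  shows "u \<otimes> v \<in> lspan R C W"
proof -
  note C = subringE[OF assms(3)]
  have vc: "v \<in> carrier R" using lspan_closed[OF assms(2) C(1) assms(5)] .
  have 1: "a \<otimes> v \<in> lspan R C W" if a: "a \<in> U" for a
    using assms(2)
  proof induct
    case lspan_zero
    have "a \<otimes> \<zero> = \<zero>" using a assms(4) by auto
    then show ?case by (simp add: lspan.lspan_zero)
  next
    case (lspan_step c b w)
    then have cl: "c \<in> carrier R" "a \<in> carrier R" "b \<in> carrier R" "w \<in> carrier R"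
      using subsetD[OF C(1)] a assms(4,5) lspan_closed[OF lspan_step(3) C(1) assms(5)] by auto
    then have "a \<otimes> (c \<otimes> b \<oplus> w) = c \<otimes> (a \<otimes> b) \<oplus> a \<otimes> w" by algebra
    then show ?case using lspan_step assms(6)[OF a] by (simp add: lspan.intros)
  qed
  show ?thesis using assms(1)
  proof induct
    case lspan_zero
    then show ?case using vc assms by (auto intro: lspan.intros)
  next
    case (lspan_step c a w)
    then have cl: "c \<in> carrier R" "a \<in> carrier R" "v \<in> carrier R" "w \<in> carrier R"
      using subsetD[OF C(1)] vc assms(4) lspan_closed[OF lspan_step(3) C(1) assms(4)] by auto
    then have "(c \<otimes> a \<oplus> w) \<otimes> v = c \<otimes> (a \<otimes> v) \<oplus> w \<otimes> v" by algebra
    then show ?case using lspan_step 1 assms C lspan_add lspan_smult by simp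
  qed
qed

lemma lspan_family:
  assumes "v \<in> lspan R C (u ` I)" "finite I" "subring C R" "u ` I \<subseteq> carrier R"
  shows "\<exists>c \<in> I \<rightarrow> C. v = (\<Oplus>i\<in>I. c i \<otimes> u i)"
  using assms(1)
proof induct
  case lspan_zero
  have "\<zero> = (\<Oplus>i\<in>I. \<zero> \<otimes> u i)"
    using assms(4) by (intro add.finprod_one_eqI[symmetric]) auto
  then show ?case by (rule bexI[where x = "\<lambda>i. \<zero>"]) (use subringE(2)[OF assms(3)] in blast)
next
  case (lspan_step c x v)
  note C = subringE[OF assms(3)]
  from lspan_step obtain d where d: "d \<in> I \<rightarrow> C" "v = (\<Oplus>i\<in>I. d i \<otimes> u i)" by blast
  from lspan_step obtain j where j: "j \<in> I" "x = u j" by blast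
  let ?e = "\<lambda>i. if i = j then c else \<zero>"
  have cl: "\<And>i. i \<in> I \<Longrightarrow> u i \<in> carrier R" "\<And>i. i \<in> I \<Longrightarrow> d i \<in> carrier R" "c \<in> carrier R"
    using assms d C lspan_step by auto
  have "c \<otimes> x = (\<Oplus>i\<in>I. if i = j then c \<otimes> u i else \<zero>)"
    using j cl by (subst add.finprod_singleton_swap[OF j(1) assms(2)]) auto
  also have "\<dots> = (\<Oplus>i\<in>I. ?e i \<otimes> u i)"
    using cl by (intro finsum_cong') auto
  finally have "c \<otimes> x \<oplus> v = (\<Oplus>i\<in>I. ?e i \<otimes> u i \<oplus> d i \<otimes> u i)"
    using d cl by (subst finsum_addf) (auto simp: Pi_def)
  also have "\<dots> = (\<Oplus>i\<in>I. (?e i \<oplus> d i) \<otimes> u i)"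
    using cl by (intro finsum_cong') (auto simp: l_distr)
  finally have eq: "c \<otimes> x \<oplus> v = (\<Oplus>i\<in>I. (?e i \<oplus> d i) \<otimes> u i)" .
  have "(\<lambda>i. ?e i \<oplus> d i) \<in> I \<rightarrow> C"
  proof
    fix i assume "i \<in> I"
    then have "d i \<in> C" "?e i \<in> C" using d C(2) lspan_step(1) by auto
    then show "?e i \<oplus> d i \<in> C" by (rule C(7)[rotated])
  qed
  with eq show ?case by (rule bexI)
qed

lemma lspan_finite_support:
  assumes "v \<in> lspan R C U"
  shows "\<exists>U0. finite U0 \<and> U0 \<subseteq> U \<and> v \<in> lspan R C U0"
  using assms
proof induct
  case lspan_zero
  then show ?case by (auto intro: lspan.intros)
next
  case (lspan_step c u v)
  then obtain U0 where U0: "finite U0" "U0 \<subseteq> U" "v \<in> lspan R C U0" by blast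
  then have "v \<in> lspan R C (insert u U0)" using lspan_mono by blast
  then show ?case using lspan_step U0
    by (intro exI[of _ "insert u U0"]) (auto intro: lspan.intros)
qed

lemma lspan_finite_support_set:
  assumes "finite V" "V \<subseteq> lspan R C U"
  shows "\<exists>U0. finite U0 \<and> U0 \<subseteq> U \<and> V \<subseteq> lspan R C U0"
proof -
  have "\<forall>v\<in>V. \<exists>U0. finite U0 \<and> U0 \<subseteq> U \<and> v \<in> lspan R C U0"
    using assms lspan_finite_support by blast
  then obtain f where f: "\<And>v. v \<in> V \<Longrightarrow> finite (f v) \<and> f v \<subseteq> U \<and> v \<in> lspan R C (f v)"
    by metis
  have "v \<in> lspan R C (\<Union>v\<in>V. f v)" if "v \<in> V" for v
    using f[OF that] lspan_mono[of C C "f v" "\<Union>v\<in>V. f v"] that by blast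
  then show ?thesis using assms f by (intro exI[of _ "\<Union>v\<in>V. f v"]) auto
qed

lemma lspan_subring:
  assumes "subring C R" "U \<subseteq> carrier R" "\<one> \<in> U" "\<And>a b. \<lbrakk>a \<in> U; b \<in> U\<rbrakk> \<Longrightarrow> a \<otimes> b \<in> U"
  shows "subring (lspan R C U) R"
proof (rule subringI)
  note C = subringE[OF assms(1)]
  show "lspan R C U \<subseteq> carrier R" using lspan_carrier C assms by blast
  show "\<one> \<in> lspan R C U" using lspan_base assms by blast
  show "\<And>h. h \<in> lspan R C U \<Longrightarrow> \<ominus> h \<in> lspan R C U" using lspan_uminus assms by blast
  show "\<And>g h. \<lbrakk>g \<in> lspan R C U; h \<in> lspan R C U\<rbrakk> \<Longrightarrow> g \<otimes> h \<in> lspan R C U"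
    using lspan_mult[OF _ _ assms(1,2,2)] assms by blast
  show "\<And>g h. \<lbrakk>g \<in> lspan R C U; h \<in> lspan R C U\<rbrakk> \<Longrightarrow> g \<oplus> h \<in> lspan R C U"
    using lspan_add assms C by blast
qed

lemma lspan_insert:
  assumes "v \<in> lspan R C (insert w U)" "subring C R" "w \<in> carrier R" "U \<subseteq> carrier R"
  shows "\<exists>c\<in>C. \<exists>u\<in>lspan R C U. v = c \<otimes> w \<oplus> u"
  using assms(1)
proof induct
  case lspan_zero
  have "\<zero> = \<zero> \<otimes> w \<oplus> \<zero>" using assms by simp
  then show ?case
    by (rule bexI[OF bexI[OF _ lspan.lspan_zero] subringE(2)[OF assms(2)]])
next
  case (lspan_step c x v)
  note C = subringE[OF assms(2)]
  from lspan_step obtain d u where d: "d \<in> C" "u \<in> lspan R C U" "v = d \<otimes> w \<oplus> u" by blast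
  have cl: "c \<in> carrier R" "d \<in> carrier R" "u \<in> carrier R" "x \<in> carrier R"
    using subsetD[OF C(1)] lspan_step(1,2) d(1) assms(3,4) lspan_closed[OF d(2) C(1) assms(4)] by auto
  show ?case
  proof (cases "x = w")
    case True
    have "c \<otimes> x \<oplus> v = (c \<oplus> d) \<otimes> w \<oplus> u" using cl d assms True by algebra
    moreover have "c \<oplus> d \<in> C" using C(7) lspan_step(1) d(1) by simp
    ultimately show ?thesis using d(2) by blast
  next
    case False
    then have "c \<otimes> x \<oplus> u \<in> lspan R C U" using lspan_step(1,2) d(2) by (intro lspan.lspan_step) auto
    moreover have "c \<otimes> x \<oplus> v = d \<otimes> w \<oplus> (c \<otimes> x \<oplus> u)" unfolding d(3) using cl assms(3) by algebra
    ultimately show ?thesis using d(1) by blast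
  qed
qed

lemma finsum_lsmult:
  assumes "finite W" "a \<in> carrier R" "c \<in> W \<rightarrow> carrier R" "u \<in> W \<rightarrow> carrier R"
  shows "a \<otimes> (\<Oplus>i\<in>W. c i \<otimes> u i) = (\<Oplus>i\<in>W. (a \<otimes> c i) \<otimes> u i)"
proof -
  have "a \<otimes> (\<Oplus>i\<in>W. c i \<otimes> u i) = (\<Oplus>i\<in>W. a \<otimes> (c i \<otimes> u i))"
    using assms by (intro finsum_rdistr) (auto simp: Pi_def)
  also have "\<dots> = (\<Oplus>i\<in>W. (a \<otimes> c i) \<otimes> u i)"
    using assms by (intro finsum_cong') (auto simp: m_assoc Pi_def)
  finally show ?thesis .
qed

text \<open>
  Gaussian elimination over a ring in which pivots may be zero divisors. The induction removes one
  spanning vector \<open>w j\<close> at a time and carries an element \<open>d \<noteq> \<zero>\<close> that must not annihilate all the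
  coefficients of the relation. If \<open>d\<close> annihilates every coefficient at \<open>w j\<close>, then multiplying a
  relation between the remaining parts by \<open>d\<close> gets rid of \<open>w j\<close>, and reducedness ensures
  \<open>d \<otimes> (d \<otimes> v i) \<noteq> \<zero>\<close>. Otherwise some \<open>c k\<close> with \<open>d \<otimes> c k \<noteq> \<zero>\<close> serves as pivot, and
  \<open>d \<otimes> c k\<close> takes over the role of \<open>d\<close>.
\<close>

lemma dependence_in_small_span:
  assumes C: "subring C R" and red: "\<And>x. \<lbrakk>x \<in> C; x \<otimes> x = \<zero>\<rbrakk> \<Longrightarrow> x = \<zero>"
    and J: "finite J" "w \<in> J \<rightarrow> carrier R"
    and I: "finite I" "card J < card I" "\<And>i. i \<in> I \<Longrightarrow> u i \<in> lspan R C (w ` J)"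
    and d: "d \<in> C" "d \<noteq> \<zero>"
  shows "\<exists>v \<in> I \<rightarrow> C. (\<exists>i\<in>I. d \<otimes> v i \<noteq> \<zero>) \<and> (\<Oplus>i\<in>I. v i \<otimes> u i) = \<zero>"
  using J I d
proof (induct J arbitrary: I u d rule: finite_induct)
  case empty
  note CE = subringE[OF C]
  have u: "u i = \<zero>" if "i \<in> I" for i
    using empty(4)[OF that] by (simp add: lspan_empty)
  obtain i where "i \<in> I" using empty by fastforce
  moreover have "(\<Oplus>i\<in>I. \<one> \<otimes> u i) = \<zero>"
    using u by (intro add.finprod_one_eqI) simp
  ultimately show ?case using empty CE
    by (intro bexI[of _ "\<lambda>i. \<one>"]) auto
next
  case (insert j J I u d)
  note CE = subringE[OF C]
  have wj: "w j \<in> carrier R" and wJ: "w ` J \<subseteq> carrier R" using insert by auto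
  have "\<forall>i\<in>I. \<exists>c. \<exists>x. c \<in> C \<and> x \<in> lspan R C (w ` J) \<and> u i = c \<otimes> w j \<oplus> x"
  proof
    fix i assume "i \<in> I"
    then have "u i \<in> lspan R C (insert (w j) (w ` J))" using insert(7)[of i] by simp
    from lspan_insert[OF this C wj wJ]
    show "\<exists>c. \<exists>x. c \<in> C \<and> x \<in> lspan R C (w ` J) \<and> u i = c \<otimes> w j \<oplus> x" by blast
  qed
  then obtain c x where cx: "\<And>i. i \<in> I \<Longrightarrow> c i \<in> C" "\<And>i. i \<in> I \<Longrightarrow> x i \<in> lspan R C (w ` J)"
    "\<And>i. i \<in> I \<Longrightarrow> u i = c i \<otimes> w j \<oplus> x i" by metis
  have cl1: "\<And>i. i \<in> I \<Longrightarrow> c i \<in> carrier R" "\<And>i. i \<in> I \<Longrightarrow> x i \<in> carrier R" "d \<in> carrier R"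
    using cx(1) subsetD[OF CE(1)] lspan_closed[OF cx(2) CE(1) wJ] insert(8) by auto
  then have cl: "\<And>i. i \<in> I \<Longrightarrow> c i \<in> carrier R" "\<And>i. i \<in> I \<Longrightarrow> x i \<in> carrier R"
    "\<And>i. i \<in> I \<Longrightarrow> u i \<in> carrier R" "d \<in> carrier R"
    using cx(3) wj by simp_all
  show ?case
  proof (cases "\<forall>i\<in>I. d \<otimes> c i = \<zero>")
    case True
    have "\<exists>v \<in> I \<rightarrow> C. (\<exists>i\<in>I. d \<otimes> v i \<noteq> \<zero>) \<and> (\<Oplus>i\<in>I. v i \<otimes> x i) = \<zero>"
      using insert cx by (intro insert(3)) auto
    then obtain v i where v: "v \<in> I \<rightarrow> C" "i \<in> I" "d \<otimes> v i \<noteq> \<zero>" "(\<Oplus>i\<in>I. v i \<otimes> x i) = \<zero>"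
      by blast
    have vc: "\<And>i. i \<in> I \<Longrightarrow> v i \<in> carrier R" using v(1) subsetD[OF CE(1)] by auto
    have "d \<otimes> (d \<otimes> v i) \<noteq> \<zero>"
    proof
      assume "d \<otimes> (d \<otimes> v i) = \<zero>"
      then have "(d \<otimes> v i) \<otimes> (d \<otimes> v i) = \<zero>"
        using vc[OF v(2)] cl(4) by (metis m_assoc m_closed m_comm r_null)
      moreover have "d \<otimes> v i \<in> C" using v(1,2) insert(8) by (intro CE(6)) auto
      ultimately show False using red[of "d \<otimes> v i"] v(3) by blast
    qed
    moreover have "(\<Oplus>i\<in>I. (d \<otimes> v i) \<otimes> u i) = \<zero>"
    proof -
      have "(\<Oplus>i\<in>I. (d \<otimes> v i) \<otimes> u i) = (\<Oplus>i\<in>I. (d \<otimes> v i) \<otimes> x i)"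
      proof (intro finsum_cong')
        fix i assume i: "i \<in> I"
        have "d \<otimes> v i \<otimes> u i = (d \<otimes> c i) \<otimes> (v i \<otimes> w j) \<oplus> d \<otimes> v i \<otimes> x i"
          unfolding cx(3)[OF i] using cl(1,2,4) vc wj i by algebra
        then show "d \<otimes> v i \<otimes> u i = d \<otimes> v i \<otimes> x i"
          using True i cl vc wj by simp
      qed (use cl vc in auto)
      also have "\<dots> = d \<otimes> (\<Oplus>i\<in>I. v i \<otimes> x i)"
        using cl vc insert by (intro finsum_lsmult[symmetric]) auto
      finally show ?thesis using v cl by simp
    qed
    moreover have "(\<lambda>i. d \<otimes> v i) \<in> I \<rightarrow> C" using v(1) insert(8) CE(6) by auto
    ultimately show ?thesis using v(2) by (intro bexI[of _ "\<lambda>i. d \<otimes> v i"] conjI bexI[of _ i])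
  next
    case False
    then obtain k where k: "k \<in> I" "d \<otimes> c k \<noteq> \<zero>" by blast
    let ?I = "I - {k}"
    let ?y = "\<lambda>i. c k \<otimes> u i \<ominus> c i \<otimes> u k"
    have y: "?y i = c k \<otimes> x i \<ominus> c i \<otimes> x k" if "i \<in> I" for i
      unfolding cx(3)[OF that] cx(3)[OF k(1)] using cl(1,2) that k wj by algebra
    have "\<exists>v \<in> ?I \<rightarrow> C. (\<exists>i\<in>?I. (d \<otimes> c k) \<otimes> v i \<noteq> \<zero>) \<and> (\<Oplus>i\<in>?I. v i \<otimes> ?y i) = \<zero>"
    proof (intro insert(3))
      show "w \<in> J \<rightarrow> carrier R" "finite ?I" using insert by auto
      show "card J < card ?I" using insert k by simp
      show "?y i \<in> lspan R C (w ` J)" if "i \<in> ?I" for i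
      proof -
        have "?y i = c k \<otimes> x i \<ominus> c i \<otimes> x k" using y that by blast
        also have "\<dots> \<in> lspan R C (w ` J)" unfolding a_minus_def
          using that k(1) cx by (intro lspan_add lspan_uminus lspan_smult C wJ CE(1)) auto
        finally show ?thesis .
      qed
      show "d \<otimes> c k \<in> C" "d \<otimes> c k \<noteq> \<zero>" using k insert(8) CE(6) cx(1) by auto
    qed
    then obtain v i where v: "v \<in> ?I \<rightarrow> C" "i \<in> ?I" "(d \<otimes> c k) \<otimes> v i \<noteq> \<zero>"
      "(\<Oplus>i\<in>?I. v i \<otimes> ?y i) = \<zero>" by blast
    have vc: "\<And>i. i \<in> ?I \<Longrightarrow> v i \<in> carrier R" using v(1) subsetD[OF CE(1)] by auto
    define s where "s = (\<Oplus>i\<in>?I. v i \<otimes> c i)"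
    have finI: "finite ?I" using insert by simp
    have s: "s \<in> C" "s \<in> carrier R"
    proof -
      have "s \<in> lspan R C {\<one>}" unfolding s_def
      proof (intro lspan_finsum CE)
        fix i assume "i \<in> ?I"
        then have "v i \<otimes> c i \<in> C" using v(1) cx(1) by (intro CE(6)) auto
        then have "(v i \<otimes> c i) \<otimes> \<one> \<in> lspan R C {\<one>}" using CE by (intro lspan_smult_base) auto
        then show "v i \<otimes> c i \<in> lspan R C {\<one>}" using \<open>v i \<otimes> c i \<in> C\<close> CE by auto
      qed simp
      then obtain a where "a \<in> C" "s = a \<otimes> \<one> \<oplus> \<zero>"
        using lspan_insert[of s C \<one> "{}"] C by (auto simp: lspan_empty)
      then show "s \<in> C" "s \<in> carrier R" using CE by auto
    qed
    let ?v = "\<lambda>i. if i = k then \<ominus> s else c k \<otimes> v i"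
    have eq1: "(\<Oplus>i\<in>?I. v i \<otimes> ?y i) = (\<Oplus>i\<in>?I. ?v i \<otimes> u i) \<oplus> (\<ominus> s) \<otimes> u k"
    proof -
      have "(\<Oplus>i\<in>?I. v i \<otimes> ?y i) = (\<Oplus>i\<in>?I. ?v i \<otimes> u i \<oplus> (v i \<otimes> c i) \<otimes> (\<ominus> u k))"
      proof (intro finsum_cong')
        fix i assume i: "i \<in> ?I"
        then have c: "v i \<in> carrier R" "c i \<in> carrier R" "c k \<in> carrier R" "u i \<in> carrier R" "u k \<in> carrier R"
          using vc cl k by auto
        have "v i \<otimes> ?y i = c k \<otimes> v i \<otimes> u i \<oplus> (v i \<otimes> c i) \<otimes> (\<ominus> u k)"
          using c by algebra
        then show "v i \<otimes> ?y i = ?v i \<otimes> u i \<oplus> (v i \<otimes> c i) \<otimes> (\<ominus> u k)" using i by simp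
      qed (use cl vc k in auto)
      also have "\<dots> = (\<Oplus>i\<in>?I. ?v i \<otimes> u i) \<oplus> (\<Oplus>i\<in>?I. (v i \<otimes> c i) \<otimes> (\<ominus> u k))"
        using cl vc k s by (intro finsum_addf) auto
      also have "(\<Oplus>i\<in>?I. (v i \<otimes> c i) \<otimes> (\<ominus> u k)) = s \<otimes> (\<ominus> u k)"
        unfolding s_def using cl vc k finI by (intro finsum_ldistr[symmetric]) auto
      finally show ?thesis using s cl k by (simp add: l_minus r_minus)
    qed
    have "(\<Oplus>i\<in>I. ?v i \<otimes> u i) = ?v k \<otimes> u k \<oplus> (\<Oplus>i\<in>?I. ?v i \<otimes> u i)"
    proof -
      have "I = insert k ?I" using k by blast
      then have "(\<Oplus>i\<in>I. ?v i \<otimes> u i) = (\<Oplus>i\<in>insert k ?I. ?v i \<otimes> u i)" by simp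
      also have "\<dots> = ?v k \<otimes> u k \<oplus> (\<Oplus>i\<in>?I. ?v i \<otimes> u i)"
        using cl vc k s finI by (intro finsum_insert) auto
      finally show ?thesis .
    qed
    also have "\<dots> = (\<Oplus>i\<in>?I. ?v i \<otimes> u i) \<oplus> (\<ominus> s) \<otimes> u k"
      using cl vc k s by (subst a_comm) (auto intro!: finsum_closed)
    also have "\<dots> = \<zero>" using eq1 v by simp
    finally have "(\<Oplus>i\<in>I. ?v i \<otimes> u i) = \<zero>" .
    moreover have "d \<otimes> ?v i \<noteq> \<zero>" using v vc cl k by (auto simp: m_assoc)
    moreover have "?v \<in> I \<rightarrow> C"
    proof
      fix i assume "i \<in> I"
      then show "?v i \<in> C"
        using CE(5)[OF s(1)] CE(6)[of "c k" "v i"] v(1) k(1) cx(1) by auto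
    qed
    ultimately show ?thesis using v(2) by (intro bexI[of _ ?v] conjI bexI[of _ i]) auto
  qed
qed

end

section \<open>Algebraic independence and change of the coefficient ring\<close>

definition expo :: "'i set \<Rightarrow> ('i \<Rightarrow> nat) set" where
  "expo I = {\<alpha>. \<forall>i. i \<notin> I \<longrightarrow> \<alpha> i = 0}"

definition power_prod :: "('a, 'm) ring_scheme \<Rightarrow> ('i \<Rightarrow> 'a) \<Rightarrow> 'i set \<Rightarrow> ('i \<Rightarrow> nat) \<Rightarrow> 'a" where
  "power_prod T x I \<alpha> = (\<Otimes>\<^bsub>T\<^esub>i\<in>I. x i [^]\<^bsub>T\<^esub> \<alpha> i)"

text \<open>
  As for linear independence, the relation is considered modulo \<open>P\<close>. The coefficients \<open>F\<close> may form
  an arbitrary subring.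
\<close>

definition alg_indep ::
    "('a, 'm) ring_scheme \<Rightarrow> 'a set \<Rightarrow> 'a set \<Rightarrow> 'i set \<Rightarrow> ('i \<Rightarrow> 'a) \<Rightarrow> bool" where
  "alg_indep T F P I x \<longleftrightarrow> lin_indep T F P (expo I) (power_prod T x I)"

lemma weight_less:
  fixes e :: nat
  assumes "\<And>i. i < m \<Longrightarrow> \<alpha> i < e"
  shows "(\<Sum>i<m. \<alpha> i * e ^ i) < e ^ m"
  using assms
proof (induct m)
  case (Suc m)
  have "(\<Sum>i<m. \<alpha> i * e ^ i) < e ^ m" using Suc by simp
  moreover have "Suc (\<alpha> m) * e ^ m \<le> e * e ^ m" using Suc(2)[of m] by (intro mult_right_mono) auto
  ultimately show ?case by simp
qed simp

text \<open>
  Uniqueness of the expansion to base \<open>e\<close>.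
\<close>

lemma weight_inj:
  fixes e :: nat
  assumes "\<And>i. i < m \<Longrightarrow> \<alpha> i < e" "\<And>i. i < m \<Longrightarrow> \<beta> i < e"
    "(\<Sum>i<m. \<alpha> i * e ^ i) = (\<Sum>i<m. \<beta> i * e ^ i)" "i < m"
  shows "\<alpha> i = \<beta> i"
  using assms
proof (induct m)
  case (Suc m)
  have l: "(\<Sum>i<m. \<alpha> i * e ^ i) < e ^ m" "(\<Sum>i<m. \<beta> i * e ^ i) < e ^ m"
    using Suc(2,3) by (auto intro!: weight_less)
  then have "e ^ m \<noteq> 0" by (metis not_less_zero)
  have "\<alpha> m = (\<Sum>i<Suc m. \<alpha> i * e ^ i) div e ^ m" using l \<open>e ^ m \<noteq> 0\<close> by (simp add: div_mult_self1)
  also have "\<dots> = (\<Sum>i<Suc m. \<beta> i * e ^ i) div e ^ m" by (simp only: Suc(4))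
  also have "\<dots> = \<beta> m" using l \<open>e ^ m \<noteq> 0\<close> by (simp add: div_mult_self1)
  finally have "\<alpha> m = \<beta> m" .
  then show ?case using Suc by (auto simp: less_Suc_eq)
qed simp

lemma weight_max_ex:
  fixes f :: "'b \<Rightarrow> nat"
  assumes "finite A" "A \<noteq> {}"
  shows "\<exists>a\<in>A. \<forall>b\<in>A. f b \<le> f a"
proof -
  have "Max (f ` A) \<in> f ` A" using assms by (intro Max_in) auto
  then obtain a where "a \<in> A" "Max (f ` A) = f a" by blast
  then show ?thesis using assms by (metis Max_ge finite_imageI imageI)
qed

lemma finite_card_box:
  fixes A :: "'i \<Rightarrow> nat set"
  assumes "finite I" "\<And>i. i \<in> I \<Longrightarrow> finite (A i)"
  shows "finite {\<alpha> \<in> expo I. \<forall>i\<in>I. \<alpha> i \<in> A i}"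
    and "card {\<alpha> \<in> expo I. \<forall>i\<in>I. \<alpha> i \<in> A i} = (\<Prod>i\<in>I. card (A i))"
proof -
  have "bij_betw (\<lambda>\<alpha>. restrict \<alpha> I) {\<alpha> \<in> expo I. \<forall>i\<in>I. \<alpha> i \<in> A i} (PiE I A)"
  proof (rule bij_betwI[where g = "\<lambda>f i. if i \<in> I then f i else 0"])
    show "(\<lambda>f i. if i \<in> I then f i else 0) (restrict \<alpha> I) = \<alpha>"
      if "\<alpha> \<in> {\<alpha> \<in> expo I. \<forall>i\<in>I. \<alpha> i \<in> A i}" for \<alpha>
      using that by (auto simp: expo_def fun_eq_iff)
    show "restrict (\<lambda>i. if i \<in> I then f i else 0) I = f" if "f \<in> PiE I A" for f
      using that by (auto simp: fun_eq_iff PiE_def extensional_def)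
  qed (auto simp: expo_def)
  moreover have "finite (PiE I A)" using assms by (auto intro: finite_PiE)
  ultimately show "finite {\<alpha> \<in> expo I. \<forall>i\<in>I. \<alpha> i \<in> A i}"
    "card {\<alpha> \<in> expo I. \<forall>i\<in>I. \<alpha> i \<in> A i} = (\<Prod>i\<in>I. card (A i))"
    using card_PiE[OF assms(1), of A] by (simp_all add: bij_betw_finite bij_betw_same_card)
qed

context cring
begin

lemma power_prod_closed: "x \<in> I \<rightarrow> carrier R \<Longrightarrow> power_prod R x I \<alpha> \<in> carrier R"
  unfolding power_prod_def by (intro finprod_closed) auto

lemma power_prod_add:
  assumes "x \<in> I \<rightarrow> carrier R"
  shows "power_prod R x I (\<lambda>i. \<alpha> i + \<beta> i) = power_prod R x I \<alpha> \<otimes> power_prod R x I \<beta>"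
proof -
  have "power_prod R x I (\<lambda>i. \<alpha> i + \<beta> i) = (\<Otimes>i\<in>I. x i [^] \<alpha> i \<otimes> x i [^] \<beta> i)"
    unfolding power_prod_def using assms by (intro finprod_cong') (auto simp: nat_pow_mult Pi_def)
  also have "\<dots> = power_prod R x I \<alpha> \<otimes> power_prod R x I \<beta>"
    unfolding power_prod_def using assms by (intro finprod_multf) auto
  finally show ?thesis .
qed

lemma power_prod_zero: "power_prod R x I (\<lambda>i. 0) = \<one>"
  unfolding power_prod_def by (simp add: finprod_one_eqI)

lemma power_prod_extend:
  assumes "finite I" "J \<subseteq> I" "\<alpha> \<in> expo J" "x \<in> I \<rightarrow> carrier R"
  shows "power_prod R x J \<alpha> = power_prod R x I \<alpha>"
  unfolding power_prod_def using assms
  by (intro finprod_mono_neutral_cong_left) (auto simp: expo_def)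

lemma power_prod_insert:
  assumes "finite I" "j \<notin> I" "x \<in> insert j I \<rightarrow> carrier R"
  shows "power_prod R x (insert j I) \<alpha> = x j [^] \<alpha> j \<otimes> power_prod R x I \<alpha>"
  unfolding power_prod_def using assms by (intro finprod_insert) auto

lemma solve_for_leading_term:
  assumes "d \<in> carrier R" "c \<in> carrier R" "m \<in> carrier R" "r \<in> carrier R"
    "d \<otimes> c = \<one>" "\<zero> = c \<otimes> m \<oplus> r"
  shows "m = \<ominus> (d \<otimes> r)"
proof -
  have "m = (d \<otimes> c) \<otimes> m" using assms by simp
  also have "\<dots> = d \<otimes> (c \<otimes> m \<oplus> r) \<oplus> (\<ominus> (d \<otimes> r))" using assms(1-4) by algebra
  also have "\<dots> = \<ominus> (d \<otimes> r)" using assms(1-4) assms(6)[symmetric] by simp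
  finally show ?thesis .
qed

text \<open>
  This replaces the comparison of transcendence degrees. Let \<open>l\<close> be the size of \<open>I\<close> and suppose that
  any \<open>l\<close> of the generators \<open>s\<close> satisfy a polynomial relation over the field \<open>F\<close>. Order monomials by
  a weight that separates the finitely many exponents occurring in these relations. The leading
  monomial of each relation is then an \<open>F\<close>-combination of lighter ones, so every monomial reduces
  to monomials of at most its weight that are divisible by no leading monomial. Such a good monomial
  has fewer than \<open>l\<close> exponents above the bound \<open>e\<close> for the exponents in the relations, whence only
  \<open>O(D\<^bsup>l - 1\<^esup>)\<close> good monomials have weight at most \<open>D\<close>. On the other hand there are \<open>q\<^bsup>l\<^esup>\<close> monomials in
  \<open>y\<close> with exponents below \<open>q\<close>, and they are \<open>C\<close>-combinations of monomials of weight \<open>O(q)\<close>. For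
  large \<open>q\<close> these are more elements than the good monomials spanning them, so they are linearly
  dependent over \<open>C\<close>.
\<close>

lemma alg_indep_many_imp_generators_alg_indep:
  fixes s :: "nat \<Rightarrow> 'a" and y :: "'i \<Rightarrow> 'a"
  assumes F: "subfield F R" and C: "subring C R" and FC: "F \<subseteq> C"
    and red: "\<And>a. \<lbrakk>a \<in> C; a \<otimes> a = \<zero>\<rbrakk> \<Longrightarrow> a = \<zero>"
    and s: "s \<in> {..<m} \<rightarrow> carrier R"
    and I: "finite I" and y: "y ` I \<subseteq> lspan R C (power_prod R s {..<m} ` expo {..<m})"
    and indep: "alg_indep R C {\<zero>} I y"
  shows "\<exists>J \<subseteq> {..<m}. card J = card I \<and> alg_indep R F {\<zero>} J s"
proof (rule ccontr)
  assume neg: "\<not> ?thesis"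
  have one: "\<one> \<noteq> \<zero>" using subfieldE(6)[OF F] by simp
  have FR: "subring F R" using subfieldE(1)[OF F] .
  note FE = subringE[OF FR] and CE = subringE[OF C]
  let ?l = "card I"
  let ?X = "expo {..<m}"
  let ?M = "power_prod R s {..<m}"
  define Js where "Js = {J. J \<subseteq> {..<m} \<and> card J = ?l}"
  have M: "?M \<alpha> \<in> carrier R" for \<alpha> using power_prod_closed s by blast
  have Mim: "?M ` A \<subseteq> carrier R" for A using M by blast
  have M_add: "?M (\<lambda>i. \<alpha> i + \<beta> i) = ?M \<alpha> \<otimes> ?M \<beta>" for \<alpha> \<beta> using power_prod_add s by blast
  have finJs: "finite Js" unfolding Js_def by (rule finite_subset[of _ "Pow {..<m}"]) auto

  define rel where "rel J E c \<longleftrightarrow> finite E \<and> E \<subseteq> expo J \<and> c \<in> E \<rightarrow> F \<and>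
      (\<Oplus>\<alpha>\<in>E. c \<alpha> \<otimes> power_prod R s J \<alpha>) = \<zero> \<and> (\<exists>\<alpha>\<in>E. c \<alpha> \<noteq> \<zero>)" for J E c
  have "\<exists>E c. rel J E c" if "J \<in> Js" for J
  proof -
    have "\<not> alg_indep R F {\<zero>} J s" using neg that unfolding Js_def by blast
    then obtain E c where "finite E" "E \<subseteq> expo J" "c \<in> E \<rightarrow> F" "(\<Oplus>\<alpha>\<in>E. c \<alpha> \<otimes> power_prod R s J \<alpha>) \<in> {\<zero>}"
      "\<not> (\<forall>\<alpha>\<in>E. c \<alpha> = \<zero>)"
      unfolding alg_indep_def lin_indep_def by blast
    then have "rel J E c" unfolding rel_def by blast
    then show ?thesis by blast
  qed
  then obtain E c where "\<And>J. J \<in> Js \<Longrightarrow> rel J (E J) (c J)" by metis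
  then have Ec: "\<And>J. J \<in> Js \<Longrightarrow> finite (E J) \<and> E J \<subseteq> expo J \<and> c J \<in> E J \<rightarrow> F \<and>
      (\<Oplus>\<alpha>\<in>E J. c J \<alpha> \<otimes> power_prod R s J \<alpha>) = \<zero> \<and> (\<exists>\<alpha>\<in>E J. c J \<alpha> \<noteq> \<zero>)"
    unfolding rel_def by blast
  have "finite ((\<lambda>(\<alpha>, i). \<alpha> i) ` ((\<Union>J\<in>Js. E J) \<times> {..<m}))"
    using finJs Ec by auto
  from finite_nat_set_iff_bounded[THEN iffD1, OF this] obtain e
    where e0: "\<forall>n \<in> (\<lambda>(\<alpha>, i). \<alpha> i) ` ((\<Union>J\<in>Js. E J) \<times> {..<m}). n < e" by blast
  have e: "\<alpha> i < e" if "J \<in> Js" "\<alpha> \<in> E J" "i < m" for J \<alpha> i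
  proof -
    have "(\<alpha>, i) \<in> (\<Union>J\<in>Js. E J) \<times> {..<m}" using that by auto
    then show ?thesis using e0 by (metis (mono_tags, lifting) case_prod_conv image_eqI)
  qed
  have E_supp: "\<alpha> i = 0" if "J \<in> Js" "\<alpha> \<in> E J" "i \<notin> J" for J \<alpha> i
    using Ec[OF that(1)] that(2,3) unfolding expo_def by blast
  have Js_m: "J \<subseteq> {..<m}" "card J = ?l" if "J \<in> Js" for J
    using that unfolding Js_def by auto
  have E_less: "\<alpha> i < Suc e" if "J \<in> Js" "\<alpha> \<in> E J" for J \<alpha> i
  proof (cases "i < m")
    case False
    then have "\<alpha> i = 0" using E_supp[OF that] Js_m[OF that(1)] by auto
    then show ?thesis by simp
  qed (use e[OF that] in \<open>simp add: less_SucI\<close>)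
  \<comment> \<open>Exponents in the relations are digits to base \<open>Suc e\<close>, so \<open>\<omega>\<close> separates them.\<close>
  define \<omega> where "\<omega> \<alpha> = (\<Sum>i<m. \<alpha> i * Suc e ^ i)" for \<alpha> :: "nat \<Rightarrow> nat"
  have \<omega>_add: "\<omega> (\<lambda>i. \<alpha> i + \<beta> i) = \<omega> \<alpha> + \<omega> \<beta>" for \<alpha> \<beta>
    unfolding \<omega>_def by (simp add: sum.distrib algebra_simps)
  have \<omega>_ge: "\<alpha> i \<le> \<omega> \<alpha>" if "i < m" for \<alpha> i
  proof -
    have "\<alpha> i * 1 \<le> \<alpha> i * Suc e ^ i" by (intro mult_left_mono) auto
    also have "\<dots> \<le> \<omega> \<alpha>" unfolding \<omega>_def using that by (intro member_le_sum) auto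
    finally show ?thesis by simp
  qed
  have \<omega>_inj: "\<alpha> = \<beta>" if "J \<in> Js" "\<alpha> \<in> E J" "\<beta> \<in> E J" "\<omega> \<alpha> = \<omega> \<beta>" for J \<alpha> \<beta>
  proof
    fix i show "\<alpha> i = \<beta> i"
    proof (cases "i < m")
      case True
      then show ?thesis
        using weight_inj[of m \<alpha> "Suc e" \<beta> i] that E_less unfolding \<omega>_def by blast
    next
      case False
      then have "i \<notin> J" using Js_m[OF that(1)] by auto
      then show ?thesis using E_supp[OF that(1)] that(2,3) by metis
    qed
  qed

  \<comment> \<open>The monomial of largest weight in the relation for \<open>J\<close> is a combination of lighter ones.\<close>
  have "\<exists>\<mu>\<in>E J. ?M \<mu> \<in> lspan R F (?M ` {\<beta> \<in> ?X. \<omega> \<beta> < \<omega> \<mu>})" if J: "J \<in> Js" for J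
  proof -
    let ?E = "{\<alpha> \<in> E J. c J \<alpha> \<noteq> \<zero>}"
    have fin: "finite ?E" "?E \<noteq> {}" using Ec[OF J] by auto
    obtain \<mu> where \<mu>: "\<mu> \<in> ?E" "\<And>\<alpha>. \<alpha> \<in> ?E \<Longrightarrow> \<omega> \<alpha> \<le> \<omega> \<mu>"
      using weight_max_ex[OF fin, of \<omega>] by blast
    have cE: "c J \<in> E J \<rightarrow> F" and cE': "\<And>\<alpha>. \<alpha> \<in> E J \<Longrightarrow> c J \<alpha> \<in> carrier R"
      using Ec[OF J] FE(1) by auto
    have EX: "E J \<subseteq> ?X" using E_supp[OF J] Js_m[OF J] unfolding expo_def by blast
    have eqM: "power_prod R s J \<alpha> = ?M \<alpha>" if "\<alpha> \<in> E J" for \<alpha>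
      using that Ec[OF J] Js_m(1)[OF J] s by (intro power_prod_extend) auto
    have "\<zero> = (\<Oplus>\<alpha>\<in>E J. c J \<alpha> \<otimes> power_prod R s J \<alpha>)" using Ec[OF J] by simp
    also have "\<dots> = (\<Oplus>\<alpha>\<in>E J. c J \<alpha> \<otimes> ?M \<alpha>)"
      using M cE' eqM by (intro finsum_cong') auto
    also have "\<dots> = (\<Oplus>\<alpha>\<in>insert \<mu> (E J - {\<mu>}). c J \<alpha> \<otimes> ?M \<alpha>)"
      using \<mu>(1) by (simp add: insert_absorb)
    also have "\<dots> = c J \<mu> \<otimes> ?M \<mu> \<oplus> (\<Oplus>\<alpha>\<in>E J - {\<mu>}. c J \<alpha> \<otimes> ?M \<alpha>)"
      using Ec[OF J] M cE' \<mu>(1) by (intro finsum_insert) auto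
    finally have rel: "\<zero> = c J \<mu> \<otimes> ?M \<mu> \<oplus> (\<Oplus>\<alpha>\<in>E J - {\<mu>}. c J \<alpha> \<otimes> ?M \<alpha>)" (is "_ = _ \<oplus> ?r") .
    let ?L = "lspan R F (?M ` {\<beta> \<in> ?X. \<omega> \<beta> < \<omega> \<mu>})"
    have r: "?r \<in> ?L"
    proof (intro lspan_finsum FE(1) Mim)
      fix \<alpha> assume a: "\<alpha> \<in> E J - {\<mu>}"
      show "c J \<alpha> \<otimes> ?M \<alpha> \<in> ?L"
      proof (cases "c J \<alpha> = \<zero>")
        case True
        then show ?thesis using M by (simp add: lspan.lspan_zero)
      next
        case False
        then have "\<omega> \<alpha> \<le> \<omega> \<mu>" using a \<mu>(2) by auto
        moreover have "\<omega> \<alpha> \<noteq> \<omega> \<mu>" using \<omega>_inj[OF J] a \<mu>(1) by blast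
        ultimately show ?thesis using a EX cE by (intro lspan_smult_base FE(1) Mim) auto
      qed
    qed
    have rc: "?r \<in> carrier R" using lspan_closed[OF r FE(1) Mim] .
    have cm: "c J \<mu> \<in> F - {\<zero>}" using \<mu>(1) cE by auto
    obtain d where d: "d \<in> F" "d \<otimes> c J \<mu> = \<one>"
      using subfield_m_inv(1,3)[OF F cm] by blast
    have dc: "d \<in> carrier R" "c J \<mu> \<in> carrier R" using d cm FE(1) by auto
    have "?M \<mu> = \<ominus> (d \<otimes> ?r)"
      by (rule solve_for_leading_term[OF dc M rc d(2) rel])
    also have "\<dots> \<in> ?L" using r d by (intro lspan_uminus lspan_smult FR Mim)
    finally have "?M \<mu> \<in> ?L" .
    moreover have "\<mu> \<in> E J" using \<mu>(1) by simp
    ultimately show ?thesis by (rule bexI)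
  qed
  then have "\<forall>J\<in>Js. \<exists>\<mu>. \<mu> \<in> E J \<and> ?M \<mu> \<in> lspan R F (?M ` {\<beta> \<in> ?X. \<omega> \<beta> < \<omega> \<mu>})"
    unfolding Bex_def by (intro ballI) assumption
  from bchoice[OF this] obtain \<mu> where \<mu>': "\<forall>J\<in>Js. \<mu> J \<in> E J \<and>
      ?M (\<mu> J) \<in> lspan R F (?M ` {\<beta> \<in> ?X. \<omega> \<beta> < \<omega> (\<mu> J)})" ..
  have \<mu>: "\<mu> J \<in> E J" "?M (\<mu> J) \<in> lspan R F (?M ` {\<beta> \<in> ?X. \<omega> \<beta> < \<omega> (\<mu> J)})"
    if "J \<in> Js" for J
    using \<mu>'[rule_format, OF that] by (rule conjunct1, rule conjunct2)

  \<comment> \<open>Exponents of the monomials that are divisible by no leading monomial.\<close>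
  define Good where "Good = {\<beta> \<in> ?X. \<not> (\<exists>J\<in>Js. \<forall>i. \<mu> J i \<le> \<beta> i)}"
  have reduce: "?M \<alpha> \<in> lspan R F (?M ` {\<beta> \<in> Good. \<omega> \<beta> \<le> \<omega> \<alpha>})" if "\<alpha> \<in> ?X" for \<alpha>
    using that
  proof (induct "\<omega> \<alpha>" arbitrary: \<alpha> rule: less_induct)
    case less
    show ?case
    proof (cases "\<alpha> \<in> Good")
      case True
      then show ?thesis by (intro lspan_base FR Mim) auto
    next
      case False
      then obtain J where J: "J \<in> Js" "\<And>i. \<mu> J i \<le> \<alpha> i"
        using less(2) unfolding Good_def by auto
      let ?g = "\<lambda>i. \<alpha> i - \<mu> J i"
      have \<alpha>: "\<alpha> = (\<lambda>i. ?g i + \<mu> J i)" using J(2) by auto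
      have "?M \<alpha> = ?M ?g \<otimes> ?M (\<mu> J)" by (subst \<alpha>, rule M_add)
      also have "\<dots> \<in> lspan R F (?M ` {\<beta> \<in> ?X. \<omega> \<beta> < \<omega> \<alpha>})"
      proof (rule lspan_mult[OF _ \<mu>(2)[OF J(1)] FR Mim[of "{?g}"] Mim _ Mim])
        show "?M ?g \<in> lspan R F (?M ` {?g})" by (intro lspan_base FR Mim) auto
        fix a b assume "a \<in> ?M ` {?g}" "b \<in> ?M ` {\<beta> \<in> ?X. \<omega> \<beta> < \<omega> (\<mu> J)}"
        then obtain \<beta> where \<beta>: "\<beta> \<in> ?X" "\<omega> \<beta> < \<omega> (\<mu> J)" "a = ?M ?g" "b = ?M \<beta>" by auto
        have "a \<otimes> b = ?M (\<lambda>i. ?g i + \<beta> i)" using M_add \<beta> by simp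
        moreover have "\<omega> (\<lambda>i. ?g i + \<beta> i) < \<omega> \<alpha>"
          using \<beta>(2) \<omega>_add[of ?g \<beta>] \<omega>_add[of ?g "\<mu> J"] \<alpha> by simp
        moreover have "(\<lambda>i. ?g i + \<beta> i) \<in> ?X" using less(2) \<beta>(1) unfolding expo_def by auto
        ultimately show "a \<otimes> b \<in> ?M ` {\<beta> \<in> ?X. \<omega> \<beta> < \<omega> \<alpha>}" by blast
      qed
      finally have 1: "?M \<alpha> \<in> lspan R F (?M ` {\<beta> \<in> ?X. \<omega> \<beta> < \<omega> \<alpha>})" .
      have "?M \<beta> \<in> lspan R F (?M ` {\<beta> \<in> Good. \<omega> \<beta> \<le> \<omega> \<alpha>})" if b: "\<beta> \<in> ?X" "\<omega> \<beta> < \<omega> \<alpha>" for \<beta>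
      proof -
        have "?M ` {\<gamma> \<in> Good. \<omega> \<gamma> \<le> \<omega> \<beta>} \<subseteq> ?M ` {\<beta> \<in> Good. \<omega> \<beta> \<le> \<omega> \<alpha>}" using b by auto
        then show ?thesis using less(1)[OF b(2,1)] lspan_mono[OF subset_refl] by blast
      qed
      then have "?M ` {\<beta> \<in> ?X. \<omega> \<beta> < \<omega> \<alpha>} \<subseteq> lspan R F (?M ` {\<beta> \<in> Good. \<omega> \<beta> \<le> \<omega> \<alpha>})"
        by blast
      from subsetD[OF lspan_least[OF this FR Mim] 1] show ?thesis .
    qed
  qed

  have few: "card {i. i < m \<and> Suc e \<le> \<beta> i} < ?l" if "\<beta> \<in> Good" for \<beta>
  proof (rule ccontr)
    assume "\<not> ?thesis"
    then obtain J where J: "J \<subseteq> {i. i < m \<and> Suc e \<le> \<beta> i}" "card J = ?l"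
      by (metis not_less obtain_subset_with_card_n)
    then have JJ: "J \<in> Js" unfolding Js_def by auto
    have "\<mu> J i \<le> \<beta> i" for i
    proof (cases "i \<in> J")
      case True
      then show ?thesis using E_less[OF JJ \<mu>(1)[OF JJ], of i] J(1) by fastforce
    next
      case False
      then have "\<mu> J i = 0" using E_supp[OF JJ \<mu>(1)[OF JJ]] by auto
      then show ?thesis by simp
    qed
    then show False using that JJ unfolding Good_def by auto
  qed
  \<comment> \<open>Exponent vectors that may be large, up to \<open>D\<close>, only at the positions in \<open>L\<close>.\<close>
  define A where "A D L = {\<beta> \<in> ?X. \<forall>i\<in>{..<m}. \<beta> i \<in> (if i \<in> L then {..D} else {..<Suc e})}"
    for D :: nat and L
  let ?Ls = "{L. L \<subseteq> {..<m} \<and> card L < ?l}"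
  have Good_sub: "{\<beta> \<in> Good. \<omega> \<beta> \<le> D} \<subseteq> (\<Union>L\<in>?Ls. A D L)" for D
  proof
    fix \<beta> assume b: "\<beta> \<in> {\<beta> \<in> Good. \<omega> \<beta> \<le> D}"
    let ?L = "{i. i < m \<and> Suc e \<le> \<beta> i}"
    have "\<beta> \<in> A D ?L" using b \<omega>_ge[of _ \<beta>] order_trans unfolding A_def Good_def by fastforce
    moreover have "?L \<in> ?Ls" using few b by auto
    ultimately show "\<beta> \<in> (\<Union>L\<in>?Ls. A D L)" by blast
  qed
  have card_A: "finite (A D L) \<and> card (A D L) \<le> Suc e ^ m * Suc D ^ (?l - 1)" if "L \<in> ?Ls" for D L
  proof -
    have sub: "L \<subseteq> {..<m}" "finite L" using that finite_subset by auto
    have "card (A D L) = (\<Prod>i<m. card (if i \<in> L then {..D} else {..<Suc e}))"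
      unfolding A_def by (rule finite_card_box) auto
    also have "\<dots> = (\<Prod>i<m. if i \<in> L then Suc D else Suc e)"
      by (intro prod.cong) auto
    also have "\<dots> = (\<Prod>i\<in>{..<m} - L. if i \<in> L then Suc D else Suc e) * (\<Prod>i\<in>L. if i \<in> L then Suc D else Suc e)"
      using sub by (intro prod.subset_diff) auto
    also have "\<dots> = Suc e ^ card ({..<m} - L) * Suc D ^ card L" by simp
    also have "\<dots> \<le> Suc e ^ m * Suc D ^ (?l - 1)"
    proof (intro mult_mono power_increasing)
      show "card ({..<m} - L) \<le> m" using card_mono[of "{..<m}" "{..<m} - L"] by auto
    qed (use that in auto)
    finally have "card (A D L) \<le> Suc e ^ m * Suc D ^ (?l - 1)" .
    moreover have "finite (A D L)" unfolding A_def by (rule finite_card_box) auto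
    ultimately show ?thesis by blast
  qed
  have finLs: "finite ?Ls" by (rule finite_subset[of _ "Pow {..<m}"]) auto
  define k where "k = card ?Ls * Suc e ^ m"
  have finG: "finite {\<beta> \<in> Good. \<omega> \<beta> \<le> D}" for D
    by (rule finite_subset[OF Good_sub]) (use finLs card_A in auto)
  have card_Good: "card {\<beta> \<in> Good. \<omega> \<beta> \<le> D} \<le> k * Suc D ^ (?l - 1)" for D
  proof -
    have "card {\<beta> \<in> Good. \<omega> \<beta> \<le> D} \<le> card (\<Union>L\<in>?Ls. A D L)"
      using finLs card_A by (intro card_mono Good_sub) auto
    also have "\<dots> \<le> (\<Sum>L\<in>?Ls. card (A D L))" using finLs by (rule card_UN_le)
    also have "\<dots> \<le> card ?Ls * (Suc e ^ m * Suc D ^ (?l - 1))"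
      using card_A sum_bounded_above[of ?Ls "\<lambda>L. card (A D L)"] by simp
    finally show ?thesis by (simp add: k_def algebra_simps)
  qed

  \<comment> \<open>The filtration of \<open>C[s]\<close> by weight; the \<open>y i\<close> lie in its step \<open>w\<close>.\<close>
  define G where "G d = lspan R C (?M ` {\<beta> \<in> ?X. \<omega> \<beta> \<le> d})" for d
  have G_mono: "G a \<subseteq> G b" if "a \<le> b" for a b
    unfolding G_def using that by (intro lspan_mono) auto
  have G_mult: "u \<otimes> v \<in> G (a + b)" if "u \<in> G a" "v \<in> G b" for u v a b
    unfolding G_def
  proof (rule lspan_mult[OF that[unfolded G_def] C Mim Mim _ Mim])
    fix f g assume "f \<in> ?M ` {\<beta> \<in> ?X. \<omega> \<beta> \<le> a}" "g \<in> ?M ` {\<beta> \<in> ?X. \<omega> \<beta> \<le> b}"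
    then obtain \<beta> \<gamma> where bg: "\<beta> \<in> ?X" "\<omega> \<beta> \<le> a" "f = ?M \<beta>" "\<gamma> \<in> ?X" "\<omega> \<gamma> \<le> b" "g = ?M \<gamma>" by auto
    have "f \<otimes> g = ?M (\<lambda>i. \<beta> i + \<gamma> i)" using M_add bg by simp
    moreover have "(\<lambda>i. \<beta> i + \<gamma> i) \<in> {\<beta> \<in> ?X. \<omega> \<beta> \<le> a + b}"
      using bg \<omega>_add by (auto simp: expo_def)
    ultimately show "f \<otimes> g \<in> ?M ` {\<beta> \<in> ?X. \<omega> \<beta> \<le> a + b}" by blast
  qed
  have G_one: "\<one> \<in> G a" for a
  proof -
    have "?M (\<lambda>i. 0) \<in> G a" unfolding G_def
      by (intro lspan_base C Mim) (auto simp: expo_def \<omega>_def)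
    then show ?thesis by (simp add: power_prod_zero)
  qed
  have "\<exists>U0. finite U0 \<and> U0 \<subseteq> ?M ` ?X \<and> y ` I \<subseteq> lspan R C U0"
    using I y by (intro lspan_finite_support_set) auto
  then obtain B where B: "finite B" "B \<subseteq> ?X" "y ` I \<subseteq> lspan R C (?M ` B)"
    by (metis finite_subset_image)
  obtain w where w: "\<And>\<beta>. \<beta> \<in> B \<Longrightarrow> \<omega> \<beta> \<le> w"
    using B(1) finite_nat_set_iff_bounded_le[of "\<omega> ` B"] by auto
  have yG: "y i \<in> G w" if "i \<in> I" for i
    using B w that lspan_mono[of C C "?M ` B" "?M ` {\<beta> \<in> ?X. \<omega> \<beta> \<le> w}"] unfolding G_def by blast
  have G_pow: "y i [^] n \<in> G (n * w)" if "i \<in> I" for i and n :: nat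
  proof (induct n)
    case (Suc n)
    then have "y i [^] n \<otimes> y i \<in> G (n * w + w)" using yG that G_mult by blast
    then show ?case by (simp add: add.commute)
  qed (use G_one in simp)
  have Gc: "G a \<subseteq> carrier R" for a unfolding G_def by (intro lspan_carrier CE(1) Mim)
  have yc: "y \<in> I \<rightarrow> carrier R" using yG Gc by blast
  have G_mon: "power_prod R y I' \<alpha> \<in> G ((\<Sum>i\<in>I'. \<alpha> i) * w)" if "I' \<subseteq> I" for \<alpha> I'
    using finite_subset[OF that I] that
  proof (induct I' rule: finite_induct)
    case empty
    then show ?case using G_one by (simp add: power_prod_def)
  next
    case (insert i I')
    have "power_prod R y (insert i I') \<alpha> = y i [^] \<alpha> i \<otimes> power_prod R y I' \<alpha>"
      using insert yc by (intro power_prod_insert) auto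
    moreover have "y i [^] \<alpha> i \<otimes> power_prod R y I' \<alpha> \<in> G (\<alpha> i * w + (\<Sum>i\<in>I'. \<alpha> i) * w)"
      using insert G_pow by (intro G_mult) auto
    ultimately show ?case using insert by (simp add: algebra_simps)
  qed

  \<comment> \<open>Chosen so that \<open>q ^ l\<close> exceeds \<open>k * Suc D ^ (l - 1)\<close> for \<open>D = l * q * w\<close>.\<close>
  define q where "q = Suc (k * Suc (?l * w) ^ (?l - 1))"
  define D where "D = ?l * q * w"
  define Q where "Q = {\<alpha> \<in> expo I. \<forall>i\<in>I. \<alpha> i \<in> {..<q}}"
  have Q: "finite Q" "card Q = q ^ ?l"
    using finite_card_box[OF I, of "\<lambda>i. {..<q}"] by (simp_all add: Q_def)
  have QG: "power_prod R y I \<alpha> \<in> lspan R C (?M ` {\<beta> \<in> Good. \<omega> \<beta> \<le> D})" if "\<alpha> \<in> Q" for \<alpha>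
  proof -
    have "(\<Sum>i\<in>I. \<alpha> i) \<le> ?l * q"
      using that sum_bounded_above[of I \<alpha> q] unfolding Q_def by fastforce
    then have "(\<Sum>i\<in>I. \<alpha> i) * w \<le> D" unfolding D_def by (rule mult_right_mono) simp
    then have 1: "power_prod R y I \<alpha> \<in> G D" using G_mono G_mon[of I \<alpha>] by blast
    have "?M \<beta> \<in> lspan R C (?M ` {\<beta> \<in> Good. \<omega> \<beta> \<le> D})" if "\<beta> \<in> ?X" "\<omega> \<beta> \<le> D" for \<beta>
    proof -
      have "?M ` {\<gamma> \<in> Good. \<omega> \<gamma> \<le> \<omega> \<beta>} \<subseteq> ?M ` {\<beta> \<in> Good. \<omega> \<beta> \<le> D}" using that by auto
      then show ?thesis using reduce[OF that(1)] lspan_mono[OF FC] by blast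
    qed
    then have "?M ` {\<beta> \<in> ?X. \<omega> \<beta> \<le> D} \<subseteq> lspan R C (?M ` {\<beta> \<in> Good. \<omega> \<beta> \<le> D})" by blast
    from subsetD[OF lspan_least[OF this C Mim] 1[unfolded G_def]] show ?thesis .
  qed
  have less: "card {\<beta> \<in> Good. \<omega> \<beta> \<le> D} < card Q"
  proof (cases "?l = 0")
    case True
    then have "{\<beta> \<in> Good. \<omega> \<beta> \<le> D} = {}" using few by fastforce
    then show ?thesis using Q True by (metis card.empty power_0 zero_less_one)
  next
    case False
    have "1 \<le> q" by (simp add: q_def)
    then have D_le: "Suc D \<le> q * Suc (?l * w)" unfolding D_def by (simp add: algebra_simps)
    have "card {\<beta> \<in> Good. \<omega> \<beta> \<le> D} \<le> k * Suc D ^ (?l - 1)" by (rule card_Good)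
    also have "\<dots> \<le> k * (q * Suc (?l * w)) ^ (?l - 1)"
      by (intro mult_left_mono power_mono D_le) auto
    also have "\<dots> = (k * Suc (?l * w) ^ (?l - 1)) * q ^ (?l - 1)"
      by (simp only: power_mult_distrib mult_ac)
    also have "\<dots> < q * q ^ (?l - 1)"
      by (intro mult_strict_right_mono) (auto simp: q_def)
    also have "\<dots> = card Q" using Q False by (metis power_eq_if)
    finally show ?thesis .
  qed
  have "\<exists>v\<in>Q \<rightarrow> C. (\<exists>\<alpha>\<in>Q. \<one> \<otimes> v \<alpha> \<noteq> \<zero>) \<and> (\<Oplus>\<alpha>\<in>Q. v \<alpha> \<otimes> power_prod R y I \<alpha>) = \<zero>"
  proof (rule dependence_in_small_span[OF C _ finG[of D] _ Q(1) less QG CE(3) one])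
    show "?M \<in> {\<beta> \<in> Good. \<omega> \<beta> \<le> D} \<rightarrow> carrier R" using M by blast
  qed (rule red)
  then obtain v \<alpha> where v: "v \<in> Q \<rightarrow> C" "\<alpha> \<in> Q" "\<one> \<otimes> v \<alpha> \<noteq> \<zero>"
    "(\<Oplus>\<alpha>\<in>Q. v \<alpha> \<otimes> power_prod R y I \<alpha>) = \<zero>"
    by blast
  then have "v \<alpha> = \<zero>"
    using indep Q(1) lin_indepD[of R C "{\<zero>}" "expo I" "power_prod R y I" Q v \<alpha>]
    unfolding alg_indep_def Q_def by auto
  then show False using v(3) by simp
qed

end

section \<open>Adjunction and transcendence\<close>

definition adjoin :: "('a, 'm) ring_scheme \<Rightarrow> 'a set \<Rightarrow> 'a set \<Rightarrow> 'a set" where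
  "adjoin T F V = generate_ring T (F \<union> V)"

text \<open>
  The leading coefficient of a polynomial relation for \<open>a\<close> has to vanish. Over a ring \<open>B\<close> with zero
  divisors this form is the one that leading coefficients of products can be fed into.
\<close>

definition transcendental_over :: "('a, 'm) ring_scheme \<Rightarrow> 'a set \<Rightarrow> 'a \<Rightarrow> bool" where
  "transcendental_over T B a \<longleftrightarrow> (\<forall>n b. b \<in> B \<and>
     b \<otimes>\<^bsub>T\<^esub> a [^]\<^bsub>T\<^esub> n \<in> lspan T B ((\<lambda>r. a [^]\<^bsub>T\<^esub> r) ` {..<n :: nat}) \<longrightarrow> b = \<zero>\<^bsub>T\<^esub>)"

context cring
begin

lemma subring_carrier: "subring C R \<Longrightarrow> c \<in> C \<Longrightarrow> c \<in> carrier R"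
  using subringE(1) by blast

lemma lspan_finite_support_image:
  assumes "v \<in> lspan R C (u ` I)"
  shows "\<exists>E. finite E \<and> E \<subseteq> I \<and> v \<in> lspan R C (u ` E)"
proof -
  obtain U where U: "finite U" "U \<subseteq> u ` I" "v \<in> lspan R C U"
    using lspan_finite_support[OF assms] by blast
  obtain E where "E \<subseteq> I" "finite E" "U = u ` E"
    using finite_subset_image[OF U(1,2)] by blast
  then show ?thesis using U(3) by blast
qed

lemma finprod_in_subring:
  assumes "subring S R" "f \<in> I \<rightarrow> S"
  shows "finprod R f I \<in> S"
proof (cases "finite I")
  case True
  then show ?thesis using assms(2)
  proof (induct I)
    case empty
    then show ?case using subringE(3)[OF assms(1)] by simp
  next
    case (insert i I)
    have "finprod R f (insert i I) = f i \<otimes> finprod R f I"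
      using insert subring_carrier[OF assms(1)] by (intro finprod_insert) auto
    then show ?case using insert subringE(6)[OF assms(1)] by simp
  qed
qed (use subringE(3)[OF assms(1)] in simp)

lemma pow_in_subring:
  assumes "subring S R" "a \<in> S"
  shows "a [^] (n::nat) \<in> S"
  by (induct n) (use assms subringE(3,6)[OF assms(1)] in auto)

lemma lspan_in_subring:
  assumes "subring S R" "C \<subseteq> S" "U \<subseteq> S"
  shows "lspan R C U \<subseteq> S"
proof
  fix v assume "v \<in> lspan R C U"
  then show "v \<in> S"
  proof induct
    case lspan_zero
    then show ?case by (rule subringE(2)[OF assms(1)])
  next
    case (lspan_step c u v)
    then show ?case using assms(2,3) by (intro subringE(6,7)[OF assms(1)]) auto
  qed
qed

lemma adjoin_subring:
  assumes "F \<subseteq> carrier R" "V \<subseteq> carrier R"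
  shows "subring (adjoin R F V) R"
  unfolding adjoin_def using assms by (intro generate_ring_is_subring) auto

lemma adjoin_carrier:
  assumes "F \<subseteq> carrier R" "V \<subseteq> carrier R"
  shows "adjoin R F V \<subseteq> carrier R"
  unfolding adjoin_def using assms by (intro generate_ring_incl) auto

lemma adjoin_incl: "F \<subseteq> adjoin R F V" "V \<subseteq> adjoin R F V"
  unfolding adjoin_def by (auto intro: generate_ring.incl)

lemma adjoin_least:
  assumes "subring S R" "F \<subseteq> S" "V \<subseteq> S"
  shows "adjoin R F V \<subseteq> S"
  unfolding adjoin_def
  using assms subringE(1)[OF assms(1)] by (intro generate_ring_min_subring1) auto

lemma adjoin_empty: "subring F R \<Longrightarrow> adjoin R F {} = F"
  using adjoin_least[of F F "{}"] adjoin_incl(1)[of F "{}"] by blast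

lemma power_prod_single:
  assumes "finite I" "i \<in> I" "x \<in> I \<rightarrow> carrier R"
  shows "power_prod R x I (\<lambda>j. if j = i then 1 else 0) = x i"
proof -
  have "power_prod R x I (\<lambda>j. if j = i then 1 else 0) = (\<Otimes>j\<in>I. if j = i then x j else \<one>)"
    unfolding power_prod_def using funcset_mem[OF assms(3)] by (intro finprod_cong') auto
  also have "\<dots> = x i" using assms by (intro finprod_singleton_swap)
  finally show ?thesis .
qed

lemma adjoin_eq_lspan_power_prods:
  assumes F: "subring F R" and I: "finite I" and x: "x \<in> I \<rightarrow> carrier R"
  shows "adjoin R F (x ` I) = lspan R F (power_prod R x I ` expo I)"
proof
  let ?U = "power_prod R x I ` expo I"
  have U: "?U \<subseteq> carrier R" using power_prod_closed[OF x] by blast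
  have z: "(\<lambda>i. 0) \<in> expo I" by (simp add: expo_def)
  have one: "\<one> \<in> ?U" using z power_prod_zero[of x I] by force
  have sub: "subring (lspan R F ?U) R"
  proof (intro lspan_subring F U one)
    fix a b assume "a \<in> ?U" "b \<in> ?U"
    then obtain \<alpha> \<beta> where ab: "\<alpha> \<in> expo I" "\<beta> \<in> expo I" "a = power_prod R x I \<alpha>" "b = power_prod R x I \<beta>"
      by auto
    then have "a \<otimes> b = power_prod R x I (\<lambda>i. \<alpha> i + \<beta> i)" using power_prod_add[OF x] by simp
    moreover have "(\<lambda>i. \<alpha> i + \<beta> i) \<in> expo I" using ab by (simp add: expo_def)
    ultimately show "a \<otimes> b \<in> ?U" by blast
  qed
  show "adjoin R F (x ` I) \<subseteq> lspan R F ?U"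
  proof (rule adjoin_least[OF sub])
    show "F \<subseteq> lspan R F ?U"
    proof
      fix c assume c: "c \<in> F"
      then have "c \<otimes> \<one> \<in> lspan R F ?U" using one subringE(1)[OF F] U by (intro lspan_smult_base)
      then show "c \<in> lspan R F ?U" using subring_carrier[OF F c] by simp
    qed
    show "x ` I \<subseteq> lspan R F ?U"
    proof
      fix y assume "y \<in> x ` I"
      then obtain i where i: "i \<in> I" "y = x i" by blast
      have "(\<lambda>j. if j = i then 1 else 0) \<in> expo I" using i by (auto simp: expo_def)
      then have "power_prod R x I (\<lambda>j. if j = i then 1 else 0) \<in> ?U" by blast
      then have "y \<in> ?U" using power_prod_single[OF I i(1) x] i by simp
      then show "y \<in> lspan R F ?U" using F U by (intro lspan_base)
    qed
  qed
  have sA: "subring (adjoin R F (x ` I)) R" using x subringE(1)[OF F] by (intro adjoin_subring) auto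
  show "lspan R F ?U \<subseteq> adjoin R F (x ` I)"
  proof (intro lspan_in_subring sA adjoin_incl image_subsetI)
    fix \<alpha> show "power_prod R x I \<alpha> \<in> adjoin R F (x ` I)"
      unfolding power_prod_def
      using adjoin_incl(2)[of "x ` I" F] by (intro finprod_in_subring sA) (auto intro!: pow_in_subring sA)
  qed
qed

lemma adjoin_insert_eq_lspan:
  assumes "F \<subseteq> carrier R" "V \<subseteq> carrier R" "a \<in> carrier R"
  shows "adjoin R F (insert a V) = lspan R (adjoin R F V) (range (\<lambda>r::nat. a [^] r))"
proof
  let ?U = "range (\<lambda>r::nat. a [^] r)" and ?B = "adjoin R F V"
  have B: "subring ?B R" using assms by (intro adjoin_subring)
  have U: "?U \<subseteq> carrier R" using assms by auto
  have one: "\<one> \<in> ?U" by (metis nat_pow_0 rangeI)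
  have sub: "subring (lspan R ?B ?U) R"
  proof (intro lspan_subring B U one)
    fix u v assume "u \<in> ?U" "v \<in> ?U"
    then obtain m n :: nat where "u = a [^] m" "v = a [^] n" by auto
    then have "u \<otimes> v = a [^] (m + n)" using assms by (simp add: nat_pow_mult)
    then show "u \<otimes> v \<in> ?U" by blast
  qed
  have Bs: "?B \<subseteq> lspan R ?B ?U"
  proof
    fix c assume c: "c \<in> ?B"
    then have "c \<otimes> \<one> \<in> lspan R ?B ?U" using one subringE(1)[OF B] U by (intro lspan_smult_base)
    then show "c \<in> lspan R ?B ?U" using subring_carrier[OF B c] by simp
  qed
  show "adjoin R F (insert a V) \<subseteq> lspan R ?B ?U"
  proof (rule adjoin_least[OF sub])
    show "F \<subseteq> lspan R ?B ?U" using Bs adjoin_incl(1) by blast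
    have "a [^] (1::nat) \<in> lspan R ?B ?U" by (rule lspan_base[OF B _ U]) blast
    then show "insert a V \<subseteq> lspan R ?B ?U" using Bs adjoin_incl(2)[of V F] assms by auto
  qed
  have sA: "subring (adjoin R F (insert a V)) R" using assms by (intro adjoin_subring) auto
  show "lspan R ?B ?U \<subseteq> adjoin R F (insert a V)"
  proof (intro lspan_in_subring sA image_subsetI)
    show "?B \<subseteq> adjoin R F (insert a V)" unfolding adjoin_def using assms by (intro mono_generate_ring) auto
    show "a [^] n \<in> adjoin R F (insert a V)" for n :: nat
      using adjoin_incl(2)[of "insert a V" F] by (intro pow_in_subring sA) auto
  qed
qed

lemma alg_indep_subset:
  assumes "alg_indep R F P I x" "J \<subseteq> I" "finite I" "x \<in> I \<rightarrow> carrier R" "F \<subseteq> carrier R"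
  shows "alg_indep R F P J x"
  unfolding alg_indep_def lin_indep_def
proof (intro allI impI)
  fix W c assume h: "finite W \<and> W \<subseteq> expo J \<and> c \<in> W \<rightarrow> F \<and> (\<Oplus>\<alpha>\<in>W. c \<alpha> \<otimes> power_prod R x J \<alpha>) \<in> P"
  have WI: "W \<subseteq> expo I" using h assms(2) unfolding expo_def by blast
  have "(\<Oplus>\<alpha>\<in>W. c \<alpha> \<otimes> power_prod R x J \<alpha>) = (\<Oplus>\<alpha>\<in>W. c \<alpha> \<otimes> power_prod R x I \<alpha>)"
    using h assms power_prod_closed[OF assms(4)]
    by (intro finsum_cong') (auto simp: power_prod_extend[OF assms(3,2) _ assms(4)] subset_iff)
  then show "\<forall>\<alpha>\<in>W. c \<alpha> = \<zero>"
    using h WI assms(1) lin_indepD[of R F P "expo I" "power_prod R x I" W c] unfolding alg_indep_def by auto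
qed

text \<open>
  Written out in monomials in \<open>x\<close> over \<open>F\<close>, the term \<open>b \<otimes> x j [^] n\<close> involves only exponents equal to \<open>n\<close>
  at \<open>j\<close>, whereas the lower terms involve only smaller ones. Nothing cancels between the two, so all
  coefficients of \<open>b\<close> vanish.
\<close>

lemma alg_indep_imp_transcendental:
  assumes F: "subring F R" and I: "finite I" and x: "x \<in> I \<rightarrow> carrier R" and j: "j \<in> I"
    and ind: "alg_indep R F {\<zero>} I x"
  shows "transcendental_over R (adjoin R F (x ` (I - {j}))) (x j)"
  unfolding transcendental_over_def
proof (intro allI impI, elim conjE)
  let ?I = "I - {j}" and ?a = "x j"
  let ?B = "adjoin R F (x ` ?I)" and ?M = "power_prod R x I" and ?M' = "power_prod R x ?I"
  fix n :: nat and b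
  assume b: "b \<in> ?B" and bn: "b \<otimes> ?a [^] n \<in> lspan R ?B ((\<lambda>r. ?a [^] r) ` {..<n})"
  have a: "?a \<in> carrier R" using x j by auto
  have x': "x \<in> ?I \<rightarrow> carrier R" "finite ?I" using x I by auto
  have B: "?B = lspan R F (?M' ` expo ?I)" using adjoin_eq_lspan_power_prods[OF F x'(2,1)] .
  have Mim: "?M ` A \<subseteq> carrier R" "?M' ` A' \<subseteq> carrier R" for A A'
    using power_prod_closed[OF x] power_prod_closed[OF x'(1)] by auto
  have MM: "?M (\<alpha>(j := r)) = ?a [^] r \<otimes> ?M' \<alpha>" for \<alpha> and r :: nat
  proof -
    have "?M (\<alpha>(j := r)) = power_prod R x (insert j ?I) (\<alpha>(j := r))" using j by (simp add: insert_absorb)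
    also have "\<dots> = ?a [^] r \<otimes> power_prod R x ?I (\<alpha>(j := r))"
      using x' a by (subst power_prod_insert) auto
    also have "power_prod R x ?I (\<alpha>(j := r)) = ?M' \<alpha>"
      unfolding power_prod_def using x' by (intro finprod_cong') auto
    finally show ?thesis .
  qed
  have cB: "c \<otimes> ?a [^] r \<in> lspan R F (?M ` {\<alpha> \<in> expo I. \<alpha> j = r})" if "c \<in> ?B" for c and r :: nat
  proof (rule lspan_mult[OF that[unfolded B] _ F Mim(2) _ _ Mim(1)])
    show "?a [^] r \<in> lspan R F {?a [^] r}" using a by (intro lspan_base F) auto
    show "{?a [^] r} \<subseteq> carrier R" using a by simp
    fix u v assume "u \<in> ?M' ` expo ?I" "v \<in> {?a [^] r}"
    then obtain \<alpha> where \<alpha>: "\<alpha> \<in> expo ?I" "u = ?M' \<alpha>" "v = ?a [^] r" by auto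
    have "u \<otimes> v = ?M (\<alpha>(j := r))"
      unfolding MM \<alpha> using a power_prod_closed[OF x'(1)] by (intro m_comm) auto
    moreover have "\<alpha>(j := r) \<in> {\<alpha> \<in> expo I. \<alpha> j = r}" using \<alpha>(1) j by (auto simp: expo_def)
    ultimately show "u \<otimes> v \<in> ?M ` {\<alpha> \<in> expo I. \<alpha> j = r}" by blast
  qed
  have low: "v \<in> lspan R F (?M ` {\<alpha> \<in> expo I. \<alpha> j < n})"
    if "v \<in> lspan R ?B ((\<lambda>r. ?a [^] r) ` {..<n})" for v
    using that
  proof induct
    case (lspan_step c u v)
    then obtain r where r: "r < n" "u = ?a [^] r" by auto
    have "?M ` {\<alpha> \<in> expo I. \<alpha> j = r} \<subseteq> ?M ` {\<alpha> \<in> expo I. \<alpha> j < n}" using r by auto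
    then have "c \<otimes> u \<in> lspan R F (?M ` {\<alpha> \<in> expo I. \<alpha> j < n})"
      using cB[OF lspan_step(1), of r] lspan_mono[OF subset_refl] r by blast
    then show ?case using lspan_step(4) subringE(1)[OF F] Mim by (intro lspan_add) auto
  qed (rule lspan.lspan_zero)
  obtain E1 where E1: "finite E1" "E1 \<subseteq> {\<alpha> \<in> expo I. \<alpha> j < n}" "b \<otimes> ?a [^] n \<in> lspan R F (?M ` E1)"
    using lspan_finite_support_image[OF low[OF bn]] by blast
  obtain E2 where E2: "finite E2" "E2 \<subseteq> expo ?I" "b \<in> lspan R F (?M' ` E2)"
    using lspan_finite_support_image[OF b[unfolded B]] by blast
  obtain d where d: "d \<in> E1 \<rightarrow> F" "b \<otimes> ?a [^] n = (\<Oplus>\<alpha>\<in>E1. d \<alpha> \<otimes> ?M \<alpha>)"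
    using lspan_family[OF E1(3,1) F Mim(1)] by blast
  obtain c where c: "c \<in> E2 \<rightarrow> F" "b = (\<Oplus>\<alpha>\<in>E2. c \<alpha> \<otimes> ?M' \<alpha>)"
    using lspan_family[OF E2(3,1) F Mim(2)] by blast
  have Mc: "?M \<alpha> \<in> carrier R" "?M' \<alpha> \<in> carrier R" for \<alpha>
    using power_prod_closed[OF x] power_prod_closed[OF x'(1)] by auto
  have cc: "c \<alpha> \<in> carrier R" if "\<alpha> \<in> E2" for \<alpha> using c(1) that subring_carrier[OF F] by auto
  have dc: "d \<alpha> \<in> carrier R" if "\<alpha> \<in> E1" for \<alpha> using d(1) that subring_carrier[OF F] by auto
  \<comment> \<open>Collect both sides in one relation: \<open>b\<close> contributes the exponents raised to \<open>n\<close> at \<open>j\<close>.\<close>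
  define up where "up \<alpha> = \<alpha>(j := n)" for \<alpha>
  have up_inj: "inj_on up E2"
  proof
    fix \<alpha> \<beta> assume h: "\<alpha> \<in> E2" "\<beta> \<in> E2" "up \<alpha> = up \<beta>"
    then have "\<alpha> j = 0" "\<beta> j = 0" using E2(2) by (auto simp: expo_def)
    then show "\<alpha> = \<beta>" using h(3) unfolding up_def by (metis fun_upd_idem fun_upd_upd)
  qed
  have up_back: "(up \<alpha>)(j := 0) = \<alpha>" if "\<alpha> \<in> E2" for \<alpha>
    using E2(2) that unfolding up_def expo_def by (auto simp: fun_eq_iff)
  define e where "e \<gamma> = (if \<gamma> j = n then c (\<gamma>(j := 0)) else \<ominus> d \<gamma>)" for \<gamma>
  have e_up: "e (up \<alpha>) = c \<alpha>" if "\<alpha> \<in> E2" for \<alpha>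
    using up_back[OF that] unfolding e_def by (simp add: up_def)
  have e_E1: "e \<alpha> = \<ominus> d \<alpha>" if "\<alpha> \<in> E1" for \<alpha> using that E1(2) unfolding e_def by auto
  have "b \<otimes> ?a [^] n = (\<Oplus>\<alpha>\<in>E2. c \<alpha> \<otimes> ?M' \<alpha> \<otimes> ?a [^] n)"
    unfolding c(2) using E2 cc Mc a by (intro finsum_ldistr) auto
  also have "\<dots> = (\<Oplus>\<alpha>\<in>E2. e (up \<alpha>) \<otimes> ?M (up \<alpha>))"
  proof (intro finsum_cong')
    fix \<alpha> assume \<alpha>: "\<alpha> \<in> E2"
    have "c \<alpha> \<otimes> ?M' \<alpha> \<otimes> ?a [^] n = c \<alpha> \<otimes> (?a [^] n \<otimes> ?M' \<alpha>)"
      using cc[OF \<alpha>] Mc(2) a by (simp add: m_assoc m_comm[of "?a [^] n"])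
    then show "c \<alpha> \<otimes> ?M' \<alpha> \<otimes> ?a [^] n = e (up \<alpha>) \<otimes> ?M (up \<alpha>)"
      using e_up[OF \<alpha>] MM[of \<alpha> n] by (simp add: up_def)
  qed (use cc Mc e_up in auto)
  also have "\<dots> = (\<Oplus>\<gamma>\<in>up ` E2. e \<gamma> \<otimes> ?M \<gamma>)"
    using up_inj e_up cc Mc by (intro finsum_reindex[symmetric]) auto
  finally have s2: "b \<otimes> ?a [^] n = (\<Oplus>\<gamma>\<in>up ` E2. e \<gamma> \<otimes> ?M \<gamma>)" .
  have "x ` ?I \<subseteq> carrier R" using x'(1) by auto
  then have bc: "b \<in> carrier R"
    using subring_carrier[OF adjoin_subring[OF subringE(1)[OF F]] b] by simp
  have dne: "(\<Oplus>\<alpha>\<in>E1. e \<alpha> \<otimes> ?M \<alpha>) = \<ominus> (b \<otimes> ?a [^] n)"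
  proof -
    have "(\<Oplus>\<alpha>\<in>E1. e \<alpha> \<otimes> ?M \<alpha>) = (\<Oplus>\<alpha>\<in>E1. (\<ominus> \<one>) \<otimes> (d \<alpha> \<otimes> ?M \<alpha>))"
      using e_E1 dc Mc by (intro finsum_cong') (auto simp: l_minus)
    also have "\<dots> = (\<ominus> \<one>) \<otimes> (\<Oplus>\<alpha>\<in>E1. d \<alpha> \<otimes> ?M \<alpha>)"
      using dc Mc E1 by (intro finsum_rdistr[symmetric]) auto
    also have "\<dots> = (\<ominus> \<one>) \<otimes> (b \<otimes> ?a [^] n)" using d(2) by simp
    also have "\<dots> = \<ominus> (b \<otimes> ?a [^] n)"
      using bc a by (subst l_minus) auto
    finally show ?thesis .
  qed
  have disj: "E1 \<inter> up ` E2 = {}" using E1(2) unfolding up_def by auto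
  have ec: "e \<in> E1 \<union> up ` E2 \<rightarrow> F"
  proof (rule funcsetI)
    fix \<gamma> assume "\<gamma> \<in> E1 \<union> up ` E2"
    then consider "\<gamma> \<in> E1" | \<alpha> where "\<alpha> \<in> E2" "\<gamma> = up \<alpha>" by blast
    then show "e \<gamma> \<in> F"
      by cases (use funcset_mem[OF c(1)] funcset_mem[OF d(1)] subringE(5)[OF F] e_up e_E1 in simp_all)
  qed
  have ecc: "e \<gamma> \<in> carrier R" if "\<gamma> \<in> E1 \<union> up ` E2" for \<gamma>
    using funcset_mem[OF ec that] subring_carrier[OF F] by blast
  have "(\<Oplus>\<gamma>\<in>E1 \<union> up ` E2. e \<gamma> \<otimes> ?M \<gamma>) =
      (\<Oplus>\<gamma>\<in>E1. e \<gamma> \<otimes> ?M \<gamma>) \<oplus> (\<Oplus>\<gamma>\<in>up ` E2. e \<gamma> \<otimes> ?M \<gamma>)"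
    using E1 E2 disj ecc Mc by (intro finsum_Un_disjoint) auto
  also have "\<dots> = \<zero>" unfolding dne s2[symmetric] using a bc by (simp add: l_neg)
  finally have sum0: "(\<Oplus>\<gamma>\<in>E1 \<union> up ` E2. e \<gamma> \<otimes> ?M \<gamma>) \<in> {\<zero>}" by simp
  have sub: "E1 \<union> up ` E2 \<subseteq> expo I" using E1(2) E2(2) j unfolding up_def expo_def by auto
  have "e (up \<alpha>) = \<zero>" if "\<alpha> \<in> E2" for \<alpha>
    by (rule lin_indepD[OF ind[unfolded alg_indep_def] _ sub ec sum0]) (use E1 E2 that in auto)
  then have "c \<alpha> = \<zero>" if "\<alpha> \<in> E2" for \<alpha> using that e_up by simp
  then show "b = \<zero>" unfolding c(2) using Mc by (intro add.finprod_one_eqI) simp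
qed

text \<open>
  In a relation of degree \<open>N\<close> in \<open>x j\<close>, the coefficient of \<open>x j [^] N\<close> is a polynomial in the other
  elements. It vanishes by transcendence, hence its coefficients vanish by independence; the rest of
  the relation has smaller degree in \<open>x j\<close>.
\<close>

lemma transcendental_imp_alg_indep_insert:
  assumes F: "subring F R" and I: "finite I" "j \<notin> I" and x: "x \<in> insert j I \<rightarrow> carrier R"
    and ind: "alg_indep R F {\<zero>} I x" and tr: "transcendental_over R (adjoin R F (x ` I)) (x j)"
  shows "alg_indep R F {\<zero>} (insert j I) x"
proof -
  let ?a = "x j"
  let ?B = "adjoin R F (x ` I)" and ?M = "power_prod R x (insert j I)" and ?M' = "power_prod R x I"
  have a: "?a \<in> carrier R" and x': "x \<in> I \<rightarrow> carrier R" using x by auto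
  have B: "?B = lspan R F (?M' ` expo I)" using adjoin_eq_lspan_power_prods[OF F I(1) x'] .
  have Bs: "subring ?B R" using x' subringE(1)[OF F] by (intro adjoin_subring) auto
  have Mc: "?M \<alpha> \<in> carrier R" "?M' \<alpha> \<in> carrier R" for \<alpha>
    using power_prod_closed[OF x] power_prod_closed[OF x'] by auto
  have MM: "?M \<alpha> = ?M' (\<alpha>(j := 0)) \<otimes> ?a [^] (\<alpha> j)" for \<alpha>
  proof -
    have "?M' (\<alpha>(j := 0)) = ?M' \<alpha>"
      unfolding power_prod_def using x' I(2) by (intro finprod_cong') auto
    then show ?thesis using power_prod_insert[OF I x] m_comm Mc a by simp
  qed
  have M'B: "?M' (\<alpha>(j := 0)) \<in> ?B" if "\<alpha> \<in> expo (insert j I)" for \<alpha>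
  proof -
    have "\<alpha>(j := 0) \<in> expo I" using that by (auto simp: expo_def)
    then show ?thesis unfolding B using Mc by (intro lspan_base F) auto
  qed
  have "\<forall>\<alpha>\<in>W. c \<alpha> = \<zero>" if "finite W" "W \<subseteq> expo (insert j I)" "c \<in> W \<rightarrow> F"
    "(\<Oplus>\<alpha>\<in>W. c \<alpha> \<otimes> ?M \<alpha>) = \<zero>" "\<And>\<alpha>. \<alpha> \<in> W \<Longrightarrow> \<alpha> j < N" for W c and N :: nat
    using that
  proof (induct N arbitrary: W)
    case (Suc N)
    let ?W = "{\<alpha>\<in>W. \<alpha> j = N}" and ?W' = "{\<alpha>\<in>W. \<alpha> j \<noteq> N}"
    have cF: "c \<alpha> \<in> F" "c \<alpha> \<in> carrier R" if "\<alpha> \<in> W" for \<alpha>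
      using Suc(4) that subring_carrier[OF F] by auto
    define b where "b = (\<Oplus>\<alpha>\<in>?W. c \<alpha> \<otimes> ?M' (\<alpha>(j := 0)))"
    have fin: "finite ?W" "finite ?W'" using Suc(2) by auto
    have "W = ?W \<union> ?W'" by auto
    then have "(\<Oplus>\<alpha>\<in>W. c \<alpha> \<otimes> ?M \<alpha>) = (\<Oplus>\<alpha>\<in>?W \<union> ?W'. c \<alpha> \<otimes> ?M \<alpha>)" by simp
    also have "\<dots> = (\<Oplus>\<alpha>\<in>?W. c \<alpha> \<otimes> ?M \<alpha>) \<oplus> (\<Oplus>\<alpha>\<in>?W'. c \<alpha> \<otimes> ?M \<alpha>)"
      using fin cF Mc by (intro finsum_Un_disjoint) auto
    finally have 1: "(\<Oplus>\<alpha>\<in>?W. c \<alpha> \<otimes> ?M \<alpha>) \<oplus> (\<Oplus>\<alpha>\<in>?W'. c \<alpha> \<otimes> ?M \<alpha>) = \<zero>" using Suc(5) by simp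
    have "(\<Oplus>\<alpha>\<in>?W. c \<alpha> \<otimes> ?M \<alpha>) = (\<Oplus>\<alpha>\<in>?W. c \<alpha> \<otimes> ?M' (\<alpha>(j := 0)) \<otimes> ?a [^] N)"
      using cF Mc a MM by (intro finsum_cong') (auto simp: m_assoc)
    also have "\<dots> = b \<otimes> ?a [^] N"
      unfolding b_def using fin cF Mc a by (intro finsum_ldistr[symmetric]) auto
    finally have 2: "(\<Oplus>\<alpha>\<in>?W. c \<alpha> \<otimes> ?M \<alpha>) = b \<otimes> ?a [^] N" .
    have bB: "b \<in> ?B" unfolding b_def B
    proof (intro lspan_finsum)
      fix \<alpha> assume \<alpha>: "\<alpha> \<in> ?W"
      then have "\<alpha>(j := 0) \<in> expo I" using Suc(3) by (auto simp: expo_def)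
      then show "c \<alpha> \<otimes> ?M' (\<alpha>(j := 0)) \<in> lspan R F (?M' ` expo I)"
        using \<alpha> cF Mc subringE(1)[OF F] by (intro lspan_smult_base) auto
    qed (use Mc subringE(1)[OF F] in auto)
    let ?D = "lspan R ?B ((\<lambda>r. ?a [^] r) ` {..<N})"
    have ac: "(\<lambda>r. ?a [^] r) ` {..<N} \<subseteq> carrier R" using a by auto
    have 3: "(\<Oplus>\<alpha>\<in>?W'. c \<alpha> \<otimes> ?M \<alpha>) \<in> ?D"
    proof (intro lspan_finsum ac subringE(1)[OF Bs])
      fix \<alpha> assume \<alpha>: "\<alpha> \<in> ?W'"
      then have "\<alpha> j < N" using Suc(6)[of \<alpha>] by auto
      moreover have "c \<alpha> \<in> ?B" using cF \<alpha> adjoin_incl(1)[of F "x ` I"] by auto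
      then have "c \<alpha> \<otimes> ?M' (\<alpha>(j := 0)) \<in> ?B" using M'B \<alpha> Suc(3) by (intro subringE(6)[OF Bs]) auto
      ultimately have "(c \<alpha> \<otimes> ?M' (\<alpha>(j := 0))) \<otimes> ?a [^] \<alpha> j \<in> ?D"
        by (intro lspan_smult_base ac subringE(1)[OF Bs]) auto
      then show "c \<alpha> \<otimes> ?M \<alpha> \<in> ?D" unfolding MM[of \<alpha>] using cF(2)[of \<alpha>] Mc a \<alpha> by (simp add: m_assoc)
    qed
    have bc: "b \<in> carrier R" using subring_carrier[OF Bs bB] .
    have "b \<otimes> ?a [^] N = \<ominus> (\<Oplus>\<alpha>\<in>?W'. c \<alpha> \<otimes> ?M \<alpha>)"
      using 1 2 bc a lspan_closed[OF 3 subringE(1)[OF Bs] ac] by (intro minus_equality[symmetric]) auto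
    then have "b \<otimes> ?a [^] N \<in> ?D" using lspan_uminus[OF 3 Bs ac] by simp
    then have b0: "b = \<zero>" using tr bB unfolding transcendental_over_def by blast
    let ?d = "\<lambda>\<alpha>. \<alpha>(j := 0)"
    have inj: "inj_on ?d ?W"
    proof
      fix \<alpha> \<beta> assume h: "\<alpha> \<in> ?W" "\<beta> \<in> ?W" "?d \<alpha> = ?d \<beta>"
      have "\<alpha> = (?d \<alpha>)(j := N)" "\<beta> = (?d \<beta>)(j := N)" using h by (auto simp: fun_eq_iff)
      then show "\<alpha> = \<beta>" using h(3) by simp
    qed
    let ?e = "\<lambda>\<gamma>. c (\<gamma>(j := N))"
    have e: "?e (?d \<alpha>) = c \<alpha>" if "\<alpha> \<in> ?W" for \<alpha>
    proof -
      have "(?d \<alpha>)(j := N) = \<alpha>" using that by (auto simp: fun_eq_iff)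
      then show ?thesis by simp
    qed
    have "(\<Oplus>\<gamma>\<in>?d ` ?W. ?e \<gamma> \<otimes> ?M' \<gamma>) = (\<Oplus>\<alpha>\<in>?W. ?e (?d \<alpha>) \<otimes> ?M' (?d \<alpha>))"
    proof (rule finsum_reindex[OF _ inj])
      show "(\<lambda>\<gamma>. ?e \<gamma> \<otimes> ?M' \<gamma>) \<in> ?d ` ?W \<rightarrow> carrier R"
      proof
        fix \<gamma> assume "\<gamma> \<in> ?d ` ?W"
        then obtain \<alpha> where "\<alpha> \<in> ?W" "\<gamma> = ?d \<alpha>" by blast
        then show "?e \<gamma> \<otimes> ?M' \<gamma> \<in> carrier R" using e cF(2) Mc by auto
      qed
    qed
    also have "\<dots> = b" unfolding b_def using e cF Mc by (intro finsum_cong') auto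
    finally have sum0: "(\<Oplus>\<gamma>\<in>?d ` ?W. ?e \<gamma> \<otimes> ?M' \<gamma>) \<in> {\<zero>}" using b0 by simp
    have dW: "?d ` ?W \<subseteq> expo I" using Suc(3) by (auto simp: expo_def)
    have eF: "?e \<in> ?d ` ?W \<rightarrow> F" using e cF(1) by auto
    have W0: "c \<alpha> = \<zero>" if "\<alpha> \<in> ?W" for \<alpha>
    proof -
      have "?e (?d \<alpha>) = \<zero>"
        by (rule lin_indepD[OF ind[unfolded alg_indep_def] _ dW eF sum0]) (use fin that in auto)
      then show ?thesis using e[OF that] by simp
    qed
    have "(\<Oplus>\<alpha>\<in>?W'. c \<alpha> \<otimes> ?M \<alpha>) = \<zero>"
    proof -
      have "(\<Oplus>\<alpha>\<in>?W'. c \<alpha> \<otimes> ?M \<alpha>) \<in> carrier R" using cF Mc by (intro finsum_closed) auto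
      then show ?thesis using 1 2 b0 a by simp
    qed
    then have "\<forall>\<alpha>\<in>?W'. c \<alpha> = \<zero>"
      using fin Suc(3,4) Suc(6) by (intro Suc(1)) (auto simp: less_Suc_eq)
    then show ?case using W0 by auto
  qed (auto)
  note main = this
  show ?thesis unfolding alg_indep_def lin_indep_def
  proof (intro allI impI, elim conjE)
    fix W c assume h: "finite W" "W \<subseteq> expo (insert j I)" "c \<in> W \<rightarrow> F"
      "(\<Oplus>\<alpha>\<in>W. c \<alpha> \<otimes> ?M \<alpha>) \<in> {\<zero>}"
    obtain N where "\<forall>n\<in>(\<lambda>\<alpha>. \<alpha> j) ` W. n < N"
      using finite_nat_set_iff_bounded[THEN iffD1, of "(\<lambda>\<alpha>. \<alpha> j) ` W"] h(1) by blast
    then show "\<forall>\<alpha>\<in>W. c \<alpha> = \<zero>" using h main[of W c N] by auto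
  qed
qed

end

section \<open>Prime ideal chains and algebraic independence\<close>

context cring
begin

text \<open>
  The values at \<open>a\<close> of the polynomials over \<open>B\<close> of degree less than \<open>n\<close>.
\<close>

abbreviation pspan :: "'a set \<Rightarrow> 'a \<Rightarrow> nat \<Rightarrow> 'a set" where
  "pspan B a n \<equiv> lspan R B ((\<lambda>r. a [^] r) ` {..<n})"

lemma pspan_mono: "m \<le> n \<Longrightarrow> pspan B a m \<subseteq> pspan B a n"
  by (intro lspan_mono) auto

lemma pows_carrier: "a \<in> carrier R \<Longrightarrow> (\<lambda>r. a [^] r) ` (A :: nat set) \<subseteq> carrier R"
  by auto

lemma pspan_carrier: "\<lbrakk>v \<in> pspan B a n; subring B R; a \<in> carrier R\<rbrakk> \<Longrightarrow> v \<in> carrier R"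
  using lspan_closed subringE(1) pows_carrier by metis

lemma pspan_mult:
  assumes "subring B R" "a \<in> carrier R" "u \<in> pspan B a m" "v \<in> pspan B a (Suc n)"
  shows "u \<otimes> v \<in> pspan B a (m + n)"
proof (rule lspan_mult[OF assms(3,4,1)])
  show "(\<lambda>r. a [^] r) ` {..<m} \<subseteq> carrier R" "(\<lambda>r. a [^] r) ` {..<Suc n} \<subseteq> carrier R"
    "(\<lambda>r. a [^] r) ` {..<m + n} \<subseteq> carrier R" by (intro pows_carrier assms)+
  fix f g assume "f \<in> (\<lambda>r. a [^] r) ` {..<m}" "g \<in> (\<lambda>r. a [^] r) ` {..<Suc n}"
  then obtain r s where rs: "r < m" "s < Suc n" "f = a [^] r" "g = a [^] s" by auto
  then have "f \<otimes> g = a [^] (r + s)" using assms(2) by (simp add: nat_pow_mult)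
  then show "f \<otimes> g \<in> (\<lambda>r. a [^] r) ` {..<m + n}" using rs by auto
qed

lemma pspan_monomial:
  assumes "subring B R" "a \<in> carrier R" "b \<in> B" "n < m"
  shows "b \<otimes> a [^] n \<in> pspan B a m"
  using assms subringE(1) by (intro lspan_smult_base pows_carrier) auto

lemma pspan_const:
  assumes "subring B R" "a \<in> carrier R" "b \<in> B" "0 < m"
  shows "b \<in> pspan B a m"
  using pspan_monomial[OF assms] subring_carrier[OF assms(1,3)] by simp

lemma pspan_leading_term:
  assumes B: "subring B R" and a: "a \<in> carrier R" and u: "u \<in> pspan B a N" "u \<noteq> \<zero>"
  shows "\<exists>n<N. \<exists>b\<in>B. b \<noteq> \<zero> \<and> (\<exists>u'\<in>pspan B a n. u = b \<otimes> a [^] n \<oplus> u')"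
  using u(1)
proof (induct N)
  case 0
  then show ?case using u(2) by (simp add: lspan_empty)
next
  case (Suc N)
  then have "u \<in> lspan R B (insert (a [^] N) ((\<lambda>r. a [^] r) ` {..<N}))" by (simp add: lessThan_Suc)
  from lspan_insert[OF this B _ pows_carrier[OF a]] obtain b u'
    where b: "b \<in> B" "u' \<in> pspan B a N" "u = b \<otimes> a [^] N \<oplus> u'" using a by auto
  show ?case
  proof (cases "b = \<zero>")
    case True
    then have "u = u'" using b pspan_carrier[OF b(2) B a] a by simp
    then show ?thesis using Suc(1) b(2) less_SucI by blast
  qed (use b in blast)
qed

lemma range_pows_pspan:
  assumes "u \<in> lspan R B (range (\<lambda>r::nat. a [^] r))"
  shows "\<exists>N. u \<in> pspan B a N"
proof -
  obtain E where E: "finite E" "u \<in> lspan R B ((\<lambda>r::nat. a [^] r) ` E)"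
    using lspan_finite_support_image[OF assms] by blast
  obtain N where "\<forall>r\<in>E. r < N" using finite_nat_set_iff_bounded[THEN iffD1, OF E(1)] by blast
  then have "(\<lambda>r. a [^] r) ` E \<subseteq> (\<lambda>r. a [^] r) ` {..<N}" by auto
  then show ?thesis using E(2) lspan_mono[OF subset_refl] by blast
qed

lemma leading_term_mult:
  assumes B: "subring B R" and a: "a \<in> carrier R" and b: "b \<in> B" "c \<in> B"
    and u: "u' \<in> pspan B a n" "u = b \<otimes> a [^] n \<oplus> u'"
    and v: "v' \<in> pspan B a m" "v = c \<otimes> a [^] m \<oplus> v'"
  shows "\<exists>w\<in>pspan B a (n + m). u \<otimes> v = (b \<otimes> c) \<otimes> a [^] (n + m) \<oplus> w"
proof -
  have cl: "b \<in> carrier R" "c \<in> carrier R" "u' \<in> carrier R" "v' \<in> carrier R"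
    "a [^] n \<in> carrier R" "a [^] m \<in> carrier R"
    using subring_carrier[OF B] pspan_carrier[OF _ B a] assms by auto
  have im: "(\<lambda>r. a [^] r) ` {..<Suc m} \<subseteq> carrier R" by (rule pows_carrier[OF a])
  have vS: "v \<in> pspan B a (Suc m)" unfolding v(2)
    using pspan_monomial[OF B a b(2), of m "Suc m"] v(1) pspan_mono[of m "Suc m" B a]
    by (intro lspan_add subringE(1)[OF B] im) auto
  have 1: "v' \<otimes> (b \<otimes> a [^] n) \<in> pspan B a (m + n)"
    by (intro pspan_mult B a v(1) pspan_monomial b) simp
  have 2: "u' \<otimes> v \<in> pspan B a (n + m)" by (intro pspan_mult B a u(1) vS)
  have im': "(\<lambda>r. a [^] r) ` {..<n + m} \<subseteq> carrier R" by (rule pows_carrier[OF a])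
  have w: "v' \<otimes> (b \<otimes> a [^] n) \<oplus> u' \<otimes> v \<in> pspan B a (n + m)"
    using 1 2 by (intro lspan_add subringE(1)[OF B] im') (simp_all add: add.commute)
  have gen: "(b \<otimes> p \<oplus> u') \<otimes> (c \<otimes> q \<oplus> v') = (b \<otimes> c) \<otimes> (p \<otimes> q) \<oplus> (v' \<otimes> (b \<otimes> p) \<oplus> u' \<otimes> (c \<otimes> q \<oplus> v'))"
    if "p \<in> carrier R" "q \<in> carrier R" for p q
    using that cl(1-4) by algebra
  have "u \<otimes> v = (b \<otimes> c) \<otimes> a [^] (n + m) \<oplus> (v' \<otimes> (b \<otimes> a [^] n) \<oplus> u' \<otimes> v)"
    unfolding u(2) v(2) using gen[OF cl(5,6)] a by (simp add: nat_pow_mult)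
  then show ?thesis using w by blast
qed

text \<open>
  The product of the leading coefficients of \<open>u\<close> and \<open>v\<close> is the leading coefficient of \<open>u \<otimes> v\<close>.
\<close>

lemma transcendental_no_zero_divisors:
  assumes B: "subring B R" and a: "a \<in> carrier R" and tr: "transcendental_over R B a"
    and nz: "\<And>b c. \<lbrakk>b \<in> B; c \<in> B; b \<otimes> c = \<zero>\<rbrakk> \<Longrightarrow> b = \<zero> \<or> c = \<zero>"
    and u: "u \<in> lspan R B (range (\<lambda>r::nat. a [^] r))" and v: "v \<in> lspan R B (range (\<lambda>r::nat. a [^] r))"
    and uv: "u \<otimes> v = \<zero>"
  shows "u = \<zero> \<or> v = \<zero>"
proof (rule ccontr)
  assume neg: "\<not> ?thesis"
  obtain N where N: "u \<in> pspan B a N" using range_pows_pspan[OF u] by blast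
  obtain M where M: "v \<in> pspan B a M" using range_pows_pspan[OF v] by blast
  obtain n b u' where b: "b \<in> B" "b \<noteq> \<zero>" "u' \<in> pspan B a n" "u = b \<otimes> a [^] n \<oplus> u'"
    using pspan_leading_term[OF B a N] neg by blast
  obtain m c v' where c: "c \<in> B" "c \<noteq> \<zero>" "v' \<in> pspan B a m" "v = c \<otimes> a [^] m \<oplus> v'"
    using pspan_leading_term[OF B a M] neg by blast
  obtain w where w: "w \<in> pspan B a (n + m)" "u \<otimes> v = (b \<otimes> c) \<otimes> a [^] (n + m) \<oplus> w"
    using leading_term_mult[OF B a b(1) c(1) b(3,4) c(3,4)] by blast
  have bc: "b \<otimes> c \<in> B" using b c subringE(6)[OF B] by blast
  have "(b \<otimes> c) \<otimes> a [^] (n + m) = \<ominus> w"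
    using w(2)[unfolded uv, symmetric] subring_carrier[OF B bc] a pspan_carrier[OF w(1) B a]
    by (intro minus_equality[symmetric]) auto
  then have "(b \<otimes> c) \<otimes> a [^] (n + m) \<in> pspan B a (n + m)"
    using lspan_uminus[OF w(1) B pows_carrier[OF a]] by simp
  then have "b \<otimes> c = \<zero>" using tr bc unfolding transcendental_over_def by blast
  then show False using nz b c by blast
qed

lemma alg_indep_empty:
  fixes x :: "'i \<Rightarrow> 'a"
  assumes "subring F R" "F \<inter> P = {\<zero>}"
  shows "alg_indep R F P {} x"
  unfolding alg_indep_def lin_indep_def
proof (intro allI impI, elim conjE)
  fix W c assume h: "finite W" "W \<subseteq> expo {}" "c \<in> W \<rightarrow> F" "(\<Oplus>\<alpha>\<in>W. c \<alpha> \<otimes> power_prod R x {} \<alpha>) \<in> P"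
  have "expo {} = {\<lambda>_ :: 'i. 0 :: nat}" by (auto simp: expo_def fun_eq_iff)
  then have "W = {} \<or> W = {\<lambda>_. 0}" using h(2) by (metis subset_singletonD)
  then show "\<forall>\<alpha>\<in>W. c \<alpha> = \<zero>"
  proof
    assume W: "W = {\<lambda>_. 0}"
    have c: "c (\<lambda>_. 0) \<in> F" using h W by auto
    then have "(\<Oplus>\<alpha>\<in>W. c \<alpha> \<otimes> power_prod R x {} \<alpha>) = c (\<lambda>_. 0)"
      using subring_carrier[OF assms(1) c] unfolding W power_prod_def by simp
    then show ?thesis using h(4) W c assms(2) by auto
  qed simp
qed

lemma subfield_inter_proper_ideal:
  assumes F: "subfield F R" and P: "ideal P R" "P \<noteq> carrier R"
  shows "F \<inter> P = {\<zero>}"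
proof -
  have "c = \<zero>" if c: "c \<in> F" "c \<in> P" for c
  proof (rule ccontr)
    assume "c \<noteq> \<zero>"
    then have c': "c \<in> F - {\<zero>}" using c by simp
    obtain d where d: "d \<in> F" "d \<otimes> c = \<one>" using subfield_m_inv(1,3)[OF F c'] by blast
    have "\<one> \<in> P" using ideal.I_l_closed[OF P(1) c(2), of d] d subfieldE(3)[OF F] by auto
    then show False using ideal.one_imp_carrier[OF P(1)] P(2) by blast
  qed
  moreover have "\<zero> \<in> F" "\<zero> \<in> P"
    using subringE(2)[OF subfieldE(1)[OF F]] additive_subgroup.zero_closed[OF ideal.axioms(1)[OF P(1)]] by auto
  ultimately show ?thesis by blast
qed

text \<open>
  Induction down the chain. Given independent \<open>x\<close> with \<open>F[x] \<inter> P 1 = {\<zero>}\<close>, take any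
  \<open>a \<in> P 1 - P 0\<close>. A polynomial in \<open>a\<close> over \<open>F[x]\<close> that lies in \<open>P 0\<close> has its constant term in
  \<open>F[x] \<inter> P 1\<close>, so it is \<open>a\<close> times a polynomial of smaller degree, and this factor lies in \<open>P 0\<close>
  because \<open>a\<close> does not. By descent all coefficients vanish. This gives both the transcendence of
  \<open>a\<close> over \<open>F[x]\<close> and \<open>F[x, a] \<inter> P 0 = {\<zero>}\<close>.
\<close>

lemma primeideal_chain_imp_alg_indep:
  assumes F: "subfield F R"
    and P: "\<And>i. i \<le> l \<Longrightarrow> primeideal (P i) R" "\<And>i. i < l \<Longrightarrow> P i \<subset> P (Suc i)"
  shows "\<exists>x :: nat \<Rightarrow> 'a. x \<in> {..<l} \<rightarrow> carrier R \<and> alg_indep R F {\<zero>} {..<l} x \<and>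
    adjoin R F (x ` {..<l}) \<inter> P 0 = {\<zero>}"
  using P
proof (induct l arbitrary: P)
  case 0
  have FR: "subring F R" using subfieldE(1)[OF F] .
  have P0: "primeideal (P 0) R" using 0 by simp
  have "F \<inter> {\<zero>} = {\<zero>}" using subringE(2)[OF FR] by auto
  then have "alg_indep R F {\<zero>} {..<0} x" for x :: "nat \<Rightarrow> 'a" using alg_indep_empty[OF FR] by simp
  moreover have "F \<inter> P 0 = {\<zero>}"
    using subfield_inter_proper_ideal[OF F primeideal.axioms(1)[OF P0]] primeideal.I_notcarr[OF P0] by metis
  ultimately show ?case using adjoin_empty[OF FR] by simp
next
  case (Suc l)
  have FR: "subring F R" using subfieldE(1)[OF F] .
  obtain x :: "nat \<Rightarrow> 'a" where x: "x \<in> {..<l} \<rightarrow> carrier R" "alg_indep R F {\<zero>} {..<l} x"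
    "adjoin R F (x ` {..<l}) \<inter> P 1 = {\<zero>}"
    using Suc(1)[of "\<lambda>i. P (Suc i)"] Suc(2,3) by auto
  have pr: "primeideal (P 0) R" "primeideal (P 1) R" and lt: "P 0 \<subset> P 1" using Suc(2,3) by auto
  obtain a where a: "a \<in> P 1" "a \<notin> P 0" using lt by blast
  interpret P0: primeideal "P 0" R by (rule pr)
  interpret P1: primeideal "P 1" R by (rule pr)
  have ac: "a \<in> carrier R" using a P1.Icarr by blast
  let ?B = "adjoin R F (x ` {..<l})"
  have B: "subring ?B R" using x(1) subringE(1)[OF FR] by (intro adjoin_subring) auto
  \<comment> \<open>A polynomial of degree at most \<open>n\<close> in \<open>a\<close> that lies in \<open>P 0\<close>: its constant term is in \<open>P 1\<close>.\<close>
  have key: "b = \<zero> \<and> v = \<zero>" if "b \<in> ?B" "v \<in> pspan ?B a n" "b \<otimes> a [^] n \<oplus> v \<in> P 0" for n b v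
    using that
  proof (induct n arbitrary: v)
    case 0
    then have v: "v = \<zero>" by (simp add: lspan_empty)
    then have "b \<in> P 0" using 0 subring_carrier[OF B 0(1)] by simp
    then show ?case using v 0(1) lt x(3) by blast
  next
    case (Suc n)
    have bc: "b \<in> carrier R" using subring_carrier[OF B Suc(2)] .
    have im: "(\<lambda>r. a [^] r) ` {..<n} \<subseteq> carrier R" by (rule pows_carrier[OF ac])
    have "\<exists>g\<in>?B. \<exists>v'\<in>pspan ?B a n. v = g \<oplus> a \<otimes> v'"
      using Suc(3)
    proof induct
      case lspan_zero
      show ?case by (rule bexI[OF bexI[OF _ lspan.lspan_zero] subringE(2)[OF B]]) (use ac in simp)
    next
      case (lspan_step c u w)
      then obtain g v' where g: "g \<in> ?B" "v' \<in> pspan ?B a n" "w = g \<oplus> a \<otimes> v'" by blast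
      obtain r where r: "r < Suc n" "u = a [^] r" using lspan_step(2) by auto
      have cl: "c \<in> carrier R" "g \<in> carrier R" "v' \<in> carrier R"
        using subring_carrier[OF B] pspan_carrier[OF g(2) B ac] lspan_step(1) g(1) by auto
      show ?case
      proof (cases r)
        case 0
        then have "c \<otimes> u \<oplus> w = (c \<oplus> g) \<oplus> a \<otimes> v'" using r g(3) cl ac by (simp add: a_assoc)
        moreover have "c \<oplus> g \<in> ?B" using lspan_step(1) g(1) by (rule subringE(7)[OF B])
        ultimately show ?thesis using g(2) by blast
      next
        case (Suc r')
        have "c \<otimes> a [^] r' \<in> pspan ?B a n" using r Suc by (intro pspan_monomial B ac lspan_step(1)) auto
        then have 1: "c \<otimes> a [^] r' \<oplus> v' \<in> pspan ?B a n" using g(2) by (intro lspan_add subringE(1)[OF B] im)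
        have gen: "c \<otimes> (p \<otimes> a) \<oplus> (g \<oplus> a \<otimes> v') = g \<oplus> a \<otimes> (c \<otimes> p \<oplus> v')" if "p \<in> carrier R" for p
          using that cl ac by algebra
        have "c \<otimes> u \<oplus> w = g \<oplus> a \<otimes> (c \<otimes> a [^] r' \<oplus> v')"
          using gen[of "a [^] r'"] ac r(2) Suc g(3) by simp
        then show ?thesis using 1 g(1) by blast
      qed
    qed
    then obtain g v' where g: "g \<in> ?B" "v' \<in> pspan ?B a n" "v = g \<oplus> a \<otimes> v'" by blast
    have cl: "g \<in> carrier R" "v' \<in> carrier R"
      using subring_carrier[OF B g(1)] pspan_carrier[OF g(2) B ac] by auto
    have gen: "b \<otimes> (p \<otimes> a) \<oplus> (g \<oplus> a \<otimes> v') = g \<oplus> a \<otimes> (b \<otimes> p \<oplus> v')" if "p \<in> carrier R" for p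
      using that cl ac bc by algebra
    have eq: "b \<otimes> a [^] Suc n \<oplus> v = g \<oplus> a \<otimes> (b \<otimes> a [^] n \<oplus> v')"
      using gen[of "a [^] n"] ac g(3) by simp
    let ?t = "b \<otimes> a [^] n \<oplus> v'"
    have tc: "?t \<in> carrier R" using bc ac cl by simp
    have in1: "g \<oplus> a \<otimes> ?t \<in> P 1" using Suc(4) eq lt by auto
    have at: "a \<otimes> ?t \<in> P 1" using a tc P1.I_r_closed by blast
    have "(g \<oplus> a \<otimes> ?t) \<oplus> \<ominus> (a \<otimes> ?t) \<in> P 1"
      by (rule P1.a_closed[OF in1 P1.a_inv_closed[OF at]])
    moreover have "(g \<oplus> a \<otimes> ?t) \<oplus> \<ominus> (a \<otimes> ?t) = g" using cl ac tc by (simp add: a_assoc r_neg)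
    ultimately have "g \<in> P 1" by simp
    then have g0: "g = \<zero>" using g(1) x(3) by blast
    then have "a \<otimes> ?t \<in> P 0" using Suc(4) eq ac tc by simp
    then have "?t \<in> P 0" using P0.I_prime[OF ac tc] a(2) by blast
    then have "b = \<zero> \<and> v' = \<zero>" using Suc(1)[OF Suc(2) g(2)] by blast
    then show ?case using g(3) g0 ac by simp
  qed
  define y where "y = x(l := a)"
  have yx: "y ` {..<l} = x ` {..<l}" unfolding y_def by auto
  have yS: "{..<Suc l} = insert l {..<l}" by auto
  have yc: "y \<in> insert l {..<l} \<rightarrow> carrier R" using x(1) ac unfolding y_def by auto
  have yal: "alg_indep R F {\<zero>} {..<l} y"
  proof -
    have "power_prod R y {..<l} = power_prod R x {..<l}"
    proof
      fix \<alpha> show "power_prod R y {..<l} \<alpha> = power_prod R x {..<l} \<alpha>"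
        unfolding power_prod_def y_def using x(1) by (intro finprod_cong') auto
    qed
    then show ?thesis using x(2) unfolding alg_indep_def by simp
  qed
  have tr: "transcendental_over R ?B a"
    unfolding transcendental_over_def
  proof (intro allI impI, elim conjE)
    fix n b assume h: "b \<in> ?B" "b \<otimes> a [^] n \<in> pspan ?B a n"
    have "\<ominus> (b \<otimes> a [^] n) \<in> pspan ?B a n" by (rule lspan_uminus[OF h(2) B pows_carrier[OF ac]])
    moreover have "b \<otimes> a [^] n \<oplus> \<ominus> (b \<otimes> a [^] n) \<in> P 0"
      using subring_carrier[OF B h(1)] ac by (simp add: r_neg)
    ultimately show "b = \<zero>" using key h(1) by blast
  qed
  have "alg_indep R F {\<zero>} {..<Suc l} y" unfolding yS
    by (rule transcendental_imp_alg_indep_insert[OF FR _ _ yc yal]) (use tr yx in \<open>auto simp: y_def\<close>)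
  moreover have "adjoin R F (y ` {..<Suc l}) \<inter> P 0 = {\<zero>}"
  proof -
    have "y ` {..<Suc l} = insert a (x ` {..<l})" unfolding yS by (auto simp: y_def)
    then have eq: "adjoin R F (y ` {..<Suc l}) = lspan R ?B (range (\<lambda>r::nat. a [^] r))"
      using adjoin_insert_eq_lspan[of F "x ` {..<l}" a] x(1) ac subringE(1)[OF FR] by auto
    have "u = \<zero>" if u: "u \<in> adjoin R F (y ` {..<Suc l})" "u \<in> P 0" for u
    proof -
      obtain N where N: "u \<in> pspan ?B a N" using range_pows_pspan u(1) unfolding eq by blast
      have "\<zero> \<otimes> a [^] N \<oplus> u \<in> P 0" using u(2) P0.Icarr ac by simp
      then show ?thesis using key[OF subringE(2)[OF B] N] by blast
    qed
    moreover have "\<zero> \<in> adjoin R F (y ` {..<Suc l})" unfolding eq by (rule lspan.lspan_zero)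
    ultimately show ?thesis using P0.zero_closed by blast
  qed
  ultimately show ?case using yc unfolding yS by blast
qed

text \<open>
  By Zorn's lemma there is an ideal that is maximal among those containing \<open>I\<close> and disjoint from
  \<open>S\<close>. It is prime: adjoining either of two elements outside it produces elements of \<open>S\<close>, and their
  product would lie in the ideal if the product of the two elements did.
\<close>

lemma exists_primeideal_disjoint:
  assumes I: "ideal I R" and S: "S \<subseteq> carrier R" "\<one> \<in> S" "\<And>a b. \<lbrakk>a \<in> S; b \<in> S\<rbrakk> \<Longrightarrow> a \<otimes> b \<in> S"
    and dis: "I \<inter> S = {}"
  shows "\<exists>P. primeideal P R \<and> I \<subseteq> P \<and> P \<inter> S = {}"
proof -
  define A where "A = {J. ideal J R \<and> I \<subseteq> J \<and> J \<inter> S = {}}"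
  have "\<exists>M\<in>A. \<forall>J\<in>A. M \<subseteq> J \<longrightarrow> J = M"
  proof (rule subset_Zorn_nonempty)
    show "A \<noteq> {}" using I dis unfolding A_def by blast
    fix C assume C: "C \<noteq> {}" "subset.chain A C"
    have CA: "C \<subseteq> A" and lin: "\<And>J K. \<lbrakk>J \<in> C; K \<in> C\<rbrakk> \<Longrightarrow> J \<subseteq> K \<or> K \<subseteq> J"
      using C(2) unfolding subset.chain_def by auto
    have id: "ideal J R" if "J \<in> C" for J using CA that unfolding A_def by blast
    have "ideal (\<Union>C) R"
    proof (rule idealI)
      show "ring R" by (rule ring_axioms)
      show "subgroup (\<Union>C) (add_monoid R)"
      proof (rule add.subgroupI)
        show "\<Union>C \<subseteq> carrier R" using ideal.Icarr[OF id] by auto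
        obtain J where J: "J \<in> C" using C(1) by blast
        then have "\<zero> \<in> J" using additive_subgroup.zero_closed[OF ideal.axioms(1)[OF id[OF J]]] by simp
        then show "\<Union>C \<noteq> {}" using J by auto
        show "\<ominus> a \<in> \<Union>C" if a: "a \<in> \<Union>C" for a
        proof -
          obtain J where J: "J \<in> C" "a \<in> J" using a by blast
          show ?thesis
            using additive_subgroup.a_inv_closed[OF ideal.axioms(1)[OF id[OF J(1)]] J(2)] J(1) by blast
        qed
        show "a \<oplus> b \<in> \<Union>C" if ab: "a \<in> \<Union>C" "b \<in> \<Union>C" for a b
        proof -
          obtain J K where JK: "J \<in> C" "K \<in> C" "a \<in> J" "b \<in> K" using ab by blast
          then obtain L where L: "L \<in> C" "a \<in> L" "b \<in> L" using lin[OF JK(1,2)] by blast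
          show ?thesis
            using additive_subgroup.a_closed[OF ideal.axioms(1)[OF id[OF L(1)]] L(2,3)] L(1) by blast
        qed
      qed
      fix a x assume "a \<in> \<Union>C" and xc: "x \<in> carrier R"
      then obtain J where J: "J \<in> C" "a \<in> J" by blast
      show "x \<otimes> a \<in> \<Union>C" using ideal.I_l_closed[OF id[OF J(1)] J(2) xc] J(1) by blast
      show "a \<otimes> x \<in> \<Union>C" using ideal.I_r_closed[OF id[OF J(1)] J(2) xc] J(1) by blast
    qed
    moreover have "I \<subseteq> J \<and> J \<inter> S = {}" if "J \<in> C" for J using CA that unfolding A_def by auto
    then have "I \<subseteq> \<Union>C" "\<Union>C \<inter> S = {}" using C(1) by auto
    ultimately show "\<Union>C \<in> A" unfolding A_def by simp
  qed
  then obtain P where PA: "P \<in> A" "\<And>J. \<lbrakk>J \<in> A; P \<subseteq> J\<rbrakk> \<Longrightarrow> J = P" by blast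
  then have P: "ideal P R" "I \<subseteq> P" "P \<inter> S = {}" unfolding A_def by auto
  have max: "J = P" if "ideal J R" "P \<subseteq> J" "J \<inter> S = {}" for J
    using PA(2)[of J] that P(2) unfolding A_def by auto
  interpret P: ideal P R by (rule P(1))
  have meets: "\<exists>p\<in>P. \<exists>r\<in>carrier R. p \<oplus> r \<otimes> a \<in> S" if a: "a \<in> carrier R" "a \<notin> P" for a
  proof (rule ccontr)
    assume neg: "\<not> ?thesis"
    let ?J = "set_add R P (PIdl a)"
    have J: "ideal ?J R" by (intro add_ideals P(1) cgenideal_ideal a)
    have "P \<subseteq> ?J"
    proof
      fix p assume p: "p \<in> P"
      have "p = p \<oplus> \<zero> \<otimes> a" using p P.Icarr a by simp
      moreover have "\<zero> \<otimes> a \<in> PIdl a" unfolding cgenideal_def by blast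
      ultimately show "p \<in> ?J" using p unfolding set_add_defs by auto
    qed
    moreover have "?J \<inter> S = {}"
      using neg unfolding set_add_defs cgenideal_def by auto
    ultimately have "?J = P" by (rule max[OF J])
    moreover have "a \<in> ?J"
    proof -
      have "a = \<zero> \<oplus> \<one> \<otimes> a" using a by simp
      moreover have "\<one> \<otimes> a \<in> PIdl a" unfolding cgenideal_def by blast
      ultimately show ?thesis using P.zero_closed unfolding set_add_defs by auto
    qed
    ultimately show False using a by blast
  qed
  have "primeideal P R"
  proof (rule primeidealI[OF P(1) is_cring])
    show "carrier R \<noteq> P" using P(3) S by blast
    fix a b assume ab: "a \<in> carrier R" "b \<in> carrier R" "a \<otimes> b \<in> P"
    show "a \<in> P \<or> b \<in> P"
    proof (rule ccontr)
      assume "\<not> ?thesis"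
      then obtain p r q s where h: "p \<in> P" "r \<in> carrier R" "p \<oplus> r \<otimes> a \<in> S"
        "q \<in> P" "s \<in> carrier R" "q \<oplus> s \<otimes> b \<in> S" using meets ab by metis
      have pc: "p \<in> carrier R" "q \<in> carrier R" using h P.Icarr by auto
      have "(p \<oplus> r \<otimes> a) \<otimes> (q \<oplus> s \<otimes> b) = p \<otimes> (q \<oplus> s \<otimes> b) \<oplus> ((r \<otimes> a) \<otimes> q \<oplus> (r \<otimes> s) \<otimes> (a \<otimes> b))"
        using pc h(2,5) ab(1,2) by algebra
      also have "\<dots> \<in> P"
      proof (intro P.a_closed)
        show "p \<otimes> (q \<oplus> s \<otimes> b) \<in> P" using h(1,5) ab(2) pc by (intro P.I_r_closed) auto
        show "(r \<otimes> a) \<otimes> q \<in> P" using h(2,4) ab(1) by (intro P.I_l_closed) auto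
        show "(r \<otimes> s) \<otimes> (a \<otimes> b) \<in> P" using h(2,5) P.I_l_closed[OF ab(3), of "r \<otimes> s"] by simp
      qed
      finally show False using S(3)[OF h(3,6)] P(3) by blast
    qed
  qed
  then show ?thesis using P by blast
qed

end

section \<open>Prime ideals that keep elements algebraically independent\<close>

lemma (in ring_hom_ring) hom_generate_ring:
  assumes "H \<subseteq> carrier R"
  shows "h ` generate_ring R H = generate_ring S (h ` H)"
proof
  have hc: "x \<in> carrier R" if "x \<in> generate_ring R H" for x
    using R.generate_ring_in_carrier[OF assms that] .
  show "h ` generate_ring R H \<subseteq> generate_ring S (h ` H)"
  proof (rule image_subsetI)
    fix x assume "x \<in> generate_ring R H"
    then show "h x \<in> generate_ring S (h ` H)"
      by induct (use hc in \<open>auto intro: generate_ring.intros\<close>)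
  qed
  have sub: "subring (h ` generate_ring R H) S"
    by (intro img_is_subring R.generate_ring_is_subring assms)
  show "generate_ring S (h ` H) \<subseteq> h ` generate_ring R H"
    using assms by (intro S.generate_ring_min_subring1 sub) (auto intro: generate_ring.incl)
qed

lemma (in ring_hom_cring) hom_power_prod:
  assumes "x \<in> I \<rightarrow> carrier R"
  shows "h (power_prod R x I \<alpha>) = power_prod S (h \<circ> x) I \<alpha>"
proof -
  have pw: "h (a [^] n) = h a [^]\<^bsub>S\<^esub> n" if "a \<in> carrier R" for a and n :: nat
    using that by (induct n) auto
  have "h (power_prod R x I \<alpha>) = (\<Otimes>\<^bsub>S\<^esub>i\<in>I. (h \<circ> (\<lambda>i. x i [^] \<alpha> i)) i)"
    unfolding power_prod_def using assms by (intro hom_finprod) auto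
  also have "\<dots> = power_prod S (h \<circ> x) I \<alpha>"
    unfolding power_prod_def using assms by (intro S.finprod_cong') (auto simp: pw Pi_def)
  finally show ?thesis .
qed

lemma (in ring_hom_cring) hom_lincomb:
  assumes "c \<in> W \<rightarrow> carrier R" "u \<in> W \<rightarrow> carrier R"
  shows "h (\<Oplus>i\<in>W. c i \<otimes> u i) = (\<Oplus>\<^bsub>S\<^esub>i\<in>W. h (c i) \<otimes>\<^bsub>S\<^esub> h (u i))"
proof -
  have "h (\<Oplus>i\<in>W. c i \<otimes> u i) = (\<Oplus>\<^bsub>S\<^esub>i\<in>W. (h \<circ> (\<lambda>i. c i \<otimes> u i)) i)"
    using assms by (intro hom_finsum) auto
  also have "\<dots> = (\<Oplus>\<^bsub>S\<^esub>i\<in>W. h (c i) \<otimes>\<^bsub>S\<^esub> h (u i))"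
    using assms by (intro S.finsum_cong') (auto simp: Pi_def)
  finally show ?thesis .
qed

text \<open>
  Once a suitable nonzero \<open>f \<in> B\<close> is inverted, \<open>B[S]\<close> becomes a finite module over \<open>B\<close>. The
  elements of \<open>S\<close> are adjoined one by one: if \<open>g \<otimes> a [^] n\<close> is a combination of lower powers of \<open>a\<close>,
  so is \<open>g [^] r \<otimes> a [^] r\<close> for every \<open>r\<close>, and \<open>f\<close> is replaced by \<open>f \<otimes> g\<close>.
\<close>

lemma (in domain) algebraic_common_denominator:
  assumes B: "subring B R" and S: "finite S" "S \<subseteq> carrier R"
    and alg: "\<And>a. a \<in> S \<Longrightarrow> \<not> transcendental_over R B a"
  shows "\<exists>f\<in>B. f \<noteq> \<zero> \<and> (\<exists>E. finite E \<and> E \<subseteq> carrier R \<and>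
    (\<forall>u\<in>adjoin R B S. \<exists>N::nat. f [^] N \<otimes> u \<in> lspan R B E))"
  using S alg
proof (induct S rule: finite_induct)
  case empty
  have "\<exists>N::nat. \<one> [^] N \<otimes> u \<in> lspan R B {\<one>}" if u: "u \<in> adjoin R B {}" for u
  proof -
    have uB: "u \<in> B" using u adjoin_empty[OF B] by simp
    then have "u \<otimes> \<one> \<in> lspan R B {\<one>}" using subringE(1)[OF B] by (intro lspan_smult_base) auto
    then show ?thesis using subring_carrier[OF B uB] by simp
  qed
  then show ?case using subringE(3)[OF B] by (intro bexI[of _ \<one>] conjI exI[of _ "{\<one>}"]) auto
next
  case (insert a S)
  note BC = subringE(1)[OF B]
  have a: "a \<in> carrier R" and Sc: "S \<subseteq> carrier R" using insert by auto
  obtain f E where f: "f \<in> B" "f \<noteq> \<zero>" and E: "finite E" "E \<subseteq> carrier R"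
    and fE: "\<And>u. u \<in> adjoin R B S \<Longrightarrow> \<exists>N::nat. f [^] N \<otimes> u \<in> lspan R B E"
    using insert by auto
  obtain n g where g: "g \<in> B" "g \<noteq> \<zero>" "g \<otimes> a [^] n \<in> pspan B a n"
    using insert(5)[of a] unfolding transcendental_over_def by blast
  have fc: "f \<in> carrier R" and gc: "g \<in> carrier R" using f g BC by auto
  have pc: "(\<lambda>r. a [^] r) ` (A :: nat set) \<subseteq> carrier R" for A by (rule pows_carrier[OF a])
  have ga: "(g \<otimes> a) \<otimes> v \<in> pspan B a n" if "v \<in> pspan B a n" for v
    using that
  proof induct
    case lspan_zero
    have "(g \<otimes> a) \<otimes> \<zero> = \<zero>" using gc a by simp
    then show ?case by (simp add: lspan.lspan_zero)
  next
    case (lspan_step c u v)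
    then obtain r where r: "r < n" "u = a [^] r" by auto
    have cl: "c \<in> carrier R" "v \<in> carrier R" "u \<in> carrier R"
      using lspan_step(1) BC pspan_carrier[OF lspan_step(3) B a] r a by auto
    have "g \<otimes> a [^] Suc r \<in> pspan B a n"
    proof (cases "Suc r = n")
      case True
      then show ?thesis using g(3) by simp
    next
      case False
      then show ?thesis using r by (intro pspan_monomial B a g(1)) auto
    qed
    then have "c \<otimes> (g \<otimes> a [^] Suc r) \<in> pspan B a n" by (rule lspan_smult[OF _ lspan_step(1) B pc])
    then have 1: "c \<otimes> (g \<otimes> a [^] Suc r) \<oplus> (g \<otimes> a) \<otimes> v \<in> pspan B a n"
      using lspan_step(4) by (intro lspan_add BC pc)
    have "(g \<otimes> a) \<otimes> (c \<otimes> u \<oplus> v) = c \<otimes> (g \<otimes> (u \<otimes> a)) \<oplus> (g \<otimes> a) \<otimes> v"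
      using cl gc a by algebra
    then show ?case using 1 r(2) by simp
  qed
  have n0: "0 < n"
  proof (rule ccontr)
    assume "\<not> 0 < n"
    then have "g = \<zero>" using g(3) gc by (simp add: lspan_empty)
    then show False using g(2) by simp
  qed
  have gar: "g [^] r \<otimes> a [^] r \<in> pspan B a n" for r :: nat
  proof (induct r)
    case 0
    show ?case using pspan_const[OF B a subringE(3)[OF B] n0] by simp
  next
    case (Suc r)
    have gen: "(p \<otimes> g) \<otimes> (q \<otimes> a) = (g \<otimes> a) \<otimes> (p \<otimes> q)" if "p \<in> carrier R" "q \<in> carrier R" for p q
      using that gc a by algebra
    show ?case using ga[OF Suc] gen[of "g [^] r" "a [^] r"] gc a by simp
  qed
  let ?h = "f \<otimes> g"
  define E' where "E' = (\<lambda>(e, r). e \<otimes> a [^] r) ` (E \<times> {..<n})"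
  have hB: "?h \<in> B" using f g subringE(6)[OF B] by blast
  have h0: "?h \<noteq> \<zero>" using f g fc gc integral by blast
  have hc: "?h \<in> carrier R" using fc gc by simp
  have E': "finite E'" "E' \<subseteq> carrier R" unfolding E'_def using E a by auto
  have pw: "f [^] (m::nat) \<in> B" "g [^] m \<in> B" "?h [^] m \<in> B" for m
    using pow_in_subring[OF B] f g hB by auto
  have step: "\<exists>N::nat. ?h [^] N \<otimes> (c \<otimes> a [^] r) \<in> lspan R B E'" if c: "c \<in> adjoin R B S" for c and r :: nat
  proof -
    have cc: "c \<in> carrier R" using subring_carrier[OF adjoin_subring[OF BC Sc] c] .
    obtain N :: nat where N: "f [^] N \<otimes> c \<in> lspan R B E" using fE[OF c] by blast
    have "(f [^] N \<otimes> c) \<otimes> (g [^] r \<otimes> a [^] r) \<in> lspan R B E'"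
      by (rule lspan_mult[OF N gar B E(2) pc _ E'(2)]) (force simp: E'_def)
    then have "(f [^] r \<otimes> g [^] N) \<otimes> ((f [^] N \<otimes> c) \<otimes> (g [^] r \<otimes> a [^] r)) \<in> lspan R B E'"
      by (rule lspan_smult[OF _ subringE(6)[OF B pw(1,2)] B E'(2)])
    also have "(f [^] r \<otimes> g [^] N) \<otimes> ((f [^] N \<otimes> c) \<otimes> (g [^] r \<otimes> a [^] r)) = ?h [^] (N + r) \<otimes> (c \<otimes> a [^] r)"
    proof -
      have gen: "(p \<otimes> q) \<otimes> ((s \<otimes> c) \<otimes> (t \<otimes> w)) = ((s \<otimes> p) \<otimes> (q \<otimes> t)) \<otimes> (c \<otimes> w)"
        if "p \<in> carrier R" "q \<in> carrier R" "s \<in> carrier R" "t \<in> carrier R" "w \<in> carrier R" for p q s t w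
        using that cc by algebra
      show ?thesis using gen[of "f [^] r" "g [^] N" "f [^] N" "g [^] r" "a [^] r"] fc gc a
        by (simp add: nat_pow_mult nat_pow_distrib)
    qed
    finally show ?thesis by blast
  qed
  have "\<exists>N::nat. ?h [^] N \<otimes> u \<in> lspan R B E'" if "u \<in> lspan R (adjoin R B S) (range (\<lambda>r::nat. a [^] r))" for u
    using that
  proof induct
    case lspan_zero
    have "?h [^] (0::nat) \<otimes> \<zero> \<in> lspan R B E'" by (simp add: lspan.lspan_zero)
    then show ?case by blast
  next
    case (lspan_step c u v)
    obtain r :: nat where r: "u = a [^] r" using lspan_step(2) by auto
    obtain N :: nat where N: "?h [^] N \<otimes> (c \<otimes> u) \<in> lspan R B E'" using step[OF lspan_step(1), of r] r by auto
    obtain M :: nat where M: "?h [^] M \<otimes> v \<in> lspan R B E'" using lspan_step(4) by blast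
    have cl: "c \<in> carrier R" "v \<in> carrier R" "u \<in> carrier R"
      using subring_carrier[OF adjoin_subring[OF BC Sc] lspan_step(1)] a r
        lspan_closed[OF lspan_step(3) subringE(1)[OF adjoin_subring[OF BC Sc]] pc] by auto
    have "?h [^] M \<otimes> (?h [^] N \<otimes> (c \<otimes> u)) \<oplus> ?h [^] N \<otimes> (?h [^] M \<otimes> v) \<in> lspan R B E'"
      by (rule lspan_add[OF lspan_smult[OF N pw(3) B E'(2)] lspan_smult[OF M pw(3) B E'(2)] BC E'(2)])
    also have "?h [^] M \<otimes> (?h [^] N \<otimes> (c \<otimes> u)) \<oplus> ?h [^] N \<otimes> (?h [^] M \<otimes> v) = ?h [^] (M + N) \<otimes> (c \<otimes> u \<oplus> v)"
    proof -
      have gen: "p \<otimes> (q \<otimes> (c \<otimes> u)) \<oplus> q \<otimes> (p \<otimes> v) = (p \<otimes> q) \<otimes> (c \<otimes> u \<oplus> v)"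
        if "p \<in> carrier R" "q \<in> carrier R" for p q
        using that cl by algebra
      show ?thesis using gen[of "?h [^] M" "?h [^] N"] hc by (simp add: nat_pow_mult)
    qed
    finally show ?case by blast
  qed
  then have "\<forall>u\<in>adjoin R B (insert a S). \<exists>N::nat. ?h [^] N \<otimes> u \<in> lspan R B E'"
    using adjoin_insert_eq_lspan[OF BC Sc a] by simp
  then show ?case using hB h0 E' by blast
qed

text \<open>
  Nakayama's lemma for the module generated by \<open>E\<close> and the ideal generated by \<open>p\<close>. The set \<open>\<Theta>\<close>
  stands for the elements whose residues modulo \<open>p\<close> lie in a given multiplicative set. If some
  \<open>q \<in> \<Theta>\<close> maps every generator into \<open>p\<close> times the module, then an element of \<open>\<Theta>\<close> annihilates the
  module. The generators are eliminated one at a time, in place of the usual determinant.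
\<close>

lemma (in cring) nakayama_principal:
  assumes B: "subring B R" and p: "p \<in> B"
    and \<Theta>: "\<Theta> \<subseteq> B" "\<And>q r. \<lbrakk>q \<in> \<Theta>; r \<in> \<Theta>\<rbrakk> \<Longrightarrow> q \<otimes> r \<in> \<Theta>" "\<And>q c. \<lbrakk>q \<in> \<Theta>; c \<in> B\<rbrakk> \<Longrightarrow> q \<oplus> p \<otimes> c \<in> \<Theta>"
    and E: "finite E" "E \<subseteq> carrier R" and q: "q \<in> \<Theta>"
    and qE: "\<And>e. e \<in> E \<Longrightarrow> \<exists>m\<in>lspan R B E. q \<otimes> e = p \<otimes> m"
  shows "\<exists>r\<in>\<Theta>. \<forall>e\<in>E. r \<otimes> e = \<zero>"
  using E q qE
proof (induct E arbitrary: q rule: finite_induct)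
  case empty
  then show ?case by blast
next
  case (insert a E q)
  note BC = subringE(1)[OF B]
  have a: "a \<in> carrier R" and Ec: "E \<subseteq> carrier R" using insert by auto
  have qB: "q \<in> B" and qc: "q \<in> carrier R" and pc: "p \<in> carrier R" using insert(5) \<Theta>(1) BC p by auto
  obtain m where m: "m \<in> lspan R B (insert a E)" "q \<otimes> a = p \<otimes> m" using insert(6) by blast
  obtain c m' where c: "c \<in> B" "m' \<in> lspan R B E" "m = c \<otimes> a \<oplus> m'"
    using lspan_insert[OF m(1) B a Ec] by blast
  have cc: "c \<in> carrier R" "m' \<in> carrier R" using c(1) BC lspan_closed[OF c(2) BC Ec] by auto
  define u where "u = q \<oplus> p \<otimes> (\<ominus> c)"
  have u\<Theta>: "u \<in> \<Theta>" unfolding u_def using insert(5) c(1) subringE(5)[OF B] \<Theta>(3) by blast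
  have uB: "u \<in> B" and uc: "u \<in> carrier R" using u\<Theta> \<Theta>(1) BC by auto
  have ua: "u \<otimes> a = p \<otimes> m'"
  proof -
    have "u \<otimes> a = q \<otimes> a \<oplus> p \<otimes> ((\<ominus> c) \<otimes> a)" unfolding u_def using qc pc cc a by algebra
    also have "\<dots> = p \<otimes> m'" unfolding m(2) c(3) using pc cc a by algebra
    finally show ?thesis .
  qed
  have "\<exists>r\<in>\<Theta>. \<forall>e\<in>E. r \<otimes> e = \<zero>"
  proof (rule insert(3)[OF Ec])
    show "q \<otimes> u \<in> \<Theta>" using insert(5) u\<Theta> \<Theta>(2) by blast
    fix e assume e: "e \<in> E"
    have ec: "e \<in> carrier R" using e Ec by auto
    obtain x where x: "x \<in> lspan R B (insert a E)" "q \<otimes> e = p \<otimes> x" using insert(6) e by blast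
    obtain d x' where d: "d \<in> B" "x' \<in> lspan R B E" "x = d \<otimes> a \<oplus> x'"
      using lspan_insert[OF x(1) B a Ec] by blast
    have dc: "d \<in> carrier R" "x' \<in> carrier R" using d(1) BC lspan_closed[OF d(2) BC Ec] by auto
    have "(q \<otimes> u) \<otimes> e = u \<otimes> (q \<otimes> e)" using qc uc ec by algebra
    also have "\<dots> = p \<otimes> (d \<otimes> (u \<otimes> a) \<oplus> u \<otimes> x')" unfolding x(2) d(3) using pc uc dc a by algebra
    also have "\<dots> = p \<otimes> (d \<otimes> (p \<otimes> m') \<oplus> u \<otimes> x')" unfolding ua ..
    finally have "(q \<otimes> u) \<otimes> e = p \<otimes> (d \<otimes> (p \<otimes> m') \<oplus> u \<otimes> x')" .
    moreover have "d \<otimes> (p \<otimes> m') \<oplus> u \<otimes> x' \<in> lspan R B E"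
      by (rule lspan_add[OF lspan_smult[OF lspan_smult[OF c(2) p B Ec] d(1) B Ec]
            lspan_smult[OF d(2) uB B Ec] BC Ec])
    ultimately show "\<exists>m\<in>lspan R B E. (q \<otimes> u) \<otimes> e = p \<otimes> m" by blast
  qed
  then obtain r where r: "r \<in> \<Theta>" "\<And>e. e \<in> E \<Longrightarrow> r \<otimes> e = \<zero>" by blast
  have rc: "r \<in> carrier R" using r \<Theta>(1) BC by auto
  have kill: "r \<otimes> v = \<zero>" if "v \<in> lspan R B E" for v
    using that
  proof induct
    case lspan_zero
    show ?case using rc by simp
  next
    case (lspan_step b e v)
    have "r \<otimes> (b \<otimes> e \<oplus> v) = b \<otimes> (r \<otimes> e) \<oplus> r \<otimes> v"
      using rc lspan_step(1,2) BC Ec lspan_closed[OF lspan_step(3) BC Ec]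
      by (simp add: r_distr m_lcomm subset_iff)
    then show ?case using r(2) lspan_step(1,2,4) BC by auto
  qed
  have "r \<otimes> u \<in> \<Theta>" using r(1) u\<Theta> \<Theta>(2) by blast
  moreover have "(r \<otimes> u) \<otimes> e = \<zero>" if e: "e \<in> insert a E" for e
  proof (cases "e = a")
    case True
    have "(r \<otimes> u) \<otimes> e = p \<otimes> (r \<otimes> m')" using ua True rc uc a pc cc by (simp add: m_assoc m_lcomm)
    then show ?thesis using kill[OF c(2)] pc by simp
  next
    case False
    then have "e \<in> E" using e by simp
    then have "u \<otimes> (r \<otimes> e) = \<zero>" using r(2) uc by simp
    then show ?thesis using e a Ec rc uc by (auto simp: m_assoc m_lcomm subset_iff)
  qed
  ultimately show ?case by blast
qed

text \<open>
  Let \<open>B' = F[x\<^sub>i | i \<noteq> j]\<close> and \<open>B = B'[x\<^sub>j]\<close>. As the whole domain is algebraic over \<open>B\<close>, it becomes a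
  finite \<open>B\<close>-module after inverting some \<open>f \<in> B\<close>. The prime ideal is to contain \<open>p = \<one> \<oplus> x\<^sub>j \<otimes> f\<close>:
  modulo this element \<open>f\<close> is a unit, so finiteness survives, and \<open>p\<close> has positive degree in
  \<open>x\<^sub>j\<close>. What has to be excluded is that a multiple of \<open>p\<close> is a nonzero element \<open>s\<close> of \<open>B'\<close>. Then \<open>s\<close>
  would map the finite module into \<open>p\<close> times itself, and by Nakayama's lemma an element \<open>t + p g\<close>
  with \<open>\<zero> \<noteq> t \<in> B'\<close> and \<open>g \<in> B\<close> would annihilate a power of \<open>f\<close> and therefore be zero; this is
  impossible by comparing degrees in \<open>x\<^sub>j\<close>.
\<close>

lemma (in domain) exists_nonzero_primeideal_keeping_alg_indep:
  assumes F: "subring F R" and I: "finite I" "j \<in> I" and x: "x \<in> I \<rightarrow> carrier R"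
    and ind: "alg_indep R F {\<zero>} I x"
    and S: "finite S" "S \<subseteq> carrier R" "carrier R = adjoin R F S"
    and alg: "\<And>a. a \<in> S \<Longrightarrow> \<not> transcendental_over R (adjoin R F (x ` I)) a"
  shows "\<exists>P. primeideal P R \<and> P \<noteq> {\<zero>} \<and> adjoin R F (x ` (I - {j})) \<inter> P = {\<zero>}"
proof -
  let ?a = "x j"
  let ?B' = "adjoin R F (x ` (I - {j}))" and ?B = "adjoin R F (x ` I)"
  have FC: "F \<subseteq> carrier R" by (rule subringE(1)[OF F])
  have a: "?a \<in> carrier R" and xc: "x ` I \<subseteq> carrier R" "x ` (I - {j}) \<subseteq> carrier R" using x I by auto
  have B': "subring ?B' R" and B: "subring ?B R" using adjoin_subring FC xc by auto
  note BC = subringE(1)[OF B] and B'C = subringE(1)[OF B']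
  have "x ` I = insert ?a (x ` (I - {j}))" using I(2) by auto
  then have Beq: "?B = lspan R ?B' (range (\<lambda>r::nat. ?a [^] r))"
    using adjoin_insert_eq_lspan[OF FC xc(2) a] by simp
  have tr: "transcendental_over R ?B' ?a" by (rule alg_indep_imp_transcendental[OF F I(1) x I(2) ind])
  have B'B: "?B' \<subseteq> ?B" unfolding adjoin_def using FC xc by (intro mono_generate_ring) auto
  have aB: "?a \<in> ?B" using adjoin_incl(2)[of "x ` I" F] I(2) by auto
  obtain f E where f: "f \<in> ?B" "f \<noteq> \<zero>" and E: "finite E" "E \<subseteq> carrier R"
    and fE': "\<And>u. u \<in> adjoin R ?B S \<Longrightarrow> \<exists>N::nat. f [^] N \<otimes> u \<in> lspan R ?B E"
    using algebraic_common_denominator[OF B S(1,2) alg] by blast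
  have "adjoin R F S \<subseteq> adjoin R ?B S"
    using adjoin_incl(1)[of F "x ` I"] BC S(2) unfolding adjoin_def
    by (intro mono_generate_ring) auto
  then have fE: "\<exists>N::nat. f [^] N \<otimes> u \<in> lspan R ?B E" if "u \<in> carrier R" for u
    using fE' that S(3) by blast
  have fc: "f \<in> carrier R" using f BC by auto
  define p where "p = \<one> \<oplus> ?a \<otimes> f"
  have pB: "p \<in> ?B" unfolding p_def using aB f(1) subringE(3,6,7)[OF B] by blast
  have pc: "p \<in> carrier R" using pB BC by auto
  obtain N0 where N0: "f \<in> pspan ?B' ?a N0" using range_pows_pspan f(1) unfolding Beq by blast
  obtain n b f' where b: "b \<in> ?B'" "b \<noteq> \<zero>" "f' \<in> pspan ?B' ?a n" "f = b \<otimes> ?a [^] n \<oplus> f'"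
    using pspan_leading_term[OF B' a N0 f(2)] by blast
  \<comment> \<open>The elements congruent to a nonzero element of \<open>B'\<close> modulo \<open>p\<close>.\<close>
  define \<Theta> where "\<Theta> = {q. \<exists>s\<in>?B'. \<exists>g\<in>?B. s \<noteq> \<zero> \<and> q = s \<oplus> p \<otimes> g}"
  have \<Theta>1: "\<Theta> \<subseteq> ?B" unfolding \<Theta>_def using B'B pB subringE(6,7)[OF B] by blast
  have \<Theta>2: "q \<otimes> r \<in> \<Theta>" if qr: "q \<in> \<Theta>" "r \<in> \<Theta>" for q r
  proof -
    obtain s g where s: "s \<in> ?B'" "g \<in> ?B" "s \<noteq> \<zero>" "q = s \<oplus> p \<otimes> g" using qr unfolding \<Theta>_def by blast
    obtain t h where t: "t \<in> ?B'" "h \<in> ?B" "t \<noteq> \<zero>" "r = t \<oplus> p \<otimes> h" using qr unfolding \<Theta>_def by blast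
    have cl: "s \<in> carrier R" "t \<in> carrier R" "g \<in> carrier R" "h \<in> carrier R" using s t B'C BC by auto
    have "q \<otimes> r = s \<otimes> t \<oplus> p \<otimes> (s \<otimes> h \<oplus> g \<otimes> t \<oplus> g \<otimes> (p \<otimes> h))"
      unfolding s(4) t(4) using cl pc by algebra
    moreover have "s \<otimes> t \<in> ?B'" using s t subringE(6)[OF B'] by blast
    moreover have "s \<otimes> t \<noteq> \<zero>" using s t cl integral by blast
    moreover have "s \<in> ?B" "t \<in> ?B" using s t B'B by auto
    then have "s \<otimes> h \<oplus> g \<otimes> t \<oplus> g \<otimes> (p \<otimes> h) \<in> ?B"
      using s(2) t(2) pB by (intro subringE(6,7)[OF B])
    ultimately show ?thesis unfolding \<Theta>_def by blast
  qed
  have \<Theta>3: "q \<oplus> p \<otimes> c \<in> \<Theta>" if qr: "q \<in> \<Theta>" "c \<in> ?B" for q c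
  proof -
    obtain s g where s: "s \<in> ?B'" "g \<in> ?B" "s \<noteq> \<zero>" "q = s \<oplus> p \<otimes> g" using qr unfolding \<Theta>_def by blast
    have cl: "s \<in> carrier R" "g \<in> carrier R" "c \<in> carrier R" using s qr B'C BC by auto
    have "q \<oplus> p \<otimes> c = s \<oplus> p \<otimes> (g \<oplus> c)" unfolding s(4) using cl pc by algebra
    moreover have "g \<oplus> c \<in> ?B" using s qr subringE(7)[OF B] by blast
    ultimately show ?thesis using s unfolding \<Theta>_def by blast
  qed
  have \<Theta>0: "\<zero> \<notin> \<Theta>"
  proof
    assume "\<zero> \<in> \<Theta>"
    then obtain s g where s: "s \<in> ?B'" "g \<in> ?B" "s \<noteq> \<zero>" "s \<oplus> p \<otimes> g = \<zero>"
      unfolding \<Theta>_def by auto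
    have cl: "s \<in> carrier R" "g \<in> carrier R" using s B'C BC by auto
    have "g \<noteq> \<zero>" using s(3,4) cl pc by auto
    moreover obtain M0 where M0: "g \<in> pspan ?B' ?a M0" using range_pows_pspan s(2) unfolding Beq by blast
    ultimately obtain m c g' where c: "c \<in> ?B'" "c \<noteq> \<zero>" "g' \<in> pspan ?B' ?a m" "g = c \<otimes> ?a [^] m \<oplus> g'"
      using pspan_leading_term[OF B' a M0] by blast
    obtain w where w: "w \<in> pspan ?B' ?a (n + m)" "f \<otimes> g = (b \<otimes> c) \<otimes> ?a [^] (n + m) \<oplus> w"
      using leading_term_mult[OF B' a b(1) c(1) b(3,4) c(3,4)] by blast
    let ?k = "Suc (n + m)"
    have bc: "b \<otimes> c \<in> ?B'" using b c subringE(6)[OF B'] by blast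
    have wc: "w \<in> carrier R" and bcc: "b \<otimes> c \<in> carrier R" and powc: "?a [^] (n + m) \<in> carrier R"
      using pspan_carrier[OF w(1) B' a] subring_carrier[OF B' bc] a by auto
    have pw: "(\<lambda>r. ?a [^] r) ` (A :: nat set) \<subseteq> carrier R" for A by (rule pows_carrier[OF a])
    have 1: "s \<in> pspan ?B' ?a ?k" by (rule pspan_const[OF B' a s(1)]) simp
    have "g \<in> pspan ?B' ?a (Suc m)" unfolding c(4)
      using pspan_monomial[OF B' a c(1), of m "Suc m"] c(3) pspan_mono[of m "Suc m" ?B' ?a]
      by (intro lspan_add B'C pw) auto
    then have 2: "g \<in> pspan ?B' ?a ?k" using pspan_mono[of "Suc m" ?k] by auto
    have "\<one> \<otimes> ?a [^] (1::nat) \<in> pspan ?B' ?a (Suc 1)"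
      by (rule pspan_monomial[OF B' a subringE(3)[OF B']]) simp
    then have "w \<otimes> ?a \<in> pspan ?B' ?a (n + m + 1)" using a by (intro pspan_mult B' w(1)) auto
    then have 3: "w \<otimes> ?a \<in> pspan ?B' ?a ?k" by simp
    have gen: "s \<oplus> p \<otimes> g = (b \<otimes> c) \<otimes> (q \<otimes> ?a) \<oplus> (s \<oplus> g \<oplus> w \<otimes> ?a)"
      if fg: "f \<otimes> g = (b \<otimes> c) \<otimes> q \<oplus> w" and q: "q \<in> carrier R" for q
    proof -
      have "s \<oplus> p \<otimes> g = (s \<oplus> g) \<oplus> ?a \<otimes> (f \<otimes> g)" unfolding p_def using cl fc a by algebra
      also have "\<dots> = (s \<oplus> g) \<oplus> ?a \<otimes> ((b \<otimes> c) \<otimes> q \<oplus> w)" unfolding fg ..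
      also have "\<dots> = (b \<otimes> c) \<otimes> (q \<otimes> ?a) \<oplus> (s \<oplus> g \<oplus> w \<otimes> ?a)"
        using cl bcc q wc a by algebra
      finally show ?thesis .
    qed
    have "s \<oplus> p \<otimes> g = (b \<otimes> c) \<otimes> ?a [^] ?k \<oplus> (s \<oplus> g \<oplus> w \<otimes> ?a)"
      using gen[OF w(2) powc] by simp
    then have "(b \<otimes> c) \<otimes> ?a [^] ?k \<oplus> (s \<oplus> g \<oplus> w \<otimes> ?a) = \<zero>" using s(4) by simp
    then have "(b \<otimes> c) \<otimes> ?a [^] ?k = \<ominus> (s \<oplus> g \<oplus> w \<otimes> ?a)"
      using bcc a cl wc by (intro minus_equality[symmetric]) auto
    moreover have "\<ominus> (s \<oplus> g \<oplus> w \<otimes> ?a) \<in> pspan ?B' ?a ?k"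
      using 1 2 3 by (intro lspan_uminus lspan_add B' B'C pw)
    ultimately have "b \<otimes> c = \<zero>" using tr bc unfolding transcendental_over_def by metis
    then show False using b c B'C integral by blast
  qed
  \<comment> \<open>Modulo \<open>p\<close>, the element \<open>f\<close> is invertible with inverse \<open>- x\<^sub>j\<close>.\<close>
  have inv_f: "\<exists>u\<in>?B. \<exists>t\<in>?B. \<one> = u \<otimes> f [^] N \<oplus> p \<otimes> t" for N :: nat
  proof (induct N)
    case 0
    have "\<one> = \<one> \<otimes> f [^] (0::nat) \<oplus> p \<otimes> \<zero>" using pc by simp
    then show ?case using subringE(2,3)[OF B] by blast
  next
    case (Suc N)
    then obtain u t where u: "u \<in> ?B" "t \<in> ?B" "\<one> = u \<otimes> f [^] N \<oplus> p \<otimes> t" by blast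
    have cl: "u \<in> carrier R" "t \<in> carrier R" using u BC by auto
    have gen: "u \<otimes> q \<oplus> p \<otimes> t = (\<ominus> (u \<otimes> ?a)) \<otimes> (q \<otimes> f) \<oplus> p \<otimes> (u \<otimes> q \<oplus> t)" if "q \<in> carrier R" for q
      unfolding p_def using cl that a fc by algebra
    have "\<one> = (\<ominus> (u \<otimes> ?a)) \<otimes> f [^] Suc N \<oplus> p \<otimes> (u \<otimes> f [^] N \<oplus> t)"
      using gen[of "f [^] N"] u(3) fc by simp
    moreover have "\<ominus> (u \<otimes> ?a) \<in> ?B" "u \<otimes> f [^] N \<oplus> t \<in> ?B"
      using u aB f pow_in_subring[OF B f(1)] by (auto intro!: subringE(5,6,7)[OF B])
    ultimately show ?case by blast
  qed
  have nodiv: "p \<otimes> y \<notin> ?B' - {\<zero>}" if y: "y \<in> carrier R" for y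
  proof
    assume "p \<otimes> y \<in> ?B' - {\<zero>}"
    then have s: "p \<otimes> y \<in> ?B'" "p \<otimes> y \<noteq> \<zero>" by auto
    define s where "s = p \<otimes> y"
    have sc: "s \<in> carrier R" using s(1) B'C unfolding s_def by blast
    have "s = s \<oplus> p \<otimes> \<zero>" using sc pc by simp
    then have s\<Theta>: "s \<in> \<Theta>" unfolding \<Theta>_def using s subringE(2)[OF B] unfolding s_def by blast
    have sB: "s \<in> ?B" using s\<Theta> \<Theta>1 by blast
    have "\<exists>m\<in>lspan R ?B E. s \<otimes> e = p \<otimes> m" if e: "e \<in> E" for e
    proof -
      have ec: "e \<in> carrier R" using e E by auto
      obtain N :: nat where N: "f [^] N \<otimes> (y \<otimes> e) \<in> lspan R ?B E" using fE[of "y \<otimes> e"] y ec by auto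
      obtain u t where u: "u \<in> ?B" "t \<in> ?B" "\<one> = u \<otimes> f [^] N \<oplus> p \<otimes> t" using inv_f by blast
      have cl: "u \<in> carrier R" "t \<in> carrier R" using u BC by auto
      have gen: "(u \<otimes> q \<oplus> p \<otimes> t) \<otimes> (s \<otimes> e) = p \<otimes> (u \<otimes> (q \<otimes> (y \<otimes> e)) \<oplus> (t \<otimes> s) \<otimes> e)"
        if "q \<in> carrier R" for q
        unfolding s_def using that cl y ec pc by algebra
      have "s \<otimes> e = \<one> \<otimes> (s \<otimes> e)" using sc ec by simp
      also have "\<dots> = p \<otimes> (u \<otimes> (f [^] N \<otimes> (y \<otimes> e)) \<oplus> (t \<otimes> s) \<otimes> e)"
        unfolding u(3) using fc by (intro gen) simp
      finally have "s \<otimes> e = p \<otimes> (u \<otimes> (f [^] N \<otimes> (y \<otimes> e)) \<oplus> (t \<otimes> s) \<otimes> e)" .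
      moreover have "u \<otimes> (f [^] N \<otimes> (y \<otimes> e)) \<oplus> (t \<otimes> s) \<otimes> e \<in> lspan R ?B E"
        by (rule lspan_add[OF lspan_smult[OF N u(1) B E(2)]
              lspan_smult_base[OF subringE(6)[OF B u(2) sB] e BC E(2)] BC E(2)])
      ultimately show ?thesis by blast
    qed
    then obtain r where r: "r \<in> \<Theta>" "\<And>e. e \<in> E \<Longrightarrow> r \<otimes> e = \<zero>"
      using nakayama_principal[OF B pB \<Theta>1 \<Theta>2 \<Theta>3 E s\<Theta>] by blast
    have rc: "r \<in> carrier R" using r(1) \<Theta>1 BC by auto
    obtain N :: nat where N: "f [^] N \<otimes> \<one> \<in> lspan R ?B E" using fE by blast
    have "r \<otimes> v = \<zero>" if "v \<in> lspan R ?B E" for v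
      using that
    proof induct
      case lspan_zero
      show ?case using rc by simp
    next
      case (lspan_step b e v)
      have cl: "b \<in> carrier R" "e \<in> carrier R" "v \<in> carrier R"
        using lspan_step(1,2) BC E(2) lspan_closed[OF lspan_step(3) BC E(2)] by auto
      have "r \<otimes> (b \<otimes> e \<oplus> v) = b \<otimes> (r \<otimes> e) \<oplus> r \<otimes> v" using rc cl by algebra
      then show ?case using r(2)[OF lspan_step(2)] lspan_step(4) cl by simp
    qed
    then have "r \<otimes> f [^] N = \<zero>" using N fc by simp
    moreover have "f [^] N \<noteq> \<zero>"
    proof (induct N)
      case (Suc N)
      then show ?case using f(2) fc integral[of "f [^] N" f] by auto
    qed simp
    ultimately have "r = \<zero>" using integral rc fc by blast
    then show False using r(1) \<Theta>0 by blast
  qed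
  have S': "?B' - {\<zero>} \<subseteq> carrier R" "\<one> \<in> ?B' - {\<zero>}" using B'C subringE(3)[OF B'] by auto
  have S'm: "g \<otimes> h \<in> ?B' - {\<zero>}" if "g \<in> ?B' - {\<zero>}" "h \<in> ?B' - {\<zero>}" for g h
    using that subringE(6)[OF B'] integral[of g h] B'C by blast
  have "PIdl p \<inter> (?B' - {\<zero>}) = {}"
  proof -
    have "x \<notin> ?B' - {\<zero>}" if "x \<in> PIdl p" for x
    proof -
      obtain y where y: "y \<in> carrier R" "x = y \<otimes> p" using \<open>x \<in> PIdl p\<close> unfolding cgenideal_def by blast
      then show ?thesis using nodiv[OF y(1)] pc by (simp add: m_comm)
    qed
    then show ?thesis by blast
  qed
  from exists_primeideal_disjoint[OF cgenideal_ideal[OF pc] S' S'm this]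
  obtain P where P: "primeideal P R" "PIdl p \<subseteq> P" "P \<inter> (?B' - {\<zero>}) = {}" by blast
  have pP: "p \<in> P" using cgenideal_self[OF pc] P(2) by blast
  have "p \<noteq> \<zero>"
  proof
    assume p0: "p = \<zero>"
    have bc: "b \<in> carrier R" "f' \<in> carrier R" "?a [^] n \<in> carrier R"
      using b(1) B'C pspan_carrier[OF b(3) B' a] a by auto
    have gen: "\<one> \<oplus> ?a \<otimes> (b \<otimes> q \<oplus> f') = b \<otimes> (q \<otimes> ?a) \<oplus> (\<one> \<oplus> f' \<otimes> ?a)" if "q \<in> carrier R" for q
      using that bc a by algebra
    have "b \<otimes> ?a [^] Suc n \<oplus> (\<one> \<oplus> f' \<otimes> ?a) = \<zero>"
      using gen[OF bc(3)] p0 b(4) unfolding p_def by simp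
    then have "b \<otimes> ?a [^] Suc n = \<ominus> (\<one> \<oplus> f' \<otimes> ?a)"
      using bc a by (intro minus_equality[symmetric]) auto
    moreover have "\<one> \<otimes> ?a [^] (1::nat) \<in> pspan ?B' ?a (Suc 1)"
      by (rule pspan_monomial[OF B' a subringE(3)[OF B']]) simp
    then have "f' \<otimes> ?a \<in> pspan ?B' ?a (n + 1)" using a by (intro pspan_mult B' b(3)) auto
    then have "\<ominus> (\<one> \<oplus> f' \<otimes> ?a) \<in> pspan ?B' ?a (Suc n)"
      using pspan_const[OF B' a subringE(3)[OF B'], of "Suc n"]
      by (intro lspan_uminus lspan_add B' B'C pows_carrier[OF a]) auto
    ultimately have "b = \<zero>" using tr b(1) unfolding transcendental_over_def by metis
    then show False using b(2) by simp
  qed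
  then have "P \<noteq> {\<zero>}" using pP by blast
  moreover have "\<zero> \<in> ?B'" "\<zero> \<in> P"
    using subringE(2)[OF B'] additive_subgroup.zero_closed[OF ideal.axioms(1)[OF primeideal.axioms(1)[OF P(1)]]] by auto
  then have "?B' \<inter> P = {\<zero>}" using P(3) by blast
  ultimately show ?thesis using P(1) by blast
qed

section \<open>Krull dimension as a transcendence number\<close>

text \<open>
  Natural numbers suffice as indices of finite families, and a fixed index type makes the existence of
  a family expressible.
\<close>

definition alg_indep_of_size :: "('a, 'm) ring_scheme \<Rightarrow> 'a set \<Rightarrow> 'a set \<Rightarrow> nat \<Rightarrow> bool" where
  "alg_indep_of_size T F A l \<longleftrightarrow> (\<exists>(x :: nat \<Rightarrow> 'a) I. finite I \<and> card I = l \<and> x \<in> I \<rightarrow> A \<and>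
     alg_indep T F {\<zero>\<^bsub>T\<^esub>} I x)"

context cring
begin

lemma alg_indep_cong:
  assumes "\<And>i. i \<in> I \<Longrightarrow> x i = y i" "y \<in> I \<rightarrow> carrier R"
  shows "alg_indep R F P I x = alg_indep R F P I y"
proof -
  have "power_prod R x I = power_prod R y I"
  proof
    fix \<alpha> show "power_prod R x I \<alpha> = power_prod R y I \<alpha>"
      unfolding power_prod_def using assms by (intro finprod_cong') auto
  qed
  then show ?thesis unfolding alg_indep_def by simp
qed

lemma lincomb_in_adjoin:
  assumes "subring F R" "finite I" "x \<in> I \<rightarrow> carrier R" "W \<subseteq> expo I" "c \<in> W \<rightarrow> F"
  shows "(\<Oplus>\<alpha>\<in>W. c \<alpha> \<otimes> power_prod R x I \<alpha>) \<in> adjoin R F (x ` I)"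
  unfolding adjoin_eq_lspan_power_prods[OF assms(1-3)]
proof (intro lspan_finsum lspan_smult_base subringE(1)[OF assms(1)])
  show "power_prod R x I ` expo I \<subseteq> carrier R" using power_prod_closed[OF assms(3)] by auto
  then show "power_prod R x I ` expo I \<subseteq> carrier R" .
qed (use assms in auto)

lemma alg_indep_mod:
  assumes "alg_indep R F {\<zero>} I x" "subring F R" "finite I" "x \<in> I \<rightarrow> carrier R"
    "adjoin R F (x ` I) \<inter> P = {\<zero>}"
  shows "alg_indep R F P I x"
  unfolding alg_indep_def lin_indep_def
proof (intro allI impI, elim conjE)
  fix W c assume h: "finite W" "W \<subseteq> expo I" "c \<in> W \<rightarrow> F" "(\<Oplus>\<alpha>\<in>W. c \<alpha> \<otimes> power_prod R x I \<alpha>) \<in> P"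
  have "(\<Oplus>\<alpha>\<in>W. c \<alpha> \<otimes> power_prod R x I \<alpha>) \<in> {\<zero>}"
    using h(4) lincomb_in_adjoin[OF assms(2,3,4) h(2,3)] assms(5) by blast
  from lin_indepD[OF assms(1)[unfolded alg_indep_def] h(1-3) this]
  show "\<forall>\<alpha>\<in>W. c \<alpha> = \<zero>" by blast
qed

end

lemma (in ring_hom_cring) alg_indep_vimage:
  assumes F: "subring F R" and inj: "\<And>c. \<lbrakk>c \<in> F; h c = \<zero>\<^bsub>S\<^esub>\<rbrakk> \<Longrightarrow> c = \<zero>"
    and x: "x \<in> I \<rightarrow> carrier R" and ind: "alg_indep S (h ` F) Q I (h \<circ> x)"
  shows "alg_indep R F {r \<in> carrier R. h r \<in> Q} I x"
  unfolding alg_indep_def lin_indep_def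
proof (intro allI impI, elim conjE)
  fix W c assume w: "finite W" "W \<subseteq> expo I" "c \<in> W \<rightarrow> F"
    "(\<Oplus>\<alpha>\<in>W. c \<alpha> \<otimes> power_prod R x I \<alpha>) \<in> {r \<in> carrier R. h r \<in> Q}"
  have cc: "c \<in> W \<rightarrow> carrier R" using w(3) R.subring_carrier[OF F] by auto
  have "h (\<Oplus>\<alpha>\<in>W. c \<alpha> \<otimes> power_prod R x I \<alpha>) = (\<Oplus>\<^bsub>S\<^esub>\<alpha>\<in>W. h (c \<alpha>) \<otimes>\<^bsub>S\<^esub> h (power_prod R x I \<alpha>))"
    using cc R.power_prod_closed[OF x] by (intro hom_lincomb) auto
  also have "\<dots> = (\<Oplus>\<^bsub>S\<^esub>\<alpha>\<in>W. h (c \<alpha>) \<otimes>\<^bsub>S\<^esub> power_prod S (h \<circ> x) I \<alpha>)"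
    by (simp add: hom_power_prod[OF x])
  finally have "(\<Oplus>\<^bsub>S\<^esub>\<alpha>\<in>W. h (c \<alpha>) \<otimes>\<^bsub>S\<^esub> power_prod S (h \<circ> x) I \<alpha>) \<in> Q" using w(4) by simp
  moreover have "(\<lambda>\<alpha>. h (c \<alpha>)) \<in> W \<rightarrow> h ` F" using w(3) by auto
  ultimately have "h (c \<alpha>) = \<zero>\<^bsub>S\<^esub>" if "\<alpha> \<in> W" for \<alpha>
    using lin_indepD[OF ind[unfolded alg_indep_def] w(1,2), of "\<lambda>\<alpha>. h (c \<alpha>)"] that by blast
  then show "\<forall>\<alpha>\<in>W. c \<alpha> = \<zero>" using inj w(3) by auto
qed

lemma (in ring_hom_cring) alg_indep_image:
  assumes F: "subring F R" and x: "x \<in> I \<rightarrow> carrier R" and ind: "alg_indep R F {r \<in> carrier R. h r \<in> Q} I x"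
  shows "alg_indep S (h ` F) Q I (h \<circ> x)"
  unfolding alg_indep_def lin_indep_def
proof (intro allI impI, elim conjE)
  fix W c assume w: "finite W" "W \<subseteq> expo I" "c \<in> W \<rightarrow> h ` F"
    "(\<Oplus>\<^bsub>S\<^esub>\<alpha>\<in>W. c \<alpha> \<otimes>\<^bsub>S\<^esub> power_prod S (h \<circ> x) I \<alpha>) \<in> Q"
  have "\<forall>\<alpha>\<in>W. \<exists>d. d \<in> F \<and> c \<alpha> = h d" using w(3) by auto
  from bchoice[OF this] obtain d where d: "\<And>\<alpha>. \<alpha> \<in> W \<Longrightarrow> d \<alpha> \<in> F \<and> c \<alpha> = h (d \<alpha>)" by auto
  have dc: "d \<in> W \<rightarrow> carrier R" using d R.subring_carrier[OF F] by auto
  have pc: "power_prod S (h \<circ> x) I \<alpha> \<in> carrier S" for \<alpha>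
  proof (rule S.power_prod_closed, rule funcsetI)
    fix i assume "i \<in> I"
    then show "(h \<circ> x) i \<in> carrier S" using funcset_mem[OF x] by simp
  qed
  have "h (\<Oplus>\<alpha>\<in>W. d \<alpha> \<otimes> power_prod R x I \<alpha>) = (\<Oplus>\<^bsub>S\<^esub>\<alpha>\<in>W. h (d \<alpha>) \<otimes>\<^bsub>S\<^esub> h (power_prod R x I \<alpha>))"
    using dc R.power_prod_closed[OF x] by (intro hom_lincomb) auto
  also have "\<dots> = (\<Oplus>\<^bsub>S\<^esub>\<alpha>\<in>W. c \<alpha> \<otimes>\<^bsub>S\<^esub> power_prod S (h \<circ> x) I \<alpha>)"
    using d funcset_mem[OF dc] pc by (intro S.finsum_cong') (auto simp: hom_power_prod[OF x])
  finally have "(\<Oplus>\<alpha>\<in>W. d \<alpha> \<otimes> power_prod R x I \<alpha>) \<in> {r \<in> carrier R. h r \<in> Q}"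
    using w(4) funcset_mem[OF dc] R.power_prod_closed[OF x] by (auto intro!: R.finsum_closed)
  then have mem: "(\<Oplus>\<alpha>\<in>W. d \<alpha> \<otimes> power_prod R x I \<alpha>) \<in> {r \<in> carrier R. h r \<in> Q}" .
  have dF: "d \<in> W \<rightarrow> F" using d by blast
  show "\<forall>\<alpha>\<in>W. c \<alpha> = \<zero>\<^bsub>S\<^esub>"
  proof
    fix \<alpha> assume \<alpha>: "\<alpha> \<in> W"
    have "d \<alpha> = \<zero>" by (rule lin_indepD[OF ind[unfolded alg_indep_def] w(1,2) dF mem \<alpha>])
    then show "c \<alpha> = \<zero>\<^bsub>S\<^esub>" using d[OF \<alpha>] by simp
  qed
qed

context cring
begin

text \<open>
  In the domain obtained by dividing by \<open>P\<close>, the family \<open>x\<close> is enlarged by generators of the algebra to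
  a maximal independent family. All generators are then algebraic over it, so there is a nonzero prime
  ideal of the quotient that preserves the independence of all members except \<open>x j\<close>; its preimage is \<open>P'\<close>.
\<close>

lemma larger_primeideal_dropping_one:
  fixes x :: "nat \<Rightarrow> 'a"
  assumes F: "subfield F R" and P: "primeideal P R" and S: "finite S" "S \<subseteq> carrier R" "carrier R = adjoin R F S"
    and I: "finite I" "j \<in> I" and x: "x \<in> I \<rightarrow> carrier R" and ind: "alg_indep R F P I x"
  shows "\<exists>P' I' (x' :: nat \<Rightarrow> 'a). primeideal P' R \<and> P \<subset> P' \<and> finite I' \<and> card I \<le> Suc (card I') \<and>
    x' \<in> I' \<rightarrow> carrier R \<and> alg_indep R F P' I' x'"
proof -
  have FR: "subring F R" using subfieldE(1)[OF F] .
  interpret P: primeideal P R by (rule P)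
  let ?Q = "R Quot P"
  define h where "h = (+>) P"
  interpret Q: domain ?Q by (rule P.quotient_is_domain)
  interpret h: ring_hom_cring R ?Q h unfolding h_def by (rule P.rcos_ring_hom_cring)
  have hr: "ring_hom_ring R ?Q h" unfolding h_def by (rule P.rcos_ring_hom_ring)
  have surj: "carrier ?Q = h ` carrier R" unfolding h_def FactRing_simps by auto
  have zQ: "\<zero>\<^bsub>?Q\<^esub> = P" by (simp add: FactRing_def)
  have ker: "{r \<in> carrier R. h r \<in> {\<zero>\<^bsub>?Q\<^esub>}} = P"
  proof -
    have "h r = P \<longleftrightarrow> r \<in> P" if "r \<in> carrier R" for r
      unfolding h_def using P.rcos_const_imp_mem[OF that] a_rcos_zero[OF P.is_ideal] by blast
    then show ?thesis unfolding zQ singleton_iff using P.Icarr by blast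
  qed
  have FP: "F \<inter> P = {\<zero>}"
    using subfield_inter_proper_ideal[OF F P.is_ideal] P.I_notcarr by metis
  have hF: "subfield (h ` F) ?Q"
    by (rule ring_hom_ring.img_is_subfield(2)[OF hr F]) (rule Q.one_not_zero)
  have hFR: "subring (h ` F) ?Q" by (rule subfieldE(1)[OF hF])
  obtain s and m :: nat where s: "S = s ` {..<m}"
    using finite_imp_nat_seg_image_inj_on[OF S(1)] by (auto simp: lessThan_def)
  obtain N where N: "\<forall>i\<in>I. i < N" using finite_nat_set_iff_bounded[THEN iffD1, OF I(1)] by blast
  \<comment> \<open>A single sequence listing \<open>x\<close> and, from position \<open>N\<close> on, the generators.\<close>
  define fam where "fam i = (if i < N then x i else s (i - N))" for i
  let ?J0 = "I \<union> {N..<N + m}"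
  have famI: "fam i = x i" if "i \<in> I" for i using that N unfolding fam_def by auto
  have famS: "fam (N + i) = s i" for i unfolding fam_def by simp
  have famc: "fam \<in> ?J0 \<rightarrow> carrier R"
  proof (rule funcsetI)
    fix i assume "i \<in> ?J0"
    then consider "i \<in> I" | k where "i = N + k" "k < m" by (auto simp: le_iff_add)
    then show "fam i \<in> carrier R"
    proof cases
      case 1
      then show ?thesis using x famI by auto
    next
      case 2
      then show ?thesis using famS s S(2) by auto
    qed
  qed
  have "alg_indep R F {r \<in> carrier R. h r \<in> {\<zero>\<^bsub>?Q\<^esub>}} I fam"
    unfolding ker using ind alg_indep_cong[of I fam x] famI x by simp
  then have indI: "alg_indep ?Q (h ` F) {\<zero>\<^bsub>?Q\<^esub>} I (h \<circ> fam)"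
    using famc by (intro h.alg_indep_image FR) auto
  \<comment> \<open>A member of maximal size leaves all generators algebraic over it.\<close>
  define \<J> where "\<J> = {J. I \<subseteq> J \<and> J \<subseteq> ?J0 \<and> alg_indep ?Q (h ` F) {\<zero>\<^bsub>?Q\<^esub>} J (h \<circ> fam)}"
  have "finite \<J>" unfolding \<J>_def by (rule finite_subset[of _ "Pow ?J0"]) (use I in auto)
  moreover have "\<J> \<noteq> {}" unfolding \<J>_def using indI by blast
  ultimately obtain J where J: "J \<in> \<J>" "\<And>K. K \<in> \<J> \<Longrightarrow> card K \<le> card J"
    using weight_max_ex[of \<J> card] by blast
  have J': "I \<subseteq> J" "J \<subseteq> ?J0" "alg_indep ?Q (h ` F) {\<zero>\<^bsub>?Q\<^esub>} J (h \<circ> fam)"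
    using J(1) unfolding \<J>_def by auto
  have finJ: "finite J" using J'(2) I(1) finite_subset by blast
  have hfc: "(h \<circ> fam) i \<in> carrier ?Q" if "i \<in> ?J0" for i
    using h.hom_closed[OF funcset_mem[OF famc that]] by simp
  have hfJ: "h \<circ> fam \<in> J \<rightarrow> carrier ?Q" using J'(2) hfc by (intro funcsetI) blast
  let ?B = "adjoin ?Q (h ` F) ((h \<circ> fam) ` J)"
  have Bs: "subring ?B ?Q" using hfJ subringE(1)[OF hFR] by (intro Q.adjoin_subring) auto
  have alg: "\<not> transcendental_over ?Q ?B a" if a: "a \<in> h ` S" for a
  proof
    assume tr: "transcendental_over ?Q ?B a"
    obtain k where k: "k < m" "a = (h \<circ> fam) (N + k)" using a famS unfolding s by auto
    have ac: "a \<in> carrier ?Q" using a S(2) by auto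
    show False
    proof (cases "N + k \<in> J")
      case True
      then have aB: "a \<in> ?B" using Q.adjoin_incl(2)[of "(h \<circ> fam) ` J" "h ` F"] k by blast
      have "a \<in> lspan ?Q ?B ((\<lambda>r. a [^]\<^bsub>?Q\<^esub> r) ` {..<1::nat})" by (rule Q.pspan_const[OF Bs ac aB]) simp
      then have "\<one>\<^bsub>?Q\<^esub> \<otimes>\<^bsub>?Q\<^esub> a [^]\<^bsub>?Q\<^esub> (1::nat) \<in> lspan ?Q ?B ((\<lambda>r. a [^]\<^bsub>?Q\<^esub> r) ` {..<1::nat})"
        using ac by simp
      then have "\<one>\<^bsub>?Q\<^esub> = \<zero>\<^bsub>?Q\<^esub>"
        using tr subringE(3)[OF Bs] unfolding transcendental_over_def by blast
      then show False using Q.one_not_zero by blast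
    next
      case False
      have "alg_indep ?Q (h ` F) {\<zero>\<^bsub>?Q\<^esub>} (insert (N + k) J) (h \<circ> fam)"
      proof (rule Q.transcendental_imp_alg_indep_insert[OF hFR finJ False _ J'(3)])
        show "h \<circ> fam \<in> insert (N + k) J \<rightarrow> carrier ?Q"
          using J'(2) hfc k by (intro funcsetI) (auto simp del: o_apply)
        show "transcendental_over ?Q ?B ((h \<circ> fam) (N + k))" using tr k by simp
      qed
      then have "insert (N + k) J \<in> \<J>" unfolding \<J>_def using J' k by auto
      then show False using J(2)[of "insert (N + k) J"] finJ False by simp
    qed
  qed
  have Qgen: "carrier ?Q = adjoin ?Q (h ` F) (h ` S)"
  proof -
    have "carrier ?Q = h ` generate_ring R (F \<union> S)" using surj S(3) unfolding adjoin_def by simp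
    also have "\<dots> = generate_ring ?Q (h ` (F \<union> S))"
      using S(2) subringE(1)[OF FR] by (intro ring_hom_ring.hom_generate_ring[OF hr]) auto
    finally show ?thesis unfolding adjoin_def image_Un .
  qed
  have jJ: "j \<in> J" using I(2) J'(1) by blast
  have "\<exists>P2. primeideal P2 ?Q \<and> P2 \<noteq> {\<zero>\<^bsub>?Q\<^esub>} \<and>
      adjoin ?Q (h ` F) ((h \<circ> fam) ` (J - {j})) \<inter> P2 = {\<zero>\<^bsub>?Q\<^esub>}"
    using S(1,2) alg
    by (intro Q.exists_nonzero_primeideal_keeping_alg_indep[OF hFR finJ jJ hfJ J'(3) _ _ Qgen]) auto
  then obtain P2 where P2: "primeideal P2 ?Q" "P2 \<noteq> {\<zero>\<^bsub>?Q\<^esub>}"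
    "adjoin ?Q (h ` F) ((h \<circ> fam) ` (J - {j})) \<inter> P2 = {\<zero>\<^bsub>?Q\<^esub>}" by blast
  interpret P2: primeideal P2 ?Q by (rule P2(1))
  let ?P' = "{r \<in> carrier R. h r \<in> P2}"
  have pr: "primeideal ?P' R" by (rule ring_hom_ring.primeideal_vimage[OF hr is_cring P2(1)])
  have ker0: "h r = \<zero>\<^bsub>?Q\<^esub>" if "r \<in> P" for r using ker that by blast
  then have "P \<subseteq> ?P'" using P2.zero_closed P.Icarr by auto
  moreover have "P \<noteq> ?P'"
  proof -
    obtain q where q: "q \<in> P2" "q \<noteq> \<zero>\<^bsub>?Q\<^esub>" using P2(2) P2.zero_closed by blast
    then obtain r where "r \<in> carrier R" "q = h r" using surj P2.Icarr by blast
    then show ?thesis using q ker0 by auto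
  qed
  ultimately have lt: "P \<subset> ?P'" by blast
  have "alg_indep ?Q (h ` F) {\<zero>\<^bsub>?Q\<^esub>} (J - {j}) (h \<circ> fam)"
    using subringE(1)[OF hFR] by (intro Q.alg_indep_subset[OF J'(3) _ finJ hfJ]) auto
  then have "alg_indep ?Q (h ` F) P2 (J - {j}) (h \<circ> fam)"
    using hfJ finJ by (intro Q.alg_indep_mod[OF _ hFR _ _ P2(3)]) auto
  then have "alg_indep R F ?P' (J - {j}) fam"
  proof (rule h.alg_indep_vimage[OF FR, rotated 2])
    show "fam \<in> J - {j} \<rightarrow> carrier R" using famc J'(2) by auto
    fix c assume "c \<in> F" "h c = \<zero>\<^bsub>?Q\<^esub>"
    then have "c \<in> P" using ker subring_carrier[OF FR] by auto
    then show "c = \<zero>" using FP \<open>c \<in> F\<close> by blast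
  qed
  moreover have "card I \<le> Suc (card (J - {j}))" using card_mono[OF finJ J'(1)] jJ finJ by simp
  moreover have "fam \<in> J - {j} \<rightarrow> carrier R" using famc J'(2) by auto
  ultimately show ?thesis using pr lt finJ by (intro exI[of _ ?P'] exI[of _ "J - {j}"] exI[of _ fam]) auto
qed

lemma alg_indep_imp_primeideal_chain:
  fixes x :: "nat \<Rightarrow> 'a"
  assumes F: "subfield F R" and S: "finite S" "S \<subseteq> carrier R" "carrier R = adjoin R F S"
    and "primeideal P R" "finite I" "l \<le> card I" "x \<in> I \<rightarrow> carrier R" "alg_indep R F P I x"
  shows "\<exists>Q. Q 0 = P \<and> (\<forall>i\<le>l. primeideal (Q i) R) \<and> (\<forall>i<l. Q i \<subset> Q (Suc i))"
  using assms(5-9)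
proof (induct l arbitrary: P I x)
  case 0
  then have "\<forall>i\<le>0::nat. primeideal P R" by blast
  then show ?case by (intro exI[of _ "\<lambda>_. P"] conjI) simp_all
next
  case (Suc l)
  have "I \<noteq> {}" using Suc(4) by (metis card.empty not_less_eq_eq le0)
  then obtain j where j: "j \<in> I" by blast
  obtain P' I' and x' :: "nat \<Rightarrow> 'a" where P': "primeideal P' R" "P \<subset> P'" "finite I'"
    "card I \<le> Suc (card I')" "x' \<in> I' \<rightarrow> carrier R" "alg_indep R F P' I' x'"
    using larger_primeideal_dropping_one[OF F Suc(2) S Suc(3) j Suc(5,6)] by blast
  obtain Q where Q: "Q 0 = P'" "\<And>i. i \<le> l \<Longrightarrow> primeideal (Q i) R" "\<And>i. i < l \<Longrightarrow> Q i \<subset> Q (Suc i)"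
  proof -
    have "l \<le> card I'" using P'(4) Suc(4) by linarith
    from Suc(1)[OF P'(1,3) this P'(5,6)] show ?thesis using that by blast
  qed
  define Q' where "Q' i = (if i = 0 then P else Q (i - 1))" for i
  have "primeideal (Q' i) R" if "i \<le> Suc l" for i
    using that Suc(2) Q(2)[of "i - 1"] unfolding Q'_def by (cases i) simp_all
  moreover have "Q' i \<subset> Q' (Suc i)" if "i < Suc l" for i
    using that P'(2) Q(1) Q(3)[of "i - 1"] unfolding Q'_def by (cases i) simp_all
  moreover have "Q' 0 = P" by (simp add: Q'_def)
  ultimately show ?case by blast
qed

lemma alg_indep_adjoin_no_zero_divisors:
  assumes F: "subfield F R" and "finite I" "x \<in> I \<rightarrow> carrier R" "alg_indep R F {\<zero>} I x"
    "u \<in> adjoin R F (x ` I)" "v \<in> adjoin R F (x ` I)" "u \<otimes> v = \<zero>"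
  shows "u = \<zero> \<or> v = \<zero>"
  using assms(2-7)
proof (induct I arbitrary: u v rule: finite_induct)
  case empty
  have FR: "subring F R" using subfieldE(1)[OF F] .
  have "u \<in> F" "v \<in> F" using empty(3,4) adjoin_empty[OF FR] by simp_all
  then show ?case using subfieldE(5)[OF F] empty(5) by blast
next
  case (insert j I)
  have FR: "subring F R" using subfieldE(1)[OF F] .
  have FC: "F \<subseteq> carrier R" by (rule subringE(1)[OF FR])
  have x: "x \<in> I \<rightarrow> carrier R" "x j \<in> carrier R" using insert(4) by auto
  have xI: "x ` I \<subseteq> carrier R" using x(1) by auto
  have ind: "alg_indep R F {\<zero>} I x"
    by (rule alg_indep_subset[OF insert(5) _ _ insert(4) FC]) (use insert(1) in auto)
  let ?B = "adjoin R F (x ` I)"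
  have "insert j I - {j} = I" using insert(2) by auto
  then have tr: "transcendental_over R ?B (x j)"
    using alg_indep_imp_transcendental[OF FR _ insert(4) _ insert(5), of j] insert(1) by simp
  have eq: "adjoin R F (x ` insert j I) = lspan R ?B (range (\<lambda>r::nat. x j [^] r))"
    using adjoin_insert_eq_lspan[OF FC xI x(2)] by simp
  show ?case
  proof (rule transcendental_no_zero_divisors[OF adjoin_subring[OF FC xI] x(2) tr])
    show "b = \<zero> \<or> c = \<zero>" if "b \<in> ?B" "c \<in> ?B" "b \<otimes> c = \<zero>" for b c
      using insert(3)[OF x(1) ind that] .
  qed (rule insert(6)[unfolded eq] insert(7)[unfolded eq] insert(8))+
qed

text \<open>
  A chain of length \<open>l\<close> yields \<open>l\<close> independent elements by \<open>primeideal_chain_imp_alg_indep\<close>. Conversely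
  the polynomial ring \<open>F[x]\<close> generated by \<open>l\<close> independent elements is a domain, so some prime ideal
  avoids its nonzero elements; from there one climbs \<open>l\<close> steps, losing one element at each.
\<close>

theorem krull_dim_ge_iff_alg_indep_of_size:
  assumes F: "subfield F R" and S: "finite S" "S \<subseteq> carrier R" "carrier R = adjoin R F S"
  shows "enat l \<le> krull_dim R \<longleftrightarrow> alg_indep_of_size R F (carrier R) l"
proof -
  have FR: "subring F R" using subfieldE(1)[OF F] .
  have FC: "F \<subseteq> carrier R" by (rule subringE(1)[OF FR])
  define L where "L = {l. \<exists>P :: nat \<Rightarrow> 'a set. (\<forall>i\<le>l. primeideal (P i) R) \<and> (\<forall>i<l. P i \<subset> P (Suc i))}"
  have kd: "krull_dim R = (SUP l\<in>L. enat l)" unfolding krull_dim_def L_def ..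
  have down: "l \<in> L" if "m \<in> L" "l \<le> m" for l m :: nat
  proof -
    from that(1) obtain P where P: "\<forall>i\<le>m. primeideal (P i) R" "\<forall>i<m. P i \<subset> P (Suc i)"
      unfolding L_def by blast
    have "\<forall>i\<le>l. primeideal (P i) R"
    proof (intro allI impI)
      fix i assume "i \<le> l"
      then have "i \<le> m" using that(2) by simp
      then show "primeideal (P i) R" using P(1) by blast
    qed
    moreover have "\<forall>i<l. P i \<subset> P (Suc i)"
    proof (intro allI impI)
      fix i assume "i < l"
      then have "i < m" using that(2) by simp
      then show "P i \<subset> P (Suc i)" using P(2) by blast
    qed
    ultimately show ?thesis unfolding L_def by blast
  qed
  have ge: "enat l \<le> krull_dim R" if a: "alg_indep_of_size R F (carrier R) l"
  proof -
    from a obtain x :: "nat \<Rightarrow> 'a" and I where x: "finite I" "card I = l" "x \<in> I \<rightarrow> carrier R" "alg_indep R F {\<zero>} I x"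
      unfolding alg_indep_of_size_def by blast
    let ?A = "adjoin R F (x ` I)"
    have xI: "x ` I \<subseteq> carrier R" using x by auto
    have A: "subring ?A R" by (rule adjoin_subring[OF FC xI])
    have "\<exists>P. primeideal P R \<and> {\<zero>} \<subseteq> P \<and> P \<inter> (?A - {\<zero>}) = {}"
    proof (rule exists_primeideal_disjoint[OF zeroideal])
      show "?A - {\<zero>} \<subseteq> carrier R" "\<one> \<in> ?A - {\<zero>}" "{\<zero>} \<inter> (?A - {\<zero>}) = {}"
        using subringE(1,3)[OF A] subfieldE(6)[OF F] by auto
      fix a b assume "a \<in> ?A - {\<zero>}" "b \<in> ?A - {\<zero>}"
      then show "a \<otimes> b \<in> ?A - {\<zero>}"
        using alg_indep_adjoin_no_zero_divisors[OF F x(1,3,4)] subringE(6)[OF A] by blast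
    qed
    then obtain P where P: "primeideal P R" "P \<inter> (?A - {\<zero>}) = {}" by blast
    have "\<zero> \<in> P"
      by (rule additive_subgroup.zero_closed[OF ideal.axioms(1)[OF primeideal.axioms(1)[OF P(1)]]])
    then have "?A \<inter> P = {\<zero>}" using P(2) subringE(2)[OF A] by blast
    then have "alg_indep R F P I x" by (rule alg_indep_mod[OF x(4) FR x(1,3)])
    from alg_indep_imp_primeideal_chain[OF F S P(1) x(1) _ x(3) this, of l] x(2)
    obtain Q where "\<forall>i\<le>l. primeideal (Q i) R" "\<forall>i<l. Q i \<subset> Q (Suc i)" by blast
    then have "l \<in> L" unfolding L_def by blast
    then show ?thesis unfolding kd by (rule SUP_upper)
  qed
  have "alg_indep_of_size R F (carrier R) l" if le: "enat l \<le> krull_dim R"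
  proof -
    have "l \<in> L"
    proof (rule ccontr)
      assume nl: "l \<notin> L"
      show False
      proof (cases l)
        case 0
        have "\<exists>P. primeideal P R \<and> {\<zero>} \<subseteq> P \<and> P \<inter> {\<one>} = {}"
          by (rule exists_primeideal_disjoint[OF zeroideal]) (use subfieldE(6)[OF F] in simp_all)
        then obtain P where "primeideal P R" by blast
        then have "0 \<in> L" unfolding L_def by (intro CollectI exI[of _ "\<lambda>_. P"]) simp
        then show False using nl 0 by simp
      next
        case (Suc k)
        have "m \<le> k" if "m \<in> L" for m using down[OF that, of l] nl Suc by (cases "l \<le> m") auto
        then have "krull_dim R \<le> enat k" unfolding kd by (intro SUP_least) auto
        then have "enat l \<le> enat k" using le order_trans by blast
        then show False using Suc by simp
      qed
    qed
    then obtain P where P: "\<And>i. i \<le> l \<Longrightarrow> primeideal (P i) R" "\<And>i. i < l \<Longrightarrow> P i \<subset> P (Suc i)"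
      unfolding L_def by blast
    have "\<exists>x :: nat \<Rightarrow> 'a. x \<in> {..<l} \<rightarrow> carrier R \<and> alg_indep R F {\<zero>} {..<l} x \<and>
        adjoin R F (x ` {..<l}) \<inter> P 0 = {\<zero>}"
      using P by (intro primeideal_chain_imp_alg_indep[OF F]) auto
    then obtain x :: "nat \<Rightarrow> 'a" where "x \<in> {..<l} \<rightarrow> carrier R" "alg_indep R F {\<zero>} {..<l} x" by blast
    then show ?thesis unfolding alg_indep_of_size_def
      by (intro exI[of _ x] exI[of _ "{..<l}"]) simp
  qed
  with ge show ?thesis by blast
qed

end

section \<open>The tensor square of an algebra\<close>

context cring
begin

lemma carrier_pair_ring: "p \<in> carrier (pair_ring R R) \<longleftrightarrow> Poly_Mapping.keys p \<subseteq> carrier R \<times> carrier R"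
  by (simp add: pair_ring_def)

lemma frag_of_in_pair_ring: "\<lbrakk>a \<in> carrier R; b \<in> carrier R\<rbrakk> \<Longrightarrow> frag_of (a, b) \<in> carrier (pair_ring R R)"
  by (simp add: carrier_pair_ring keys_frag_of)

lemma diff_in_pair_ring:
  "\<lbrakk>p \<in> carrier (pair_ring R R); q \<in> carrier (pair_ring R R)\<rbrakk> \<Longrightarrow> p - q \<in> carrier (pair_ring R R)"
  unfolding carrier_pair_ring using keys_diff[of p q] by blast

lemma zero_in_pair_ring: "0 \<in> carrier (pair_ring R R)"
  by (simp add: carrier_pair_ring)

lemma add_in_pair_ring:
  "\<lbrakk>p \<in> carrier (pair_ring R R); q \<in> carrier (pair_ring R R)\<rbrakk> \<Longrightarrow> p + q \<in> carrier (pair_ring R R)"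
  using diff_in_pair_ring[of p "0 - q"] diff_in_pair_ring[of 0 q] zero_in_pair_ring by simp

lemma pair_ring_induct [consumes 1, case_names zero pair diff]:
  assumes "p \<in> carrier (pair_ring R R)" "Q 0"
    "\<And>a b. \<lbrakk>a \<in> carrier R; b \<in> carrier R\<rbrakk> \<Longrightarrow> Q (frag_of (a, b))"
    "\<And>p q. \<lbrakk>p \<in> carrier (pair_ring R R); q \<in> carrier (pair_ring R R); Q p; Q q\<rbrakk> \<Longrightarrow> Q (p - q)"
  shows "Q p"
proof -
  have "p \<in> carrier (pair_ring R R) \<and> Q p"
    using assms(1)[unfolded carrier_pair_ring]
  proof (induct p rule: frag_induction)
    case (one x)
    then show ?case using assms(3) frag_of_in_pair_ring by (cases x) auto
  qed (use assms(2,4) zero_in_pair_ring diff_in_pair_ring in auto)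
  then show ?thesis ..
qed

text \<open>
  A name for the product, so that its bilinearity can be used without unfolding the ring record.
\<close>

definition pmul :: "('a \<times> 'a \<Rightarrow>\<^sub>0 int) \<Rightarrow> ('a \<times> 'a \<Rightarrow>\<^sub>0 int) \<Rightarrow> ('a \<times> 'a \<Rightarrow>\<^sub>0 int)" where
  "pmul p q = frag_extend (\<lambda>(a, b). frag_extend (\<lambda>(c, d). frag_of (a \<otimes> c, b \<otimes> d)) q) p"

lemma pair_ring_ops:
  "x \<otimes>\<^bsub>pair_ring R R\<^esub> y = pmul x y" "x \<oplus>\<^bsub>pair_ring R R\<^esub> y = x + y"
  "\<zero>\<^bsub>pair_ring R R\<^esub> = 0" "\<one>\<^bsub>pair_ring R R\<^esub> = frag_of (\<one>, \<one>)"
  by (simp_all add: pair_ring_def pmul_def)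

lemma pmul_of: "pmul (frag_of (a, b)) (frag_of (c, d)) = frag_of (a \<otimes> c, b \<otimes> d)"
  by (simp add: pmul_def)

lemma pmul_zero: "pmul 0 q = 0" "pmul p 0 = 0"
  by (simp_all add: pmul_def frag_extend_eq_0 split: prod.splits)

lemma pmul_diff_left: "pmul (p - p') q = pmul p q - pmul p' q"
  by (simp add: pmul_def frag_extend_diff)

lemma pmul_diff_right: "pmul p (q - q') = pmul p q - pmul p q'"
proof -
  have "Poly_Mapping.keys p \<subseteq> UNIV" by simp
  then show ?thesis
  proof (induct p rule: frag_induction)
    case (one x)
    then show ?case by (cases x) (simp add: pmul_def frag_extend_diff)
  next
    case (diff a b)
    then show ?case by (simp add: pmul_diff_left)
  qed (simp add: pmul_zero)
qed

lemma pmul_add_left: "pmul (p + p') q = pmul p q + pmul p' q"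
  using pmul_diff_left[of p "0 - p'" q] pmul_diff_left[of 0 p' q] by (simp add: pmul_zero)

lemma pmul_closed:
  assumes "p \<in> carrier (pair_ring R R)" "q \<in> carrier (pair_ring R R)"
  shows "pmul p q \<in> carrier (pair_ring R R)"
  using assms(1)
proof (induct p rule: pair_ring_induct)
  case (pair a b)
  show ?case using assms(2)
  proof (induct q rule: pair_ring_induct)
    case (pair c d)
    then show ?case using \<open>a \<in> carrier R\<close> \<open>b \<in> carrier R\<close> by (simp add: pmul_of frag_of_in_pair_ring)
  qed (simp_all add: pmul_zero pmul_diff_right zero_in_pair_ring diff_in_pair_ring)
qed (simp_all add: pmul_zero pmul_diff_left zero_in_pair_ring diff_in_pair_ring)

lemma pmul_comm:
  assumes "p \<in> carrier (pair_ring R R)" "q \<in> carrier (pair_ring R R)"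
  shows "pmul p q = pmul q p"
  using assms(1)
proof (induct p rule: pair_ring_induct)
  case (pair a b)
  show ?case using assms(2)
  proof (induct q rule: pair_ring_induct)
    case (pair c d)
    then show ?case using \<open>a \<in> carrier R\<close> \<open>b \<in> carrier R\<close> by (simp add: pmul_of m_comm)
  qed (simp_all add: pmul_zero pmul_diff_right pmul_diff_left)
qed (simp_all add: pmul_zero pmul_diff_left pmul_diff_right)

lemma pmul_assoc:
  assumes "p \<in> carrier (pair_ring R R)" "q \<in> carrier (pair_ring R R)" "r \<in> carrier (pair_ring R R)"
  shows "pmul (pmul p q) r = pmul p (pmul q r)"
  using assms(1)
proof (induct p rule: pair_ring_induct)
  case (pair a b)
  show ?case using assms(2)
  proof (induct q rule: pair_ring_induct)
    case (pair c d)
    show ?case using assms(3)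
    proof (induct r rule: pair_ring_induct)
      case (pair e f)
      then show ?case using \<open>a \<in> carrier R\<close> \<open>b \<in> carrier R\<close> \<open>c \<in> carrier R\<close> \<open>d \<in> carrier R\<close>
        by (simp add: pmul_of m_assoc)
    qed (simp_all add: pmul_zero pmul_diff_right)
  qed (simp_all add: pmul_zero pmul_diff_left pmul_diff_right)
qed (simp_all add: pmul_zero pmul_diff_left)

lemma pmul_one: "p \<in> carrier (pair_ring R R) \<Longrightarrow> pmul (frag_of (\<one>, \<one>)) p = p"
  by (induct p rule: pair_ring_induct) (simp_all add: pmul_zero pmul_diff_right pmul_of)

lemma pair_ring_cring: "cring (pair_ring R R)"
proof (rule cringI)
  show "abelian_group (pair_ring R R)"
  proof (rule abelian_groupI, unfold pair_ring_ops)
    fix p assume "p \<in> carrier (pair_ring R R)"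
    then have "0 - p \<in> carrier (pair_ring R R)" by (intro diff_in_pair_ring zero_in_pair_ring)
    then show "\<exists>q\<in>carrier (pair_ring R R). q + p = 0" by (intro bexI[of _ "0 - p"]) simp_all
  qed (auto intro: add_in_pair_ring zero_in_pair_ring simp: algebra_simps)
  show "Group.comm_monoid (pair_ring R R)"
    by (rule comm_monoidI, unfold pair_ring_ops)
      (auto intro: pmul_closed pmul_assoc pmul_comm pmul_one frag_of_in_pair_ring)
  show "(x \<oplus>\<^bsub>pair_ring R R\<^esub> y) \<otimes>\<^bsub>pair_ring R R\<^esub> z =
      x \<otimes>\<^bsub>pair_ring R R\<^esub> z \<oplus>\<^bsub>pair_ring R R\<^esub> y \<otimes>\<^bsub>pair_ring R R\<^esub> z" for x y z
    unfolding pair_ring_ops by (rule pmul_add_left)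
qed

end

locale tensor_square = cring R for R :: "('r, 'y) ring_scheme" (structure) +
  fixes K :: "('k, 'x) ring_scheme" and \<iota> :: "'k \<Rightarrow> 'r"
  assumes iota_closed: "c \<in> carrier K \<Longrightarrow> \<iota> c \<in> carrier R"
begin

abbreviation "PR \<equiv> pair_ring R R"
abbreviation "TI \<equiv> tensor_ideal K \<iota> R \<iota> R"
abbreviation "TR \<equiv> tensor_ring K \<iota> R \<iota> R"
abbreviation "tens \<equiv> tensor K \<iota> R \<iota> R"

definition rels :: "('r \<times> 'r \<Rightarrow>\<^sub>0 int) set" where
  "rels = {frag_of (a \<oplus> a', b) - frag_of (a, b) - frag_of (a', b) | a a' b.
        a \<in> carrier R \<and> a' \<in> carrier R \<and> b \<in> carrier R} \<union>
     {frag_of (a, b \<oplus> b') - frag_of (a, b) - frag_of (a, b') | a b b'.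
        a \<in> carrier R \<and> b \<in> carrier R \<and> b' \<in> carrier R} \<union>
     {frag_of (\<iota> c \<otimes> a, b) - frag_of (a, \<iota> c \<otimes> b) | a b c.
        a \<in> carrier R \<and> b \<in> carrier R \<and> c \<in> carrier K}"

lemma rels_cases [consumes 1]:
  assumes "x \<in> rels"
  obtains (add_left) a a' b where "a \<in> carrier R" "a' \<in> carrier R" "b \<in> carrier R"
      "x = frag_of (a \<oplus> a', b) - frag_of (a, b) - frag_of (a', b)"
  | (add_right) a b b' where "a \<in> carrier R" "b \<in> carrier R" "b' \<in> carrier R"
      "x = frag_of (a, b \<oplus> b') - frag_of (a, b) - frag_of (a, b')"
  | (scalar) a b c where "a \<in> carrier R" "b \<in> carrier R" "c \<in> carrier K"
      "x = frag_of (\<iota> c \<otimes> a, b) - frag_of (a, \<iota> c \<otimes> b)"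
  using assms unfolding rels_def Un_iff mem_Collect_eq by (elim disjE exE conjE) metis+

lemma rels_closed: "rels \<subseteq> carrier PR"
proof
  fix x assume "x \<in> rels"
  then show "x \<in> carrier PR"
    by (cases rule: rels_cases)
      (simp_all add: diff_in_pair_ring frag_of_in_pair_ring iota_closed)
qed

interpretation PR: cring PR by (rule pair_ring_cring)

lemma TI_eq: "TI = Idl\<^bsub>PR\<^esub> rels"
  unfolding tensor_ideal_def rels_def ..

lemma TI_ideal: "ideal TI PR"
  unfolding TI_eq by (rule PR.genideal_ideal[OF rels_closed])

lemma rels_TI: "rels \<subseteq> TI"
  unfolding TI_eq by (rule PR.genideal_self[OF rels_closed])

interpretation TI: ideal TI PR by (rule TI_ideal)

lemma TR_cring: "cring TR"
  unfolding tensor_ring_def by (rule TI.quotient_is_cring[OF PR.is_cring])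

interpretation TR: cring TR by (rule TR_cring)

definition proj :: "('r \<times> 'r \<Rightarrow>\<^sub>0 int) \<Rightarrow> ('r \<times> 'r \<Rightarrow>\<^sub>0 int) set" where
  "proj p = TI +>\<^bsub>PR\<^esub> p"

lemma proj_hom: "ring_hom_cring PR TR proj"
  using TI.rcos_ring_hom_cring[OF PR.is_cring] unfolding tensor_ring_def proj_def[abs_def] .

interpretation proj: ring_hom_cring PR TR proj by (rule proj_hom)

lemma proj_surj: "carrier TR = proj ` carrier PR"
  unfolding tensor_ring_def FactRing_simps proj_def by auto

lemma proj_zero_iff: "p \<in> carrier PR \<Longrightarrow> proj p = \<zero>\<^bsub>TR\<^esub> \<longleftrightarrow> p \<in> TI"
proof -
  assume p: "p \<in> carrier PR"
  have "\<zero>\<^bsub>TR\<^esub> = TI" by (simp add: tensor_ring_def FactRing_def)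
  then show ?thesis unfolding proj_def
    using TI.rcos_const_imp_mem[OF p] PR.a_rcos_zero[OF TI_ideal] by metis
qed

lemma proj_diff:
  assumes "p \<in> carrier PR" "q \<in> carrier PR"
  shows "proj (p - q) = proj p \<ominus>\<^bsub>TR\<^esub> proj q"
proof -
  have c: "p - q \<in> carrier PR" using assms by (rule diff_in_pair_ring)
  have "proj p = proj ((p - q) \<oplus>\<^bsub>PR\<^esub> q)" by (simp add: pair_ring_ops)
  also have "\<dots> = proj (p - q) \<oplus>\<^bsub>TR\<^esub> proj q" using c assms by (intro proj.hom_add)
  finally have "proj p = proj (p - q) \<oplus>\<^bsub>TR\<^esub> proj q" .
  then show ?thesis using c assms
    by (simp add: a_minus_def TR.a_assoc TR.r_neg)
qed

lemma proj_eq_iff: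
  assumes "p \<in> carrier PR" "q \<in> carrier PR"
  shows "proj p = proj q \<longleftrightarrow> p - q \<in> TI"
proof -
  have c: "p - q \<in> carrier PR" using assms by (rule diff_in_pair_ring)
  have "p - q \<in> TI \<longleftrightarrow> proj p \<ominus>\<^bsub>TR\<^esub> proj q = \<zero>\<^bsub>TR\<^esub>"
    using proj_zero_iff[OF c] proj_diff[OF assms] by simp
  also have "\<dots> \<longleftrightarrow> proj p = proj q" using assms by simp
  finally show ?thesis by blast
qed

lemma proj_zero: "proj 0 = \<zero>\<^bsub>TR\<^esub>"
  using proj.hom_zero by (simp add: pair_ring_ops)

lemma tens_proj: "tens a b = proj (frag_of (a, b))"
  unfolding tensor_def proj_def ..

lemma tens_closed: "\<lbrakk>a \<in> carrier R; b \<in> carrier R\<rbrakk> \<Longrightarrow> tens a b \<in> carrier TR"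
  unfolding tens_proj by (intro proj.hom_closed frag_of_in_pair_ring)

lemma tens_mult:
  assumes "a \<in> carrier R" "b \<in> carrier R" "c \<in> carrier R" "d \<in> carrier R"
  shows "tens a b \<otimes>\<^bsub>TR\<^esub> tens c d = tens (a \<otimes> c) (b \<otimes> d)"
  using proj.hom_mult[of "frag_of (a, b)" "frag_of (c, d)"] assms frag_of_in_pair_ring
  unfolding tens_proj by (simp add: pair_ring_ops pmul_of)

lemma tens_one: "tens \<one> \<one> = \<one>\<^bsub>TR\<^esub>"
  using proj.hom_one unfolding tens_proj by (simp add: pair_ring_ops)

lemma proj_add: "\<lbrakk>p \<in> carrier PR; q \<in> carrier PR\<rbrakk> \<Longrightarrow> proj (p + q) = proj p \<oplus>\<^bsub>TR\<^esub> proj q"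
  using proj.hom_add[of p q] by (simp add: pair_ring_ops)

lemma tens_add_left:
  assumes "a \<in> carrier R" "a' \<in> carrier R" "b \<in> carrier R"
  shows "tens (a \<oplus> a') b = tens a b \<oplus>\<^bsub>TR\<^esub> tens a' b"
proof -
  have "frag_of (a \<oplus> a', b) - frag_of (a, b) - frag_of (a', b) \<in> TI"
    using rels_TI assms unfolding rels_def by blast
  then have "frag_of (a \<oplus> a', b) - (frag_of (a, b) + frag_of (a', b)) \<in> TI"
    by (simp add: diff_diff_eq)
  then show ?thesis unfolding tens_proj
    using assms by (subst proj_add[symmetric]) (auto simp: proj_eq_iff frag_of_in_pair_ring add_in_pair_ring)
qed

lemma tens_add_right:
  assumes "a \<in> carrier R" "b \<in> carrier R" "b' \<in> carrier R"
  shows "tens a (b \<oplus> b') = tens a b \<oplus>\<^bsub>TR\<^esub> tens a b'"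
proof -
  have "frag_of (a, b \<oplus> b') - frag_of (a, b) - frag_of (a, b') \<in> TI"
    using rels_TI assms unfolding rels_def by blast
  then have "frag_of (a, b \<oplus> b') - (frag_of (a, b) + frag_of (a, b')) \<in> TI"
    by (simp add: diff_diff_eq)
  then show ?thesis unfolding tens_proj
    using assms by (subst proj_add[symmetric]) (auto simp: proj_eq_iff frag_of_in_pair_ring add_in_pair_ring)
qed

lemma tens_balanced:
  assumes "a \<in> carrier R" "b \<in> carrier R" "c \<in> carrier K"
  shows "tens (\<iota> c \<otimes> a) b = tens a (\<iota> c \<otimes> b)"
proof -
  have "frag_of (\<iota> c \<otimes> a, b) - frag_of (a, \<iota> c \<otimes> b) \<in> TI"
    using rels_TI assms unfolding rels_def by blast
  then show ?thesis unfolding tens_proj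
    using assms iota_closed by (subst proj_eq_iff) (auto simp: frag_of_in_pair_ring)
qed

definition lt where "lt a = tens a \<one>"
definition rt where "rt b = tens \<one> b"

lemma lt_hom: "lt \<in> ring_hom R TR"
  by (rule ring_hom_memI) (simp_all add: lt_def tens_closed tens_mult tens_add_left tens_one)

lemma rt_hom: "rt \<in> ring_hom R TR"
  by (rule ring_hom_memI) (simp_all add: rt_def tens_closed tens_mult tens_add_right tens_one)

lemma tens_lt_rt: "\<lbrakk>a \<in> carrier R; b \<in> carrier R\<rbrakk> \<Longrightarrow> tens a b = lt a \<otimes>\<^bsub>TR\<^esub> rt b"
  by (simp add: lt_def rt_def tens_mult)

lemma lt_iota: "c \<in> carrier K \<Longrightarrow> lt (\<iota> c) = rt (\<iota> c)"
  using tens_balanced[of \<one> \<one> c] iota_closed by (simp add: lt_def rt_def)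

lemma TR_induct [consumes 1, case_names zero tens diff]:
  assumes "t \<in> carrier TR" "Q \<zero>\<^bsub>TR\<^esub>" "\<And>a b. \<lbrakk>a \<in> carrier R; b \<in> carrier R\<rbrakk> \<Longrightarrow> Q (tens a b)"
    "\<And>s t. \<lbrakk>s \<in> carrier TR; t \<in> carrier TR; Q s; Q t\<rbrakk> \<Longrightarrow> Q (s \<ominus>\<^bsub>TR\<^esub> t)"
  shows "Q t"
proof -
  obtain p where p: "p \<in> carrier PR" "t = proj p" using assms(1) proj_surj by blast
  have "p \<in> carrier PR \<and> Q (proj p)" using p(1)
  proof (induct p rule: pair_ring_induct)
    case zero
    then show ?case using assms(2) by (simp add: proj_zero zero_in_pair_ring)
  next
    case (pair a b)
    then show ?case using assms(3)[OF pair] by (simp add: tens_proj frag_of_in_pair_ring)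
  next
    case (diff p q)
    then show ?case using assms(4)[of "proj p" "proj q"] by (simp add: proj_diff diff_in_pair_ring)
  qed
  then show ?thesis using p by simp
qed

lemma TR_lspan: "carrier TR = lspan TR (lt ` carrier R) (rt ` carrier R)"
proof
  have im: "lt ` carrier R \<subseteq> carrier TR" "rt ` carrier R \<subseteq> carrier TR"
    using ring_hom_closed[OF lt_hom] ring_hom_closed[OF rt_hom] by auto
  show "lspan TR (lt ` carrier R) (rt ` carrier R) \<subseteq> carrier TR" by (rule TR.lspan_carrier[OF im])
  have "ring_hom_ring R TR lt" by (intro ring_hom_ringI2 ring_axioms TR.ring_axioms lt_hom)
  then have sub: "subring (lt ` carrier R) TR"
    by (rule ring_hom_ring.img_is_subring) (rule carrier_is_subring)
  show "carrier TR \<subseteq> lspan TR (lt ` carrier R) (rt ` carrier R)"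
  proof
    fix t assume "t \<in> carrier TR"
    then show "t \<in> lspan TR (lt ` carrier R) (rt ` carrier R)"
    proof (induct t rule: TR_induct)
      case zero
      show ?case by (rule lspan.lspan_zero)
    next
      case (tens a b)
      then show ?case unfolding tens_lt_rt[OF tens] by (intro TR.lspan_smult_base im) auto
    next
      case (diff s t)
      then show ?case unfolding a_minus_def by (intro TR.lspan_add TR.lspan_uminus sub im)
    qed
  qed
qed

text \<open>
  The universal property for balanced biadditive maps. Since \<open>TI\<close> is the ideal generated by the
  relations, it is not enough that the induced map \<open>H\<close> on the free abelian group kills the
  relations. The set \<open>Z\<close> of the proof is the largest ideal contained in the kernel of \<open>H\<close>, and it contains
  the relations because their products with pairs are again relations.
\<close>

lemma additive_map_ex:
  fixes \<beta> :: "'r \<Rightarrow> 'r \<Rightarrow> 'r"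
  assumes cl: "\<And>a b. \<lbrakk>a \<in> carrier R; b \<in> carrier R\<rbrakk> \<Longrightarrow> \<beta> a b \<in> carrier R"
    and left: "\<And>a a' b. \<lbrakk>a \<in> carrier R; a' \<in> carrier R; b \<in> carrier R\<rbrakk> \<Longrightarrow> \<beta> (a \<oplus> a') b = \<beta> a b \<oplus> \<beta> a' b"
    and right: "\<And>a b b'. \<lbrakk>a \<in> carrier R; b \<in> carrier R; b' \<in> carrier R\<rbrakk> \<Longrightarrow> \<beta> a (b \<oplus> b') = \<beta> a b \<oplus> \<beta> a b'"
    and bal: "\<And>a b c. \<lbrakk>a \<in> carrier R; b \<in> carrier R; c \<in> carrier K\<rbrakk> \<Longrightarrow> \<beta> (\<iota> c \<otimes> a) b = \<beta> a (\<iota> c \<otimes> b)"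
  shows "\<exists>f. (\<forall>t\<in>carrier TR. f t \<in> carrier R) \<and>
    (\<forall>s\<in>carrier TR. \<forall>t\<in>carrier TR. f (s \<oplus>\<^bsub>TR\<^esub> t) = f s \<oplus> f t) \<and>
    (\<forall>a\<in>carrier R. \<forall>b\<in>carrier R. f (tens a b) = \<beta> a b)"
proof -
  have im: "case_prod \<beta> ` (carrier R \<times> carrier R) \<subseteq> carrier (add_monoid R)" using cl by auto
  obtain H where H: "H \<in> hom (free_Abelian_group (carrier R \<times> carrier R)) (add_monoid R)"
    "\<And>x. x \<in> carrier R \<times> carrier R \<Longrightarrow> H (frag_of x) = case_prod \<beta> x"
    using comm_group.free_Abelian_group_universal[OF a_comm_group im] by blast
  have carr: "carrier (free_Abelian_group (carrier R \<times> carrier R)) = carrier PR" by (simp add: pair_ring_def)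
  have Hc: "H p \<in> carrier R" if "p \<in> carrier PR" for p
    using hom_in_carrier[OF H(1)] that unfolding carr by simp
  have Hadd: "H (p + q) = H p \<oplus> H q" if "p \<in> carrier PR" "q \<in> carrier PR" for p q
    using hom_mult[OF H(1)] that unfolding carr by simp
  have Hdiff: "H (p - q) = H p \<ominus> H q" if pq: "p \<in> carrier PR" "q \<in> carrier PR" for p q
  proof -
    have c: "p - q \<in> carrier PR" using pq by (rule diff_in_pair_ring)
    have "H p = H (p - q) \<oplus> H q" using Hadd[OF c pq(2)] by simp
    then show ?thesis using Hc c pq by (simp add: a_minus_def a_assoc r_neg)
  qed
  have H0: "H 0 = \<zero>"
  proof -
    have "H (0 - 0) = H 0 \<ominus> H 0" by (intro Hdiff zero_in_pair_ring)
    also have "\<dots> = \<zero>" using Hc[OF zero_in_pair_ring] by (simp add: a_minus_def r_neg)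
    finally show ?thesis by simp
  qed
  have Hof: "H (frag_of (a, b)) = \<beta> a b" if "a \<in> carrier R" "b \<in> carrier R" for a b
    using H(2)[of "(a, b)"] that by simp
  define Z where "Z = {p \<in> carrier PR. \<forall>q\<in>carrier PR. H (pmul p q) = \<zero>}"
  have "ideal Z PR"
  proof (rule idealI)
    show "ring PR" by (rule PR.ring_axioms)
    show "subgroup Z (add_monoid PR)"
    proof (rule PR.add.subgroupI)
      show "Z \<subseteq> carrier PR" unfolding Z_def by blast
      have "0 \<in> Z" unfolding Z_def using H0 zero_in_pair_ring by (simp add: pmul_zero)
      then show "Z \<noteq> {}" by blast
      fix p q assume p: "p \<in> Z" and q: "q \<in> Z"
      show "p \<oplus>\<^bsub>PR\<^esub> q \<in> Z"
        using p q unfolding Z_def pair_ring_ops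
        by (auto simp: pmul_add_left Hadd pmul_closed add_in_pair_ring)
    next
      fix p assume p: "p \<in> Z"
      then have pc: "p \<in> carrier PR" unfolding Z_def by blast
      have "\<ominus>\<^bsub>PR\<^esub> p = 0 - p"
        using diff_in_pair_ring[OF zero_in_pair_ring pc]
        by (intro PR.minus_equality) (simp_all add: pair_ring_ops pc)
      moreover have "0 - p \<in> Z" unfolding Z_def
      proof (intro CollectI conjI ballI)
        show "0 - p \<in> carrier PR" by (intro diff_in_pair_ring zero_in_pair_ring pc)
        fix q assume q: "q \<in> carrier PR"
        have "H (pmul (0 - p) q) = H 0 \<ominus> H (pmul p q)"
          unfolding pmul_diff_left pmul_zero by (intro Hdiff zero_in_pair_ring pmul_closed pc q)
        then show "H (pmul (0 - p) q) = \<zero>" using p q H0 unfolding Z_def by simp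
      qed
      ultimately show "\<ominus>\<^bsub>PR\<^esub> p \<in> Z" by simp
    qed
    fix p x assume p: "p \<in> Z" and x: "x \<in> carrier PR"
    have pc: "p \<in> carrier PR" using p unfolding Z_def by blast
    have "pmul p x \<in> Z" unfolding Z_def
    proof (intro CollectI conjI ballI)
      show "pmul p x \<in> carrier PR" by (rule pmul_closed[OF pc x])
      fix q assume q: "q \<in> carrier PR"
      show "H (pmul (pmul p x) q) = \<zero>"
        unfolding pmul_assoc[OF pc x q] using p pmul_closed[OF x q] unfolding Z_def by blast
    qed
    then show "p \<otimes>\<^bsub>PR\<^esub> x \<in> Z" "x \<otimes>\<^bsub>PR\<^esub> p \<in> Z"
      unfolding pair_ring_ops using pmul_comm[OF x pc] by simp_all
  qed
  moreover have "rels \<subseteq> Z"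
  proof
    fix x assume x: "x \<in> rels"
    have "H (pmul x q) = \<zero>" if q: "q \<in> carrier PR" for q
      using q
    proof (induct q rule: pair_ring_induct)
      case zero
      show ?case by (simp add: pmul_zero H0)
    next
      case (diff p q)
      have "H (pmul x (p - q)) = H (pmul x p) \<ominus> H (pmul x q)"
        unfolding pmul_diff_right using x rels_closed diff(1,2) by (intro Hdiff pmul_closed) auto
      then show ?case using diff(3,4) by simp
    next
      case (pair d e)
      have canc: "(u \<oplus> v) \<ominus> u \<ominus> v = \<zero>" if "u \<in> carrier R" "v \<in> carrier R" for u v
        using that by algebra
      have pr: "H (frag_of (a, b) - frag_of (a', b') - frag_of (a'', b'')) = \<beta> a b \<ominus> \<beta> a' b' \<ominus> \<beta> a'' b''"
        if "a \<in> carrier R" "b \<in> carrier R" "a' \<in> carrier R" "b' \<in> carrier R" "a'' \<in> carrier R" "b'' \<in> carrier R"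
        for a b a' b' a'' b''
        using that by (simp add: Hdiff Hof frag_of_in_pair_ring diff_in_pair_ring)
      show ?case using x
      proof (cases rule: rels_cases)
        case (add_left a a' b)
        have "pmul (frag_of (a \<oplus> a', b) - frag_of (a, b) - frag_of (a', b)) (frag_of (d, e)) =
            frag_of ((a \<oplus> a') \<otimes> d, b \<otimes> e) - frag_of (a \<otimes> d, b \<otimes> e) - frag_of (a' \<otimes> d, b \<otimes> e)"
          by (simp add: pmul_diff_left pmul_of)
        then have "H (pmul x (frag_of (d, e))) =
            (\<beta> (a \<otimes> d) (b \<otimes> e) \<oplus> \<beta> (a' \<otimes> d) (b \<otimes> e)) \<ominus> \<beta> (a \<otimes> d) (b \<otimes> e) \<ominus> \<beta> (a' \<otimes> d) (b \<otimes> e)"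
          using add_left pair left[of "a \<otimes> d" "a' \<otimes> d" "b \<otimes> e"] cl
          by (simp only: pr l_distr m_closed a_closed)
        then show ?thesis using canc cl add_left pair by (simp only: m_closed)
      next
        case (add_right a b b')
        have "pmul (frag_of (a, b \<oplus> b') - frag_of (a, b) - frag_of (a, b')) (frag_of (d, e)) =
            frag_of (a \<otimes> d, (b \<oplus> b') \<otimes> e) - frag_of (a \<otimes> d, b \<otimes> e) - frag_of (a \<otimes> d, b' \<otimes> e)"
          by (simp add: pmul_diff_left pmul_of)
        then have "H (pmul x (frag_of (d, e))) =
            (\<beta> (a \<otimes> d) (b \<otimes> e) \<oplus> \<beta> (a \<otimes> d) (b' \<otimes> e)) \<ominus> \<beta> (a \<otimes> d) (b \<otimes> e) \<ominus> \<beta> (a \<otimes> d) (b' \<otimes> e)"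
          using add_right pair right[of "a \<otimes> d" "b \<otimes> e" "b' \<otimes> e"] cl
          by (simp only: pr l_distr m_closed a_closed)
        then show ?thesis using canc cl add_right pair by (simp only: m_closed)
      next
        case (scalar a b c)
        have "pmul (frag_of (\<iota> c \<otimes> a, b) - frag_of (a, \<iota> c \<otimes> b)) (frag_of (d, e)) =
            frag_of (\<iota> c \<otimes> (a \<otimes> d), b \<otimes> e) - frag_of (a \<otimes> d, \<iota> c \<otimes> (b \<otimes> e))"
          using scalar pair iota_closed by (simp add: pmul_diff_left pmul_of m_assoc)
        then show ?thesis using scalar pair bal[of "a \<otimes> d" "b \<otimes> e" c] cl iota_closed
          by (simp add: Hdiff Hof frag_of_in_pair_ring)
      qed
    qed
    then show "x \<in> Z" unfolding Z_def using x rels_closed by blast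
  qed
  ultimately have "TI \<subseteq> Z" unfolding TI_eq by (rule PR.genideal_minimal)
  have HTI: "H p = \<zero>" if p: "p \<in> TI" for p
  proof -
    have pc: "p \<in> carrier PR" using p TI.Icarr by blast
    have o: "frag_of (\<one>, \<one>) \<in> carrier PR" by (intro frag_of_in_pair_ring) auto
    have "H (pmul p (frag_of (\<one>, \<one>))) = \<zero>" using p o \<open>TI \<subseteq> Z\<close> unfolding Z_def by blast
    then show ?thesis using pmul_comm[OF pc o] pmul_one[OF pc] by simp
  qed
  define f where "f t = H (SOME p. p \<in> carrier PR \<and> proj p = t)" for t
  have f: "f (proj p) = H p" if p: "p \<in> carrier PR" for p
  proof -
    let ?q = "SOME q. q \<in> carrier PR \<and> proj q = proj p"
    have q: "?q \<in> carrier PR \<and> proj ?q = proj p" by (rule someI[of _ p]) (use p in simp)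
    then have "?q - p \<in> TI" using proj_eq_iff p by blast
    then have "H (?q - p) = \<zero>" by (rule HTI)
    then have "H ?q \<ominus> H p = \<zero>" using Hdiff q p by simp
    then show ?thesis unfolding f_def using Hc q p by simp
  qed
  have "f t \<in> carrier R" if "t \<in> carrier TR" for t
    using that f Hc unfolding proj_surj by auto
  moreover have "f (s \<oplus>\<^bsub>TR\<^esub> t) = f s \<oplus> f t" if "s \<in> carrier TR" "t \<in> carrier TR" for s t
  proof -
    obtain p q where pq: "p \<in> carrier PR" "q \<in> carrier PR" "s = proj p" "t = proj q"
      using \<open>s \<in> carrier TR\<close> \<open>t \<in> carrier TR\<close> unfolding proj_surj by blast
    then show ?thesis using f Hadd proj_add[OF pq(1,2)] add_in_pair_ring by metis
  qed
  moreover have "f (tens a b) = \<beta> a b" if "a \<in> carrier R" "b \<in> carrier R" for a b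
    using f Hof that frag_of_in_pair_ring unfolding tens_proj by simp
  ultimately show ?thesis by blast
qed

text \<open>
  The map on the free abelian group induced by \<open>f\<close> preserves the relations, so it sends cosets into
  cosets, and \<open>tensor_endo\<close> selects the only element of the image.
\<close>

lemma tensor_endo_props:
  assumes f: "f \<in> ring_hom R R" and fi: "\<And>c. c \<in> carrier K \<Longrightarrow> \<exists>c'\<in>carrier K. f (\<iota> c) = \<iota> c'"
  shows "tensor_endo K \<iota> R \<iota> R f f \<in> ring_hom TR TR"
    and "\<And>a b. \<lbrakk>a \<in> carrier R; b \<in> carrier R\<rbrakk> \<Longrightarrow> tensor_endo K \<iota> R \<iota> R f f (tens a b) = tens (f a) (f b)"
proof -
  define \<Phi> where "\<Phi> = frag_extend (\<lambda>(a, b). frag_of (f a, f b))"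
  have fc: "f a \<in> carrier R" if "a \<in> carrier R" for a using ring_hom_closed[OF f that] .
  have \<Phi>_of: "\<Phi> (frag_of (a, b)) = frag_of (f a, f b)" for a b by (simp add: \<Phi>_def)
  have \<Phi>_diff: "\<Phi> (p - q) = \<Phi> p - \<Phi> q" for p q by (simp add: \<Phi>_def frag_extend_diff)
  have \<Phi>_add: "\<Phi> (p + q) = \<Phi> p + \<Phi> q" for p q by (simp add: \<Phi>_def frag_extend_add)
  have \<Phi>_zero: "\<Phi> 0 = 0" by (simp add: \<Phi>_def)
  have \<Phi>c: "\<Phi> p \<in> carrier PR" if "p \<in> carrier PR" for p
    using that by (induct p rule: pair_ring_induct)
      (simp_all add: \<Phi>_zero \<Phi>_of \<Phi>_diff fc zero_in_pair_ring frag_of_in_pair_ring diff_in_pair_ring)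
  have \<Phi>_mult: "\<Phi> (pmul p q) = pmul (\<Phi> p) (\<Phi> q)" if p: "p \<in> carrier PR" and q: "q \<in> carrier PR" for p q
    using p
  proof (induct p rule: pair_ring_induct)
    case (pair a b)
    show ?case using q
    proof (induct q rule: pair_ring_induct)
      case (pair c d)
      then show ?case using \<open>a \<in> carrier R\<close> \<open>b \<in> carrier R\<close>
        by (simp add: pmul_of \<Phi>_of ring_hom_mult[OF f])
    qed (simp_all add: pmul_zero \<Phi>_zero \<Phi>_diff pmul_diff_right)
  qed (simp_all add: pmul_zero \<Phi>_zero \<Phi>_diff pmul_diff_left)
  have \<Phi>_hom: "\<Phi> \<in> ring_hom PR PR"
    by (rule ring_hom_memI) (simp_all add: \<Phi>c pair_ring_ops \<Phi>_mult \<Phi>_add \<Phi>_of ring_hom_one[OF f])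
  have "ring_hom_ring PR PR \<Phi>" by (intro ring_hom_ringI2 PR.ring_axioms \<Phi>_hom)
  then have id: "ideal {p \<in> carrier PR. \<Phi> p \<in> TI} PR" by (rule ring_hom_ring.ideal_vimage[OF _ TI_ideal])
  have "rels \<subseteq> {p \<in> carrier PR. \<Phi> p \<in> TI}"
  proof
    fix x assume x: "x \<in> rels"
    have "\<Phi> x \<in> rels" using x
    proof (cases rule: rels_cases)
      case (add_left a a' b)
      then show ?thesis unfolding rels_def add_left(4) \<Phi>_diff \<Phi>_of ring_hom_add[OF f add_left(1,2)] using fc by blast
    next
      case (add_right a b b')
      then show ?thesis unfolding rels_def add_right(4) \<Phi>_diff \<Phi>_of ring_hom_add[OF f add_right(2,3)] using fc by blast
    next
      case (scalar a b c)
      obtain c' where c': "c' \<in> carrier K" "f (\<iota> c) = \<iota> c'" using fi[OF scalar(3)] by blast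
      show ?thesis
        unfolding rels_def scalar(4) \<Phi>_diff \<Phi>_of ring_hom_mult[OF f iota_closed[OF scalar(3)] scalar(1)]
          ring_hom_mult[OF f iota_closed[OF scalar(3)] scalar(2)] c'(2)
        using fc scalar c'(1) by blast
    qed
    then show "x \<in> {p \<in> carrier PR. \<Phi> p \<in> TI}" using x rels_closed rels_TI by blast
  qed
  then have "TI \<subseteq> {p \<in> carrier PR. \<Phi> p \<in> TI}" unfolding TI_eq by (rule PR.genideal_minimal[OF id[unfolded TI_eq]])
  then have \<Phi>_TI: "\<Phi> p \<in> TI" if "p \<in> TI" for p using that by blast
  let ?E = "tensor_endo K \<iota> R \<iota> R f f"
  have E: "?E (proj p) = proj (\<Phi> p)" if p: "p \<in> carrier PR" for p
  proof -
    have "proj (\<Phi> q) = proj (\<Phi> p)" if q: "q \<in> proj p" for q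
    proof -
      obtain i where i: "i \<in> TI" "q = i + p"
        using q unfolding proj_def a_r_coset_def' by (auto simp: pair_ring_ops)
      then have qc: "q \<in> carrier PR" using p TI.Icarr add_in_pair_ring by blast
      have "q - p \<in> TI" using i by simp
      then have "\<Phi> q - \<Phi> p \<in> TI" using \<Phi>_TI[of "q - p"] by (simp add: \<Phi>_diff)
      then show ?thesis using proj_eq_iff[OF \<Phi>c[OF qc] \<Phi>c[OF p]] by blast
    qed
    moreover have "p \<in> proj p" unfolding proj_def by (rule TI.a_rcos_self[OF p])
    ultimately have "(\<lambda>q. proj (\<Phi> q)) ` proj p = {proj (\<Phi> p)}" by blast
    then show ?thesis unfolding tensor_endo_def proj_def[symmetric] \<Phi>_def[symmetric] by simp
  qed
  show "?E \<in> ring_hom TR TR"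
  proof (rule ring_hom_memI)
    show "?E t \<in> carrier TR" if "t \<in> carrier TR" for t
      using that E \<Phi>c unfolding proj_surj by auto
    fix s t assume "s \<in> carrier TR" "t \<in> carrier TR"
    then obtain p q where pq: "p \<in> carrier PR" "q \<in> carrier PR" "s = proj p" "t = proj q"
      unfolding proj_surj by blast
    have st: "s \<otimes>\<^bsub>TR\<^esub> t = proj (pmul p q)" "s \<oplus>\<^bsub>TR\<^esub> t = proj (p + q)"
      using pq proj.hom_mult[OF pq(1,2)] proj_add[OF pq(1,2)] by (simp_all add: pair_ring_ops)
    show "?E (s \<otimes>\<^bsub>TR\<^esub> t) = ?E s \<otimes>\<^bsub>TR\<^esub> ?E t"
      unfolding st using E pq \<Phi>_mult proj.hom_mult[OF \<Phi>c[OF pq(1)] \<Phi>c[OF pq(2)]]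
      by (simp add: pmul_closed pair_ring_ops)
    show "?E (s \<oplus>\<^bsub>TR\<^esub> t) = ?E s \<oplus>\<^bsub>TR\<^esub> ?E t"
      unfolding st using E pq \<Phi>_add proj_add[OF \<Phi>c[OF pq(1)] \<Phi>c[OF pq(2)]]
      by (simp add: add_in_pair_ring)
  next
    have o: "frag_of (\<one>, \<one>) \<in> carrier PR" by (intro frag_of_in_pair_ring) auto
    show "?E \<one>\<^bsub>TR\<^esub> = \<one>\<^bsub>TR\<^esub>"
      unfolding tens_one[symmetric] tens_proj using E[OF o] \<Phi>_of ring_hom_one[OF f] by simp
  qed
  show "?E (tens a b) = tens (f a) (f b)" if "a \<in> carrier R" "b \<in> carrier R" for a b
    unfolding tens_proj using E[OF frag_of_in_pair_ring[OF that]] \<Phi>_of by simp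
qed

end

text \<open>
  Among the subspaces that contain \<open>V\<close> but not \<open>w\<close>, a maximal one is a complement of the line
  through \<open>w\<close>. The functional is the coefficient at \<open>w\<close>.
\<close>

lemma (in cring) linear_functional_ex:
  assumes C: "subfield C R" and V: "V \<subseteq> carrier R" and w: "w \<in> carrier R" "w \<notin> lspan R C V"
  shows "\<exists>f. (\<forall>s\<in>carrier R. f s \<in> C) \<and> (\<forall>s\<in>carrier R. \<forall>t\<in>carrier R. f (s \<oplus> t) = f s \<oplus> f t) \<and>
    (\<forall>c\<in>C. \<forall>s\<in>carrier R. f (c \<otimes> s) = c \<otimes> f s) \<and> f w = \<one> \<and> (\<forall>v\<in>V. f v = \<zero>)"
proof -
  have CR: "subring C R" using subfieldE(1)[OF C] .
  note CE = subringE[OF CR]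
  define A where "A = {M. M \<subseteq> carrier R \<and> V \<subseteq> M \<and> lspan R C M = M \<and> w \<notin> M}"
  have clos: "lspan R C (lspan R C U) = lspan R C U" if "U \<subseteq> carrier R" for U
  proof
    show "lspan R C (lspan R C U) \<subseteq> lspan R C U" by (rule lspan_least[OF subset_refl CR that])
    show "lspan R C U \<subseteq> lspan R C (lspan R C U)"
      using lspan_base[OF CR _ lspan_carrier[OF CE(1) that]] by blast
  qed
  have "\<exists>M\<in>A. \<forall>N\<in>A. M \<subseteq> N \<longrightarrow> N = M"
  proof (rule subset_Zorn_nonempty)
    have "V \<subseteq> lspan R C V" using lspan_base[OF CR _ V] by blast
    then have "lspan R C V \<in> A" unfolding A_def using clos[OF V] lspan_carrier[OF CE(1) V] w by simp
    then show "A \<noteq> {}" by blast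
    fix D assume D: "D \<noteq> {}" "subset.chain A D"
    have DA: "D \<subseteq> A" and lin: "\<And>J L. \<lbrakk>J \<in> D; L \<in> D\<rbrakk> \<Longrightarrow> J \<subseteq> L \<or> L \<subseteq> J"
      using D(2) unfolding subset.chain_def by auto
    have mem: "M \<subseteq> carrier R" "V \<subseteq> M" "lspan R C M = M" "w \<notin> M" if "M \<in> D" for M
      using DA that unfolding A_def by auto
    have UD: "\<Union>D \<subseteq> carrier R" using mem(1) by blast
    have "lspan R C (\<Union>D) \<subseteq> \<Union>D"
    proof
      fix v assume "v \<in> lspan R C (\<Union>D)"
      then show "v \<in> \<Union>D"
      proof induct
        case lspan_zero
        obtain M where "M \<in> D" using D(1) by blast
        then show ?case using mem(3) lspan.lspan_zero[of R C M] by blast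
      next
        case (lspan_step c u v)
        then obtain J L where JL: "J \<in> D" "u \<in> J" "L \<in> D" "v \<in> L" by blast
        then obtain M where M: "M \<in> D" "u \<in> M" "v \<in> M" using lin[OF JL(1,3)] by blast
        have "c \<otimes> u \<oplus> v \<in> lspan R C M"
          using lspan_step(1) M(2,3) mem(3)[OF M(1)] by (intro lspan.lspan_step) auto
        then show ?case using mem(3)[OF M(1)] M(1) by blast
      qed
    qed
    moreover have "\<Union>D \<subseteq> lspan R C (\<Union>D)" using lspan_base[OF CR _ UD] by blast
    ultimately have "lspan R C (\<Union>D) = \<Union>D" by blast
    moreover have "V \<subseteq> \<Union>D" using D(1) mem(2) by blast
    moreover have "w \<notin> \<Union>D" using mem(4) by blast
    ultimately show "\<Union>D \<in> A" unfolding A_def using UD by simp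
  qed
  then obtain M where MA: "M \<in> A" and max: "\<And>N. \<lbrakk>N \<in> A; M \<subseteq> N\<rbrakk> \<Longrightarrow> N = M" by blast
  have M: "M \<subseteq> carrier R" "V \<subseteq> M" "lspan R C M = M" "w \<notin> M" using MA unfolding A_def by auto
  have Mz: "\<zero> \<in> M" using lspan.lspan_zero[of R C M] M(3) by simp
  have Madd: "u \<oplus> v \<in> M" if "u \<in> M" "v \<in> M" for u v
    using lspan_add[of u C M v] that M CE(1) by simp
  have Msm: "c \<otimes> u \<in> M" if "c \<in> C" "u \<in> M" for c u
    using lspan_smult[of u C M c] that M CR by simp
  have Muni: "\<ominus> u \<in> M" if "u \<in> M" for u
    using lspan_uminus[of u C M] that M CR by simp
  have ex: "\<exists>c\<in>C. \<exists>m\<in>M. s = c \<otimes> w \<oplus> m" if s: "s \<in> carrier R" for s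
  proof (cases "s \<in> M")
    case True
    have "s = \<zero> \<otimes> w \<oplus> s" using s w by simp
    then show ?thesis using True CE(2) by blast
  next
    case False
    have iM: "insert s M \<subseteq> carrier R" using s M by blast
    have "w \<in> lspan R C (insert s M)"
    proof (rule ccontr)
      assume "w \<notin> lspan R C (insert s M)"
      moreover have sub: "insert s M \<subseteq> lspan R C (insert s M)" using lspan_base[OF CR _ iM] by blast
      ultimately have "lspan R C (insert s M) \<in> A"
        unfolding A_def using clos[OF iM] lspan_carrier[OF CE(1) iM] M(2) by blast
      then have "lspan R C (insert s M) = M" using max sub by blast
      then show False using sub False by blast
    qed
    then obtain c m where c: "c \<in> C" "m \<in> lspan R C M" "w = c \<otimes> s \<oplus> m"
      using lspan_insert[OF _ CR s M(1)] by blast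
    have m: "m \<in> M" "m \<in> carrier R" using c M by auto
    have "c \<noteq> \<zero>"
    proof
      assume "c = \<zero>"
      then have "w = m" using c s m by simp
      then show False using m M(4) by blast
    qed
    then have c': "c \<in> C - {\<zero>}" using c by blast
    obtain d where d: "d \<in> C" "d \<otimes> c = \<one>" using subfield_m_inv(1,3)[OF C c'] by blast
    have cc: "c \<in> carrier R" "d \<in> carrier R" using c d CE(1) by auto
    have "d \<otimes> w \<oplus> \<ominus> (d \<otimes> m) = (d \<otimes> c) \<otimes> s" unfolding c(3) using cc s m(2) by algebra
    then have "s = d \<otimes> w \<oplus> \<ominus> (d \<otimes> m)" using d s by simp
    then show ?thesis using d Muni Msm m by blast
  qed
  have uniq: "c = c'" if c: "c \<in> C" "c' \<in> C" "m \<in> M" "m' \<in> M" "c \<otimes> w \<oplus> m = c' \<otimes> w \<oplus> m'" for c c' m m'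
  proof (rule ccontr)
    assume ne: "c \<noteq> c'"
    have cl: "c \<in> carrier R" "c' \<in> carrier R" "m \<in> carrier R" "m' \<in> carrier R" using c M CE(1) by auto
    have nz: "c \<ominus> c' \<in> C - {\<zero>}"
      using c(1,2) ne cl CE(5,7) by (simp add: a_minus_def[symmetric]) (simp add: a_minus_def CE(5,7))
    obtain d where d: "d \<in> C" "d \<otimes> (c \<ominus> c') = \<one>" using subfield_m_inv(1,3)[OF C nz] by blast
    have dc: "d \<in> carrier R" using d CE(1) by auto
    have "(c \<ominus> c') \<otimes> w = (c \<otimes> w \<oplus> m) \<ominus> c' \<otimes> w \<ominus> m" using cl w by algebra
    also have "\<dots> = m' \<oplus> \<ominus> m" unfolding c(5) using cl w by algebra
    finally have "d \<otimes> ((c \<ominus> c') \<otimes> w) \<in> M" using Msm d Madd Muni c by metis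
    moreover have "d \<otimes> ((c \<ominus> c') \<otimes> w) = (d \<otimes> (c \<ominus> c')) \<otimes> w" using dc cl w by (simp add: m_assoc)
    ultimately show False using d(2) w M(4) by simp
  qed
  define f where "f s = (THE c. c \<in> C \<and> (\<exists>m\<in>M. s = c \<otimes> w \<oplus> m))" for s
  have f: "f s = c" if "c \<in> C" "m \<in> M" "s = c \<otimes> w \<oplus> m" for s c m
    unfolding f_def
  proof (rule the_equality)
    show "c \<in> C \<and> (\<exists>m\<in>M. s = c \<otimes> w \<oplus> m)" using that by blast
    fix c' assume "c' \<in> C \<and> (\<exists>m\<in>M. s = c' \<otimes> w \<oplus> m)"
    then obtain m' where "c' \<in> C" "m' \<in> M" "s = c' \<otimes> w \<oplus> m'" by blast
    then show "c' = c" using uniq[of c' c m' m] that by simp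
  qed
  have dec: "\<exists>m\<in>M. f s \<in> C \<and> s = f s \<otimes> w \<oplus> m" if "s \<in> carrier R" for s
  proof -
    obtain c m where "c \<in> C" "m \<in> M" "s = c \<otimes> w \<oplus> m" using ex[OF \<open>s \<in> carrier R\<close>] by blast
    moreover from this have "f s = c" by (rule f)
    ultimately show ?thesis by (intro bexI[of _ m]) simp_all
  qed
  have "f (s \<oplus> t) = f s \<oplus> f t" if "s \<in> carrier R" "t \<in> carrier R" for s t
  proof -
    obtain m where m: "m \<in> M" "f s \<in> C" "s = f s \<otimes> w \<oplus> m" using dec \<open>s \<in> carrier R\<close> by blast
    obtain m' where m': "m' \<in> M" "f t \<in> C" "t = f t \<otimes> w \<oplus> m'" using dec \<open>t \<in> carrier R\<close> by blast
    have cl: "f s \<in> carrier R" "f t \<in> carrier R" "m \<in> carrier R" "m' \<in> carrier R" using m m' M CE(1) by auto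
    have gen: "(a \<otimes> w \<oplus> m) \<oplus> (b \<otimes> w \<oplus> m') = (a \<oplus> b) \<otimes> w \<oplus> (m \<oplus> m')"
      if "a \<in> carrier R" "b \<in> carrier R" for a b
      using that cl(3,4) w by algebra
    have "s \<oplus> t = (f s \<oplus> f t) \<otimes> w \<oplus> (m \<oplus> m')" using gen[OF cl(1,2)] m(3) m'(3) by metis
    then show ?thesis using f[of "f s \<oplus> f t" "m \<oplus> m'"] m m' Madd CE(7) by blast
  qed
  moreover have "f (c \<otimes> s) = c \<otimes> f s" if "c \<in> C" "s \<in> carrier R" for c s
  proof -
    obtain m where m: "m \<in> M" "f s \<in> C" "s = f s \<otimes> w \<oplus> m" using dec \<open>s \<in> carrier R\<close> by blast
    have cl: "f s \<in> carrier R" "m \<in> carrier R" "c \<in> carrier R" using m M CE(1) that by auto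
    have gen: "c \<otimes> (a \<otimes> w \<oplus> m) = (c \<otimes> a) \<otimes> w \<oplus> c \<otimes> m" if "a \<in> carrier R" for a
      using that cl(2,3) w by algebra
    have "c \<otimes> s = (c \<otimes> f s) \<otimes> w \<oplus> c \<otimes> m" using gen[OF cl(1)] m(3) by metis
    then show ?thesis using f[of "c \<otimes> f s" "c \<otimes> m"] m Msm \<open>c \<in> C\<close> CE(6) by blast
  qed
  moreover have "f w = \<one>" using w by (intro f[of \<one> \<zero>] CE(3) Mz) simp
  moreover have "f v = \<zero>" if "v \<in> V" for v
  proof (rule f[of \<zero> v])
    show "v = \<zero> \<otimes> w \<oplus> v" using w V that by auto
  qed (use that M CE(2) in auto)
  ultimately show ?thesis using dec by blast
qed

lemma (in cring) lin_indep_not_in_lspan: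
  assumes C: "subring C R" "\<one> \<noteq> \<zero>" and y: "y \<in> I \<rightarrow> carrier R" and ind: "lin_indep R C {\<zero>} I y"
    and W: "finite W" "W \<subseteq> I" "i \<in> I" "i \<notin> W"
  shows "y i \<notin> lspan R C (y ` W)"
proof
  assume h: "y i \<in> lspan R C (y ` W)"
  note CE = subringE[OF C(1)]
  have yW: "y ` W \<subseteq> carrier R" using y W by auto
  obtain c where c: "c \<in> W \<rightarrow> C" "y i = (\<Oplus>j\<in>W. c j \<otimes> y j)"
    using lspan_family[OF h W(1) C(1) yW] by blast
  have cc: "c j \<in> carrier R" if "j \<in> W" for j using funcset_mem[OF c(1) that] CE(1) by auto
  have yc: "y j \<in> carrier R" if "j \<in> I" for j using funcset_mem[OF y that] .
  define d where "d j = (if j = i then \<ominus> \<one> else c j)" for j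
  have dF: "d \<in> insert i W \<rightarrow> C"
  proof (rule funcsetI)
    fix j assume "j \<in> insert i W"
    then show "d j \<in> C" unfolding d_def using funcset_mem[OF c(1)] CE(3,5) by auto
  qed
  have "(\<Oplus>j\<in>insert i W. d j \<otimes> y j) = d i \<otimes> y i \<oplus> (\<Oplus>j\<in>W. d j \<otimes> y j)"
    using W cc yc by (intro finsum_insert) (auto simp: d_def)
  also have "(\<Oplus>j\<in>W. d j \<otimes> y j) = (\<Oplus>j\<in>W. c j \<otimes> y j)"
    using W cc yc by (intro finsum_cong') (auto simp: d_def)
  also have "d i \<otimes> y i \<oplus> (\<Oplus>j\<in>W. c j \<otimes> y j) = \<zero>"
    using yc[OF W(3)] unfolding c(2)[symmetric] by (simp add: d_def l_minus l_neg)
  finally have "d i = \<zero>"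
    using lin_indepD[OF ind _ _ dF, of i] W by auto
  then have "\<one> = \<zero>" by (metis d_def minus_minus minus_zero one_closed)
  then show False using C(2) by blast
qed

context tensor_square
begin

text \<open>
  Let \<open>g\<close> be a \<open>K\<close>-linear functional on \<open>R\<close> with value \<open>\<one>\<close> at \<open>y i\<close> and \<open>\<zero>\<close> at the other \<open>y j\<close>. The
  map \<open>id \<otimes> g\<close> takes the given relation to \<open>a i\<close>.
\<close>

lemma rt_lin_indep:
  assumes C: "subfield (\<iota> ` carrier K) R" and y: "y \<in> I \<rightarrow> carrier R"
    and ind: "lin_indep R (\<iota> ` carrier K) {\<zero>} I y"
    and W: "finite W" "W \<subseteq> I" and a: "a \<in> W \<rightarrow> carrier R"
    and rel: "(\<Oplus>\<^bsub>TR\<^esub>i\<in>W. lt (a i) \<otimes>\<^bsub>TR\<^esub> rt (y i)) = \<zero>\<^bsub>TR\<^esub>" and i: "i \<in> W"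
  shows "a i = \<zero>"
proof -
  have CR: "subring (\<iota> ` carrier K) R" using subfieldE(1)[OF C] .
  interpret T: cring TR by (rule TR_cring)
  have yc: "y j \<in> carrier R" if "j \<in> W" for j using funcset_mem[OF y] W that by blast
  have ac: "a j \<in> carrier R" if "j \<in> W" for j using funcset_mem[OF a that] .
  have "y i \<notin> lspan R (\<iota> ` carrier K) (y ` (W - {i}))"
    by (rule lin_indep_not_in_lspan[OF CR _ y ind]) (use subfieldE(6)[OF C] W i in auto)
  moreover have "y ` (W - {i}) \<subseteq> carrier R" using yc by auto
  ultimately obtain g where g: "\<And>s. s \<in> carrier R \<Longrightarrow> g s \<in> \<iota> ` carrier K"
    "\<And>s t. \<lbrakk>s \<in> carrier R; t \<in> carrier R\<rbrakk> \<Longrightarrow> g (s \<oplus> t) = g s \<oplus> g t"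
    "\<And>c s. \<lbrakk>c \<in> \<iota> ` carrier K; s \<in> carrier R\<rbrakk> \<Longrightarrow> g (c \<otimes> s) = c \<otimes> g s"
    "g (y i) = \<one>" "\<And>v. v \<in> y ` (W - {i}) \<Longrightarrow> g v = \<zero>"
    using linear_functional_ex[OF C _ yc[OF i]] by (metis (no_types, lifting))
  have gc: "g s \<in> carrier R" if "s \<in> carrier R" for s using g(1)[OF that] iota_closed by auto
  have "\<exists>f. (\<forall>t\<in>carrier TR. f t \<in> carrier R) \<and>
    (\<forall>s\<in>carrier TR. \<forall>t\<in>carrier TR. f (s \<oplus>\<^bsub>TR\<^esub> t) = f s \<oplus> f t) \<and>
    (\<forall>a\<in>carrier R. \<forall>b\<in>carrier R. f (tens a b) = a \<otimes> g b)"
  proof (rule additive_map_ex)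
    fix a b c assume "a \<in> carrier R" "b \<in> carrier R" "c \<in> carrier K"
    then show "\<iota> c \<otimes> a \<otimes> g b = a \<otimes> g (\<iota> c \<otimes> b)"
      using g(3)[of "\<iota> c" b] gc iota_closed by (simp add: m_assoc m_lcomm)
  qed (use gc g(2) in \<open>simp_all add: l_distr r_distr\<close>)
  then obtain f where f: "\<And>t. t \<in> carrier TR \<Longrightarrow> f t \<in> carrier R"
    "\<And>s t. \<lbrakk>s \<in> carrier TR; t \<in> carrier TR\<rbrakk> \<Longrightarrow> f (s \<oplus>\<^bsub>TR\<^esub> t) = f s \<oplus> f t"
    "\<And>a b. \<lbrakk>a \<in> carrier R; b \<in> carrier R\<rbrakk> \<Longrightarrow> f (tens a b) = a \<otimes> g b" by blast
  have f0: "f \<zero>\<^bsub>TR\<^esub> = \<zero>"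
  proof -
    have "f \<zero>\<^bsub>TR\<^esub> \<oplus> f \<zero>\<^bsub>TR\<^esub> = f \<zero>\<^bsub>TR\<^esub>" using f(2)[of "\<zero>\<^bsub>TR\<^esub>" "\<zero>\<^bsub>TR\<^esub>"] by simp
    then show ?thesis using f(1)[OF T.zero_closed] by (metis add.l_cancel_one)
  qed
  have tc: "lt (a j) \<otimes>\<^bsub>TR\<^esub> rt (y j) = tens (a j) (y j)" if "j \<in> W" for j
    using tens_lt_rt ac yc that by simp
  have tcc: "tens (a j) (y j) \<in> carrier TR" if "j \<in> W" for j using tens_closed ac yc that by simp
  have "f (\<Oplus>\<^bsub>TR\<^esub>j\<in>W'. tens (a j) (y j)) = (\<Oplus>j\<in>W'. a j \<otimes> g (y j))" if "W' \<subseteq> W" for W'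
    using finite_subset[OF that W(1)] that
  proof (induct W' rule: finite_induct)
    case empty
    then show ?case using f0 by simp
  next
    case (insert j W')
    have "(\<Oplus>\<^bsub>TR\<^esub>j\<in>insert j W'. tens (a j) (y j)) = tens (a j) (y j) \<oplus>\<^bsub>TR\<^esub> (\<Oplus>\<^bsub>TR\<^esub>j\<in>W'. tens (a j) (y j))"
      using insert tcc by (intro T.finsum_insert) auto
    moreover have "(\<Oplus>\<^bsub>TR\<^esub>j\<in>W'. tens (a j) (y j)) \<in> carrier TR"
      using insert tcc by (intro T.finsum_closed) auto
    moreover have "(\<Oplus>j\<in>insert j W'. a j \<otimes> g (y j)) = a j \<otimes> g (y j) \<oplus> (\<Oplus>j\<in>W'. a j \<otimes> g (y j))"
      using insert ac yc gc by (intro finsum_insert) auto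
    ultimately show ?case using insert f(2,3) tcc ac yc by simp
  qed
  from this[OF subset_refl] have "f (\<Oplus>\<^bsub>TR\<^esub>j\<in>W. tens (a j) (y j)) = (\<Oplus>j\<in>W. a j \<otimes> g (y j))" .
  also have "\<dots> = (\<Oplus>j\<in>W. if j = i then a j else \<zero>)"
    using g(4,5) ac by (intro finsum_cong') auto
  also have "\<dots> = a i" using W i ac by (intro add.finprod_singleton_swap) auto
  finally have "f (\<Oplus>\<^bsub>TR\<^esub>j\<in>W. tens (a j) (y j)) = a i" .
  moreover have "(\<Oplus>\<^bsub>TR\<^esub>j\<in>W. tens (a j) (y j)) = (\<Oplus>\<^bsub>TR\<^esub>i\<in>W. lt (a i) \<otimes>\<^bsub>TR\<^esub> rt (y i))"
    using tc tcc by (intro T.finsum_cong') auto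
  ultimately show ?thesis using rel f0 by simp
qed

lemma lt_inj:
  assumes C: "subfield (\<iota> ` carrier K) R" and a: "a \<in> carrier R" "lt a = \<zero>\<^bsub>TR\<^esub>"
  shows "a = \<zero>"
proof -
  interpret T: cring TR by (rule TR_cring)
  have "lin_indep R (\<iota> ` carrier K) {\<zero>} {0::nat} (\<lambda>_. \<one>)"
    unfolding lin_indep_def
  proof (intro allI impI, elim conjE)
    fix W c assume h: "W \<subseteq> {0::nat}" "c \<in> W \<rightarrow> \<iota> ` carrier K" "(\<Oplus>i\<in>W. c i \<otimes> \<one>) \<in> {\<zero>}"
    have cc: "c i \<in> carrier R" if "i \<in> W" for i using funcset_mem[OF h(2) that] iota_closed by auto
    have "W = {} \<or> W = {0}" using h(1) by blast
    then show "\<forall>i\<in>W. c i = \<zero>" using h(3) cc by auto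
  qed
  moreover have "rt \<one> = \<one>\<^bsub>TR\<^esub>" by (rule ring_hom_one[OF rt_hom])
  ultimately show ?thesis
    using rt_lin_indep[OF C, of "\<lambda>_. \<one>" "{0::nat}" "{0}" "\<lambda>_. a" 0] a ring_hom_closed[OF lt_hom a(1)]
    by simp
qed

end

section \<open>Determinants over a commutative ring\<close>

context cring
begin

lemma finsum_insert_closed:
  assumes "finite A" "a \<notin> A" "\<And>x. x \<in> insert a A \<Longrightarrow> f x \<in> carrier R"
  shows "finsum R f (insert a A) = f a \<oplus> finsum R f A"
  using assms by (intro finsum_insert) auto

lemma finsum_mem: "(\<And>x. x \<in> A \<Longrightarrow> f x \<in> carrier R) \<Longrightarrow> finsum R f A \<in> carrier R"
  by (intro finsum_closed) auto

lemma finprod_mem: "(\<And>x. x \<in> A \<Longrightarrow> f x \<in> carrier R) \<Longrightarrow> finprod R f A \<in> carrier R"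
  by (intro finprod_closed) auto

lemma finsum_eqI:
  "(\<And>x. x \<in> A \<Longrightarrow> f x = g x) \<Longrightarrow> (\<And>x. x \<in> A \<Longrightarrow> g x \<in> carrier R) \<Longrightarrow> finsum R f A = finsum R g A"
  by (intro finsum_cong') auto

lemma finprod_eqI:
  "(\<And>x. x \<in> A \<Longrightarrow> f x = g x) \<Longrightarrow> (\<And>x. x \<in> A \<Longrightarrow> g x \<in> carrier R) \<Longrightarrow> finprod R f A = finprod R g A"
  by (intro finprod_cong') auto

lemma finsum_Sigma_pair:
  assumes "finite A" "finite B" "\<And>a b. \<lbrakk>a \<in> A; b \<in> B\<rbrakk> \<Longrightarrow> f a b \<in> carrier R"
  shows "(\<Oplus>a\<in>A. \<Oplus>b\<in>B. f a b) = (\<Oplus>x\<in>A \<times> B. f (fst x) (snd x))"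
  using assms(1,3)
proof (induct A rule: finite_induct)
  case (insert a A)
  have "insert a A \<times> B = Pair a ` B \<union> A \<times> B" by auto
  then have "(\<Oplus>x\<in>insert a A \<times> B. f (fst x) (snd x)) =
      (\<Oplus>x\<in>Pair a ` B. f (fst x) (snd x)) \<oplus> (\<Oplus>x\<in>A \<times> B. f (fst x) (snd x))"
    using insert assms(2) by (simp only:, intro finsum_Un_disjoint) auto
  also have "(\<Oplus>x\<in>Pair a ` B. f (fst x) (snd x)) = (\<Oplus>b\<in>B. f a b)"
    using insert by (subst finsum_reindex) (auto simp: inj_on_def)
  also have "(\<Oplus>x\<in>A \<times> B. f (fst x) (snd x)) = (\<Oplus>a\<in>A. \<Oplus>b\<in>B. f a b)" using insert by simp
  also have "(\<Oplus>b\<in>B. f a b) \<oplus> (\<Oplus>a\<in>A. \<Oplus>b\<in>B. f a b) = (\<Oplus>a\<in>insert a A. \<Oplus>b\<in>B. f a b)"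
    using insert by (intro finsum_insert_closed[symmetric]) (auto intro!: finsum_mem)
  finally show ?case ..
qed simp

lemma finsum_swap:
  assumes "finite A" "finite B" "\<And>a b. \<lbrakk>a \<in> A; b \<in> B\<rbrakk> \<Longrightarrow> f a b \<in> carrier R"
  shows "(\<Oplus>a\<in>A. \<Oplus>b\<in>B. f a b) = (\<Oplus>b\<in>B. \<Oplus>a\<in>A. f a b)"
  using assms(1,3)
proof (induct A rule: finite_induct)
  case empty
  then show ?case by (simp add: add.finprod_one_eqI)
next
  case (insert a A)
  have "(\<Oplus>a\<in>insert a A. \<Oplus>b\<in>B. f a b) = (\<Oplus>b\<in>B. f a b) \<oplus> (\<Oplus>a\<in>A. \<Oplus>b\<in>B. f a b)"
    using insert by (intro finsum_insert_closed) (auto intro!: finsum_mem)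
  also have "\<dots> = (\<Oplus>b\<in>B. f a b) \<oplus> (\<Oplus>b\<in>B. \<Oplus>a\<in>A. f a b)" using insert by simp
  also have "\<dots> = (\<Oplus>b\<in>B. f a b \<oplus> (\<Oplus>a\<in>A. f a b))"
    using insert by (intro finsum_addf[symmetric]) (auto intro!: finsum_mem)
  also have "\<dots> = (\<Oplus>b\<in>B. \<Oplus>a\<in>insert a A. f a b)"
    using insert by (intro finsum_eqI) (auto simp: finsum_insert_closed intro!: finsum_mem)
  finally show ?case .
qed

lemma finprod_finsum_distrib:
  fixes f :: "'i \<Rightarrow> 'j \<Rightarrow> 'a"
  assumes "finite I" "finite L" "\<And>i l. \<lbrakk>i \<in> I; l \<in> L\<rbrakk> \<Longrightarrow> f i l \<in> carrier R"
  shows "(\<Otimes>i\<in>I. \<Oplus>l\<in>L. f i l) = (\<Oplus>g\<in>PiE I (\<lambda>_. L). \<Otimes>i\<in>I. f i (g i))"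
  using assms(1,3)
proof (induct I rule: finite_induct)
  case empty
  then show ?case by simp
next
  case (insert k I)
  have fin: "finite (PiE I (\<lambda>_. L))" using insert(1) assms(2) by (intro finite_PiE) auto
  let ?h = "\<lambda>(l, g). g(k := l)"
  have inj: "inj_on ?h (L \<times> PiE I (\<lambda>_. L))"
  proof (rule inj_onI, clarsimp)
    fix l g l' g' assume h: "g \<in> PiE I (\<lambda>_. L)" "g' \<in> PiE I (\<lambda>_. L)" "g(k := l) = g'(k := l')"
    have "l = l'" using fun_cong[OF h(3), of k] by simp
    moreover have "g i = g' i" for i
    proof (cases "i = k")
      case True
      then show ?thesis using h(1,2) insert(2) by (auto simp: PiE_def extensional_def)
    next
      case False
      then show ?thesis using fun_cong[OF h(3), of i] by simp
    qed
    ultimately show "l = l' \<and> g = g'" by auto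
  qed
  have im: "?h ` (L \<times> PiE I (\<lambda>_. L)) = PiE (insert k I) (\<lambda>_. L)"
    by (simp add: PiE_insert_eq)
  have fc: "f i l \<in> carrier R" if "i \<in> insert k I" "l \<in> L" for i l using insert(4) that by blast
  have gm: "g i \<in> L" if "g \<in> PiE I (\<lambda>_. L)" "i \<in> I" for g i using that by auto
  have pc: "(\<Otimes>i\<in>I. f i (g i)) \<in> carrier R" if "g \<in> PiE I (\<lambda>_. L)" for g
    using that fc gm by (intro finprod_closed) auto
  have "(\<Otimes>i\<in>insert k I. \<Oplus>l\<in>L. f i l) = (\<Oplus>l\<in>L. f k l) \<otimes> (\<Otimes>i\<in>I. \<Oplus>l\<in>L. f i l)"
    using insert(1,2) fc by (intro finprod_insert) (auto intro!: finsum_closed)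
  also have "\<dots> = (\<Oplus>l\<in>L. f k l) \<otimes> (\<Oplus>g\<in>PiE I (\<lambda>_. L). \<Otimes>i\<in>I. f i (g i))"
    using insert(3) fc by simp
  also have "\<dots> = (\<Oplus>l\<in>L. f k l \<otimes> (\<Oplus>g\<in>PiE I (\<lambda>_. L). \<Otimes>i\<in>I. f i (g i)))"
    using assms(2) fc pc by (intro finsum_ldistr) (auto intro!: finsum_closed)
  also have "\<dots> = (\<Oplus>l\<in>L. \<Oplus>g\<in>PiE I (\<lambda>_. L). f k l \<otimes> (\<Otimes>i\<in>I. f i (g i)))"
  proof (intro finsum_cong' refl)
    fix l assume l: "l \<in> L"
    show "f k l \<otimes> (\<Oplus>g\<in>PiE I (\<lambda>_. L). \<Otimes>i\<in>I. f i (g i)) =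
        (\<Oplus>g\<in>PiE I (\<lambda>_. L). f k l \<otimes> (\<Otimes>i\<in>I. f i (g i)))"
      using fin fc l pc by (intro finsum_rdistr) auto
  qed (use fc pc in \<open>auto intro!: finsum_closed\<close>)
  also have "\<dots> = (\<Oplus>l\<in>L. \<Oplus>g\<in>PiE I (\<lambda>_. L). \<Otimes>i\<in>insert k I. f i ((?h (l, g)) i))"
  proof (intro finsum_cong' refl)
    fix l g assume lg: "l \<in> L" "g \<in> PiE I (\<lambda>_. L)"
    have "(\<Otimes>i\<in>insert k I. f i ((?h (l, g)) i)) = f k l \<otimes> (\<Otimes>i\<in>I. f i ((?h (l, g)) i))"
      using insert(1,2) fc lg gm by (subst finprod_insert) (auto split: if_splits)
    also have "(\<Otimes>i\<in>I. f i ((?h (l, g)) i)) = (\<Otimes>i\<in>I. f i (g i))"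
      using insert(2) fc lg gm by (intro finprod_cong') auto
    finally show "f k l \<otimes> (\<Otimes>i\<in>I. f i (g i)) = (\<Otimes>i\<in>insert k I. f i ((?h (l, g)) i))" ..
  next
    show "(\<lambda>g. \<Otimes>i\<in>insert k I. f i ((?h (l, g)) i)) \<in> PiE I (\<lambda>_. L) \<rightarrow> carrier R" if "l \<in> L" for l
      using that fc gm by (auto intro!: finprod_closed)
    show "(\<lambda>l. \<Oplus>g\<in>PiE I (\<lambda>_. L). \<Otimes>i\<in>insert k I. f i ((?h (l, g)) i)) \<in> L \<rightarrow> carrier R"
      using fc gm by (auto intro!: finsum_closed finprod_closed)
  qed
  also have "\<dots> = (\<Oplus>x\<in>L \<times> PiE I (\<lambda>_. L). \<Otimes>i\<in>insert k I. f i ((?h (fst x, snd x)) i))"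
    using assms(2) fin fc gm by (intro finsum_Sigma_pair) (auto intro!: finprod_mem)
  also have "\<dots> = (\<Oplus>x\<in>L \<times> PiE I (\<lambda>_. L). \<Otimes>i\<in>insert k I. f i (?h x i))"
    by (simp add: case_prod_unfold)
  also have "\<dots> = (\<Oplus>g\<in>?h ` (L \<times> PiE I (\<lambda>_. L)). \<Otimes>i\<in>insert k I. f i (g i))"
  proof (rule finsum_reindex[OF _ inj, symmetric], unfold im, rule funcsetI)
    fix g assume "g \<in> PiE (insert k I) (\<lambda>_. L)"
    then show "(\<Otimes>i\<in>insert k I. f i (g i)) \<in> carrier R" using fc by (intro finprod_mem) auto
  qed
  finally show ?case unfolding im .
qed

definition sgn_perm :: "(nat \<Rightarrow> nat) \<Rightarrow> 'a \<Rightarrow> 'a" where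
  "sgn_perm p t = (if evenperm p then t else \<ominus> t)"

lemma sgn_perm_closed: "t \<in> carrier R \<Longrightarrow> sgn_perm p t \<in> carrier R"
  by (simp add: sgn_perm_def)

lemma mat_det_sgn: "mat_det R n M = (\<Oplus>p\<in>{p. p permutes {..<n}}. sgn_perm p (\<Otimes>i\<in>{..<n}. M i (p i)))"
  unfolding mat_det_def sgn_perm_def ..

lemma mat_det_closed:
  assumes "\<And>i j. \<lbrakk>i < n; j < n\<rbrakk> \<Longrightarrow> M i j \<in> carrier R"
  shows "mat_det R n M \<in> carrier R"
  unfolding mat_det_sgn
proof (intro finsum_mem sgn_perm_closed finprod_mem assms)
  fix p i assume "p \<in> {p. p permutes {..<n}}" "i \<in> {..<n}"
  then show "p i < n" using permutes_in_image[of p "{..<n}" i] by auto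
qed auto

text \<open>
  Composition with the transposition of the two rows matches even permutations with odd ones and leaves
  the products unchanged, so the terms cancel in pairs, also in characteristic two.
\<close>

lemma mat_det_equal_rows:
  assumes M: "\<And>i j. \<lbrakk>i < n; j < n\<rbrakk> \<Longrightarrow> M i j \<in> carrier R"
    and ab: "a < n" "b < n" "a \<noteq> b" "\<And>j. j < n \<Longrightarrow> M a j = M b j"
  shows "mat_det R n M = \<zero>"
proof -
  let ?S = "{p. p permutes {..<n}}"
  let ?t = "\<lambda>p. \<Otimes>i\<in>{..<n}. M i (p i)"
  let ?\<tau> = "transpose a b"
  have tau: "?\<tau> permutes {..<n}" using ab by (intro permutes_swap_id) auto
  have pn: "p i < n" if "p permutes {..<n}" "i < n" for p i
    using permutes_in_image[OF that(1), of i] that(2) by simp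
  have tc: "?t p \<in> carrier R" if "p permutes {..<n}" for p
    using M pn[OF that] by (intro finprod_mem) auto
  have t: "?t (p \<circ> ?\<tau>) = ?t p" if p: "p permutes {..<n}" for p
  proof -
    have "?t p = (\<Otimes>i\<in>?\<tau> ` {..<n}. M i (p i))" using permutes_image[OF tau] by simp
    also have "\<dots> = (\<Otimes>i\<in>{..<n}. M (?\<tau> i) (p (?\<tau> i)))"
      using M pn[OF p] permutes_image[OF tau] permutes_inj_on[OF tau] by (intro finprod_reindex) auto
    also have "\<dots> = ?t (p \<circ> ?\<tau>)"
    proof (intro finprod_eqI)
      fix i assume "i \<in> {..<n}"
      then have i: "i < n" and pi: "p (?\<tau> i) < n" using pn[OF p] pn[OF tau] by auto
      show "M (?\<tau> i) (p (?\<tau> i)) = M i ((p \<circ> ?\<tau>) i)"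
        using ab(4)[OF pi] by (auto simp: transpose_def)
      show "M i ((p \<circ> ?\<tau>) i) \<in> carrier R" using M i pi by simp
    qed
    finally show ?thesis ..
  qed
  let ?E = "{p \<in> ?S. evenperm p}" and ?O = "{p \<in> ?S. \<not> evenperm p}"
  have fin: "finite ?S" by (intro finite_permutations) simp
  have perm: "permutation p" if "p permutes {..<n}" for p
    using that permutation_permutes by (metis finite_lessThan)
  have parity: "evenperm (p \<circ> ?\<tau>) \<longleftrightarrow> \<not> evenperm p" if "p permutes {..<n}" for p
    using evenperm_comp[OF perm[OF that] perm[OF tau]] ab(3) by (simp add: evenperm_swap)
  have invol: "(p \<circ> ?\<tau>) \<circ> ?\<tau> = p" for p :: "nat \<Rightarrow> nat" by (simp add: o_assoc[symmetric])
  have OE: "?O = (\<lambda>p. p \<circ> ?\<tau>) ` ?E"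
  proof
    show "?O \<subseteq> (\<lambda>p. p \<circ> ?\<tau>) ` ?E"
    proof
      fix p assume "p \<in> ?O"
      then have "p \<circ> ?\<tau> \<in> ?E" using permutes_compose[OF tau] parity by auto
      then show "p \<in> (\<lambda>p. p \<circ> ?\<tau>) ` ?E" using invol[of p] by (metis (no_types, lifting) image_eqI)
    qed
    show "(\<lambda>p. p \<circ> ?\<tau>) ` ?E \<subseteq> ?O" using permutes_compose[OF tau] parity by auto
  qed
  have inj: "inj_on (\<lambda>p. p \<circ> ?\<tau>) ?E" by (rule inj_onI) (metis invol)
  have "(\<Oplus>p\<in>?O. sgn_perm p (?t p)) = (\<Oplus>p\<in>?E. sgn_perm (p \<circ> ?\<tau>) (?t (p \<circ> ?\<tau>)))"
    unfolding OE
  proof (rule finsum_reindex[OF _ inj], unfold OE[symmetric], rule funcsetI)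
    fix p assume "p \<in> ?O"
    then show "sgn_perm p (?t p) \<in> carrier R" using tc by (auto intro: sgn_perm_closed)
  qed
  also have "\<dots> = (\<Oplus>p\<in>?E. (\<ominus> \<one>) \<otimes> ?t p)"
  proof (rule finsum_eqI)
    fix p assume p: "p \<in> ?E"
    then have "?t p \<in> carrier R" "?t (p \<circ> ?\<tau>) = ?t p" "\<not> evenperm (p \<circ> ?\<tau>)" using tc t parity by auto
    then show "sgn_perm (p \<circ> ?\<tau>) (?t (p \<circ> ?\<tau>)) = (\<ominus> \<one>) \<otimes> ?t p" "(\<ominus> \<one>) \<otimes> ?t p \<in> carrier R"
      by (simp_all add: sgn_perm_def l_minus)
  qed
  also have "\<dots> = (\<ominus> \<one>) \<otimes> (\<Oplus>p\<in>?E. ?t p)"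
    using fin tc by (intro finsum_rdistr[symmetric]) auto
  also have "\<dots> = \<ominus> (\<Oplus>p\<in>?E. ?t p)"
    using tc finsum_mem[of ?E ?t] by (simp add: l_minus)
  finally have odd: "(\<Oplus>p\<in>?O. sgn_perm p (?t p)) = \<ominus> (\<Oplus>p\<in>?E. ?t p)" .
  have ev: "(\<Oplus>p\<in>?E. sgn_perm p (?t p)) = (\<Oplus>p\<in>?E. ?t p)"
    using tc by (intro finsum_eqI) (auto simp: sgn_perm_def)
  have SEO: "?S = ?E \<union> ?O" by auto
  have "mat_det R n M = (\<Oplus>p\<in>?E \<union> ?O. sgn_perm p (?t p))"
    unfolding mat_det_sgn by (rule arg_cong[OF SEO])
  also have "\<dots> = (\<Oplus>p\<in>?E. sgn_perm p (?t p)) \<oplus> (\<Oplus>p\<in>?O. sgn_perm p (?t p))"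
    using fin tc by (intro finsum_Un_disjoint) (auto intro!: sgn_perm_closed)
  also have "\<dots> = \<zero>" unfolding ev odd using tc finsum_mem[of ?E ?t] by (simp add: r_neg)
  finally show ?thesis .
qed

lemma mat_det_permute_rows:
  assumes M: "\<And>i j. \<lbrakk>i < n; j < n\<rbrakk> \<Longrightarrow> M i j \<in> carrier R" and q: "q permutes {..<n}"
  shows "mat_det R n (\<lambda>i. M (q i)) = sgn_perm q (mat_det R n M)"
proof -
  let ?S = "{p. p permutes {..<n}}"
  let ?t = "\<lambda>p. \<Otimes>i\<in>{..<n}. M i (p i)"
  have pn: "p i < n" if "p permutes {..<n}" "i < n" for p i
    using permutes_in_image[OF that(1), of i] that(2) by simp
  have tc: "?t p \<in> carrier R" if "p permutes {..<n}" for p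
    using M pn[OF that] by (intro finprod_mem) auto
  have fin: "finite ?S" by (intro finite_permutations) simp
  have perm: "permutation p" if "p permutes {..<n}" for p
    using that permutation_permutes by (metis finite_lessThan)
  have t: "(\<Otimes>i\<in>{..<n}. M (q i) ((p \<circ> q) i)) = ?t p" if p: "p permutes {..<n}" for p
  proof -
    have "?t p = (\<Otimes>i\<in>q ` {..<n}. M i (p i))" using permutes_image[OF q] by simp
    also have "\<dots> = (\<Otimes>i\<in>{..<n}. M (q i) (p (q i)))"
      using M pn[OF p] permutes_image[OF q] permutes_inj_on[OF q] by (intro finprod_reindex) auto
    finally show ?thesis by simp
  qed
  have im: "(\<lambda>p. p \<circ> q) ` ?S = ?S"
  proof
    show "(\<lambda>p. p \<circ> q) ` ?S \<subseteq> ?S" using permutes_compose[OF q] by auto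
    show "?S \<subseteq> (\<lambda>p. p \<circ> q) ` ?S"
    proof
      fix p assume "p \<in> ?S"
      then have "p \<circ> inv_into UNIV q \<in> ?S" using permutes_compose[OF permutes_inv[OF q]] by auto
      moreover have "(p \<circ> inv_into UNIV q) \<circ> q = p" using permutes_inv_o[OF q] by (simp add: o_assoc[symmetric])
      ultimately show "p \<in> (\<lambda>p. p \<circ> q) ` ?S" by (metis (no_types, lifting) image_eqI)
    qed
  qed
  have inj: "inj_on (\<lambda>p. p \<circ> q) ?S"
  proof (rule inj_onI)
    fix p p' assume "p \<circ> q = p' \<circ> q"
    then have "(p \<circ> q) \<circ> inv_into UNIV q = (p' \<circ> q) \<circ> inv_into UNIV q" by simp
    then show "p = p'" using permutes_inv_o[OF q] by (simp add: o_assoc[symmetric])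
  qed
  let ?f = "\<lambda>p. sgn_perm p (\<Otimes>i\<in>{..<n}. M (q i) (p i))"
  have fc: "?f p \<in> carrier R" if "p permutes {..<n}" for p
    using M pn[OF that] pn[OF q] by (intro sgn_perm_closed finprod_mem) auto
  have "mat_det R n (\<lambda>i. M (q i)) = (\<Oplus>p\<in>(\<lambda>p. p \<circ> q) ` ?S. ?f p)" unfolding im mat_det_sgn ..
  also have "\<dots> = (\<Oplus>p\<in>?S. ?f (p \<circ> q))"
    by (rule finsum_reindex[OF _ inj], unfold im) (use fc in auto)
  also have "\<dots> = (\<Oplus>p\<in>?S. sgn_perm q \<one> \<otimes> sgn_perm p (?t p))"
  proof (rule finsum_eqI)
    fix p assume p: "p \<in> ?S"
    then have "evenperm (p \<circ> q) = (evenperm p = evenperm q)" using evenperm_comp[OF perm[of p] perm[OF q]] by simp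
    then show "?f (p \<circ> q) = sgn_perm q \<one> \<otimes> sgn_perm p (?t p)"
      using t tc p by (simp add: sgn_perm_def l_minus r_minus del: o_apply)
    show "sgn_perm q \<one> \<otimes> sgn_perm p (?t p) \<in> carrier R" using tc p by (simp add: sgn_perm_closed)
  qed
  also have "\<dots> = sgn_perm q \<one> \<otimes> mat_det R n M"
    unfolding mat_det_sgn using fin tc by (intro finsum_rdistr[symmetric]) (auto intro!: sgn_perm_closed)
  also have "\<dots> = sgn_perm q (mat_det R n M)"
    using mat_det_closed[OF M] by (simp add: sgn_perm_def l_minus)
  finally show ?thesis .
qed

text \<open>
  Multilinear expansion of the rows of the product gives a sum over all maps \<open>g\<close> of
  \<open>\<Otimes>i. M i (g i)\<close> times the determinant of the rows \<open>g i\<close> of \<open>N\<close>. The latter vanishes unless \<open>g\<close> is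
  a permutation, and then it is \<open>mat_det R n N\<close> up to sign.
\<close>

lemma mat_det_mult:
  assumes M: "\<And>i j. \<lbrakk>i < n; j < n\<rbrakk> \<Longrightarrow> M i j \<in> carrier R"
    and N: "\<And>i j. \<lbrakk>i < n; j < n\<rbrakk> \<Longrightarrow> N i j \<in> carrier R"
  shows "mat_det R n (mat_mult R n M N) = mat_det R n M \<otimes> mat_det R n N"
proof -
  let ?S = "{p. p permutes {..<n}}"
  let ?G = "PiE {..<n} (\<lambda>_. {..<n})"
  let ?m = "\<lambda>g. \<Otimes>i\<in>{..<n}. M i (g i)"
  have pn: "p i < n" if "p permutes {..<n}" "i < n" for p i
    using permutes_in_image[OF that(1), of i] that(2) by simp
  have gn: "g i < n" if "g \<in> ?G" "i < n" for g i using that by auto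
  have fin: "finite ?S" "finite ?G" by (auto intro!: finite_permutations finite_PiE)
  have mc: "?m g \<in> carrier R" if "\<And>i. i < n \<Longrightarrow> g i < n" for g
    using M that by (intro finprod_mem) auto
  have nc: "(\<Otimes>i\<in>{..<n}. N (g i) (p i)) \<in> carrier R"
    if "p permutes {..<n}" "\<And>i. i < n \<Longrightarrow> g i < n" for g p
    using N that pn[OF that(1)] by (intro finprod_mem) auto
  have dc: "mat_det R n (\<lambda>i. N (g i)) \<in> carrier R" if "\<And>i. i < n \<Longrightarrow> g i < n" for g
    using N that by (intro mat_det_closed) auto
  have sm: "sgn_perm p (a \<otimes> b) = a \<otimes> sgn_perm p b" if "a \<in> carrier R" "b \<in> carrier R" for p a b
    using that by (simp add: sgn_perm_def r_minus)
  have "mat_det R n (mat_mult R n M N) = (\<Oplus>p\<in>?S. \<Oplus>g\<in>?G. ?m g \<otimes> sgn_perm p (\<Otimes>i\<in>{..<n}. N (g i) (p i)))"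
    unfolding mat_det_sgn
  proof (rule finsum_eqI)
    fix p assume "p \<in> ?S"
    then have p: "p permutes {..<n}" by simp
    have "(\<Otimes>i\<in>{..<n}. mat_mult R n M N i (p i)) = (\<Oplus>g\<in>?G. \<Otimes>i\<in>{..<n}. M i (g i) \<otimes> N (g i) (p i))"
      unfolding mat_mult_def using M N pn[OF p] by (intro finprod_finsum_distrib) auto
    also have "\<dots> = (\<Oplus>g\<in>?G. ?m g \<otimes> (\<Otimes>i\<in>{..<n}. N (g i) (p i)))"
    proof (rule finsum_eqI)
      fix g assume g: "g \<in> ?G"
      show "(\<Otimes>i\<in>{..<n}. M i (g i) \<otimes> N (g i) (p i)) = ?m g \<otimes> (\<Otimes>i\<in>{..<n}. N (g i) (p i))"
        using M N gn[OF g] pn[OF p] by (intro finprod_multf) auto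
      show "?m g \<otimes> (\<Otimes>i\<in>{..<n}. N (g i) (p i)) \<in> carrier R" using mc nc[OF p] gn[OF g] by simp
    qed
    finally have e: "(\<Otimes>i\<in>{..<n}. mat_mult R n M N i (p i)) = (\<Oplus>g\<in>?G. ?m g \<otimes> (\<Otimes>i\<in>{..<n}. N (g i) (p i)))" .
    have c: "?m g \<otimes> (\<Otimes>i\<in>{..<n}. N (g i) (p i)) \<in> carrier R" if "g \<in> ?G" for g
      using mc nc[OF p] gn[OF that] by simp
    have "sgn_perm p (\<Oplus>g\<in>?G. ?m g \<otimes> (\<Otimes>i\<in>{..<n}. N (g i) (p i))) =
        (\<Oplus>g\<in>?G. sgn_perm p \<one> \<otimes> (?m g \<otimes> (\<Otimes>i\<in>{..<n}. N (g i) (p i))))"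
    proof -
      have "sgn_perm p (\<Oplus>g\<in>?G. ?m g \<otimes> (\<Otimes>i\<in>{..<n}. N (g i) (p i))) =
        sgn_perm p \<one> \<otimes> (\<Oplus>g\<in>?G. ?m g \<otimes> (\<Otimes>i\<in>{..<n}. N (g i) (p i)))"
        using finsum_mem[of ?G, OF c] by (simp add: sgn_perm_def l_minus)
      also have "\<dots> = (\<Oplus>g\<in>?G. sgn_perm p \<one> \<otimes> (?m g \<otimes> (\<Otimes>i\<in>{..<n}. N (g i) (p i))))"
        using fin c by (intro finsum_rdistr) (auto intro!: sgn_perm_closed)
      finally show ?thesis .
    qed
    also have "\<dots> = (\<Oplus>g\<in>?G. ?m g \<otimes> sgn_perm p (\<Otimes>i\<in>{..<n}. N (g i) (p i)))"
    proof (rule finsum_eqI)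
      fix g assume g: "g \<in> ?G"
      have h: "?m g \<in> carrier R" "(\<Otimes>i\<in>{..<n}. N (g i) (p i)) \<in> carrier R" using mc nc[OF p] gn[OF g] by auto
      then show "sgn_perm p \<one> \<otimes> (?m g \<otimes> (\<Otimes>i\<in>{..<n}. N (g i) (p i))) = ?m g \<otimes> sgn_perm p (\<Otimes>i\<in>{..<n}. N (g i) (p i))"
        by (simp add: sgn_perm_def l_minus r_minus)
      show "?m g \<otimes> sgn_perm p (\<Otimes>i\<in>{..<n}. N (g i) (p i)) \<in> carrier R" using h by (simp add: sgn_perm_closed)
    qed
    finally show "sgn_perm p (\<Otimes>i\<in>{..<n}. mat_mult R n M N i (p i)) =
        (\<Oplus>g\<in>?G. ?m g \<otimes> sgn_perm p (\<Otimes>i\<in>{..<n}. N (g i) (p i)))" unfolding e .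
    show "(\<Oplus>g\<in>?G. ?m g \<otimes> sgn_perm p (\<Otimes>i\<in>{..<n}. N (g i) (p i))) \<in> carrier R"
      using mc nc[OF p] gn by (intro finsum_mem m_closed sgn_perm_closed) auto
  qed
  also have "\<dots> = (\<Oplus>g\<in>?G. \<Oplus>p\<in>?S. ?m g \<otimes> sgn_perm p (\<Otimes>i\<in>{..<n}. N (g i) (p i)))"
    using fin mc nc gn by (intro finsum_swap m_closed sgn_perm_closed) auto
  also have "\<dots> = (\<Oplus>g\<in>?G. ?m g \<otimes> mat_det R n (\<lambda>i. N (g i)))"
  proof (rule finsum_eqI)
    fix g assume g: "g \<in> ?G"
    show "(\<Oplus>p\<in>?S. ?m g \<otimes> sgn_perm p (\<Otimes>i\<in>{..<n}. N (g i) (p i))) = ?m g \<otimes> mat_det R n (\<lambda>i. N (g i))"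
      unfolding mat_det_sgn using fin mc nc gn[OF g]
      by (intro finsum_rdistr[symmetric]) (auto intro!: sgn_perm_closed)
    show "?m g \<otimes> mat_det R n (\<lambda>i. N (g i)) \<in> carrier R" using mc dc gn[OF g] by simp
  qed
  also have "\<dots> = (\<Oplus>g\<in>(\<lambda>q. restrict q {..<n}) ` ?S. ?m g \<otimes> mat_det R n (\<lambda>i. N (g i)))"
  proof (rule add.finprod_mono_neutral_cong_right)
    show "finite ?G" by (rule fin)
    show "(\<lambda>q. restrict q {..<n}) ` ?S \<subseteq> ?G"
      using pn by (intro image_subsetI) (simp add: restrict_PiE_iff)
    show "(\<lambda>g. ?m g \<otimes> mat_det R n (\<lambda>i. N (g i))) \<in> ?G \<rightarrow> carrier R" using mc dc gn by auto
    fix g assume g: "g \<in> ?G - (\<lambda>q. restrict q {..<n}) ` ?S"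
    have "\<not> inj_on g {..<n}"
    proof
      assume inj: "inj_on g {..<n}"
      let ?q = "\<lambda>i. if i < n then g i else i"
      have "?q permutes {..<n}"
        using inj gn[of g] g by (intro inj_imp_permutes) (auto simp: inj_on_def)
      moreover have "g = restrict ?q {..<n}" using g by (auto simp: fun_eq_iff PiE_def extensional_def)
      ultimately show False using g by blast
    qed
    then obtain a b where ab: "a < n" "b < n" "a \<noteq> b" "g a = g b" unfolding inj_on_def by auto
    have "mat_det R n (\<lambda>i. N (g i)) = \<zero>"
      using N gn[of g] g ab by (intro mat_det_equal_rows[of n _ a b]) auto
    then show "?m g \<otimes> mat_det R n (\<lambda>i. N (g i)) = \<zero>" using mc gn[of g] g by simp
  qed simp
  also have "\<dots> = (\<Oplus>q\<in>?S. ?m (restrict q {..<n}) \<otimes> mat_det R n (\<lambda>i. N (restrict q {..<n} i)))"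
  proof (rule finsum_reindex)
    show "inj_on (\<lambda>q. restrict q {..<n}) ?S"
    proof (rule inj_onI)
      fix p q assume h: "p \<in> ?S" "q \<in> ?S" "restrict p {..<n} = restrict q {..<n}"
      show "p = q"
      proof
        fix i show "p i = q i"
        proof (cases "i < n")
          case True
          then show ?thesis using fun_cong[OF h(3), of i] by simp
        next
          case False
          then show ?thesis using h(1,2) by (simp add: permutes_def)
        qed
      qed
    qed
    show "(\<lambda>g. ?m g \<otimes> mat_det R n (\<lambda>i. N (g i))) \<in> (\<lambda>q. restrict q {..<n}) ` ?S \<rightarrow> carrier R"
      using mc dc pn by auto
  qed
  also have "\<dots> = (\<Oplus>q\<in>?S. sgn_perm q (?m q) \<otimes> mat_det R n N)"
  proof (rule finsum_eqI)
    fix q assume "q \<in> ?S"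
    then have q: "q permutes {..<n}" by simp
    have m: "?m (restrict q {..<n}) = ?m q" using M pn[OF q] by (intro finprod_eqI) auto
    have "mat_det R n (\<lambda>i. N (restrict q {..<n} i)) = mat_det R n (\<lambda>i. N (q i))"
      unfolding mat_det_sgn using N pn[OF q] pn
      by (intro finsum_eqI arg_cong[where f = "sgn_perm _"] finprod_eqI sgn_perm_closed finprod_mem) auto
    also have "\<dots> = sgn_perm q (mat_det R n N)" using N q by (intro mat_det_permute_rows) auto
    finally show "?m (restrict q {..<n}) \<otimes> mat_det R n (\<lambda>i. N (restrict q {..<n} i)) = sgn_perm q (?m q) \<otimes> mat_det R n N"
      using m mc[of q] pn[OF q] mat_det_closed[of n N] N by (simp add: sgn_perm_def l_minus r_minus)
    show "sgn_perm q (?m q) \<otimes> mat_det R n N \<in> carrier R"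
      using mc[of q] pn[OF q] mat_det_closed[of n N] N by (simp add: sgn_perm_closed)
  qed
  also have "\<dots> = mat_det R n M \<otimes> mat_det R n N"
    unfolding mat_det_sgn[of n M] using fin mc pn mat_det_closed[of n N] N
    by (intro finsum_ldistr[symmetric]) (auto intro!: sgn_perm_closed)
  finally show ?thesis .
qed

lemma mat_det_one: "mat_det R n (mat_one R) = \<one>"
proof -
  let ?S = "{p. p permutes {..<n}}"
  have fin: "finite ?S" by (intro finite_permutations) simp
  have z: "(\<Otimes>i\<in>{..<n}. mat_one R i (p i)) = \<zero>" if p: "p \<in> ?S - {id}" for p
  proof -
    obtain k where k: "p k \<noteq> k" using p by (auto simp: fun_eq_iff)
    then have kn: "k < n" using p by (auto simp: permutes_def)
    have mc: "mat_one R i (p i) \<in> carrier R" for i unfolding mat_one_def by simp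
    have ins: "{..<n} = insert k ({..<n} - {k})" using kn by auto
    have "(\<Otimes>i\<in>{..<n}. mat_one R i (p i)) = (\<Otimes>i\<in>insert k ({..<n} - {k}). mat_one R i (p i))"
      by (rule arg_cong[OF ins])
    also have "\<dots> = mat_one R k (p k) \<otimes> (\<Otimes>i\<in>{..<n} - {k}. mat_one R i (p i))"
      using mc by (intro finprod_insert) auto
    also have "\<dots> = \<zero>" using k mc by (simp add: mat_one_def finprod_mem)
    finally show ?thesis .
  qed
  have "mat_det R n (mat_one R) = (\<Oplus>p\<in>{id}. sgn_perm p (\<Otimes>i\<in>{..<n}. mat_one R i (p i)))"
    unfolding mat_det_sgn
  proof (rule add.finprod_mono_neutral_cong_right[OF fin])
    show "{id} \<subseteq> ?S" by (simp add: permutes_id)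
    show "sgn_perm p (\<Otimes>i\<in>{..<n}. mat_one R i (p i)) = \<zero>" if "p \<in> ?S - {id}" for p
      using z[OF that] by (simp add: sgn_perm_def)
    show "(\<lambda>p. sgn_perm p (\<Otimes>i\<in>{..<n}. mat_one R i (p i))) \<in> ?S \<rightarrow> carrier R"
      by (auto intro!: sgn_perm_closed finprod_mem simp: mat_one_def)
  qed simp
  also have "\<dots> = \<one>"
  proof -
    have "(\<Otimes>i\<in>{..<n}. mat_one R i (id i)) = \<one>" by (rule finprod_one_eqI) (simp add: mat_one_def)
    then show ?thesis by (simp add: sgn_perm_def)
  qed
  finally show ?thesis .
qed

end

section \<open>Growth rates of shifted sequences\<close>

text \<open>
  As \<open>d'\<close> grows at most linearly, replacing the denominator \<open>i + c + 1\<close> by \<open>i + 1\<close> changes the quotient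
  by at most \<open>C * c / (i + 1)\<close>.
\<close>

lemma limsup_ratio_mono_shift:
  fixes d d' :: "nat \<Rightarrow> nat" and C c :: nat
  assumes le: "\<And>i. d i \<le> d' (i + c)" and bound: "\<And>i. d' i \<le> C * (i + 1)"
  shows "limsup (\<lambda>i. ereal (real (d i) / real (i + 1))) \<le> limsup (\<lambda>i. ereal (real (d' i) / real (i + 1)))"
proof (rule ereal_le_epsilon2)
  fix e :: real assume e: "0 < e"
  let ?b = "\<lambda>i. ereal (real (d' i) / real (i + 1))"
  have "eventually (\<lambda>i. ereal (real (d i) / real (i + 1)) \<le> (?b \<circ> (\<lambda>i. i + c)) i + ereal e) sequentially"
  proof (rule eventually_sequentiallyI[of "nat \<lceil>real (C * c) / e\<rceil>"])
    fix i assume "nat \<lceil>real (C * c) / e\<rceil> \<le> i"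
    then have "real (C * c) / e \<le> real i" by linarith
    then have "real (C * c) \<le> e * real i" using e by (simp add: field_simps)
    also have "\<dots> \<le> e * real (i + 1)" using e by simp
    finally have small: "real (C * c) / real (i + 1) \<le> e" by (simp add: field_simps)
    let ?x = "real (d' (i + c)) / real (i + c + 1)"
    have "real (d' (i + c)) \<le> real C * real (i + c + 1)"
      using bound[of "i + c"] by (metis of_nat_le_iff of_nat_mult)
    then have xC: "?x \<le> real C" by (simp add: field_simps)
    have "real (d i) / real (i + 1) \<le> real (d' (i + c)) / real (i + 1)"
      using le[of i] by (intro divide_right_mono) auto
    also have "\<dots> = ?x * (real (i + c + 1) / real (i + 1))" by simp
    also have "real (i + c + 1) / real (i + 1) = 1 + real c / real (i + 1)" by (simp add: field_simps)
    also have "?x * (1 + real c / real (i + 1)) = ?x + ?x * (real c / real (i + 1))"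
      by (simp only: distrib_left mult_1_right)
    also have "\<dots> \<le> ?x + real C * (real c / real (i + 1))"
      using xC by (intro add_left_mono mult_right_mono) auto
    also have "real C * (real c / real (i + 1)) = real (C * c) / real (i + 1)" by simp
    also have "?x + \<dots> \<le> ?x + e" using small by simp
    finally show "ereal (real (d i) / real (i + 1)) \<le> (?b \<circ> (\<lambda>i. i + c)) i + ereal e" by simp
  qed
  then have "limsup (\<lambda>i. ereal (real (d i) / real (i + 1))) \<le> limsup (\<lambda>i. (?b \<circ> (\<lambda>i. i + c)) i + ereal e)"
    by (rule Limsup_mono)
  also have "\<dots> = limsup (?b \<circ> (\<lambda>i. i + c)) + ereal e"
    by (rule Limsup_add_ereal_right) simp_all
  also have "\<dots> \<le> limsup ?b + ereal e"
    by (intro add_right_mono limsup_subseq_mono) (simp add: strict_mono_def)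
  finally show "limsup (\<lambda>i. ereal (real (d i) / real (i + 1))) \<le> limsup ?b + ereal e" .
qed

section \<open>Linear disjointness of constants\<close>

text \<open>
  The relations between \<open>u j\<close> and the \<open>u i\<close> with \<open>i \<in> W\<close> have their coefficients at \<open>u j\<close> in an ideal
  \<open>J\<close> of \<open>R\<close>, and \<open>J\<close> is stable under \<open>\<phi>\<close> because the \<open>u i\<close> are constants. If \<open>J\<close> were the whole ring, there
  would be a relation with coefficient \<open>\<one>\<close> at \<open>u j\<close>. Subtracting it from its image under \<open>\<Phi>\<close> gives
  a relation between the \<open>u i\<close> with \<open>i \<in> W\<close> alone, which is trivial by induction; so all coefficients
  would be constants, and the family would be dependent over \<open>k\<close>. By \<open>\<phi>\<close>-simplicity \<open>J\<close> is zero, and the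
  induction hypothesis applies to what is left of the relation.
\<close>

lemma (in ring_hom_cring) constants_lin_indep:
  assumes \<phi>: "\<phi> \<in> ring_hom R R" and \<Phi>: "\<Phi> \<in> ring_hom S S" and comm: "\<And>a. a \<in> carrier R \<Longrightarrow> \<Phi> (h a) = h (\<phi> a)"
    and simple: "phi_simple R \<phi>" and k: "subring k S" and fixk: "\<And>a. \<lbrakk>a \<in> carrier R; \<phi> a = a\<rbrakk> \<Longrightarrow> h a \<in> k"
    and one: "\<one>\<^bsub>S\<^esub> \<noteq> \<zero>\<^bsub>S\<^esub>"
    and u: "\<And>i. i \<in> I \<Longrightarrow> u i \<in> carrier S" "\<And>i. i \<in> I \<Longrightarrow> \<Phi> (u i) = u i"
    and ind: "lin_indep S k {\<zero>\<^bsub>S\<^esub>} I u"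
    and W: "finite W" "W \<subseteq> I" and a: "a \<in> W \<rightarrow> carrier R"
    and rel: "(\<Oplus>\<^bsub>S\<^esub>i\<in>W. h (a i) \<otimes>\<^bsub>S\<^esub> u i) = \<zero>\<^bsub>S\<^esub>" and i: "i \<in> W"
  shows "a i = \<zero>"
  using W a rel i
proof (induct W arbitrary: a i rule: finite_induct)
  case (insert j W a)
  interpret \<Phi>: ring_hom_cring S S \<Phi> by (intro ring_hom_cring.intro ring_hom_cring_axioms.intro S.is_cring \<Phi>)
  interpret \<phi>: ring_hom_cring R R \<phi> by (intro ring_hom_cring.intro ring_hom_cring_axioms.intro R.is_cring \<phi>)
  have WI: "W \<subseteq> I" and jI: "j \<in> I" using insert(4) by auto
  have uj: "u j \<in> carrier S" "\<Phi> (u j) = u j" using u jI by auto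
  have uW: "u i \<in> carrier S" "\<Phi> (u i) = u i" if "i \<in> W" for i using u WI that by auto
  define L where "L c = (\<Oplus>\<^bsub>S\<^esub>i\<in>W. h (c i) \<otimes>\<^bsub>S\<^esub> u i)" for c
  have Lc: "L c \<in> carrier S" if "\<And>i. i \<in> W \<Longrightarrow> c i \<in> carrier R" for c
    unfolding L_def using that uW by (intro S.finsum_closed) auto
  have Ladd: "L (\<lambda>i. c i \<oplus> d i) = L c \<oplus>\<^bsub>S\<^esub> L d"
    if "\<And>i. i \<in> W \<Longrightarrow> c i \<in> carrier R" "\<And>i. i \<in> W \<Longrightarrow> d i \<in> carrier R" for c d
  proof -
    have "L (\<lambda>i. c i \<oplus> d i) = (\<Oplus>\<^bsub>S\<^esub>i\<in>W. h (c i) \<otimes>\<^bsub>S\<^esub> u i \<oplus>\<^bsub>S\<^esub> h (d i) \<otimes>\<^bsub>S\<^esub> u i)"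
      unfolding L_def using that uW by (intro S.finsum_cong') (auto simp: S.l_distr)
    also have "\<dots> = L c \<oplus>\<^bsub>S\<^esub> L d"
      unfolding L_def using that uW by (intro S.finsum_addf) auto
    finally show ?thesis .
  qed
  have Lsm: "L (\<lambda>i. r \<otimes> c i) = h r \<otimes>\<^bsub>S\<^esub> L c"
    if "r \<in> carrier R" "\<And>i. i \<in> W \<Longrightarrow> c i \<in> carrier R" for r c
  proof -
    have "L (\<lambda>i. r \<otimes> c i) = (\<Oplus>\<^bsub>S\<^esub>i\<in>W. h r \<otimes>\<^bsub>S\<^esub> (h (c i) \<otimes>\<^bsub>S\<^esub> u i))"
      unfolding L_def using that uW by (intro S.finsum_cong') (auto simp: S.m_assoc)
    also have "\<dots> = h r \<otimes>\<^bsub>S\<^esub> L c"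
      unfolding L_def using that uW insert(1) by (intro S.finsum_rdistr[symmetric]) auto
    finally show ?thesis .
  qed
  have L\<Phi>: "\<Phi> (L c) = L (\<lambda>i. \<phi> (c i))" if "\<And>i. i \<in> W \<Longrightarrow> c i \<in> carrier R" for c
  proof -
    have "\<Phi> (L c) = (\<Oplus>\<^bsub>S\<^esub>i\<in>W. \<Phi> (h (c i)) \<otimes>\<^bsub>S\<^esub> \<Phi> (u i))"
      unfolding L_def using that uW by (intro \<Phi>.hom_lincomb) auto
    also have "\<dots> = L (\<lambda>i. \<phi> (c i))"
      unfolding L_def using that uW comm by (intro S.finsum_cong') auto
    finally show ?thesis .
  qed
  have L0: "L (\<lambda>i. \<zero>) = \<zero>\<^bsub>S\<^esub>" using Lsm[of \<zero> "\<lambda>i. \<zero>"] Lc[of "\<lambda>i. \<zero>"] by simp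
  \<comment> \<open>The possible coefficients at \<open>u j\<close>, up to the embedding \<open>h\<close>.\<close>
  define J where "J = {b \<in> carrier R. \<exists>c\<in>W \<rightarrow> carrier R. h b \<otimes>\<^bsub>S\<^esub> u j \<oplus>\<^bsub>S\<^esub> L c = \<zero>\<^bsub>S\<^esub>}"
  have Jmult: "r \<otimes> b \<in> J" if r: "r \<in> carrier R" and b: "b \<in> J" for r b
  proof -
    obtain c where c: "b \<in> carrier R" "c \<in> W \<rightarrow> carrier R" "h b \<otimes>\<^bsub>S\<^esub> u j \<oplus>\<^bsub>S\<^esub> L c = \<zero>\<^bsub>S\<^esub>"
      using b unfolding J_def by blast
    have cc: "\<And>i. i \<in> W \<Longrightarrow> c i \<in> carrier R" using c by auto
    have "h (r \<otimes> b) \<otimes>\<^bsub>S\<^esub> u j \<oplus>\<^bsub>S\<^esub> L (\<lambda>i. r \<otimes> c i) = h r \<otimes>\<^bsub>S\<^esub> (h b \<otimes>\<^bsub>S\<^esub> u j \<oplus>\<^bsub>S\<^esub> L c)"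
      using r c(1) uj Lc[OF cc] Lsm[OF r cc] by (simp add: S.r_distr S.m_assoc)
    then have "h (r \<otimes> b) \<otimes>\<^bsub>S\<^esub> u j \<oplus>\<^bsub>S\<^esub> L (\<lambda>i. r \<otimes> c i) = \<zero>\<^bsub>S\<^esub>" using c(3) r by simp
    moreover have "(\<lambda>i. r \<otimes> c i) \<in> W \<rightarrow> carrier R" using cc r by auto
    ultimately show ?thesis unfolding J_def using r c(1) by blast
  qed
  have Jid: "ideal J R"
  proof (rule idealI)
    show "ring R" by (rule R.ring_axioms)
    show "subgroup J (add_monoid R)"
    proof (rule R.add.subgroupI)
      show "J \<subseteq> carrier R" unfolding J_def by blast
      have "h \<zero> \<otimes>\<^bsub>S\<^esub> u j \<oplus>\<^bsub>S\<^esub> L (\<lambda>i. \<zero>) = \<zero>\<^bsub>S\<^esub>" using L0 uj by simp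
      then have "\<zero> \<in> J" unfolding J_def by blast
      then show "J \<noteq> {}" by blast
      show "\<ominus> b \<in> J" if "b \<in> J" for b
      proof -
        have "b \<in> carrier R" using that unfolding J_def by blast
        then show ?thesis using Jmult[of "\<ominus> \<one>" b] that by (simp add: R.l_minus)
      qed
      show "b \<oplus> b' \<in> J" if bb: "b \<in> J" "b' \<in> J" for b b'
      proof -
        obtain c where c: "b \<in> carrier R" "c \<in> W \<rightarrow> carrier R" "h b \<otimes>\<^bsub>S\<^esub> u j \<oplus>\<^bsub>S\<^esub> L c = \<zero>\<^bsub>S\<^esub>"
          using bb unfolding J_def by blast
        obtain c' where c': "b' \<in> carrier R" "c' \<in> W \<rightarrow> carrier R" "h b' \<otimes>\<^bsub>S\<^esub> u j \<oplus>\<^bsub>S\<^esub> L c' = \<zero>\<^bsub>S\<^esub>"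
          using bb unfolding J_def by blast
        have cc: "\<And>i. i \<in> W \<Longrightarrow> c i \<in> carrier R" "\<And>i. i \<in> W \<Longrightarrow> c' i \<in> carrier R" using c c' by auto
        have gen: "(x \<oplus>\<^bsub>S\<^esub> x') \<otimes>\<^bsub>S\<^esub> w \<oplus>\<^bsub>S\<^esub> (y \<oplus>\<^bsub>S\<^esub> y') = (x \<otimes>\<^bsub>S\<^esub> w \<oplus>\<^bsub>S\<^esub> y) \<oplus>\<^bsub>S\<^esub> (x' \<otimes>\<^bsub>S\<^esub> w \<oplus>\<^bsub>S\<^esub> y')"
          if "x \<in> carrier S" "x' \<in> carrier S" "y \<in> carrier S" "y' \<in> carrier S" "w \<in> carrier S" for x x' y y' w
          using that by (simp add: S.l_distr S.a_ac)
        have "h (b \<oplus> b') \<otimes>\<^bsub>S\<^esub> u j \<oplus>\<^bsub>S\<^esub> L (\<lambda>i. c i \<oplus> c' i) =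
            (h b \<otimes>\<^bsub>S\<^esub> u j \<oplus>\<^bsub>S\<^esub> L c) \<oplus>\<^bsub>S\<^esub> (h b' \<otimes>\<^bsub>S\<^esub> u j \<oplus>\<^bsub>S\<^esub> L c')"
          using c(1) c'(1) uj Ladd[OF cc] gen[of "h b" "h b'" "L c" "L c'" "u j"] Lc[OF cc(1)] Lc[OF cc(2)] by simp
        then have "h (b \<oplus> b') \<otimes>\<^bsub>S\<^esub> u j \<oplus>\<^bsub>S\<^esub> L (\<lambda>i. c i \<oplus> c' i) = \<zero>\<^bsub>S\<^esub>" using c(3) c'(3) by simp
        moreover have "(\<lambda>i. c i \<oplus> c' i) \<in> W \<rightarrow> carrier R" using cc by auto
        ultimately show ?thesis unfolding J_def using c(1) c'(1) by blast
      qed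
    qed
    show "x \<otimes> b \<in> J" if "b \<in> J" "x \<in> carrier R" for b x using Jmult that by blast
    show "b \<otimes> x \<in> J" if "b \<in> J" "x \<in> carrier R" for b x
    proof -
      have "b \<in> carrier R" using that unfolding J_def by blast
      then show ?thesis using Jmult[OF that(2,1)] that by (simp add: R.m_comm)
    qed
  qed
  have J\<phi>: "\<phi> ` J \<subseteq> J"
  proof (rule image_subsetI)
    fix b assume "b \<in> J"
    then obtain c where c: "b \<in> carrier R" "c \<in> W \<rightarrow> carrier R" "h b \<otimes>\<^bsub>S\<^esub> u j \<oplus>\<^bsub>S\<^esub> L c = \<zero>\<^bsub>S\<^esub>"
      unfolding J_def by blast
    have cc: "\<And>i. i \<in> W \<Longrightarrow> c i \<in> carrier R" using c by auto
    have "\<Phi> (h b \<otimes>\<^bsub>S\<^esub> u j \<oplus>\<^bsub>S\<^esub> L c) = h (\<phi> b) \<otimes>\<^bsub>S\<^esub> u j \<oplus>\<^bsub>S\<^esub> L (\<lambda>i. \<phi> (c i))"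
      using c(1) uj comm L\<Phi>[OF cc] Lc[OF cc] by simp
    then have "h (\<phi> b) \<otimes>\<^bsub>S\<^esub> u j \<oplus>\<^bsub>S\<^esub> L (\<lambda>i. \<phi> (c i)) = \<zero>\<^bsub>S\<^esub>" using c(3) by simp
    moreover have "(\<lambda>i. \<phi> (c i)) \<in> W \<rightarrow> carrier R" using cc by auto
    ultimately show "\<phi> b \<in> J" unfolding J_def using c(1) by blast
  qed
  have "\<forall>I. ideal I R \<and> \<phi> ` I \<subseteq> I \<longrightarrow> I = {\<zero>} \<or> I = carrier R"
    by (rule conjunct2[OF simple[unfolded phi_simple_def]])
  from mp[OF spec[OF this] conjI[OF Jid J\<phi>]] have JJ: "J = {\<zero>} \<or> J = carrier R" .
  have ac: "a i \<in> carrier R" if "i \<in> insert j W" for i using funcset_mem[OF insert(5) that] .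
  have rel: "h (a j) \<otimes>\<^bsub>S\<^esub> u j \<oplus>\<^bsub>S\<^esub> L a = \<zero>\<^bsub>S\<^esub>"
  proof -
    have "(\<Oplus>\<^bsub>S\<^esub>i\<in>insert j W. h (a i) \<otimes>\<^bsub>S\<^esub> u i) = h (a j) \<otimes>\<^bsub>S\<^esub> u j \<oplus>\<^bsub>S\<^esub> L a"
      unfolding L_def using insert(1,2) ac uj uW by (intro S.finsum_insert) auto
    then show ?thesis using insert(6) by simp
  qed
  have ajJ: "a j \<in> J" unfolding J_def using rel ac by blast
  have "J \<noteq> carrier R"
  proof
    assume "J = carrier R"
    then have "\<one> \<in> J" by simp
    then obtain c where c: "c \<in> W \<rightarrow> carrier R" "h \<one> \<otimes>\<^bsub>S\<^esub> u j \<oplus>\<^bsub>S\<^esub> L c = \<zero>\<^bsub>S\<^esub>"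
      unfolding J_def by blast
    have cc: "\<And>i. i \<in> W \<Longrightarrow> c i \<in> carrier R" using c by auto
    have \<phi>c: "\<And>i. i \<in> W \<Longrightarrow> \<phi> (c i) \<in> carrier R" using cc by auto
    have nc: "\<And>i. i \<in> W \<Longrightarrow> \<ominus> c i \<in> carrier R" using cc by auto
    have 1: "u j \<oplus>\<^bsub>S\<^esub> L c = \<zero>\<^bsub>S\<^esub>" using c(2) uj by simp
    have "\<Phi> (u j \<oplus>\<^bsub>S\<^esub> L c) = u j \<oplus>\<^bsub>S\<^esub> L (\<lambda>i. \<phi> (c i))" using uj L\<Phi>[OF cc] Lc[OF cc] by simp
    then have 2: "u j \<oplus>\<^bsub>S\<^esub> L (\<lambda>i. \<phi> (c i)) = \<zero>\<^bsub>S\<^esub>" using 1 by simp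
    have "L c \<oplus>\<^bsub>S\<^esub> u j = \<zero>\<^bsub>S\<^esub>" using 1 S.a_comm[OF uj(1) Lc[OF cc]] by simp
    from S.minus_equality[OF this uj(1) Lc[OF cc]] have "\<ominus>\<^bsub>S\<^esub> u j = L c" .
    moreover have "L (\<lambda>i. \<phi> (c i)) \<oplus>\<^bsub>S\<^esub> u j = \<zero>\<^bsub>S\<^esub>" using 2 S.a_comm[OF uj(1) Lc[OF \<phi>c]] by simp
    from S.minus_equality[OF this uj(1) Lc[OF \<phi>c]] have "\<ominus>\<^bsub>S\<^esub> u j = L (\<lambda>i. \<phi> (c i))" .
    ultimately have "L (\<lambda>i. \<phi> (c i)) = L c" by simp
    moreover have "L (\<lambda>i. \<ominus> c i) = \<ominus>\<^bsub>S\<^esub> L c"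
    proof -
      have "L (\<lambda>i. \<ominus> c i) = L (\<lambda>i. (\<ominus> \<one>) \<otimes> c i)"
        unfolding L_def using cc uW by (intro S.finsum_cong') (auto simp: R.l_minus)
      also have "\<dots> = \<ominus>\<^bsub>S\<^esub> L c" using Lsm[OF _ cc, of "\<ominus> \<one>"] Lc[OF cc] by (simp add: S.l_minus)
      finally show ?thesis .
    qed
    ultimately have "L (\<lambda>i. \<phi> (c i) \<oplus> \<ominus> c i) = \<zero>\<^bsub>S\<^esub>" using Ladd[OF \<phi>c nc] Lc[OF cc] by (simp add: S.r_neg)
    then have rel0: "(\<Oplus>\<^bsub>S\<^esub>i\<in>W. h (\<phi> (c i) \<oplus> \<ominus> c i) \<otimes>\<^bsub>S\<^esub> u i) = \<zero>\<^bsub>S\<^esub>" unfolding L_def .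
    have ck: "h (c i) \<in> k" if "i \<in> W" for i
    proof (rule fixk[OF cc[OF that]])
      have "(\<lambda>i. \<phi> (c i) \<oplus> \<ominus> c i) \<in> W \<rightarrow> carrier R" using cc by auto
      from insert(3)[OF WI this rel0 that] have "\<phi> (c i) \<oplus> \<ominus> c i = \<zero>" .
      from R.minus_equality[OF this nc[OF that] \<phi>c[OF that]]
      show "\<phi> (c i) = c i" using cc[OF that] by simp
    qed
    define d where "d i = (if i = j then \<one>\<^bsub>S\<^esub> else h (c i))" for i
    have dk: "d \<in> insert j W \<rightarrow> k" using ck subringE(3)[OF k] unfolding d_def by auto
    have "(\<Oplus>\<^bsub>S\<^esub>i\<in>insert j W. d i \<otimes>\<^bsub>S\<^esub> u i) = d j \<otimes>\<^bsub>S\<^esub> u j \<oplus>\<^bsub>S\<^esub> (\<Oplus>\<^bsub>S\<^esub>i\<in>W. d i \<otimes>\<^bsub>S\<^esub> u i)"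
      using insert(1,2) uj uW cc by (intro S.finsum_insert) (auto simp: d_def)
    also have "(\<Oplus>\<^bsub>S\<^esub>i\<in>W. d i \<otimes>\<^bsub>S\<^esub> u i) = L c"
      unfolding L_def using insert(2) uW cc by (intro S.finsum_cong') (auto simp: d_def)
    also have "d j \<otimes>\<^bsub>S\<^esub> u j \<oplus>\<^bsub>S\<^esub> L c = \<zero>\<^bsub>S\<^esub>" using 1 uj by (simp add: d_def)
    finally have "d j = \<zero>\<^bsub>S\<^esub>"
      using lin_indepD[OF ind _ insert(4) dk, of j] insert(1) by simp
    then show False using one by (simp add: d_def)
  qed
  then have aj: "a j = \<zero>" using JJ ajJ by blast
  have "L a = \<zero>\<^bsub>S\<^esub>" using rel aj uj Lc[of a] ac by simp
  then have "a i = \<zero>" if "i \<in> W" for i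
    using insert(3)[OF WI _ _ that, of a] ac unfolding L_def by auto
  then show ?case using aj insert(7) by blast
qed simp

context cring
begin

lemma lin_indep_insert:
  assumes F: "subfield F R" and W: "finite W" "W \<subseteq> carrier R" and w: "w \<in> carrier R" "w \<notin> lspan R F W"
    and ind: "lin_indep R F {\<zero>} W (\<lambda>v. v)"
  shows "lin_indep R F {\<zero>} (insert w W) (\<lambda>v. v)"
  unfolding lin_indep_def
proof (intro allI impI, elim conjE)
  fix V c assume h: "finite V" "V \<subseteq> insert w W" "c \<in> V \<rightarrow> F" "(\<Oplus>v\<in>V. c v \<otimes> v) \<in> {\<zero>}"
  have FR: "subring F R" by (rule subfieldE(1)[OF F])
  note FE = subringE[OF FR]
  let ?V = "V - {w}"
  have cF: "c v \<in> F" "c v \<in> carrier R" if "v \<in> V" for v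
    using funcset_mem[OF h(3) that] FE(1) by auto
  have VW: "?V \<subseteq> W" using h(2) by blast
  have Vc: "v \<in> carrier R" if "v \<in> V" for v using that h(2) W w by blast
  show "\<forall>v\<in>V. c v = \<zero>"
  proof (cases "w \<in> V")
    case False
    then have "V \<subseteq> W" using h(2) by blast
    then show ?thesis using lin_indepD[OF ind h(1) _ h(3,4)] by blast
  next
    case True
    have "(\<Oplus>v\<in>insert w ?V. c v \<otimes> v) = c w \<otimes> w \<oplus> (\<Oplus>v\<in>?V. c v \<otimes> v)"
      using h(1) cF Vc True by (intro finsum_insert) auto
    moreover have "insert w ?V = V" using True by blast
    ultimately have r: "\<zero> = c w \<otimes> w \<oplus> (\<Oplus>v\<in>?V. c v \<otimes> v)" using h(4) by simp
    have rs: "(\<Oplus>v\<in>?V. c v \<otimes> v) \<in> lspan R F W"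
      using cF VW by (intro lspan_finsum lspan_smult_base FE(1) W(2)) auto
    have rc: "(\<Oplus>v\<in>?V. c v \<otimes> v) \<in> carrier R" by (rule lspan_closed[OF rs FE(1) W(2)])
    have cw: "c w = \<zero>"
    proof (rule ccontr)
      assume "c w \<noteq> \<zero>"
      then have "c w \<in> F - {\<zero>}" using cF True by blast
      then obtain d where d: "d \<in> F" "d \<otimes> c w = \<one>" using subfield_m_inv(1,3)[OF F] by blast
      have "w = \<ominus> (d \<otimes> (\<Oplus>v\<in>?V. c v \<otimes> v))"
        by (rule solve_for_leading_term[OF _ cF(2)[OF True] w(1) rc d(2) r]) (use d FE(1) in blast)
      moreover have "\<ominus> (d \<otimes> (\<Oplus>v\<in>?V. c v \<otimes> v)) \<in> lspan R F W"
        by (rule lspan_uminus[OF lspan_smult[OF rs d(1) FR W(2)] FR W(2)])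
      ultimately show False using w(2) by simp
    qed
    have "(\<Oplus>v\<in>?V. c v \<otimes> v) \<in> {\<zero>}" using r[symmetric] cw rc w(1) by simp
    then have "c v = \<zero>" if "v \<in> ?V" for v
      using lin_indepD[OF ind _ VW _ _ that, of c] h(1,3) by auto
    then show ?thesis using cw by blast
  qed
qed

lemma basis_of_finite_span:
  assumes F: "subfield F R" and "finite U" "U \<subseteq> carrier R"
  shows "\<exists>W\<subseteq>U. lin_indep R F {\<zero>} W (\<lambda>v. v) \<and> U \<subseteq> lspan R F W"
  using assms(2,3)
proof (induct U rule: finite_induct)
  case empty
  have "lin_indep R F {\<zero>} {} (\<lambda>v. v)" unfolding lin_indep_def by auto
  then show ?case by blast
next
  case (insert u U)
  have FR: "subring F R" by (rule subfieldE(1)[OF F])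
  obtain W where W: "W \<subseteq> U" "lin_indep R F {\<zero>} W (\<lambda>v. v)" "U \<subseteq> lspan R F W" using insert by auto
  have Wc: "W \<subseteq> carrier R" "finite W" using W(1) insert finite_subset by auto
  show ?case
  proof (cases "u \<in> lspan R F W")
    case True
    then show ?thesis using W by blast
  next
    case False
    have uW: "insert u W \<subseteq> carrier R" using insert Wc by blast
    have "lin_indep R F {\<zero>} (insert u W) (\<lambda>v. v)"
      using insert(4) by (intro lin_indep_insert[OF F Wc(2,1) _ False W(2)]) auto
    moreover have "u \<in> lspan R F (insert u W)" by (rule lspan_base[OF FR _ uW]) simp
    moreover have "lspan R F W \<subseteq> lspan R F (insert u W)" by (rule lspan_mono) auto
    ultimately show ?thesis using W by (intro exI[of _ "insert u W"]) auto
  qed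
qed

text \<open>
  Linear disjointness descends coefficients. If \<open>h\<close> were not in the \<open>F\<close>-span, adding it to a basis of the
  \<open>F\<close>-span of finitely many elements of \<open>U\<close> that express \<open>h\<close> over \<open>C\<close> would give a family in \<open>H\<close> that is
  independent over \<open>F\<close> but dependent over \<open>C\<close>.
\<close>

lemma lspan_descend:
  assumes F: "subfield F R" and C: "subring C R" "F \<subseteq> C" and U: "U \<subseteq> H" "H \<subseteq> carrier R"
    and H: "\<And>W. \<lbrakk>finite W; W \<subseteq> H; lin_indep R F {\<zero>} W (\<lambda>v. v)\<rbrakk> \<Longrightarrow> lin_indep R C {\<zero>} W (\<lambda>v. v)"
    and h: "h \<in> H" "h \<in> lspan R C U"
  shows "h \<in> lspan R F U"
proof (rule ccontr)
  assume neg: "h \<notin> lspan R F U"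
  have FR: "subring F R" by (rule subfieldE(1)[OF F])
  obtain U0 where U0: "finite U0" "U0 \<subseteq> U" "h \<in> lspan R C U0" using lspan_finite_support[OF h(2)] by blast
  have U0c: "U0 \<subseteq> carrier R" using U0 U by blast
  obtain W where W: "W \<subseteq> U0" "lin_indep R F {\<zero>} W (\<lambda>v. v)" "U0 \<subseteq> lspan R F W"
    using basis_of_finite_span[OF F U0(1) U0c] by blast
  have Wc: "finite W" "W \<subseteq> carrier R" "W \<subseteq> H" using W(1) U0 U finite_subset by auto
  have "lspan R F W \<subseteq> lspan R F U" using W(1) U0(2) by (intro lspan_mono) auto
  then have hW: "h \<notin> lspan R F W" using neg by blast
  have hc: "h \<in> carrier R" using h U by blast
  have "lin_indep R F {\<zero>} (insert h W) (\<lambda>v. v)" by (rule lin_indep_insert[OF F Wc(1,2) hc hW W(2)])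
  then have indC: "lin_indep R C {\<zero>} (insert h W) (\<lambda>v. v)" using Wc h by (intro H) auto
  have "h \<notin> W" using hW lspan_base[OF FR _ Wc(2)] by blast
  then have "h \<notin> lspan R C ((\<lambda>v. v) ` W)"
    using Wc hc subfieldE(6)[OF F] by (intro lin_indep_not_in_lspan[OF C(1) _ _ indC, of W h]) auto
  moreover have "U0 \<subseteq> lspan R C W" using W(3) lspan_mono[OF C(2) subset_refl] by blast
  then have "h \<in> lspan R C W" using lspan_least[OF _ C(1) Wc(2)] U0(3) by blast
  ultimately show False by simp
qed

lemma adjoin_eq_lspan_adjoin:
  assumes k: "k \<subseteq> C" and C: "subring C R" and V: "V \<subseteq> carrier R"
  shows "adjoin R C V = lspan R C (adjoin R k V)"
proof
  have kc: "k \<subseteq> carrier R" using k subringE(1)[OF C] by blast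
  let ?G = "adjoin R k V"
  have G: "subring ?G R" by (rule adjoin_subring[OF kc V])
  have sub: "subring (lspan R C ?G) R"
    by (rule lspan_subring[OF C subringE(1,3)[OF G]]) (rule subringE(6)[OF G])
  have Gs: "?G \<subseteq> lspan R C ?G" using lspan_base[OF C _ subringE(1)[OF G]] by blast
  show "adjoin R C V \<subseteq> lspan R C ?G"
  proof (rule adjoin_least[OF sub])
    show "V \<subseteq> lspan R C ?G" using Gs adjoin_incl(2)[of V k] by blast
    show "C \<subseteq> lspan R C ?G"
    proof
      fix c assume c: "c \<in> C"
      have "c \<otimes> \<one> \<in> lspan R C ?G" by (rule lspan_smult_base[OF c subringE(3)[OF G] subringE(1)[OF C] subringE(1)[OF G]])
      then show "c \<in> lspan R C ?G" using subring_carrier[OF C c] by simp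
    qed
  qed
  have A: "subring (adjoin R C V) R" by (rule adjoin_subring[OF subringE(1)[OF C] V])
  have "?G \<subseteq> adjoin R C V" by (rule adjoin_least[OF A]) (use k adjoin_incl[where F = C and V = V] in blast)+
  then show "lspan R C ?G \<subseteq> adjoin R C V" by (intro lspan_in_subring[OF A] adjoin_incl)
qed

end

section \<open>Krull dimension along a difference filtration\<close>

context cring
begin

lemma subring_cring: "subring A R \<Longrightarrow> cring (R\<lparr>carrier := A\<rparr>)"
  using subcring_iff[OF subringE(1)] subcringI' by blast

lemma nat_pow_subring: "a [^]\<^bsub>R\<lparr>carrier := A\<rparr>\<^esub> (n::nat) = a [^] n"
  by (simp add: nat_pow_def)

lemma finsum_subring:
  assumes A: "subring A R" and f: "f \<in> I \<rightarrow> A"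
  shows "finsum (R\<lparr>carrier := A\<rparr>) f I = finsum R f I"
proof -
  interpret B: cring "R\<lparr>carrier := A\<rparr>" by (rule subring_cring[OF A])
  have AC: "A \<subseteq> carrier R" by (rule subringE(1)[OF A])
  show ?thesis using f
  proof (induct I rule: infinite_finite_induct)
    case (infinite I)
    have "finsum R f I = \<zero>" using infinite by (intro finsum_infinite) auto
    moreover have "finsum (R\<lparr>carrier := A\<rparr>) f I = \<zero>\<^bsub>R\<lparr>carrier := A\<rparr>\<^esub>"
      using infinite by (intro B.finsum_infinite) auto
    ultimately show ?case by simp
  next
    case empty
    show ?case by simp
  next
    case (insert i I)
    have fA: "f j \<in> A" if "j \<in> insert i I" for j using funcset_mem[OF insert(4) that] .
    have "finsum (R\<lparr>carrier := A\<rparr>) f (insert i I) = f i \<oplus>\<^bsub>R\<lparr>carrier := A\<rparr>\<^esub> finsum (R\<lparr>carrier := A\<rparr>) f I"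
      using insert(1,2) fA by (intro B.finsum_insert) auto
    moreover have "finsum R f (insert i I) = f i \<oplus> finsum R f I"
      using insert(1,2) fA AC by (intro finsum_insert) auto
    ultimately show ?case using insert(3) fA by (simp add: Pi_def)
  qed
qed

lemma finprod_subring:
  assumes A: "subring A R" and f: "f \<in> I \<rightarrow> A"
  shows "finprod (R\<lparr>carrier := A\<rparr>) f I = finprod R f I"
proof -
  interpret B: cring "R\<lparr>carrier := A\<rparr>" by (rule subring_cring[OF A])
  have AC: "A \<subseteq> carrier R" by (rule subringE(1)[OF A])
  show ?thesis using f
  proof (induct I rule: infinite_finite_induct)
    case (infinite I)
    then show ?case by simp
  next
    case empty
    show ?case by simp
  next
    case (insert i I)
    have fA: "f j \<in> A" if "j \<in> insert i I" for j using funcset_mem[OF insert(4) that] .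
    have "finprod (R\<lparr>carrier := A\<rparr>) f (insert i I) = f i \<otimes>\<^bsub>R\<lparr>carrier := A\<rparr>\<^esub> finprod (R\<lparr>carrier := A\<rparr>) f I"
      using insert(1,2) fA by (intro B.finprod_insert) auto
    moreover have "finprod R f (insert i I) = f i \<otimes> finprod R f I"
      using insert(1,2) fA AC by (intro finprod_insert) auto
    ultimately show ?case using insert(3) fA by (simp add: Pi_def)
  qed
qed

text \<open>
  Finite sums and products in a subring agree with those of the ambient ring, so all Krull dimensions
  below can be expressed by independence inside one fixed ring.
\<close>

lemma alg_indep_subring:
  assumes A: "subring A R" and F: "F \<subseteq> A" and x: "x \<in> I \<rightarrow> A"
  shows "alg_indep (R\<lparr>carrier := A\<rparr>) F P I x \<longleftrightarrow> alg_indep R F P I x"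
proof -
  have pA: "(\<lambda>i. x i [^] \<alpha> i) \<in> I \<rightarrow> A" for \<alpha> :: "_ \<Rightarrow> nat"
    by (rule funcsetI) (rule pow_in_subring[OF A funcset_mem[OF x]])
  have pp: "power_prod (R\<lparr>carrier := A\<rparr>) x I \<alpha> = power_prod R x I \<alpha>" for \<alpha>
    unfolding power_prod_def nat_pow_subring by (rule finprod_subring[OF A pA])
  have ppA: "power_prod R x I \<alpha> \<in> A" for \<alpha>
    unfolding power_prod_def by (rule finprod_in_subring[OF A pA])
  have sums: "finsum (R\<lparr>carrier := A\<rparr>) (\<lambda>\<alpha>. c \<alpha> \<otimes> power_prod R x I \<alpha>) W = finsum R (\<lambda>\<alpha>. c \<alpha> \<otimes> power_prod R x I \<alpha>) W"
    if "c \<in> W \<rightarrow> F" for c W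
    using that F ppA subringE(6)[OF A] by (intro finsum_subring[OF A]) blast
  show ?thesis unfolding alg_indep_def lin_indep_def pp by (simp add: sums cong: conj_cong)
qed

lemma subfield_subring:
  assumes "subfield F R" "subring A R" "F \<subseteq> A"
  shows "subfield F (R\<lparr>carrier := A\<rparr>)"
proof -
  interpret B: cring "R\<lparr>carrier := A\<rparr>" by (rule subring_cring[OF assms(2)])
  have "field (R\<lparr>carrier := F\<rparr>)" by (rule subfield_iff(2)[OF assms(1)])
  then show ?thesis using B.subfield_iff(1)[of F] assms(3) by simp
qed

theorem krull_dim_adjoin_ge_iff:
  assumes F: "subfield F R" and V: "finite V" "V \<subseteq> carrier R"
  shows "enat l \<le> krull_dim (R\<lparr>carrier := adjoin R F V\<rparr>) \<longleftrightarrow> alg_indep_of_size R F (adjoin R F V) l"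
proof -
  let ?A = "adjoin R F V"
  let ?B = "R\<lparr>carrier := ?A\<rparr>"
  have FC: "F \<subseteq> carrier R" by (rule subfieldE(3)[OF F])
  have A: "subring ?A R" by (rule adjoin_subring[OF FC V(2)])
  have FV: "F \<subseteq> ?A" "V \<subseteq> ?A" using adjoin_incl by blast+
  interpret B: cring ?B by (rule subring_cring[OF A])
  have FB: "subfield F ?B" by (rule subfield_subring[OF F A FV(1)])
  have gen: "carrier ?B = adjoin ?B F V"
    using subring_gen_equality[OF A, of "F \<union> V"] FV unfolding adjoin_def by simp
  have "enat l \<le> krull_dim ?B \<longleftrightarrow> alg_indep_of_size ?B F ?A l"
    using B.krull_dim_ge_iff_alg_indep_of_size[OF FB V(1) _ gen, of l] FV(2) by simp
  also have "\<dots> \<longleftrightarrow> alg_indep_of_size R F ?A l"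
    unfolding alg_indep_of_size_def by (simp add: alg_indep_subring[OF A FV(1)] cong: conj_cong)
  finally show ?thesis .
qed

lemma alg_indep_over_bigger_ring_imp_size:
  assumes F: "subfield F R" and C: "subring C R" and FC: "F \<subseteq> C"
    and red: "\<And>a. \<lbrakk>a \<in> C; a \<otimes> a = \<zero>\<rbrakk> \<Longrightarrow> a = \<zero>"
    and V: "finite V" "V \<subseteq> carrier R"
    and y: "finite I" "y \<in> I \<rightarrow> adjoin R C V" "alg_indep R C {\<zero>} I y"
  shows "alg_indep_of_size R F V (card I)"
proof -
  obtain s where "bij_betw s {0..<card V} V" using ex_bij_betw_nat_finite[OF V(1)] by blast
  then have s: "s ` {..<card V} = V" by (simp add: bij_betw_def atLeast0LessThan)
  have sc: "s \<in> {..<card V} \<rightarrow> carrier R" using s V by auto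
  have "y ` I \<subseteq> lspan R C (power_prod R s {..<card V} ` expo {..<card V})"
    using y(2) adjoin_eq_lspan_power_prods[OF C _ sc] s by auto
  then obtain J where J: "J \<subseteq> {..<card V}" "card J = card I" "alg_indep R F {\<zero>} J s"
    using alg_indep_many_imp_generators_alg_indep[OF F C FC red sc y(1) _ y(3)] by blast
  have "finite J" by (rule finite_subset[OF J(1)]) simp
  moreover have "s \<in> J \<rightarrow> V" using s J(1) by auto
  ultimately show ?thesis unfolding alg_indep_of_size_def using J(2,3) by blast
qed

lemma alg_indep_of_size_mono: "alg_indep_of_size R F A l \<Longrightarrow> A \<subseteq> B \<Longrightarrow> alg_indep_of_size R F B l"
  unfolding alg_indep_of_size_def by blast

lemma alg_indep_of_size_le_card:
  assumes F: "subfield F R" and V: "finite V" "V \<subseteq> carrier R" and l: "alg_indep_of_size R F (adjoin R F V) l"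
  shows "l \<le> card V"
proof -
  have FR: "subring F R" by (rule subfieldE(1)[OF F])
  obtain x :: "nat \<Rightarrow> 'a" and I where x: "finite I" "card I = l" "x \<in> I \<rightarrow> adjoin R F V" "alg_indep R F {\<zero>} I x"
    using l unfolding alg_indep_of_size_def by blast
  obtain s where "bij_betw s {0..<card V} V" using ex_bij_betw_nat_finite[OF V(1)] by blast
  then have s: "s ` {..<card V} = V" by (simp add: bij_betw_def atLeast0LessThan)
  have sc: "s \<in> {..<card V} \<rightarrow> carrier R" using s V by auto
  have "x ` I \<subseteq> lspan R F (power_prod R s {..<card V} ` expo {..<card V})"
    using x(3) adjoin_eq_lspan_power_prods[OF FR _ sc] s by auto
  moreover have "a = \<zero>" if "a \<in> F" "a \<otimes> a = \<zero>" for a using subfieldE(5)[OF F] that by blast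
  ultimately obtain J where "J \<subseteq> {..<card V}" "card J = card I"
    using alg_indep_many_imp_generators_alg_indep[OF F FR subset_refl _ sc x(1) _ x(4)] by blast
  then show ?thesis using x(2) card_mono[of "{..<card V}" J] by simp
qed

end

lemma enat_le_by_finite: "(\<And>l. enat l \<le> a \<Longrightarrow> enat l \<le> b) \<Longrightarrow> a \<le> b"
proof (cases a)
  case infinity
  assume h: "\<And>l. enat l \<le> a \<Longrightarrow> enat l \<le> b"
  show ?thesis
  proof (cases b)
    case (enat m)
    then show ?thesis using h[of "Suc m"] infinity by simp
  qed simp
qed simp

definition sigma_orbit :: "('a \<Rightarrow> 'a) \<Rightarrow> 'a set \<Rightarrow> nat \<Rightarrow> 'a set" where
  "sigma_orbit \<sigma> S i = (\<Union>j\<le>i. (\<sigma> ^^ j) ` S)"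

text \<open>
  The coefficients are only required to form a ring, since the filtrations are also compared over
  the copy \<open>R \<otimes> 1\<close> of \<open>R\<close> in the tensor square.
\<close>

locale sigma_over_subring = cring R for R (structure) +
  fixes F and \<sigma>
  assumes F_subring: "subring F R" and sigma: "\<sigma> \<in> ring_hom R R" and sigma_F: "\<sigma> ` F \<subseteq> F"
begin

abbreviation orbit :: "'a set \<Rightarrow> nat \<Rightarrow> 'a set" where
  "orbit \<equiv> sigma_orbit \<sigma>"

lemma FC: "F \<subseteq> carrier R"
  by (rule subringE(1)[OF F_subring])

lemma sigma_pow_closed: "a \<in> carrier R \<Longrightarrow> (\<sigma> ^^ j) a \<in> carrier R"
  by (induct j) (auto simp: ring_hom_closed[OF sigma])

lemma orbit_finite: "finite S \<Longrightarrow> finite (orbit S i)"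
  by (simp add: sigma_orbit_def)

lemma orbit_carrier: "S \<subseteq> carrier R \<Longrightarrow> orbit S i \<subseteq> carrier R"
  using sigma_pow_closed by (auto simp: sigma_orbit_def)

lemma orbit_mono: "i \<le> j \<Longrightarrow> orbit S i \<subseteq> orbit S j"
  unfolding sigma_orbit_def by (intro UN_mono) auto

lemma adjoin_mono: "V \<subseteq> W \<Longrightarrow> W \<subseteq> carrier R \<Longrightarrow> adjoin R F V \<subseteq> adjoin R F W"
  unfolding adjoin_def using FC by (intro mono_generate_ring) auto

lemma card_orbit: "finite S \<Longrightarrow> card (orbit S i) \<le> card S * (i + 1)"
proof -
  assume S: "finite S"
  have "card (orbit S i) \<le> (\<Sum>j\<le>i. card ((\<sigma> ^^ j) ` S))" unfolding sigma_orbit_def by (intro card_UN_le) simp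
  also have "\<dots> \<le> (\<Sum>j\<le>i. card S)" by (intro sum_mono card_image_le S)
  finally show ?thesis by (simp add: mult.commute)
qed

lemma sigma_adjoin:
  assumes "V \<subseteq> carrier R"
  shows "(\<sigma> ^^ j) ` adjoin R F V \<subseteq> adjoin R F ((\<sigma> ^^ j) ` V)"
proof (induct j)
  case (Suc j)
  let ?W = "(\<sigma> ^^ j) ` V"
  have W: "?W \<subseteq> carrier R" using assms sigma_pow_closed by auto
  have sW: "\<sigma> ` ?W \<subseteq> carrier R" using W ring_hom_closed[OF sigma] by auto
  have hr: "ring_hom_ring R R \<sigma>" by (intro ring_hom_ringI2 ring_axioms sigma)
  have "\<sigma> ` adjoin R F ?W = generate_ring R (\<sigma> ` (F \<union> ?W))"
    unfolding adjoin_def using FC W by (intro ring_hom_ring.hom_generate_ring[OF hr]) auto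
  also have "\<dots> \<subseteq> adjoin R F (\<sigma> ` ?W)"
    unfolding adjoin_def using FC sW sigma_F by (intro mono_generate_ring) auto
  finally have 1: "\<sigma> ` adjoin R F ?W \<subseteq> adjoin R F (\<sigma> ` ?W)" .
  have "(\<sigma> ^^ Suc j) ` adjoin R F V = \<sigma> ` ((\<sigma> ^^ j) ` adjoin R F V)" by (simp add: image_image)
  also have "\<dots> \<subseteq> adjoin R F (\<sigma> ` ?W)" using 1 Suc by blast
  also have "\<sigma> ` ?W = (\<sigma> ^^ Suc j) ` V" by (simp add: image_image)
  finally show ?case .
qed simp

text \<open>
  If the elements of \<open>S\<close> are polynomials in conjugates of order at most \<open>c\<close>, then their conjugates of
  order \<open>i\<close> are polynomials in conjugates of order at most \<open>i + c\<close>.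
\<close>

lemma adjoin_orbit_shift:
  assumes S: "S \<subseteq> adjoin R F (orbit S' c)" and S': "S' \<subseteq> carrier R"
  shows "adjoin R F (orbit S i) \<subseteq> adjoin R F (orbit S' (i + c))"
proof (rule adjoin_least)
  have oc: "orbit S' n \<subseteq> carrier R" for n by (rule orbit_carrier[OF S'])
  show "subring (adjoin R F (orbit S' (i + c))) R" by (rule adjoin_subring[OF FC oc])
  show "F \<subseteq> adjoin R F (orbit S' (i + c))" by (rule adjoin_incl)
  show "orbit S i \<subseteq> adjoin R F (orbit S' (i + c))"
  proof
    fix v assume "v \<in> orbit S i"
    then obtain j a where j: "j \<le> i" "a \<in> S" "v = (\<sigma> ^^ j) a" unfolding sigma_orbit_def by blast
    have "v \<in> adjoin R F ((\<sigma> ^^ j) ` orbit S' c)" using sigma_adjoin[OF oc, of j c] j S by blast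
    moreover have "(\<sigma> ^^ j) ` orbit S' c \<subseteq> orbit S' (i + c)"
    proof
      fix w assume "w \<in> (\<sigma> ^^ j) ` orbit S' c"
      then obtain m b where m: "m \<le> c" "b \<in> S'" "w = (\<sigma> ^^ j) ((\<sigma> ^^ m) b)" unfolding sigma_orbit_def by auto
      then have "w = (\<sigma> ^^ (j + m)) b" by (simp add: funpow_add)
      moreover have "j + m \<le> i + c" using j m by simp
      ultimately show "w \<in> orbit S' (i + c)" unfolding sigma_orbit_def using m(2) by blast
    qed
    ultimately show "v \<in> adjoin R F (orbit S' (i + c))" using adjoin_mono[OF _ oc] by blast
  qed
qed

lemma generated_in_adjoin_orbit:
  assumes S: "S \<subseteq> carrier R" and v: "v \<in> generate_ring R (F \<union> (\<Union>i. (\<sigma> ^^ i) ` S))"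
  shows "\<exists>c. v \<in> adjoin R F (orbit S c)"
  using v
proof induct
  have A: "subring (adjoin R F (orbit S c)) R" for c by (rule adjoin_subring[OF FC orbit_carrier[OF S]])
  have mono: "adjoin R F (orbit S c) \<subseteq> adjoin R F (orbit S (max c c'))"
    "adjoin R F (orbit S c') \<subseteq> adjoin R F (orbit S (max c c'))" for c c'
    by (intro adjoin_mono orbit_mono orbit_carrier S; simp)+
  {
    case one
    show ?case using subringE(3)[OF A] by blast
  next
    case (incl h)
    show ?case
    proof (cases "h \<in> F")
      case True
      then show ?thesis using adjoin_incl(1) by blast
    next
      case False
      then obtain i where "h \<in> (\<sigma> ^^ i) ` S" using incl by blast
      then have "h \<in> orbit S i" unfolding sigma_orbit_def by blast
      then show ?thesis using adjoin_incl(2) by blast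
    qed
  next
    case (a_inv h)
    then show ?case using subringE(5)[OF A] by blast
  next
    case (eng_add g h)
    then obtain c c' where "g \<in> adjoin R F (orbit S c)" "h \<in> adjoin R F (orbit S c')" by blast
    then have "g \<oplus> h \<in> adjoin R F (orbit S (max c c'))" using mono by (intro subringE(7)[OF A]) blast+
    then show ?case by blast
  next
    case (eng_mult g h)
    then obtain c c' where "g \<in> adjoin R F (orbit S c)" "h \<in> adjoin R F (orbit S c')" by blast
    then have "g \<otimes> h \<in> adjoin R F (orbit S (max c c'))" using mono by (intro subringE(6)[OF A]) blast+
    then show ?case by blast
  }
qed

lemma finite_in_adjoin_orbit:
  assumes S: "S \<subseteq> carrier R" and V: "finite V" "V \<subseteq> generate_ring R (F \<union> (\<Union>i. (\<sigma> ^^ i) ` S))"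
  shows "\<exists>c. V \<subseteq> adjoin R F (orbit S c)"
  using V
proof (induct V rule: finite_induct)
  case (insert v V)
  then obtain c where c: "V \<subseteq> adjoin R F (orbit S c)" by auto
  obtain c' where c': "v \<in> adjoin R F (orbit S c')" using generated_in_adjoin_orbit[OF S] insert by blast
  have "adjoin R F (orbit S c) \<subseteq> adjoin R F (orbit S (max c c'))"
    "adjoin R F (orbit S c') \<subseteq> adjoin R F (orbit S (max c c'))"
    by (intro adjoin_mono orbit_mono orbit_carrier S; simp)+
  then show ?case using c c' by (intro exI[of _ "max c c'"]) blast
qed simp

end

locale sigma_over_subfield = sigma_over_subring +
  assumes F: "subfield F R"
begin

definition ord_dim :: "'a set \<Rightarrow> nat \<Rightarrow> enat" where
  "ord_dim S i = krull_dim (R\<lparr>carrier := adjoin R F (orbit S i)\<rparr>)"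

lemma ord_dim_bound:
  assumes "finite S" "S \<subseteq> carrier R"
  shows "ord_dim S i \<le> enat (card S * (i + 1))"
proof (rule enat_le_by_finite)
  fix l assume "enat l \<le> ord_dim S i"
  then have "alg_indep_of_size R F (adjoin R F (orbit S i)) l"
    unfolding ord_dim_def using krull_dim_adjoin_ge_iff[OF F orbit_finite orbit_carrier] assms by blast
  then have "l \<le> card (orbit S i)"
    using alg_indep_of_size_le_card[OF F orbit_finite orbit_carrier] assms by blast
  also have "\<dots> \<le> card S * (i + 1)" by (rule card_orbit[OF assms(1)])
  finally show "enat l \<le> enat (card S * (i + 1))" by simp
qed

lemma ord_dim_mono:
  assumes "finite S" "S \<subseteq> carrier R" "finite S'" "S' \<subseteq> carrier R"
    "adjoin R F (orbit S i) \<subseteq> adjoin R F (orbit S' i')"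
  shows "ord_dim S i \<le> ord_dim S' i'"
proof (rule enat_le_by_finite)
  fix l assume "enat l \<le> ord_dim S i"
  then have "alg_indep_of_size R F (adjoin R F (orbit S i)) l"
    unfolding ord_dim_def using krull_dim_adjoin_ge_iff[OF F orbit_finite orbit_carrier] assms by blast
  then have "alg_indep_of_size R F (adjoin R F (orbit S' i')) l"
    unfolding alg_indep_of_size_def using assms(5) by blast
  then show "enat l \<le> ord_dim S' i'"
    unfolding ord_dim_def using krull_dim_adjoin_ge_iff[OF F orbit_finite orbit_carrier] assms by blast
qed

text \<open>
  The upper limit in the definition of the \<open>\<sigma>\<close>-dimension. The dimensions are finite by
  \<open>ord_dim_bound\<close>, so passing to natural numbers loses nothing and permits arithmetic with
  real quotients.
\<close>

definition growth :: "'a set \<Rightarrow> ereal" where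
  "growth S = limsup (\<lambda>i. ereal (real (the_enat (ord_dim S i)) / real (i + 1)))"

lemma ord_dim_finite:
  assumes "finite S" "S \<subseteq> carrier R"
  shows "enat (the_enat (ord_dim S i)) = ord_dim S i"
  using ord_dim_bound[OF assms, of i] by (cases "ord_dim S i") auto

text \<open>
  A finite set is contained in some step of the filtration of any generating set, so its filtration is a
  subfiltration up to a shift, and a shift is invisible in the growth rate.
\<close>

lemma growth_mono:
  assumes S: "finite S" "S \<subseteq> carrier R" and S': "finite S'" "S' \<subseteq> carrier R"
    and gen: "carrier R = generate_ring R (F \<union> (\<Union>i. (\<sigma> ^^ i) ` S'))"
  shows "growth S \<le> growth S'"
proof -
  obtain c where c: "S \<subseteq> adjoin R F (orbit S' c)"
    using finite_in_adjoin_orbit[OF S'(2) S(1)] S(2) gen by auto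
  show ?thesis unfolding growth_def
  proof (rule limsup_ratio_mono_shift)
    fix i
    have "ord_dim S i \<le> ord_dim S' (i + c)" by (rule ord_dim_mono[OF S S' adjoin_orbit_shift[OF c S'(2)]])
    then have "enat (the_enat (ord_dim S i)) \<le> enat (the_enat (ord_dim S' (i + c)))"
      by (simp only: ord_dim_finite[OF S] ord_dim_finite[OF S'])
    then show "the_enat (ord_dim S i) \<le> the_enat (ord_dim S' (i + c))" by simp
    have "enat (the_enat (ord_dim S' i)) \<le> enat (card S' * (i + 1))"
      using ord_dim_bound[OF S'] by (simp only: ord_dim_finite[OF S'])
    then show "the_enat (ord_dim S' i) \<le> card S' * (i + 1)" by simp
  qed
qed

lemma sigma_dim_wrt_growth:
  assumes E: "\<iota> ` carrier E = F" and S: "finite S" "S \<subseteq> carrier R"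
  shows "sigma_dim_wrt E \<iota> R \<sigma> S = \<lfloor>real_of_ereal (growth S)\<rfloor>"
proof -
  have "ereal_of_enat (ord_dim S i) / ereal (real (i + 1)) =
      ereal (real (the_enat (ord_dim S i)) / real (i + 1))" for i
    by (subst ord_dim_finite[OF S, symmetric]) simp
  then show ?thesis
    unfolding sigma_dim_wrt_def growth_def E Let_def
    by (simp only: adjoin_def[symmetric] sigma_orbit_def[symmetric] ord_dim_def[symmetric])
qed

theorem sigma_dim_eq_wrt:
  assumes E: "\<iota> ` carrier E = F" and S: "finite S" "S \<subseteq> carrier R" "carrier R = sigma_generate E \<iota> R \<sigma> S"
  shows "sigma_dim E \<iota> R \<sigma> = sigma_dim_wrt E \<iota> R \<sigma> S"
  unfolding sigma_dim_def
proof (rule the_equality)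
  show "\<exists>S'. finite S' \<and> S' \<subseteq> carrier R \<and> carrier R = sigma_generate E \<iota> R \<sigma> S' \<and>
      sigma_dim_wrt E \<iota> R \<sigma> S = sigma_dim_wrt E \<iota> R \<sigma> S'"
    using S by blast
  fix d assume "\<exists>S'. finite S' \<and> S' \<subseteq> carrier R \<and> carrier R = sigma_generate E \<iota> R \<sigma> S' \<and>
      d = sigma_dim_wrt E \<iota> R \<sigma> S'"
  then obtain S' where S': "finite S'" "S' \<subseteq> carrier R" "carrier R = sigma_generate E \<iota> R \<sigma> S'"
    "d = sigma_dim_wrt E \<iota> R \<sigma> S'" by blast
  have "growth S = growth S'"
    using growth_mono[OF S(1,2) S'(1,2)] growth_mono[OF S'(1,2) S(1,2)] S(3) S'(3)
    unfolding sigma_generate_def E by (intro antisym) auto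
  then show "d = sigma_dim_wrt E \<iota> R \<sigma> S"
    unfolding S'(4) sigma_dim_wrt_growth[OF E S(1,2)] sigma_dim_wrt_growth[OF E S'(1,2)] by simp
qed

end

section \<open>Transfer between an algebra and the constants of its tensor square\<close>

lemma (in ring_hom_cring) hom_adjoin:
  assumes "F \<subseteq> carrier R" "V \<subseteq> carrier R"
  shows "h ` adjoin R F V = adjoin S (h ` F) (h ` V)"
proof -
  have "F \<union> V \<subseteq> carrier R" using assms by blast
  from ring.hom_generate_ring[OF this] show ?thesis unfolding adjoin_def by (simp add: image_Un)
qed

lemma (in ring_hom_cring) lin_indep_over_imageI:
  assumes "\<And>W a i. \<lbrakk>finite W; W \<subseteq> I; a \<in> W \<rightarrow> carrier R;
      (\<Oplus>\<^bsub>S\<^esub>i\<in>W. h (a i) \<otimes>\<^bsub>S\<^esub> u i) = \<zero>\<^bsub>S\<^esub>; i \<in> W\<rbrakk> \<Longrightarrow> a i = \<zero>"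
    and u: "\<And>i. i \<in> I \<Longrightarrow> u i \<in> carrier S"
  shows "lin_indep S (h ` carrier R) {\<zero>\<^bsub>S\<^esub>} I u"
  unfolding lin_indep_def
proof (intro allI impI ballI, elim conjE)
  fix W c i assume W: "finite W" "W \<subseteq> I" and c: "c \<in> W \<rightarrow> h ` carrier R"
    and rel: "(\<Oplus>\<^bsub>S\<^esub>i\<in>W. c i \<otimes>\<^bsub>S\<^esub> u i) \<in> {\<zero>\<^bsub>S\<^esub>}" and i: "i \<in> W"
  have "\<forall>j\<in>W. \<exists>b. b \<in> carrier R \<and> h b = c j" using funcset_mem[OF c] by (metis imageE)
  then obtain a where a: "\<And>j. j \<in> W \<Longrightarrow> a j \<in> carrier R \<and> h (a j) = c j" by metis
  have "(\<Oplus>\<^bsub>S\<^esub>i\<in>W. h (a i) \<otimes>\<^bsub>S\<^esub> u i) = (\<Oplus>\<^bsub>S\<^esub>i\<in>W. c i \<otimes>\<^bsub>S\<^esub> u i)"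
  proof (rule S.finsum_cong')
    show "(\<lambda>i. c i \<otimes>\<^bsub>S\<^esub> u i) \<in> W \<rightarrow> carrier S"
    proof (rule funcsetI)
      fix j assume j: "j \<in> W"
      have "c j \<in> carrier S" using a[OF j] hom_closed by metis
      moreover have "u j \<in> carrier S" using u W j by blast
      ultimately show "c j \<otimes>\<^bsub>S\<^esub> u j \<in> carrier S" by simp
    qed
  next
    fix j assume "j \<in> W"
    then show "h (a j) \<otimes>\<^bsub>S\<^esub> u j = c j \<otimes>\<^bsub>S\<^esub> u j" using a by simp
  qed simp
  then have "(\<Oplus>\<^bsub>S\<^esub>i\<in>W. h (a i) \<otimes>\<^bsub>S\<^esub> u i) = \<zero>\<^bsub>S\<^esub>" using rel by simp
  moreover have "a \<in> W \<rightarrow> carrier R" using a by auto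
  ultimately have "a i = \<zero>" using assms(1)[OF W _ _ i] by blast
  then show "c i = \<zero>\<^bsub>S\<^esub>" using a[OF i] hom_zero by metis
qed

text \<open>
  The intersection of all prime ideals is stable under \<open>\<phi>\<close>, because the preimage of a prime ideal under
  \<open>\<phi>\<close> is prime. It is a proper ideal, hence zero, and it contains all elements of square zero.
\<close>

lemma (in cring) phi_simple_reduced:
  assumes \<phi>: "\<phi> \<in> ring_hom R R" and simple: "phi_simple R \<phi>" and x: "x \<in> carrier R" "x \<otimes> x = \<zero>"
  shows "x = \<zero>"
proof -
  interpret \<phi>: ring_hom_ring R R \<phi> by (intro ring_hom_ringI2 ring_axioms \<phi>)
  define N where "N = \<Inter>{P. primeideal P R}"
  have neq: "\<one> \<noteq> \<zero>" using simple carrier_one_zero one_zeroD unfolding phi_simple_def by blast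
  have "{\<zero>} \<inter> {\<one>} = {}" using neq by auto
  then obtain Q where Q: "primeideal Q R" using exists_primeideal_disjoint[OF zeroideal, of "{\<one>}"] by auto
  have NQ: "N \<subseteq> Q" unfolding N_def using Q by blast
  have "ideal N R" unfolding N_def by (rule i_Intersect) (use Q primeideal.axioms(1) in auto)
  moreover have "\<phi> ` N \<subseteq> N"
  proof
    fix z assume "z \<in> \<phi> ` N"
    then obtain y where y: "y \<in> N" "z = \<phi> y" by blast
    have "z \<in> P" if P: "primeideal P R" for P
    proof -
      have "N \<subseteq> {r \<in> carrier R. \<phi> r \<in> P}"
        unfolding N_def using \<phi>.primeideal_vimage[OF is_cring P] by (intro Inter_lower) simp
      then show ?thesis using y by auto
    qed
    then show "z \<in> N" unfolding N_def by blast
  qed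
  moreover have "N \<noteq> carrier R"
  proof
    assume "N = carrier R"
    moreover have "Q \<subseteq> carrier R" using ideal.Icarr[OF primeideal.axioms(1)[OF Q]] by blast
    ultimately have "carrier R = Q" using NQ by blast
    then show False using primeideal.I_notcarr[OF Q] by blast
  qed
  ultimately have N0: "N = {\<zero>}" using simple unfolding phi_simple_def by blast
  have "x \<in> P" if P: "primeideal P R" for P
  proof -
    interpret P: primeideal P R by (rule P)
    have "x \<otimes> x \<in> P" using x(2) P.zero_closed by simp
    then show ?thesis using P.I_prime x(1) by blast
  qed
  then have "x \<in> N" unfolding N_def by blast
  then show ?thesis using N0 by blast
qed

text \<open>
  What the comparison needs to know about a Picard--Vessiot ring: finite sets \<open>S\<close> and \<open>V\<close> such that \<open>S\<close>
  generates \<open>R\<close> over \<open>K\<close>, the elements of \<open>V\<close> are constants of the tensor square, and \<open>V\<close> and the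
  image of \<open>S\<close> in the second factor are polynomials in each other over the first factor. Over \<open>C\<close> the
  tensor square is thus generated by constants.
\<close>

locale split_square = tensor_square +
  fixes \<phi> \<sigma> :: "'a \<Rightarrow> 'a" and S V
  assumes phi: "\<phi> \<in> ring_hom R R" and sigma: "\<sigma> \<in> ring_hom R R"
    and commute: "a \<in> carrier R \<Longrightarrow> \<phi> (\<sigma> a) = \<sigma> (\<phi> a)"
    and simple: "phi_simple R \<phi>"
    and K_field: "subfield (\<iota> ` carrier K) R"
    and phi_K: "c \<in> carrier K \<Longrightarrow> \<exists>c'\<in>carrier K. \<phi> (\<iota> c) = \<iota> c'"
    and sigma_K: "c \<in> carrier K \<Longrightarrow> \<exists>c'\<in>carrier K. \<sigma> (\<iota> c) = \<iota> c'"
    and const_field: "subfield {r \<in> carrier R. \<phi> r = r} R"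
    and const_K: "{r \<in> carrier R. \<phi> r = r} \<subseteq> \<iota> ` carrier K"
    and S: "finite S" "S \<subseteq> carrier R"
      "carrier R = generate_ring R (\<iota> ` carrier K \<union> (\<Union>i. (\<sigma> ^^ i) ` S))"
    and V: "finite V" "V \<subseteq> carrier (tensor_ring K \<iota> R \<iota> R)"
      "v \<in> V \<Longrightarrow> tensor_endo K \<iota> R \<iota> R \<phi> \<phi> v = v"
    and V_rt: "V \<subseteq> adjoin (tensor_ring K \<iota> R \<iota> R)
      ((\<lambda>a. tensor K \<iota> R \<iota> R a \<one>) ` carrier R) ((\<lambda>a. tensor K \<iota> R \<iota> R \<one> a) ` S)"
    and rt_V: "(\<lambda>a. tensor K \<iota> R \<iota> R \<one> a) ` S \<subseteq> adjoin (tensor_ring K \<iota> R \<iota> R)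
      ((\<lambda>a. tensor K \<iota> R \<iota> R a \<one>) ` carrier R) V"
begin

abbreviation "PhiT \<equiv> tensor_endo K \<iota> R \<iota> R \<phi> \<phi>"
abbreviation "SigmaT \<equiv> tensor_endo K \<iota> R \<iota> R \<sigma> \<sigma>"
abbreviation "C \<equiv> lt ` carrier R"
abbreviation "kR \<equiv> {r \<in> carrier R. \<phi> r = r}"
abbreviation "kT \<equiv> lt ` kR"
abbreviation "KR \<equiv> \<iota> ` carrier K"
abbreviation "H \<equiv> {t \<in> carrier TR. PhiT t = t}"

sublocale T: cring TR by (rule TR_cring)
sublocale lt: ring_hom_cring R TR lt
  by (intro ring_hom_cring.intro ring_hom_cring_axioms.intro is_cring T.is_cring lt_hom)
sublocale rt: ring_hom_cring R TR rt
  by (intro ring_hom_cring.intro ring_hom_cring_axioms.intro is_cring T.is_cring rt_hom)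
sublocale PhiT: ring_hom_cring TR TR PhiT
  by (intro ring_hom_cring.intro ring_hom_cring_axioms.intro T.is_cring tensor_endo_props(1) phi phi_K)
sublocale SigmaT: ring_hom_cring TR TR SigmaT
  by (intro ring_hom_cring.intro ring_hom_cring_axioms.intro T.is_cring tensor_endo_props(1) sigma sigma_K)

lemmas PhiT_tens = tensor_endo_props(2)[OF phi phi_K]
lemmas SigmaT_tens = tensor_endo_props(2)[OF sigma sigma_K]

lemma phi_closed: "a \<in> carrier R \<Longrightarrow> \<phi> a \<in> carrier R" by (rule ring_hom_closed[OF phi])
lemma sigma_closed: "a \<in> carrier R \<Longrightarrow> \<sigma> a \<in> carrier R" by (rule ring_hom_closed[OF sigma])
lemma sigma_pow_closed: "a \<in> carrier R \<Longrightarrow> (\<sigma> ^^ j) a \<in> carrier R"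
  by (induct j) (simp_all add: sigma_closed)

lemma PhiT_lt: "a \<in> carrier R \<Longrightarrow> PhiT (lt a) = lt (\<phi> a)"
  unfolding lt_def using PhiT_tens[of a \<one>] ring_hom_one[OF phi] by simp

lemma SigmaT_lt: "a \<in> carrier R \<Longrightarrow> SigmaT (lt a) = lt (\<sigma> a)"
  unfolding lt_def using SigmaT_tens[of a \<one>] ring_hom_one[OF sigma] by simp

lemma SigmaT_rt: "a \<in> carrier R \<Longrightarrow> SigmaT (rt a) = rt (\<sigma> a)"
  unfolding rt_def using SigmaT_tens[of \<one> a] ring_hom_one[OF sigma] by simp

lemma SigmaT_pow_rt: "a \<in> carrier R \<Longrightarrow> (SigmaT ^^ j) (rt a) = rt ((\<sigma> ^^ j) a)"
  by (induct j) (simp_all add: SigmaT_rt sigma_pow_closed)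

lemma PhiT_SigmaT: "t \<in> carrier TR \<Longrightarrow> PhiT (SigmaT t) = SigmaT (PhiT t)"
proof (induct t rule: TR_induct)
  case (tens a b)
  then show ?case by (simp add: PhiT_tens SigmaT_tens phi_closed sigma_closed commute)
qed (simp_all add: T.minus_eq)

lemma T_nontrivial: "\<one>\<^bsub>TR\<^esub> \<noteq> \<zero>\<^bsub>TR\<^esub>"
  using lt_inj[OF K_field one_closed] subfieldE(6)[OF K_field] lt.hom_one by metis

lemma lt_zero: "a \<in> carrier R \<Longrightarrow> lt a = \<zero>\<^bsub>TR\<^esub> \<Longrightarrow> a = \<zero>"
  by (rule lt_inj[OF K_field])

lemma KR_carrier: "KR \<subseteq> carrier R" using iota_closed by blast

lemma lt_K: "lt ` KR = rt ` KR" using lt_iota by (auto simp: image_iff)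

lemma C_subring: "subring C TR" by (rule lt.ring.img_is_subring[OF carrier_is_subring])

lemma kT_field: "subfield kT TR" by (rule lt.ring.img_is_subfield[OF const_field T_nontrivial])

lemma K_field_T: "subfield (rt ` KR) TR" by (rule rt.ring.img_is_subfield[OF K_field T_nontrivial])

lemma C_carrier: "C \<subseteq> carrier TR" by (rule subringE(1)[OF C_subring])

lemma C_reduced:
  assumes "a \<in> C" "a \<otimes>\<^bsub>TR\<^esub> a = \<zero>\<^bsub>TR\<^esub>" shows "a = \<zero>\<^bsub>TR\<^esub>"
proof -
  obtain b where b: "b \<in> carrier R" "a = lt b" using assms by blast
  then have "lt (b \<otimes> b) = \<zero>\<^bsub>TR\<^esub>" using assms by simp
  then have "b \<otimes> b = \<zero>" using lt_zero b(1) m_closed by blast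
  then have "b = \<zero>" by (rule phi_simple_reduced[OF phi simple b(1)])
  then show ?thesis using b by simp
qed

lemma kT_C: "kT \<subseteq> C" by blast
lemma K_C: "rt ` KR \<subseteq> C" using lt_K KR_carrier by (metis image_mono)

lemma H_subring: "subring H TR"
proof (rule T.subringI)
  show "\<one>\<^bsub>TR\<^esub> \<in> H" by simp
qed auto

lemma kT_H: "kT \<subseteq> H" using PhiT_lt by auto

lemma SigmaT_H: "t \<in> H \<Longrightarrow> SigmaT t \<in> H" using PhiT_SigmaT by simp

lemma SigmaT_pow_H: "t \<in> H \<Longrightarrow> (SigmaT ^^ j) t \<in> H"
  by (induct j) (use SigmaT_H in auto)

lemma V_H: "V \<subseteq> H" using V(2,3) by blast

interpretation SR: sigma_over_subfield R KR \<sigma>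
proof (intro sigma_over_subfield.intro sigma_over_subring.intro sigma_over_subring_axioms.intro
    sigma_over_subfield_axioms.intro is_cring K_field subfieldE(1)[OF K_field] sigma)
  show "\<sigma> ` KR \<subseteq> KR"
  proof
    fix a assume "a \<in> \<sigma> ` KR"
    then obtain c where c: "c \<in> carrier K" "a = \<sigma> (\<iota> c)" by blast
    then show "a \<in> KR" using sigma_K[OF c(1)] by (elim bexE) simp
  qed
qed

interpretation ST: sigma_over_subring TR C SigmaT
proof (intro sigma_over_subring.intro sigma_over_subring_axioms.intro T.is_cring C_subring SigmaT.homh)
  show "SigmaT ` C \<subseteq> C" using SigmaT_lt sigma_closed by auto
qed

abbreviation "OS \<equiv> sigma_orbit \<sigma> S"
abbreviation "OV \<equiv> sigma_orbit SigmaT V"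

lemma OS_props: "finite (OS i)" "OS i \<subseteq> carrier R"
  by (rule SR.orbit_finite[OF S(1)], rule SR.orbit_carrier[OF S(2)])

lemma OV_H: "OV i \<subseteq> H"
  unfolding sigma_orbit_def using SigmaT_pow_H V_H by blast

lemma OV_props: "finite (OV i)" "OV i \<subseteq> carrier TR"
  by (rule ST.orbit_finite[OF V(1)], rule ST.orbit_carrier[OF V(2)])

lemma rt_OS: "rt ` OS i = sigma_orbit SigmaT (rt ` S) i"
proof -
  have "rt ` (\<sigma> ^^ j) ` S = (SigmaT ^^ j) ` rt ` S" for j
  proof -
    have "rt ((\<sigma> ^^ j) a) = (SigmaT ^^ j) (rt a)" if "a \<in> S" for a
      using SigmaT_pow_rt S(2) that by (metis subsetD)
    then show ?thesis unfolding image_image by (rule image_cong[OF refl])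
  qed
  then show ?thesis unfolding sigma_orbit_def by (simp only: image_UN)
qed

text \<open>
  Both inclusions hold at order zero by assumption, and the coefficients \<open>C\<close> are stable under \<open>\<sigma>\<close>.
\<close>

lemma same_span: "adjoin TR C (OV i) = adjoin TR C (rt ` OS i)"
proof -
  have rtS: "rt ` S \<subseteq> carrier TR" using S(2) by auto
  have "V \<subseteq> adjoin TR C (sigma_orbit SigmaT (rt ` S) 0)"
    using V_rt unfolding sigma_orbit_def lt_def[abs_def] rt_def[abs_def] by simp
  moreover have "rt ` S \<subseteq> adjoin TR C (sigma_orbit SigmaT V 0)"
    using rt_V unfolding sigma_orbit_def lt_def[abs_def] rt_def[abs_def] by simp
  ultimately show ?thesis unfolding rt_OS
    using ST.adjoin_orbit_shift[of V "rt ` S" 0 i] ST.adjoin_orbit_shift[of "rt ` S" V 0 i] rtS V(2) by auto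
qed

lemma constants_lin_indep_over_C:
  assumes u: "\<And>i. i \<in> I \<Longrightarrow> u i \<in> H" and ind: "lin_indep TR kT {\<zero>\<^bsub>TR\<^esub>} I u"
  shows "lin_indep TR C {\<zero>\<^bsub>TR\<^esub>} I u"
proof (rule lt.lin_indep_over_imageI)
  fix W a i assume h: "finite W" "W \<subseteq> I" "a \<in> W \<rightarrow> carrier R"
    "(\<Oplus>\<^bsub>TR\<^esub>i\<in>W. lt (a i) \<otimes>\<^bsub>TR\<^esub> u i) = \<zero>\<^bsub>TR\<^esub>" "i \<in> W"
  show "a i = \<zero>"
    by (rule lt.constants_lin_indep[OF phi PhiT.homh PhiT_lt simple subfieldE(1)[OF kT_field] _ T_nontrivial _ _ ind h])
      (use u in auto)
qed (use u in auto)

lemma constants_alg_indep_over_C: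
  assumes x: "x \<in> I \<rightarrow> H" and ind: "alg_indep TR kT {\<zero>\<^bsub>TR\<^esub>} I x"
  shows "alg_indep TR C {\<zero>\<^bsub>TR\<^esub>} I x"
  unfolding alg_indep_def
proof (rule constants_lin_indep_over_C[OF _ ind[unfolded alg_indep_def]])
  fix \<alpha>
  show "power_prod TR x I \<alpha> \<in> H" unfolding power_prod_def
    by (intro T.finprod_in_subring[OF H_subring] funcsetI T.pow_in_subring[OF H_subring] funcset_mem[OF x])
qed

lemma rt_alg_indep_over_C:
  assumes y: "y \<in> I \<rightarrow> carrier R" and ind: "alg_indep R KR {\<zero>} I y"
  shows "alg_indep TR C {\<zero>\<^bsub>TR\<^esub>} I (rt \<circ> y)"
proof -
  have "lin_indep TR C {\<zero>\<^bsub>TR\<^esub>} (expo I) (\<lambda>\<alpha>. rt (power_prod R y I \<alpha>))"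
  proof (rule lt.lin_indep_over_imageI)
    fix W a i assume h: "finite W" "W \<subseteq> expo I" "a \<in> W \<rightarrow> carrier R"
      "(\<Oplus>\<^bsub>TR\<^esub>\<alpha>\<in>W. lt (a \<alpha>) \<otimes>\<^bsub>TR\<^esub> rt (power_prod R y I \<alpha>)) = \<zero>\<^bsub>TR\<^esub>" "i \<in> W"
    show "a i = \<zero>"
      by (rule rt_lin_indep[OF K_field _ ind[unfolded alg_indep_def] h])
        (use power_prod_closed[OF y] in blast)
  qed (use power_prod_closed[OF y] in simp)
  then show ?thesis unfolding alg_indep_def using rt.hom_power_prod[OF y] by simp
qed

text \<open>
  An independent family on either side stays independent over \<open>C\<close> and lies in the algebra generated
  over \<open>C\<close> by the generators of the other side; among these there are as many independent elements.
\<close>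

theorem same_transcendence:
  "alg_indep_of_size R KR (adjoin R KR (OS i)) l \<longleftrightarrow> alg_indep_of_size TR kT (adjoin TR kT (OV i)) l"
proof
  have rtO: "finite (rt ` OS i)" "rt ` OS i \<subseteq> carrier TR" using OS_props by auto
  {
    assume "alg_indep_of_size R KR (adjoin R KR (OS i)) l"
    then obtain y :: "nat \<Rightarrow> 'a" and I where y: "finite I" "card I = l" "y \<in> I \<rightarrow> adjoin R KR (OS i)"
      "alg_indep R KR {\<zero>} I y" unfolding alg_indep_of_size_def by blast
    have yc: "y \<in> I \<rightarrow> carrier R" using y(3) adjoin_carrier[OF KR_carrier OS_props(2)] by blast
    have "(rt \<circ> y) j \<in> adjoin TR C (OV i)" if "j \<in> I" for j
    proof -
      have "rt (y j) \<in> rt ` adjoin R KR (OS i)" using funcset_mem[OF y(3) that] by blast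
      also have "\<dots> = adjoin TR (rt ` KR) (rt ` OS i)" by (rule rt.hom_adjoin[OF KR_carrier OS_props(2)])
      also have "\<dots> \<subseteq> adjoin TR C (rt ` OS i)"
        unfolding adjoin_def using K_C C_carrier rtO(2) by (intro T.mono_generate_ring) auto
      finally show ?thesis unfolding same_span by simp
    qed
    then have "rt \<circ> y \<in> I \<rightarrow> adjoin TR C (OV i)" by (rule funcsetI)
    from T.alg_indep_over_bigger_ring_imp_size[OF kT_field C_subring kT_C C_reduced OV_props y(1) this
        rt_alg_indep_over_C[OF yc y(4)]]
    have "alg_indep_of_size TR kT (OV i) l" using y(2) by simp
    then show "alg_indep_of_size TR kT (adjoin TR kT (OV i)) l"
      by (rule T.alg_indep_of_size_mono[OF _ T.adjoin_incl(2)])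
  next
    assume "alg_indep_of_size TR kT (adjoin TR kT (OV i)) l"
    then obtain y :: "nat \<Rightarrow> ('a \<times> 'a \<Rightarrow>\<^sub>0 int) set" and I where y: "finite I" "card I = l" "y \<in> I \<rightarrow> adjoin TR kT (OV i)"
      "alg_indep TR kT {\<zero>\<^bsub>TR\<^esub>} I y" unfolding alg_indep_of_size_def by blast
    have "adjoin TR kT (OV i) \<subseteq> H" by (rule T.adjoin_least[OF H_subring kT_H OV_H])
    then have yH: "y \<in> I \<rightarrow> H" using y(3) by blast
    have "adjoin TR kT (OV i) \<subseteq> adjoin TR C (rt ` OS i)"
      unfolding same_span[symmetric] unfolding adjoin_def
      using kT_C C_carrier OV_props(2) by (intro T.mono_generate_ring) auto
    then have yA: "y \<in> I \<rightarrow> adjoin TR C (rt ` OS i)" using y(3) by blast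
    from T.alg_indep_over_bigger_ring_imp_size[OF K_field_T C_subring K_C C_reduced rtO y(1) yA
        constants_alg_indep_over_C[OF yH y(4)]]
    obtain z :: "nat \<Rightarrow> ('a \<times> 'a \<Rightarrow>\<^sub>0 int) set" and J where z: "finite J" "card J = l" "z \<in> J \<rightarrow> rt ` OS i"
      "alg_indep TR (rt ` KR) {\<zero>\<^bsub>TR\<^esub>} J z" unfolding alg_indep_of_size_def y(2) by blast
    define s where "s j = (SOME a. a \<in> OS i \<and> rt a = z j)" for j
    have s: "s j \<in> OS i \<and> rt (s j) = z j" if j: "j \<in> J" for j
    proof -
      obtain a where "a \<in> OS i" "z j = rt a" using funcset_mem[OF z(3) j] by blast
      then have "a \<in> OS i \<and> rt a = z j" by simp
      then show ?thesis unfolding s_def by (rule someI)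
    qed
    have sc: "s \<in> J \<rightarrow> carrier R" using s OS_props(2) by blast
    have "alg_indep TR (rt ` KR) {\<zero>\<^bsub>TR\<^esub>} J (rt \<circ> s)"
    proof (subst T.alg_indep_cong[of J "rt \<circ> s" z])
      show "z \<in> J \<rightarrow> carrier TR" using z(3) rtO(2) by blast
    qed (simp_all add: s z(4))
    moreover have "c = \<zero>" if c: "c \<in> KR" "rt c = \<zero>\<^bsub>TR\<^esub>" for c
      using c lt_iota lt_zero iota_closed by auto
    ultimately have "alg_indep R KR {r \<in> carrier R. rt r \<in> {\<zero>\<^bsub>TR\<^esub>}} J s"
      using rt.alg_indep_vimage[OF subfieldE(1)[OF K_field] _ sc] by blast
    moreover have "{\<zero>} \<subseteq> {r \<in> carrier R. rt r \<in> {\<zero>\<^bsub>TR\<^esub>}}" by simp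
    ultimately have "alg_indep R KR {\<zero>} J s" unfolding alg_indep_def lin_indep_def by blast
    then have "alg_indep_of_size R KR (OS i) l"
      unfolding alg_indep_of_size_def using z(1,2) s by blast
    then show "alg_indep_of_size R KR (adjoin R KR (OS i)) l"
      by (rule alg_indep_of_size_mono[OF _ adjoin_incl(2)])
  }
qed

theorem same_krull_dim:
  "krull_dim (R\<lparr>carrier := adjoin R KR (OS i)\<rparr>) = krull_dim (TR\<lparr>carrier := adjoin TR kT (OV i)\<rparr>)"
  (is "?a = ?b")
proof -
  have eq: "enat l \<le> ?a \<longleftrightarrow> enat l \<le> ?b" for l
    unfolding krull_dim_adjoin_ge_iff[OF K_field OS_props] T.krull_dim_adjoin_ge_iff[OF kT_field OV_props]
    by (rule same_transcendence)
  show ?thesis by (rule antisym; rule enat_le_by_finite; simp only: eq)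
qed

abbreviation "UV \<equiv> (\<Union>i. (SigmaT ^^ i) ` V)"

lemma UV_H: "UV \<subseteq> H"
  using SigmaT_pow_H V_H by blast

lemma TR_generated: "carrier TR = adjoin TR C UV"
proof
  have UVc: "UV \<subseteq> carrier TR" using UV_H by blast
  show "adjoin TR C UV \<subseteq> carrier TR" by (rule T.adjoin_carrier[OF C_carrier UVc])
  have sub: "subring (adjoin TR C UV) TR" by (rule T.adjoin_subring[OF C_carrier UVc])
  have "rt r \<in> adjoin TR C UV" if r: "r \<in> carrier R" for r
  proof -
    have "r \<in> generate_ring R (KR \<union> (\<Union>i. (\<sigma> ^^ i) ` S))" using r S(3) by simp
    then obtain i where i: "r \<in> adjoin R KR (OS i)"
      using SR.generated_in_adjoin_orbit[OF S(2)] by blast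
    have rtO: "rt ` OS i \<subseteq> carrier TR" using OS_props by auto
    have "rt r \<in> rt ` adjoin R KR (OS i)" using i by blast
    also have "\<dots> = adjoin TR (rt ` KR) (rt ` OS i)" by (rule rt.hom_adjoin[OF KR_carrier OS_props(2)])
    also have "\<dots> \<subseteq> adjoin TR C (rt ` OS i)"
      unfolding adjoin_def using K_C C_carrier rtO by (intro T.mono_generate_ring) auto
    also have "\<dots> = adjoin TR C (OV i)" by (rule same_span[symmetric])
    also have "\<dots> \<subseteq> adjoin TR C UV"
      unfolding adjoin_def sigma_orbit_def using C_carrier UVc by (intro T.mono_generate_ring) auto
    finally show ?thesis .
  qed
  then have "rt ` carrier R \<subseteq> adjoin TR C UV" by blast
  then have "lspan TR C (rt ` carrier R) \<subseteq> adjoin TR C UV"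
    by (intro T.lspan_in_subring[OF sub] adjoin_incl(1) T.adjoin_incl(1))
  then show "carrier TR \<subseteq> adjoin TR C UV" using TR_lspan by simp
qed

text \<open>
  The conjugates of \<open>V\<close> generate the tensor square over \<open>C\<close>, so a constant is a \<open>C\<close>-combination of
  elements of \<open>k[V, \<sigma>(V), \<dots>]\<close>. As these are constants as well, the coefficients descend to \<open>k\<close>.
\<close>

theorem H_generated: "H = adjoin TR kT UV"
proof
  let ?G = "adjoin TR kT UV"
  have UVc: "UV \<subseteq> carrier TR" using UV_H by blast
  have kTc: "kT \<subseteq> carrier TR" using kT_C C_carrier by (rule subset_trans)
  have sub: "subring ?G TR" by (rule T.adjoin_subring[OF kTc UVc])
  show GH: "?G \<subseteq> H" by (rule T.adjoin_least[OF H_subring kT_H UV_H])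
  show "H \<subseteq> ?G"
  proof
    fix h assume h: "h \<in> H"
    have "h \<in> carrier TR" using h by blast
    then have hl: "h \<in> lspan TR C ?G"
      using TR_generated T.adjoin_eq_lspan_adjoin[OF kT_C C_subring UVc] by metis
    have ind: "lin_indep TR C {\<zero>\<^bsub>TR\<^esub>} W (\<lambda>v. v)"
      if "finite W" "W \<subseteq> H" "lin_indep TR kT {\<zero>\<^bsub>TR\<^esub>} W (\<lambda>v. v)" for W
      by (rule constants_lin_indep_over_C[OF _ that(3)]) (use that(2) in blast)
    have Hc: "H \<subseteq> carrier TR" by blast
    have "h \<in> lspan TR kT ?G"
      by (rule T.lspan_descend[OF kT_field C_subring kT_C GH Hc ind h hl])
    moreover have "lspan TR kT ?G \<subseteq> ?G" by (intro T.lspan_in_subring[OF sub] T.adjoin_incl(1) subset_refl)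
    ultimately show "h \<in> ?G" by blast
  qed
qed

theorem sigma_dim_eq:
  assumes \<kappa>: "\<kappa> ` carrier E = kT"
  shows "sigma_dim K \<iota> R \<sigma> = sigma_dim E \<kappa> (TR\<lparr>carrier := H\<rparr>) SigmaT"
proof -
  let ?H = "TR\<lparr>carrier := H\<rparr>"
  have kH: "subfield kT ?H" by (rule T.subfield_subring[OF kT_field H_subring kT_H])
  interpret SH: sigma_over_subfield ?H kT SigmaT
  proof (intro sigma_over_subfield.intro sigma_over_subring.intro sigma_over_subring_axioms.intro
      sigma_over_subfield_axioms.intro T.subring_cring H_subring kH subfieldE(1)[OF kH])
    show "SigmaT \<in> ring_hom ?H ?H"
      by (rule ring_hom_memI) (use SigmaT_H in auto)
    show "SigmaT ` kT \<subseteq> kT"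
    proof
      fix t assume "t \<in> SigmaT ` kT"
      then obtain a where a: "a \<in> carrier R" "\<phi> a = a" "t = SigmaT (lt a)" by blast
      then have "t = lt (\<sigma> a)" "\<phi> (\<sigma> a) = \<sigma> a" using SigmaT_lt commute by simp_all
      then show "t \<in> kT" using sigma_closed a(1) by blast
    qed
  qed
  have gen: "generate_ring ?H W = generate_ring TR W" if "W \<subseteq> H" for W
    by (rule T.subring_gen_equality[OF H_subring that, symmetric])
  have kUV: "kT \<union> UV \<subseteq> H" using kT_H UV_H by blast
  have "carrier ?H = sigma_generate E \<kappa> ?H SigmaT V"
    unfolding sigma_generate_def \<kappa> gen[OF kUV] using H_generated unfolding adjoin_def by simp
  then have 1: "sigma_dim E \<kappa> ?H SigmaT = sigma_dim_wrt E \<kappa> ?H SigmaT V"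
    using V(1) V_H by (intro SH.sigma_dim_eq_wrt[OF \<kappa>]) simp_all
  have 2: "sigma_dim K \<iota> R \<sigma> = sigma_dim_wrt K \<iota> R \<sigma> S"
    by (rule SR.sigma_dim_eq_wrt[OF refl S(1,2)]) (use S(3) in \<open>simp only: sigma_generate_def\<close>)
  have "krull_dim (R\<lparr>carrier := generate_ring R (KR \<union> OS i)\<rparr>) =
      krull_dim (?H\<lparr>carrier := generate_ring ?H (\<kappa> ` carrier E \<union> OV i)\<rparr>)" for i
  proof -
    have "kT \<union> OV i \<subseteq> H" using kT_H OV_H by blast
    from gen[OF this] show ?thesis using same_krull_dim[of i] unfolding adjoin_def \<kappa> by simp
  qed
  then show ?thesis unfolding 1 2 sigma_dim_wrt_def sigma_orbit_def Let_def by simp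
qed

end

section \<open>Matrices over a commutative ring\<close>

lemma (in cring) finsum_in_subring:
  assumes B: "subring B R" and f: "\<And>i. i \<in> I \<Longrightarrow> f i \<in> B"
  shows "finsum R f I \<in> B"
proof -
  have fB: "f \<in> I \<rightarrow> B" using f by (rule funcsetI)
  interpret B: cring "R\<lparr>carrier := B\<rparr>" by (rule subring_cring[OF B])
  have "finsum (R\<lparr>carrier := B\<rparr>) f I \<in> B" using B.finsum_closed[of f I] fB by simp
  then show ?thesis using finsum_subring[OF B fB] by simp
qed

context cring
begin

lemma mat_mult_in_subring:
  assumes B: "subring B R" and M: "\<And>l. l < n \<Longrightarrow> M i l \<in> B" and N: "\<And>l. l < n \<Longrightarrow> N l j \<in> B"
  shows "mat_mult R n M N i j \<in> B"
  unfolding mat_mult_def using M N subringE(6)[OF B] by (intro finsum_in_subring[OF B]) simp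

lemma mat_det_in_subring:
  assumes B: "subring B R" and M: "\<And>i j. \<lbrakk>i < n; j < n\<rbrakk> \<Longrightarrow> M i j \<in> B"
  shows "mat_det R n M \<in> B"
  unfolding mat_det_sgn
proof (rule finsum_in_subring[OF B])
  fix p assume p: "p \<in> {p. p permutes {..<n}}"
  have "(\<Otimes>i\<in>{..<n}. M i (p i)) \<in> B"
  proof (rule finprod_in_subring[OF B])
    show "(\<lambda>i. M i (p i)) \<in> {..<n} \<rightarrow> B"
    proof (rule funcsetI)
      fix i assume "i \<in> {..<n}"
      then show "M i (p i) \<in> B" using p permutes_in_image[of p "{..<n}" i] by (intro M) auto
    qed
  qed
  then show "sgn_perm p (\<Otimes>i\<in>{..<n}. M i (p i)) \<in> B" unfolding sgn_perm_def using subringE(5)[OF B] by simp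
qed

lemma mat_det_cong:
  assumes N: "N \<in> mat_carrier R n" and eq: "mat_eq n M N"
  shows "mat_det R n M = mat_det R n N"
  unfolding mat_det_sgn
proof (rule finsum_eqI)
  fix p assume p: "p \<in> {p. p permutes {..<n}}"
  have pn: "p i < n" if "i < n" for i using p permutes_in_image[of p "{..<n}" i] that by auto
  have "(\<Otimes>i\<in>{..<n}. M i (p i)) = (\<Otimes>i\<in>{..<n}. N i (p i))"
    by (rule finprod_eqI) (use pn N eq in \<open>auto simp: mat_carrier_def mat_eq_def\<close>)
  then show "sgn_perm p (\<Otimes>i\<in>{..<n}. M i (p i)) = sgn_perm p (\<Otimes>i\<in>{..<n}. N i (p i))" by simp
  show "sgn_perm p (\<Otimes>i\<in>{..<n}. N i (p i)) \<in> carrier R"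
    by (intro sgn_perm_closed finprod_mem) (use pn N in \<open>auto simp: mat_carrier_def\<close>)
qed

lemma mat_mult_closed: "\<lbrakk>M \<in> mat_carrier R n; N \<in> mat_carrier R n\<rbrakk> \<Longrightarrow> mat_mult R n M N \<in> mat_carrier R n"
  unfolding mat_carrier_def mat_mult_def by (auto intro!: finsum_mem)

lemma mat_mult_cong:
  assumes "M' \<in> mat_carrier R n" "N' \<in> mat_carrier R n" "mat_eq n M M'" "mat_eq n N N'" "i < n" "j < n"
  shows "mat_mult R n M N i j = mat_mult R n M' N' i j"
  unfolding mat_mult_def
  by (rule finsum_eqI) (use assms in \<open>auto simp: mat_carrier_def mat_eq_def\<close>)

lemma mat_mult_assoc:
  assumes M: "M \<in> mat_carrier R n" and N: "N \<in> mat_carrier R n" and P: "P \<in> mat_carrier R n" and ij: "i < n" "j < n"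
  shows "mat_mult R n (mat_mult R n M N) P i j = mat_mult R n M (mat_mult R n N P) i j"
proof -
  have c: "M a b \<in> carrier R" "N a b \<in> carrier R" "P a b \<in> carrier R" if "a < n" "b < n" for a b
    using M N P that unfolding mat_carrier_def by auto
  have "mat_mult R n (mat_mult R n M N) P i j = (\<Oplus>l\<in>{..<n}. \<Oplus>m\<in>{..<n}. M i m \<otimes> N m l \<otimes> P l j)"
    unfolding mat_mult_def using c ij by (intro finsum_eqI finsum_ldistr finsum_mem) auto
  also have "\<dots> = (\<Oplus>m\<in>{..<n}. \<Oplus>l\<in>{..<n}. M i m \<otimes> N m l \<otimes> P l j)"
    using c ij by (intro finsum_swap) auto
  also have "\<dots> = (\<Oplus>m\<in>{..<n}. \<Oplus>l\<in>{..<n}. M i m \<otimes> (N m l \<otimes> P l j))"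
    using c ij by (intro finsum_eqI finsum_mem) (auto simp: m_assoc)
  also have "\<dots> = mat_mult R n M (mat_mult R n N P) i j"
    unfolding mat_mult_def using c ij
    by (intro finsum_eqI finsum_rdistr[symmetric]) (auto intro!: finsum_mem)
  finally show ?thesis .
qed

lemma mat_one_closed: "mat_one R \<in> mat_carrier R n"
  unfolding mat_carrier_def mat_one_def by simp

lemma mat_mult_one:
  assumes M: "M \<in> mat_carrier R n" and ij: "i < n" "j < n"
  shows "mat_mult R n (mat_one R) M i j = M i j" "mat_mult R n M (mat_one R) i j = M i j"
proof -
  have c: "M a b \<in> carrier R" if "a < n" "b < n" for a b using M that unfolding mat_carrier_def by auto
  have "mat_mult R n (mat_one R) M i j = (\<Oplus>l\<in>{..<n}. if l = i then M l j else \<zero>)"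
    unfolding mat_mult_def mat_one_def using c ij by (intro finsum_eqI) auto
  also have "\<dots> = M i j" using c ij by (intro add.finprod_singleton_swap) auto
  finally show "mat_mult R n (mat_one R) M i j = M i j" .
  have "mat_mult R n M (mat_one R) i j = (\<Oplus>l\<in>{..<n}. if l = j then M i l else \<zero>)"
    unfolding mat_mult_def mat_one_def using c ij by (intro finsum_eqI) auto
  also have "\<dots> = M i j" using c ij by (intro add.finprod_singleton_swap) auto
  finally show "mat_mult R n M (mat_one R) i j = M i j" .
qed

lemma mat_cancel:
  assumes M: "M \<in> mat_carrier R n" and N: "N \<in> mat_carrier R n" and P: "P \<in> mat_carrier R n"
    and NP: "mat_eq n (mat_mult R n N P) (mat_one R)" and ij: "i < n" "j < n"
  shows "mat_mult R n (mat_mult R n M N) P i j = M i j" "mat_mult R n N (mat_mult R n P M) i j = M i j"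
proof -
  have r: "mat_eq n A A" for A :: "nat \<Rightarrow> nat \<Rightarrow> 'a" by (simp add: mat_eq_def)
  show "mat_mult R n (mat_mult R n M N) P i j = M i j"
    using mat_mult_assoc[OF M N P ij] mat_mult_cong[OF M mat_one_closed r NP ij] mat_mult_one(2)[OF M ij] by simp
  show "mat_mult R n N (mat_mult R n P M) i j = M i j"
    using mat_mult_assoc[OF N P M ij] mat_mult_cong[OF mat_one_closed M NP r ij] mat_mult_one(1)[OF M ij] by simp
qed

end

context ring_hom_cring
begin

lemma hom_mat_carrier: "M \<in> mat_carrier R n \<Longrightarrow> (\<lambda>i j. h (M i j)) \<in> mat_carrier S n"
  unfolding mat_carrier_def by simp

lemma hom_mat_mult:
  assumes M: "M \<in> mat_carrier R n" and N: "N \<in> mat_carrier R n" and ij: "i < n" "j < n"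
  shows "h (mat_mult R n M N i j) = mat_mult S n (\<lambda>i j. h (M i j)) (\<lambda>i j. h (N i j)) i j"
  unfolding mat_mult_def using M N ij by (intro hom_lincomb) (auto simp: mat_carrier_def)

lemma hom_mat_one: "h (mat_one R i j) = mat_one S i j"
  unfolding mat_one_def by simp

end

section \<open>Picard--Vessiot rings\<close>

lemma subfield_fixed:
  assumes "field K" "\<phi> \<in> ring_hom K K"
  shows "subfield {c \<in> carrier K. \<phi> c = c} K"
proof -
  interpret field K by fact
  interpret \<phi>: ring_hom_cring K K \<phi> by (intro ring_hom_cring.intro ring_hom_cring_axioms.intro is_cring assms(2))
  show ?thesis
  proof (rule subfieldI')
    show "subring {c \<in> carrier K. \<phi> c = c} K" by (rule subringI) auto
    fix c assume c: "c \<in> {c \<in> carrier K. \<phi> c = c} - {\<zero>\<^bsub>K\<^esub>}"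
    then have u: "c \<in> Units K" using field_Units by blast
    have ic: "inv\<^bsub>K\<^esub> c \<in> carrier K" "c \<otimes>\<^bsub>K\<^esub> inv\<^bsub>K\<^esub> c = \<one>\<^bsub>K\<^esub>" using u by simp_all
    have "c \<otimes>\<^bsub>K\<^esub> \<phi> (inv\<^bsub>K\<^esub> c) = \<phi> (c \<otimes>\<^bsub>K\<^esub> inv\<^bsub>K\<^esub> c)" using c ic(1) by simp
    also have "\<dots> = \<one>\<^bsub>K\<^esub>" unfolding ic(2) by simp
    finally have "inv\<^bsub>K\<^esub> c = \<phi> (inv\<^bsub>K\<^esub> c)" using c ic(1) by (intro comm_inv_char) auto
    then show "inv\<^bsub>K\<^esub> c \<in> {c \<in> carrier K. \<phi> c = c}" using ic(1) by simp
  qed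
qed

definition entries :: "nat \<Rightarrow> (nat \<Rightarrow> nat \<Rightarrow> 'a) \<Rightarrow> 'a set" where
  "entries n M = (\<lambda>(i, j). M i j) ` ({..<n} \<times> {..<n})"

lemma entries_finite: "finite (entries n M)"
  unfolding entries_def by simp

lemma entriesI: "\<lbrakk>i < n; j < n\<rbrakk> \<Longrightarrow> M i j \<in> entries n M"
  unfolding entries_def by force

lemma entriesE: "x \<in> entries n M \<Longrightarrow> (\<And>i j. \<lbrakk>i < n; j < n; x = M i j\<rbrakk> \<Longrightarrow> thesis) \<Longrightarrow> thesis"
  unfolding entries_def by auto

lemma entries_subset: "(\<And>i j. \<lbrakk>i < n; j < n\<rbrakk> \<Longrightarrow> M i j \<in> B) \<Longrightarrow> entries n M \<subseteq> B"
  unfolding entries_def by auto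

text \<open>
  Here \<open>Y\<close> is a fundamental matrix of the equation with coefficient matrix \<open>B\<close>, and \<open>N\<close> is its inverse.
\<close>

locale fundamental_square = tensor_square +
  fixes \<phi> \<sigma> :: "'a \<Rightarrow> 'a" and n B Y N
  assumes phi: "\<phi> \<in> ring_hom R R" and sigma: "\<sigma> \<in> ring_hom R R"
    and phi_K: "c \<in> carrier K \<Longrightarrow> \<exists>c'\<in>carrier K. \<phi> (\<iota> c) = \<iota> c'"
    and sigma_K: "c \<in> carrier K \<Longrightarrow> \<exists>c'\<in>carrier K. \<sigma> (\<iota> c) = \<iota> c'"
    and K_subring: "subring (\<iota> ` carrier K) R"
    and YN: "Y \<in> mat_carrier R n" "N \<in> mat_carrier R n"
      "mat_eq n (mat_mult R n Y N) (mat_one R)" "mat_eq n (mat_mult R n N Y) (mat_one R)"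
    and B: "B \<in> mat_carrier K n"
    and phi_Y: "mat_eq n (\<lambda>i j. \<phi> (Y i j)) (mat_mult R n (\<lambda>i j. \<iota> (B i j)) Y)"
begin

interpretation T: cring TR by (rule TR_cring)
interpretation \<phi>: ring_hom_cring R R \<phi>
  by (intro ring_hom_cring.intro ring_hom_cring_axioms.intro is_cring phi)
interpretation lt: ring_hom_cring R TR lt
  by (intro ring_hom_cring.intro ring_hom_cring_axioms.intro is_cring T.is_cring lt_hom)
interpretation rt: ring_hom_cring R TR rt
  by (intro ring_hom_cring.intro ring_hom_cring_axioms.intro is_cring T.is_cring rt_hom)
interpretation PhiT: ring_hom_cring TR TR "tensor_endo K \<iota> R \<iota> R \<phi> \<phi>"
  by (intro ring_hom_cring.intro ring_hom_cring_axioms.intro T.is_cring tensor_endo_props(1) phi phi_K)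

abbreviation "A \<equiv> (\<lambda>i j. \<iota> (B i j))"
abbreviation "PhiT \<equiv> tensor_endo K \<iota> R \<iota> R \<phi> \<phi>"
abbreviation "map_mat h M \<equiv> (\<lambda>i j. h (M i j))"

lemma A: "A \<in> mat_carrier R n"
  using B iota_closed unfolding mat_carrier_def by simp

lemma YN_carrier: "Y i j \<in> carrier R" "N i j \<in> carrier R" if "i < n" "j < n"
  using YN(1,2) that unfolding mat_carrier_def by simp_all

lemma mat_eq_refl: "mat_eq n M M"
  unfolding mat_eq_def by simp

text \<open>
  Applying \<open>\<phi>\<close> to \<open>N Y = 1\<close> gives \<open>\<phi>(N) A Y = 1\<close>, so \<open>\<phi>(N) A\<close> is the inverse of \<open>Y\<close>.
\<close>

lemma phi_N_A: "mat_eq n (mat_mult R n (map_mat \<phi> N) A) N"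
  unfolding mat_eq_def
proof (intro allI impI)
  fix i j assume ij: "i < n" "j < n"
  let ?P = "mat_mult R n (map_mat \<phi> N) A"
  have pN: "map_mat \<phi> N \<in> mat_carrier R n" by (rule \<phi>.hom_mat_carrier[OF YN(2)])
  have P: "?P \<in> mat_carrier R n" by (rule mat_mult_closed[OF pN A])
  have AY: "mat_mult R n A Y \<in> mat_carrier R n" by (rule mat_mult_closed[OF A YN(1)])
  have "mat_eq n (mat_mult R n ?P Y) (mat_one R)"
    unfolding mat_eq_def
  proof (intro allI impI)
    fix a b assume ab: "a < n" "b < n"
    have "mat_mult R n ?P Y a b = mat_mult R n (map_mat \<phi> N) (mat_mult R n A Y) a b"
      by (rule mat_mult_assoc[OF pN A YN(1) ab])
    also have "\<dots> = mat_mult R n (map_mat \<phi> N) (map_mat \<phi> Y) a b"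
      by (rule mat_mult_cong[OF pN AY mat_eq_refl phi_Y ab, symmetric])
    also have "\<dots> = \<phi> (mat_mult R n N Y a b)" by (rule \<phi>.hom_mat_mult[OF YN(2,1) ab, symmetric])
    also have "mat_mult R n N Y a b = mat_one R a b" using YN(4) ab unfolding mat_eq_def by blast
    finally show "mat_mult R n ?P Y a b = mat_one R a b" by (simp add: \<phi>.hom_mat_one)
  qed
  then have "mat_mult R n (mat_mult R n ?P Y) N i j = mat_mult R n (mat_one R) N i j"
    by (intro mat_mult_cong[OF mat_one_closed YN(2) _ mat_eq_refl ij])
  then show "?P i j = N i j"
    using mat_cancel(1)[OF P YN(1,2,3) ij] mat_mult_one(1)[OF YN(2) ij] by simp
qed

text \<open>
  With \<open>g\<close> and \<open>h\<close> the two embeddings of \<open>R\<close>, in either order, \<open>\<phi>\<close> maps \<open>g(N) h(Y)\<close> to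
  \<open>g(\<phi>(N)) h(A) h(Y)\<close>. The entries of \<open>A\<close> come from \<open>K\<close>, where \<open>g\<close> and \<open>h\<close> agree, so this
  is \<open>g(\<phi>(N) A) h(Y) = g(N) h(Y)\<close>.
\<close>

lemma transfer_fixed:
  assumes g: "ring_hom_cring R TR g" and h: "ring_hom_cring R TR h"
    and gh: "\<And>c. c \<in> carrier K \<Longrightarrow> g (\<iota> c) = h (\<iota> c)"
    and \<Phi>: "\<And>a. a \<in> carrier R \<Longrightarrow> PhiT (g a) = g (\<phi> a)" "\<And>a. a \<in> carrier R \<Longrightarrow> PhiT (h a) = h (\<phi> a)"
    and ij: "i < n" "j < n"
  shows "PhiT (mat_mult TR n (map_mat g N) (map_mat h Y) i j) = mat_mult TR n (map_mat g N) (map_mat h Y) i j"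
proof -
  interpret g: ring_hom_cring R TR g by (rule g)
  interpret h: ring_hom_cring R TR h by (rule h)
  note M = g.hom_mat_carrier h.hom_mat_carrier
  have c: "Y a b \<in> carrier R" "N a b \<in> carrier R" if "a < n" "b < n" for a b
    using YN(1,2) that unfolding mat_carrier_def by auto
  have pN: "map_mat \<phi> N \<in> mat_carrier R n" by (rule \<phi>.hom_mat_carrier[OF YN(2)])
  have AY: "mat_mult R n A Y \<in> mat_carrier R n" by (rule mat_mult_closed[OF A YN(1)])
  have gpN: "map_mat g (map_mat \<phi> N) \<in> mat_carrier TR n" by (rule M(1)[OF pN])
  have hAY: "mat_mult TR n (map_mat h A) (map_mat h Y) \<in> mat_carrier TR n"
    by (rule T.mat_mult_closed[OF M(2)[OF A] M(2)[OF YN(1)]])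
  have "PhiT (mat_mult TR n (map_mat g N) (map_mat h Y) i j) =
      mat_mult TR n (map_mat PhiT (map_mat g N)) (map_mat PhiT (map_mat h Y)) i j"
    by (rule PhiT.hom_mat_mult[OF M(1)[OF YN(2)] M(2)[OF YN(1)] ij])
  also have "\<dots> = mat_mult TR n (map_mat g (map_mat \<phi> N)) (mat_mult TR n (map_mat h A) (map_mat h Y)) i j"
  proof (rule T.mat_mult_cong[OF gpN hAY _ _ ij])
    show "mat_eq n (map_mat PhiT (map_mat g N)) (map_mat g (map_mat \<phi> N))"
      unfolding mat_eq_def using c \<Phi> by simp
    have "PhiT (h (Y a b)) = mat_mult TR n (map_mat h A) (map_mat h Y) a b" if ab: "a < n" "b < n" for a b
    proof -
      have "PhiT (h (Y a b)) = h (\<phi> (Y a b))" by (rule \<Phi>(2)[OF c(1)[OF ab]])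
      also have "\<phi> (Y a b) = mat_mult R n A Y a b" using phi_Y ab unfolding mat_eq_def by blast
      also have "h (mat_mult R n A Y a b) = mat_mult TR n (map_mat h A) (map_mat h Y) a b"
        by (rule h.hom_mat_mult[OF A YN(1) ab])
      finally show ?thesis .
    qed
    then show "mat_eq n (map_mat PhiT (map_mat h Y)) (mat_mult TR n (map_mat h A) (map_mat h Y))"
      unfolding mat_eq_def by blast
  qed
  also have "\<dots> = mat_mult TR n (mat_mult TR n (map_mat g (map_mat \<phi> N)) (map_mat h A)) (map_mat h Y) i j"
    by (rule T.mat_mult_assoc[OF gpN M(2)[OF A] M(2)[OF YN(1)] ij, symmetric])
  also have "\<dots> = mat_mult TR n (map_mat g N) (map_mat h Y) i j"
  proof (rule T.mat_mult_cong[OF M(1)[OF YN(2)] M(2)[OF YN(1)] _ mat_eq_refl ij])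
    have hA: "map_mat h A a b = map_mat g A a b" if "a < n" "b < n" for a b
      using gh B that unfolding mat_carrier_def by simp
    have "mat_mult TR n (map_mat g (map_mat \<phi> N)) (map_mat h A) a b = g (N a b)" if ab: "a < n" "b < n" for a b
    proof -
      have "mat_mult TR n (map_mat g (map_mat \<phi> N)) (map_mat h A) a b =
          mat_mult TR n (map_mat g (map_mat \<phi> N)) (map_mat g A) a b"
        by (rule T.mat_mult_cong[OF gpN M(1)[OF A] mat_eq_refl _ ab]) (use hA in \<open>simp add: mat_eq_def\<close>)
      also have "\<dots> = g (mat_mult R n (map_mat \<phi> N) A a b)"
        by (rule g.hom_mat_mult[OF pN A ab, symmetric])
      also have "mat_mult R n (map_mat \<phi> N) A a b = N a b" using phi_N_A ab unfolding mat_eq_def by blast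
      finally show ?thesis .
    qed
    then show "mat_eq n (mat_mult TR n (map_mat g (map_mat \<phi> N)) (map_mat h A)) (map_mat g N)"
      unfolding mat_eq_def by blast
  qed
  finally show ?thesis .
qed

text \<open>
  The entries of \<open>N\<close> take the place of the inverse determinant of \<open>Y\<close>. The matrix \<open>Z'\<close> is the
  inverse of \<open>Z\<close>.
\<close>

abbreviation "S \<equiv> entries n Y \<union> entries n N"
abbreviation "Z \<equiv> mat_mult TR n (map_mat lt N) (map_mat rt Y)"
abbreviation "Z' \<equiv> mat_mult TR n (map_mat rt N) (map_mat lt Y)"
abbreviation "V \<equiv> entries n Z \<union> entries n Z'"

lemma V_fixed: "v \<in> V \<Longrightarrow> PhiT v = v"
proof -
  assume v: "v \<in> V"
  have l: "PhiT (lt a) = lt (\<phi> a)" "PhiT (rt a) = rt (\<phi> a)" if "a \<in> carrier R" for a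
    using tensor_endo_props(2)[OF phi phi_K, of a \<one>] tensor_endo_props(2)[OF phi phi_K, of \<one> a] that
    by (simp_all add: lt_def rt_def)
  have "PhiT (Z i j) = Z i j" "PhiT (Z' i j) = Z' i j" if ij: "i < n" "j < n" for i j
    by (rule transfer_fixed[OF lt.ring_hom_cring_axioms rt.ring_hom_cring_axioms lt_iota l ij],
        assumption, assumption, assumption)
      (rule transfer_fixed[OF rt.ring_hom_cring_axioms lt.ring_hom_cring_axioms lt_iota[symmetric] l(2,1) ij],
        assumption, assumption, assumption)
  then show ?thesis using v by (auto elim!: entriesE)
qed

lemma S_carrier: "S \<subseteq> carrier R"
  using YN(1,2) unfolding mat_carrier_def by (intro Un_least entries_subset) auto

lemma Z_carrier: "Z \<in> mat_carrier TR n" "Z' \<in> mat_carrier TR n"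
  by (intro T.mat_mult_closed lt.hom_mat_carrier rt.hom_mat_carrier YN)+

lemma V_carrier: "V \<subseteq> carrier TR"
  using Z_carrier unfolding mat_carrier_def by (intro Un_least entries_subset) auto

lemma C_carrier: "lt ` carrier R \<subseteq> carrier TR"
  by auto

lemma V_rt: "V \<subseteq> adjoin TR (lt ` carrier R) (rt ` S)"
proof -
  let ?G = "adjoin TR (lt ` carrier R) (rt ` S)"
  have rtS: "rt ` S \<subseteq> carrier TR" using S_carrier by auto
  have G: "subring ?G TR" by (rule T.adjoin_subring[OF C_carrier rtS])
  have l: "lt (Y i j) \<in> ?G" "lt (N i j) \<in> ?G" if ij: "i < n" "j < n" for i j
    by (rule subsetD[OF T.adjoin_incl(1) imageI], rule YN_carrier[OF ij])+
  have r: "rt (Y i j) \<in> ?G" "rt (N i j) \<in> ?G" if ij: "i < n" "j < n" for i j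
    by (rule subsetD[OF T.adjoin_incl(2) imageI], rule UnI1[OF entriesI[OF ij]])
      (rule subsetD[OF T.adjoin_incl(2) imageI], rule UnI2[OF entriesI[OF ij]])
  show ?thesis using l r by (intro Un_least entries_subset T.mat_mult_in_subring[OF G])
qed

text \<open>
  One has \<open>1 \<otimes> Y = (Y \<otimes> 1) Z\<close> and \<open>1 \<otimes> N = Z' (N \<otimes> 1)\<close>.
\<close>

lemma rt_V: "rt ` S \<subseteq> adjoin TR (lt ` carrier R) V"
proof -
  let ?G = "adjoin TR (lt ` carrier R) V"
  have G: "subring ?G TR" by (rule T.adjoin_subring[OF C_carrier V_carrier])
  have l: "lt (Y i j) \<in> ?G" "lt (N i j) \<in> ?G" if ij: "i < n" "j < n" for i j
    by (rule subsetD[OF T.adjoin_incl(1) imageI], rule YN_carrier[OF ij])+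
  have z: "Z i j \<in> ?G" "Z' i j \<in> ?G" if ij: "i < n" "j < n" for i j
    by (rule subsetD[OF T.adjoin_incl(2) UnI1[OF entriesI[OF ij]]],
        rule subsetD[OF T.adjoin_incl(2) UnI2[OF entriesI[OF ij]]])
  have inv: "mat_eq n (mat_mult TR n (map_mat lt Y) (map_mat lt N)) (mat_one TR)"
    unfolding mat_eq_def
    using lt.hom_mat_mult[OF YN(1,2)] YN(3) by (simp add: mat_eq_def lt.hom_mat_one)
  note M = lt.hom_mat_carrier rt.hom_mat_carrier
  have "rt (Y i j) \<in> ?G" if ij: "i < n" "j < n" for i j
  proof -
    have "mat_mult TR n (map_mat lt Y) Z i j = rt (Y i j)"
      by (rule T.mat_cancel(2)[OF M(2)[OF YN(1)] M(1)[OF YN(1)] M(1)[OF YN(2)] inv ij])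
    moreover have "mat_mult TR n (map_mat lt Y) Z i j \<in> ?G"
      by (rule T.mat_mult_in_subring[OF G]) (simp_all only: l z ij)
    ultimately show ?thesis by simp
  qed
  moreover have "rt (N i j) \<in> ?G" if ij: "i < n" "j < n" for i j
  proof -
    have "mat_mult TR n Z' (map_mat lt N) i j = rt (N i j)"
      by (rule T.mat_cancel(1)[OF M(2)[OF YN(2)] M(1)[OF YN(1)] M(1)[OF YN(2)] inv ij])
    moreover have "mat_mult TR n Z' (map_mat lt N) i j \<in> ?G"
      by (rule T.mat_mult_in_subring[OF G]) (simp_all only: l z ij)
    ultimately show ?thesis by simp
  qed
  ultimately show ?thesis by (intro image_subsetI) (elim UnE entriesE, simp_all)
qed

lemma inv_det_Y: "inv\<^bsub>R\<^esub> (mat_det R n Y) = mat_det R n N"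
proof (rule comm_inv_char)
  show "mat_det R n Y \<in> carrier R" "mat_det R n N \<in> carrier R" by (rule mat_det_closed, erule (1) YN_carrier)+
  have "mat_det R n Y \<otimes> mat_det R n N = mat_det R n (mat_mult R n Y N)"
    by (rule mat_det_mult[symmetric]; erule (1) YN_carrier)
  also have "\<dots> = mat_det R n (mat_one R)" by (rule mat_det_cong[OF mat_one_closed YN(3)])
  finally show "mat_det R n Y \<otimes> mat_det R n N = \<one>" by (simp only: mat_det_one)
qed

text \<open>
  The inverse determinant of \<open>Y\<close> is the determinant of \<open>N\<close>, a polynomial in the entries of \<open>N\<close>.
\<close>

lemma S_generates:
  assumes gen: "carrier R = generate_ring R (\<iota> ` carrier K \<union>
    (\<Union>i. (\<sigma> ^^ i) ` ({Y i j | i j. i < n \<and> j < n} \<union> {inv\<^bsub>R\<^esub> (mat_det R n Y)})))"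
  shows "carrier R = generate_ring R (\<iota> ` carrier K \<union> (\<Union>i. (\<sigma> ^^ i) ` S))"
proof -
  interpret SR: sigma_over_subring R "\<iota> ` carrier K" \<sigma>
  proof (intro sigma_over_subring.intro sigma_over_subring_axioms.intro is_cring K_subring sigma)
    show "\<sigma> ` \<iota> ` carrier K \<subseteq> \<iota> ` carrier K"
    proof
      fix a assume "a \<in> \<sigma> ` \<iota> ` carrier K"
      then obtain c where c: "c \<in> carrier K" "a = \<sigma> (\<iota> c)" by blast
      then show "a \<in> \<iota> ` carrier K" using sigma_K[OF c(1)] by (elim bexE) simp
    qed
  qed
  let ?U = "\<Union>i. (\<sigma> ^^ i) ` S"
  let ?G = "adjoin R (\<iota> ` carrier K) ?U"
  have Uc: "?U \<subseteq> carrier R" using SR.sigma_pow_closed S_carrier by blast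
  have G: "subring ?G R" by (rule adjoin_subring[OF SR.FC Uc])
  have Gc: "?G \<subseteq> carrier R" by (rule subringE(1)[OF G])
  have S0: "N i j \<in> adjoin R (\<iota> ` carrier K) S" if "i < n" "j < n" for i j
    using adjoin_incl(2)[of S "\<iota> ` carrier K"] entriesI[OF that, of N] by blast
  have d: "mat_det R n N \<in> adjoin R (\<iota> ` carrier K) S"
    by (rule mat_det_in_subring[OF adjoin_subring[OF SR.FC S_carrier] S0])
  have "(\<sigma> ^^ m) s \<in> ?G" if s: "s \<in> {Y i j | i j. i < n \<and> j < n} \<union> {inv\<^bsub>R\<^esub> (mat_det R n Y)}" for m s
  proof -
    have "s \<in> adjoin R (\<iota> ` carrier K) S"
      using s
    proof
      assume "s \<in> {Y i j | i j. i < n \<and> j < n}"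
      then obtain i j where ij: "i < n" "j < n" and s: "s = Y i j" by blast
      show ?thesis unfolding s by (rule subsetD[OF adjoin_incl(2) UnI1[OF entriesI[OF ij]]])
    qed (use d inv_det_Y in simp)
    then have "(\<sigma> ^^ m) s \<in> (\<sigma> ^^ m) ` adjoin R (\<iota> ` carrier K) S" by (rule imageI)
    also have "\<dots> \<subseteq> adjoin R (\<iota> ` carrier K) ((\<sigma> ^^ m) ` S)" by (rule SR.sigma_adjoin[OF S_carrier])
    also have "\<dots> \<subseteq> ?G" by (rule SR.adjoin_mono[OF _ Uc]) blast
    finally show ?thesis .
  qed
  then have W: "(\<Union>i. (\<sigma> ^^ i) ` ({Y i j | i j. i < n \<and> j < n} \<union> {inv\<^bsub>R\<^esub> (mat_det R n Y)})) \<subseteq> ?G"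
    by (intro UN_least image_subsetI)
  have "carrier R \<subseteq> ?G"
    by (subst gen, subst adjoin_def[symmetric]) (rule adjoin_least[OF G adjoin_incl(1) W])
  with Gc have "carrier R = ?G" by (rule subset_antisym[rotated])
  then show ?thesis unfolding adjoin_def .
qed

end

theorem lemma2p16:
  fixes K :: "('k, 'x) ring_scheme" and R :: "('r, 'y) ring_scheme"
    and \<phi>\<^sub>K \<sigma>\<^sub>K :: "'k \<Rightarrow> 'k" and \<phi> \<sigma> :: "'r \<Rightarrow> 'r" and \<iota> :: "'k \<Rightarrow> 'r"
    and n :: nat and A :: "nat \<Rightarrow> nat \<Rightarrow> 'k"
  assumes K: "phi_sigma_field K \<phi>\<^sub>K \<sigma>\<^sub>K"
    and A: "A \<in> GL n K"
    and R: "sigma_PV_ring TYPE('l) K \<phi>\<^sub>K \<sigma>\<^sub>K n A R \<phi> \<sigma> \<iota>"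
    and R_const: "carrier (fixed_ring R \<phi>) = \<iota> ` carrier (fixed_ring K \<phi>\<^sub>K)"
  shows "let k = fixed_ring K \<phi>\<^sub>K;
           H = fixed_ring (tensor_ring K \<iota> R \<iota> R) (tensor_endo K \<iota> R \<iota> R \<phi> \<phi>)
         in sigma_dim K \<iota> R \<sigma> =
            sigma_dim k (\<lambda>c. tensor K \<iota> R \<iota> R (\<iota> c) \<one>\<^bsub>R\<^esub>) H (tensor_endo K \<iota> R \<iota> R \<sigma> \<sigma>)"
proof -
  interpret K: phi_sigma_field K \<phi>\<^sub>K \<sigma>\<^sub>K by (rule K)
  interpret R: phi_sigma_algebra K \<phi>\<^sub>K \<sigma>\<^sub>K R \<phi> \<sigma> \<iota> using R unfolding sigma_PV_ring_def by blast
  have simple: "phi_simple R \<phi>" using R unfolding sigma_PV_ring_def by blast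
  obtain Y where Y: "Y \<in> GL n R" "mat_eq n (\<lambda>i j. \<phi> (Y i j)) (mat_mult R n (\<lambda>i j. \<iota> (A i j)) Y)"
    "carrier R = sigma_generate K \<iota> R \<sigma> ({Y i j | i j. i < n \<and> j < n} \<union> {inv\<^bsub>R\<^esub> (mat_det R n Y)})"
    using R unfolding sigma_PV_ring_def by blast
  obtain N where N: "Y \<in> mat_carrier R n" "N \<in> mat_carrier R n"
    "mat_eq n (mat_mult R n Y N) (mat_one R)" "mat_eq n (mat_mult R n N Y) (mat_one R)"
    using Y(1) unfolding GL_def by blast
  have one: "\<one>\<^bsub>R\<^esub> \<noteq> \<zero>\<^bsub>R\<^esub>" using simple R.carrier_one_zero R.one_zeroD unfolding phi_simple_def by blast
  interpret \<iota>: ring_hom_ring K R \<iota> by (intro ring_hom_ringI2 K.ring_axioms R.ring_axioms R.struct_hom)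
  let ?k = "{c \<in> carrier K. \<phi>\<^sub>K c = c}"
  have KR: "subfield (\<iota> ` carrier K) R" by (rule \<iota>.img_is_subfield(2)[OF K.carrier_is_subfield one])
  have kR: "subfield (\<iota> ` ?k) R"
    by (rule \<iota>.img_is_subfield(2)[OF subfield_fixed[OF K.field_axioms K.phi_hom] one])
  have const: "{r \<in> carrier R. \<phi> r = r} = \<iota> ` ?k" using R_const unfolding fixed_ring_def by simp
  have \<phi>K: "\<exists>c'\<in>carrier K. \<phi> (\<iota> c) = \<iota> c'" "\<exists>c'\<in>carrier K. \<sigma> (\<iota> c) = \<iota> c'" if "c \<in> carrier K" for c
    using R.struct_phi[OF that] R.struct_sigma[OF that] ring_hom_closed[OF K.phi_hom that]
      ring_hom_closed[OF K.sigma_hom that] by blast+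
  interpret F: fundamental_square R K \<iota> \<phi> \<sigma> n A Y N
  proof (intro fundamental_square.intro tensor_square.intro tensor_square_axioms.intro
      fundamental_square_axioms.intro R.is_cring \<iota>.hom_closed R.phi_hom R.sigma_hom \<phi>K subfieldE(1)[OF KR] N Y(2))
    show "A \<in> mat_carrier K n" using A unfolding GL_def by blast
  qed
  interpret split_square R K \<iota> \<phi> \<sigma> "entries n Y \<union> entries n N" F.V
  proof (intro split_square.intro split_square_axioms.intro F.tensor_square_axioms R.phi_hom R.sigma_hom
      R.phi_sigma_commute simple KR \<phi>K F.S_carrier F.V_carrier F.V_fixed)
    show "subfield {r \<in> carrier R. \<phi> r = r} R" "{r \<in> carrier R. \<phi> r = r} \<subseteq> \<iota> ` carrier K"
      unfolding const using kR by auto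
    show "carrier R = generate_ring R (\<iota> ` carrier K \<union> (\<Union>i. (\<sigma> ^^ i) ` (entries n Y \<union> entries n N)))"
      by (rule F.S_generates) (use Y(3) in \<open>simp only: sigma_generate_def\<close>)
    show "F.V \<subseteq> adjoin F.TR ((\<lambda>a. F.tens a \<one>\<^bsub>R\<^esub>) ` carrier R) (F.tens \<one>\<^bsub>R\<^esub> ` (entries n Y \<union> entries n N))"
      using F.V_rt unfolding F.lt_def[abs_def] F.rt_def[abs_def] .
    show "F.tens \<one>\<^bsub>R\<^esub> ` (entries n Y \<union> entries n N) \<subseteq> adjoin F.TR ((\<lambda>a. F.tens a \<one>\<^bsub>R\<^esub>) ` carrier R) F.V"
      using F.rt_V unfolding F.lt_def[abs_def] F.rt_def[abs_def] .
  qed (simp_all add: entries_finite)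
  have "(\<lambda>c. F.tens (\<iota> c) \<one>\<^bsub>R\<^esub>) ` carrier (fixed_ring K \<phi>\<^sub>K) = kT"
    unfolding const F.lt_def fixed_ring_def by (simp add: image_image)
  from sigma_dim_eq[OF this] show ?thesis unfolding Let_def fixed_ring_def by simp
qed

end
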